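(* Let $\mu_0$ be the Gaussian measure on $L^2(0,1)$ with mean $u_0\in V$ and covariance operator $\mathcal C=-\sigma^2\Delta^{-1}$, where $\Delta$ is the Dirichlet Laplacian on $(0,1)$ and $\sigma>0$. Assume, in addition to the standing assumptions below, that $r$ and $f'$ are uniformly (globally) Lipschitz on $\mathbb R$. Then there is a well-defined posterior probability measure $\mu_z$ on $L^2(0,1)$, absolutely continuous with respect to $\mu_0$, with Radon--Nikodym derivative $$\frac{d\mu_z}{d\mu_0}(u)\ \propto\ \exp\Big\{-\sum_{i=1}^N\big|R^{-1/2}\big(Hy(t_i)-z_i\big)\big|^2\Big\},$$ where $y$ is the solution of the evolution problem below with initial condition $y(\cdot,0)=u$. Moreover, the mean and covariance of $\mu_z$ are continuous functions of the data $z=(z_1,\dots,z_N)\in(\mathbb R^q)^N$.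
   Context: $\|\cdot\|$ and $\langle\cdot,\cdot\rangle$ denote the norm and inner product of $L^2(0,1)$; $V=H^1_0(0,1)$ with norm $\|u\|_V=\|u_x\|$. Standing assumptions: $f,r\in C^2(\mathbb R)$ and $\int_{-\infty}^0\frac{dy}{|r(y)|+1}=\int_0^\infty\frac{dy}{|r(y)|+1}=\infty$. For an initial datum $u$, $y=y(x,t)$ denotes the solution of $y_t+f(y)_x=y_{xx}+r(y)$ on $[0,1]\times(0,\infty)$ with Dirichlet boundary conditions $y(0,t)=y(1,t)=0$ and $y(\cdot,0)=u$. $H:L^2(0,1)\to\mathbb R^q$ is a bounded linear operator, $R$ is a symmetric positive definite $q\times q$ matrix, $|\cdot|$ is the Euclidean norm, $0<t_1<\dots<t_N$ are observation times and $z_1,\dots,z_N\in\mathbb R^q$ are data. "$\propto$" means equality up to a normalizing constant (depending on $z$ but not on $u$). *)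

theory Defs
  imports "HOL-Probability.Probability"
begin

definition L2 :: "(real \<Rightarrow> real) set" where
  "L2 = {u. set_borel_measurable lborel {0..1} u \<and>
            set_integrable lborel {0..1} (\<lambda>x. (u x)\<^sup>2)}"

definition L2inner :: "(real \<Rightarrow> real) \<Rightarrow> (real \<Rightarrow> real) \<Rightarrow> real" where
  "L2inner u v = (LINT x:{0..1}|lborel. u x * v x)"

definition L2norm :: "(real \<Rightarrow> real) \<Rightarrow> real" where
  "L2norm u = sqrt (L2inner u u)"

text \<open>Borel sigma-algebra of the separable Hilbert space L^2(0,1), i.e. the one
  generated by the continuous linear functionals u \<mapsto> <u,phi>.\<close>
definition L2M :: "(real \<Rightarrow> real) measure" where
  "L2M = sigma L2 {{u \<in> L2. L2inner u \<phi> \<in> B} | \<phi> B. \<phi> \<in> L2 \<and> B \<in> sets borel}"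

text \<open>V = H^1_0(0,1): u agrees a.e. on [0,1] with x \<mapsto> int_0^x g, g in L^2, with u(1)=0.\<close>
definition H10 :: "(real \<Rightarrow> real) set" where
  "H10 = {u \<in> L2. \<exists>g \<in> L2. (LINT s:{0..1}|lborel. g s) = 0 \<and>
            (AE x in lborel. x \<in> {0..1} \<longrightarrow> u x = (LINT s:{0..x}|lborel. g s))}"

text \<open>Green's function of -d^2/dx^2 on (0,1) with Dirichlet boundary conditions.\<close>
definition dirichlet_green :: "real \<Rightarrow> real \<Rightarrow> real" where
  "dirichlet_green x s = min x s * (1 - max x s)"

text \<open>Inverse of the Dirichlet Laplacian: Delta^{-1} phi = w with w'' = phi, w(0)=w(1)=0.\<close>
definition dirichlet_laplacian_inv :: "(real \<Rightarrow> real) \<Rightarrow> (real \<Rightarrow> real)" where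
  "dirichlet_laplacian_inv \<phi> = (\<lambda>x. - (LINT s:{0..1}|lborel. dirichlet_green x s * \<phi> s))"

definition prior_cov :: "real \<Rightarrow> (real \<Rightarrow> real) \<Rightarrow> (real \<Rightarrow> real)" where
  "prior_cov \<sigma> \<phi> = (\<lambda>x. - (\<sigma>\<^sup>2) * dirichlet_laplacian_inv \<phi> x)"

definition gaussian_measure_L2 ::
  "(real \<Rightarrow> real) measure \<Rightarrow> (real \<Rightarrow> real) \<Rightarrow> ((real \<Rightarrow> real) \<Rightarrow> (real \<Rightarrow> real)) \<Rightarrow> bool" where
  "gaussian_measure_L2 \<mu> m C \<longleftrightarrow> prob_space \<mu> \<and> sets \<mu> = sets L2M \<and>
     (\<forall>\<phi> \<in> L2. L2norm \<phi> \<noteq> 0 \<longrightarrow>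
        distributed \<mu> lborel (\<lambda>u. L2inner u \<phi>)
          (normal_density (L2inner m \<phi>) (sqrt (L2inner (C \<phi>) \<phi>))))"

definition is_mean_L2 :: "(real \<Rightarrow> real) measure \<Rightarrow> (real \<Rightarrow> real) \<Rightarrow> bool" where
  "is_mean_L2 \<mu> m \<longleftrightarrow> m \<in> L2 \<and>
     (\<forall>\<phi> \<in> L2. integrable \<mu> (\<lambda>u. L2inner u \<phi>) \<and>
                L2inner m \<phi> = (\<integral>u. L2inner u \<phi> \<partial>\<mu>))"

definition is_covariance_L2 ::
  "(real \<Rightarrow> real) measure \<Rightarrow> (real \<Rightarrow> real) \<Rightarrow> ((real \<Rightarrow> real) \<Rightarrow> (real \<Rightarrow> real)) \<Rightarrow> bool" where
  "is_covariance_L2 \<mu> m K \<longleftrightarrow>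
     (\<forall>\<phi> \<in> L2. K \<phi> \<in> L2) \<and>
     (\<forall>\<phi> \<in> L2. \<forall>\<psi> \<in> L2.
        integrable \<mu> (\<lambda>u. L2inner (\<lambda>x. u x - m x) \<phi> * L2inner (\<lambda>x. u x - m x) \<psi>) \<and>
        L2inner (K \<phi>) \<psi> = (\<integral>u. L2inner (\<lambda>x. u x - m x) \<phi> * L2inner (\<lambda>x. u x - m x) \<psi> \<partial>\<mu>))"

definition C2_fun :: "(real \<Rightarrow> real) \<Rightarrow> bool" where
  "C2_fun g \<longleftrightarrow> (\<exists>g' g''. (\<forall>x. (g has_real_derivative g' x) (at x)) \<and>
                          (\<forall>x. (g' has_real_derivative g'' x) (at x)) \<and> continuous_on UNIV g'')"

text \<open>y(x,t) solves y_t + f(y)_x = y_xx + r(y) on (0,1) x (0,inf), y(0,t)=y(1,t)=0,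
  y(.,t) \<rightarrow> u in L^2 as t \<rightarrow> 0+, with y in L^2(0,T;V) for every T; y is extended by 0
  outside [0,1] x (0,inf) so that it is unique as a HOL function.\<close>
definition evolution_solution ::
  "(real \<Rightarrow> real) \<Rightarrow> (real \<Rightarrow> real) \<Rightarrow> (real \<Rightarrow> real) \<Rightarrow> (real \<Rightarrow> real \<Rightarrow> real) \<Rightarrow> bool" where
  "evolution_solution f r u y \<longleftrightarrow>
     (\<forall>x t. (x \<notin> {0..1} \<or> t \<le> 0) \<longrightarrow> y x t = 0) \<and>
     continuous_on ({0..1} \<times> {0<..}) (\<lambda>(x,t). y x t) \<and>
     (\<forall>t>0. y 0 t = 0 \<and> y 1 t = 0) \<and>
     (\<exists>yx yxx yt.
        continuous_on ({0<..<1} \<times> {0<..}) (\<lambda>(x,t). yx x t) \<and>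
        continuous_on ({0<..<1} \<times> {0<..}) (\<lambda>(x,t). yxx x t) \<and>
        continuous_on ({0<..<1} \<times> {0<..}) (\<lambda>(x,t). yt x t) \<and>
        (\<forall>x \<in> {0<..<1}. \<forall>t > 0.
            ((\<lambda>s. y s t) has_real_derivative yx x t) (at x) \<and>
            ((\<lambda>s. yx s t) has_real_derivative yxx x t) (at x) \<and>
            ((\<lambda>\<tau>. y x \<tau>) has_real_derivative yt x t) (at t) \<and>
            yt x t + deriv f (y x t) * yx x t = yxx x t + r (y x t)) \<and>
        (\<forall>T>0. set_integrable lborel ({0<..<1} \<times> {0<..<T}) (\<lambda>p. (yx (fst p) (snd p))\<^sup>2))) \<and>
     ((\<lambda>t. L2norm (\<lambda>x. y x t - u x)) \<longlongrightarrow> 0) (at_right 0)"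

definition evolution_sol ::
  "(real \<Rightarrow> real) \<Rightarrow> (real \<Rightarrow> real) \<Rightarrow> (real \<Rightarrow> real) \<Rightarrow> (real \<Rightarrow> real \<Rightarrow> real)" where
  "evolution_sol f r u = (THE y. evolution_solution f r u y)"

definition bounded_linear_L2 :: "((real \<Rightarrow> real) \<Rightarrow> 'b::real_normed_vector) \<Rightarrow> bool" where
  "bounded_linear_L2 H \<longleftrightarrow>
     (\<forall>u \<in> L2. \<forall>v \<in> L2. H (\<lambda>x. u x + v x) = H u + H v) \<and>
     (\<forall>u \<in> L2. \<forall>c. H (\<lambda>x. c * u x) = c *\<^sub>R H u) \<and>
     (\<exists>K. \<forall>u \<in> L2. norm (H u) \<le> K * L2norm u)"

definition sym_pos_def :: "real^'q^'q \<Rightarrow> bool" where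
  "sym_pos_def R \<longleftrightarrow> transpose R = R \<and> (\<forall>v. v \<noteq> 0 \<longrightarrow> v \<bullet> (R *v v) > 0)"

definition mat_inv_sqrt :: "real^'q^'q \<Rightarrow> real^'q^'q" where
  "mat_inv_sqrt R = (THE S. sym_pos_def S \<and> S ** S = matrix_inv R)"

definition misfit ::
  "(real \<Rightarrow> real) \<Rightarrow> (real \<Rightarrow> real) \<Rightarrow> ((real \<Rightarrow> real) \<Rightarrow> real^'q) \<Rightarrow> real^'q^'q \<Rightarrow>
   nat \<Rightarrow> (nat \<Rightarrow> real) \<Rightarrow> (nat \<Rightarrow> real^'q) \<Rightarrow> (real \<Rightarrow> real) \<Rightarrow> real" where
  "misfit f r H R N t z u =
     (\<Sum>i<N. (norm (mat_inv_sqrt R *v (H (\<lambda>x. evolution_sol f r u x (t i)) - z i)))\<^sup>2)"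

end

theory Submission
  imports Defs
begin

text \<open>
  Everything is done in the sine basis of \<open>L\<^sup>2(0,1)\<close>. There the evolution problem becomes the
  Duhamel equation \<open>y(t) = exp(t \<Delta>) u + \<integral> exp((t-s) \<Delta>) (r(y) - f(y)\<^sub>x)(s) ds\<close> for the coefficients.
  The heat semigroup maps square summable coefficients into a weighted summable space with an
  integrable singularity in time, so a truncated equation is solved globally by Picard iteration.
  The flux \<open>f'(y) y\<^sub>x\<close> is orthogonal to \<open>y\<close>, also after truncation, and \<open>r\<close> grows linearly; the
  resulting energy estimate shows that the truncation is never active. Smoothing gives a classical
  solution. Conversely the coefficients of any classical solution satisfy the Duhamel equation, and
  a singular Gronwall argument, which uses the Lipschitz bound on \<open>f'\<close>, gives uniqueness and the
  continuity of \<open>u \<mapsto> y(t)\<close> in \<open>L\<^sup>2\<close>.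

  Hence the misfit is a measurable function of \<open>u\<close> that is nonnegative and continuous in the data,
  while the Gaussian prior has finite second moment because the variances \<open>(\<sigma> / (\<pi> k))\<^sup>2\<close> of the sine
  coefficients are summable. The normalised weights therefore define the posterior, mean and
  covariance come from the Riesz representation theorem, and their continuity follows from
  dominated convergence of the weights against \<open>1 + \<parallel>u\<parallel>\<^sup>2\<close>.
\<close>

section \<open>The Hilbert space and the sine basis\<close>

text \<open>The obstacle is that \<open>f'\<close> may grow linearly: for \<open>y\<close> in L2 the
  term \<open>f'(y) y\<^sub>x\<close> is quadratic in \<open>y\<close>, and \<open>f(y)\<close> is
  only in L1. Existence therefore measures \<open>f'(y)\<close> in L2 and \<open>y\<^sub>x\<close>
  in the sup norm; the weight \<open>om k powr (5/4)\<close> pays one power for the derivative and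
  keeps 1/4 for uniform convergence, and 5/4 + 1/2 < 2 * 15/16 lets the heat kernel absorb it.
  Truncating the argument of \<open>f'\<close> turns quadratic into linear growth, so that one
  exponential weight in time closes the Picard iteration up to any time \<open>T\<close>. Uniqueness
  starts from a solution that is not known to lie in the weighted space; there the flux is kept as
  \<open>f(y)\<close> in L1, whose cosine coefficients are bounded, and the factor
  \<open>om k\<close> from integrating by parts is absorbed by the kernel since 1 + 1/2 < 2 * 7/8.
  Elements of \<open>L2\<close> are functions, not classes: \<open>L2norm\<close> is a seminorm, and
  pointwise identities are recovered from coefficients through continuity.\<close>

lemma set_borel_measurable_mult:
  fixes u v :: "'a \<Rightarrow> real"
  assumes "set_borel_measurable M A u" "set_borel_measurable M A v"
  shows "set_borel_measurable M A (\<lambda>x. u x * v x)"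
proof -
  have "(\<lambda>x. (indicator A x *\<^sub>R u x) * (indicator A x *\<^sub>R v x)) \<in> borel_measurable M"
    using assms unfolding set_borel_measurable_def by (rule borel_measurable_times)
  moreover have "(\<lambda>x. (indicator A x *\<^sub>R u x) * (indicator A x *\<^sub>R v x)) =
      (\<lambda>x. indicator A x *\<^sub>R (u x * v x))"
    by (auto simp: indicator_def)
  ultimately show ?thesis unfolding set_borel_measurable_def by simp
qed

lemma set_borel_measurable_add:
  fixes u v :: "'a \<Rightarrow> real"
  assumes "set_borel_measurable M A u" "set_borel_measurable M A v"
  shows "set_borel_measurable M A (\<lambda>x. u x + v x)"
  using borel_measurable_add[OF assms[unfolded set_borel_measurable_def]]
  unfolding set_borel_measurable_def by (simp add: distrib_left)

lemma set_borel_measurable_cmult: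
  fixes u :: "'a \<Rightarrow> real"
  assumes "set_borel_measurable M A u"
  shows "set_borel_measurable M A (\<lambda>x. c * u x)"
  using borel_measurable_times[OF borel_measurable_const[of c] assms[unfolded set_borel_measurable_def]]
  unfolding set_borel_measurable_def by (simp add: algebra_simps)

lemma L2_mult_integrable:
  assumes "u \<in> L2" "v \<in> L2"
  shows "set_integrable lborel {0..1} (\<lambda>x. u x * v x)"
proof (rule set_integrable_bound)
  show "set_integrable lborel {0..1} (\<lambda>x. (u x)\<^sup>2 + (v x)\<^sup>2)"
    using assms by (auto simp: L2_def)
  show "set_borel_measurable lborel {0..1} (\<lambda>x. u x * v x)"
    using assms by (auto simp: L2_def intro: set_borel_measurable_mult)
  have "\<bar>a * b\<bar> \<le> a\<^sup>2 + b\<^sup>2" for a b :: real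
    using sum_squares_bound[of "\<bar>a\<bar>" "\<bar>b\<bar>"] mult_nonneg_nonneg[of "\<bar>a\<bar>" "\<bar>b\<bar>"]
    unfolding abs_mult power2_abs by linarith
  then show "AE x in lborel. x \<in> {0..1} \<longrightarrow> norm (u x * v x) \<le> norm ((u x)\<^sup>2 + (v x)\<^sup>2)"
    by (auto intro!: AE_I2)
qed

lemma L2_add [intro]:
  assumes "u \<in> L2" "v \<in> L2" shows "(\<lambda>x. u x + v x) \<in> L2"
proof -
  have "set_integrable lborel {0..1} (\<lambda>x. ((u x)\<^sup>2 + (v x)\<^sup>2) + 2 * (u x * v x))"
    using assms L2_mult_integrable[OF assms] by (auto simp: L2_def)
  then have "set_integrable lborel {0..1} (\<lambda>x. (u x + v x)\<^sup>2)"
    by (simp add: power2_sum algebra_simps)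
  then show ?thesis using assms by (auto simp: L2_def intro: set_borel_measurable_add)
qed

lemma L2_scale [intro]: "u \<in> L2 \<Longrightarrow> (\<lambda>x. c * u x) \<in> L2"
  by (auto simp: L2_def power_mult_distrib intro: set_borel_measurable_cmult)

lemma L2_uminus [intro]: "u \<in> L2 \<Longrightarrow> (\<lambda>x. - u x) \<in> L2"
  using L2_scale[of u "-1"] by simp

lemma L2_diff [intro]: "u \<in> L2 \<Longrightarrow> v \<in> L2 \<Longrightarrow> (\<lambda>x. u x - v x) \<in> L2"
  using L2_add[of u "\<lambda>x. - v x"] by auto

lemma L2_zero [simp, intro]: "(\<lambda>x. 0) \<in> L2"
  by (simp add: L2_def set_borel_measurable_def set_integrable_def)

lemma L2_sum [intro]:
  "(\<And>i. i \<in> I \<Longrightarrow> u i \<in> L2) \<Longrightarrow> (\<lambda>x. \<Sum>i\<in>I. u i x) \<in> L2"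
  by (induction I rule: infinite_finite_induct) (auto intro: L2_add)

lemma L2_continuous [intro]:
  assumes "continuous_on {0..1} u" shows "u \<in> L2"
proof -
  have "set_integrable lborel {0..1} (\<lambda>x. (u x)\<^sup>2)"
    by (intro borel_integrable_atLeastAtMost' continuous_intros assms)
  moreover have "set_borel_measurable lborel {0..1} u"
    using borel_integrable_atLeastAtMost'[OF assms]
    by (simp add: set_integrable_def set_borel_measurable_def borel_measurable_integrable)
  ultimately show ?thesis by (simp add: L2_def)
qed

lemma L2_set_integrable:
  assumes "u \<in> L2" shows "set_integrable lborel {0..1} u"
  using L2_mult_integrable[OF assms, of "\<lambda>_. 1"] by (simp add: L2_continuous)

lemma L2inner_commute: "L2inner u v = L2inner v u"
  by (simp add: L2inner_def mult.commute)

lemma L2inner_cong: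
  "(\<And>x. x \<in> {0..1} \<Longrightarrow> u x = u' x) \<Longrightarrow> (\<And>x. x \<in> {0..1} \<Longrightarrow> v x = v' x) \<Longrightarrow> L2inner u v = L2inner u' v'"
  unfolding L2inner_def by (rule set_lebesgue_integral_cong) auto

lemma L2norm_cong: "(\<And>x. x \<in> {0..1} \<Longrightarrow> u x = v x) \<Longrightarrow> L2norm u = L2norm v"
  unfolding L2norm_def by (metis L2inner_cong)

lemma L2inner_add_left:
  "u \<in> L2 \<Longrightarrow> v \<in> L2 \<Longrightarrow> w \<in> L2 \<Longrightarrow> L2inner (\<lambda>x. u x + v x) w = L2inner u w + L2inner v w"
  using L2_mult_integrable[of u w] L2_mult_integrable[of v w]
  by (simp add: L2inner_def distrib_right)

lemma L2inner_scale_left: "L2inner (\<lambda>x. c * u x) w = c * L2inner u w"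
  by (simp add: L2inner_def mult.assoc)

lemma L2inner_uminus_left: "L2inner (\<lambda>x. - u x) w = - L2inner u w"
  using L2inner_scale_left[of "-1" u w] by simp

lemma L2inner_diff_left:
  "u \<in> L2 \<Longrightarrow> v \<in> L2 \<Longrightarrow> w \<in> L2 \<Longrightarrow> L2inner (\<lambda>x. u x - v x) w = L2inner u w - L2inner v w"
  using L2inner_add_left[of u "\<lambda>x. - v x" w] by (simp add: L2inner_uminus_left L2_uminus)

lemma L2inner_zero_left [simp]: "L2inner (\<lambda>x. 0) w = 0"
  by (simp add: L2inner_def)

lemma L2inner_sum_left:
  "(\<And>i. i \<in> I \<Longrightarrow> u i \<in> L2) \<Longrightarrow> w \<in> L2 \<Longrightarrow>
    L2inner (\<lambda>x. \<Sum>i\<in>I. u i x) w = (\<Sum>i\<in>I. L2inner (u i) w)"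
proof (induction I rule: infinite_finite_induct)
  case (insert i I)
  then have "L2inner (\<lambda>x. u i x + (\<Sum>j\<in>I. u j x)) w = L2inner (u i) w + L2inner (\<lambda>x. \<Sum>j\<in>I. u j x) w"
    by (intro L2inner_add_left L2_sum) auto
  with insert show ?case by simp
qed auto

lemma L2inner_add_right:
  "u \<in> L2 \<Longrightarrow> v \<in> L2 \<Longrightarrow> w \<in> L2 \<Longrightarrow> L2inner w (\<lambda>x. u x + v x) = L2inner w u + L2inner w v"
  by (metis L2inner_add_left L2inner_commute)

lemma L2inner_diff_right:
  "u \<in> L2 \<Longrightarrow> v \<in> L2 \<Longrightarrow> w \<in> L2 \<Longrightarrow> L2inner w (\<lambda>x. u x - v x) = L2inner w u - L2inner w v"
  by (metis L2inner_diff_left L2inner_commute)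

lemma L2inner_scale_right: "L2inner w (\<lambda>x. c * u x) = c * L2inner w u"
  by (metis L2inner_scale_left L2inner_commute)

lemma L2inner_sum_right:
  "(\<And>i. i \<in> I \<Longrightarrow> u i \<in> L2) \<Longrightarrow> w \<in> L2 \<Longrightarrow>
    L2inner w (\<lambda>x. \<Sum>i\<in>I. u i x) = (\<Sum>i\<in>I. L2inner w (u i))"
  using L2inner_sum_left[of I u w] by (simp add: L2inner_commute)

lemma L2inner_self_nonneg [simp]: "0 \<le> L2inner u u"
  unfolding L2inner_def set_lebesgue_integral_def by (rule integral_nonneg_AE) auto

lemma L2norm_nonneg [simp]: "0 \<le> L2norm u"
  by (simp add: L2norm_def)

lemma L2norm_power2: "(L2norm u)\<^sup>2 = L2inner u u"
  by (simp add: L2norm_def)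

lemma L2_Cauchy_Schwarz:
  assumes u: "u \<in> L2" and v: "v \<in> L2"
  shows "\<bar>L2inner u v\<bar> \<le> L2norm u * L2norm v"
proof -
  have q: "0 \<le> L2inner u u - 2 * c * L2inner u v + c\<^sup>2 * L2inner v v" for c
  proof -
    have "0 \<le> L2inner (\<lambda>x. u x - c * v x) (\<lambda>x. u x - c * v x)" by simp
    also have "\<dots> = L2inner u u - 2 * c * L2inner u v + c\<^sup>2 * L2inner v v"
      using u v by (simp add: L2inner_diff_left L2inner_diff_right L2inner_scale_left L2inner_scale_right
         L2_diff L2_scale L2inner_commute[of v u] power2_eq_square algebra_simps)
    finally show ?thesis .
  qed
  have "(L2inner u v)\<^sup>2 \<le> L2inner u u * L2inner v v"
  proof (cases "L2inner v v = 0")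
    case True
    have "L2inner u v = 0"
    proof (rule ccontr)
      assume n: "L2inner u v \<noteq> 0"
      \<comment> \<open>\<open>L2inner\<close> is only semidefinite, so a null \<open>v\<close>
        needs its own argument: this value of \<open>c\<close> makes the quadratic expression equal
        to -1.\<close>
      from q[of "(L2inner u u + 1) / (2 * L2inner u v)"] True n
      have "0 \<le> L2inner u u - (L2inner u u + 1)" by simp
      then show False by simp
    qed
    then show ?thesis by simp
  next
    case False
    then have p: "L2inner v v > 0" using L2inner_self_nonneg[of v] by linarith
    from q[of "L2inner u v / L2inner v v"]
    have "0 \<le> L2inner u u - (L2inner u v)\<^sup>2 / L2inner v v"
      using p by (simp add: power2_eq_square field_simps)
    then show ?thesis using p by (simp add: field_simps)
  qed
  then have "sqrt ((L2inner u v)\<^sup>2) \<le> sqrt (L2inner u u * L2inner v v)"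
    by (rule real_sqrt_le_mono)
  then show ?thesis by (simp add: L2norm_def real_sqrt_mult)
qed

lemma L2norm_triangle:
  assumes u: "u \<in> L2" and v: "v \<in> L2"
  shows "L2norm (\<lambda>x. u x + v x) \<le> L2norm u + L2norm v"
proof (rule power2_le_imp_le)
  have "(L2norm (\<lambda>x. u x + v x))\<^sup>2 = L2inner u u + 2 * L2inner u v + L2inner v v"
    using u v by (simp add: L2norm_power2 L2inner_add_left L2inner_add_right L2_add L2inner_commute[of v u])
  also have "\<dots> \<le> (L2norm u)\<^sup>2 + 2 * (L2norm u * L2norm v) + (L2norm v)\<^sup>2"
    using L2_Cauchy_Schwarz[OF u v] by (simp add: L2norm_power2)
  finally show "(L2norm (\<lambda>x. u x + v x))\<^sup>2 \<le> (L2norm u + L2norm v)\<^sup>2"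
    by (simp add: power2_sum algebra_simps)
qed simp

lemma L2norm_scale: "L2norm (\<lambda>x. c * u x) = \<bar>c\<bar> * L2norm u"
  by (simp add: L2norm_def L2inner_scale_left L2inner_scale_right real_sqrt_mult flip: mult.assoc power2_eq_square)

lemma L2norm_uminus: "L2norm (\<lambda>x. - u x) = L2norm u"
  using L2norm_scale[of "-1" u] by simp

lemma L2norm_minus_commute: "L2norm (\<lambda>x. u x - v x) = L2norm (\<lambda>x. v x - u x)"
  using L2norm_uminus[of "\<lambda>x. u x - v x"] by simp

lemma L2norm_diff_triangle:
  assumes "u \<in> L2" "v \<in> L2" "w \<in> L2"
  shows "L2norm (\<lambda>x. u x - w x) \<le> L2norm (\<lambda>x. u x - v x) + L2norm (\<lambda>x. v x - w x)"
  using L2norm_triangle[of "\<lambda>x. u x - v x" "\<lambda>x. v x - w x"] assms by (auto simp: L2_diff)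

lemma L2norm_diff_le:
  assumes "u \<in> L2" "v \<in> L2"
  shows "L2norm (\<lambda>x. u x - v x) \<le> L2norm u + L2norm v"
  using L2norm_triangle[of u "\<lambda>x. - v x"] assms by (auto simp: L2norm_uminus)

lemma L2norm_rev_triangle:
  assumes "u \<in> L2" "v \<in> L2"
  shows "\<bar>L2norm u - L2norm v\<bar> \<le> L2norm (\<lambda>x. u x - v x)"
  using L2norm_triangle[of "\<lambda>x. u x - v x" v] L2norm_triangle[of "\<lambda>x. v x - u x" u]
    L2norm_minus_commute[of u v] assms by (auto simp: L2_diff)

lemma L2norm_mono:
  assumes "u \<in> L2" "v \<in> L2" "\<And>x. x \<in> {0..1} \<Longrightarrow> \<bar>u x\<bar> \<le> \<bar>v x\<bar>"
  shows "L2norm u \<le> L2norm v"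
  unfolding L2norm_def L2inner_def
proof (intro real_sqrt_le_mono set_integral_mono L2_mult_integrable assms)
  fix x :: real assume "x \<in> {0..1}"
  from assms(3)[OF this] show "u x * u x \<le> v x * v x"
    using abs_le_square_iff[of "u x" "v x"] by (simp add: power2_eq_square)
qed

lemma L2norm_const [simp]: "L2norm (\<lambda>x. c) = \<bar>c\<bar>"
  by (simp add: L2norm_def L2inner_def set_lebesgue_integral_def power2_eq_square[symmetric])

lemma L2norm_le_const:
  assumes "u \<in> L2" "\<And>x. x \<in> {0..1} \<Longrightarrow> \<bar>u x\<bar> \<le> c"
  shows "L2norm u \<le> c"
proof -
  have "0 \<le> c" using assms(2)[of 0] by simp
  then show ?thesis
    using L2norm_mono[of u "\<lambda>_. c"] assms by (auto simp: L2_continuous)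
qed

section \<open>The orthonormal families of sines and cosines\<close>

definition om :: "nat \<Rightarrow> real" where "om k = pi * real (Suc k)"
definition es :: "nat \<Rightarrow> real \<Rightarrow> real" where "es k x = sqrt 2 * sin (om k * x)"
definition ec :: "nat \<Rightarrow> real \<Rightarrow> real" where "ec k x = sqrt 2 * cos (om k * x)"
definition cf :: "(real \<Rightarrow> real) \<Rightarrow> nat \<Rightarrow> real" where "cf u k = L2inner u (es k)"

text \<open>The index is shifted by one so that every natural number is a Dirichlet mode. No
  frequency vanishes, and powers of \<open>om k\<close> increase with the exponent.\<close>

lemma om_ge_1: "1 \<le> om k"
proof -
  have "1 * 1 \<le> pi * real (Suc k)" using pi_ge_two by (intro mult_mono) auto
  then show ?thesis by (simp add: om_def)
qed

lemma om_pos [simp]: "0 < om k" "0 \<le> om k" "om k \<noteq> 0"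
  using om_ge_1[of k] by auto

lemma sin_om [simp]: "sin (om k) = 0" "sin (pi * (1 + real k)) = 0"
  using sin_npi[of "Suc k"] by (auto simp: om_def mult.commute)

lemma es_01 [simp]: "es k 0 = 0" "es k 1 = 0"
  by (simp_all add: es_def)

lemma es_continuous [continuous_intros]: "continuous_on A (es k)"
  unfolding es_def by (intro continuous_intros)

lemma ec_continuous [continuous_intros]: "continuous_on A (ec k)"
  unfolding ec_def by (intro continuous_intros)

lemma es_L2 [simp, intro]: "es k \<in> L2" and ec_L2 [simp, intro]: "ec k \<in> L2"
  by (auto intro: L2_continuous continuous_intros)

lemma es_deriv [derivative_intros]: "(es k has_real_derivative om k * ec k x) (at x within A)"
  unfolding es_def ec_def by (auto intro!: derivative_eq_intros)

lemma ec_deriv [derivative_intros]: "(ec k has_real_derivative - (om k * es k x)) (at x within A)"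
  unfolding es_def ec_def by (auto intro!: derivative_eq_intros)

lemma es_le: "\<bar>es k x\<bar> \<le> 2" and ec_le: "\<bar>ec k x\<bar> \<le> 2"
proof -
  have "sqrt 2 \<le> 2" using real_sqrt_le_mono[of 2 4] by simp
  then have "sqrt 2 * \<bar>sin (om k * x)\<bar> \<le> 2 * 1" "sqrt 2 * \<bar>cos (om k * x)\<bar> \<le> 2 * 1"
    by (intro mult_mono; simp)+
  then show "\<bar>es k x\<bar> \<le> 2" "\<bar>ec k x\<bar> \<le> 2" by (simp_all add: es_def ec_def abs_mult)
qed

lemma LINT_FTC_01:
  fixes F f :: "real \<Rightarrow> real"
  assumes "a \<le> b" "\<And>x. x \<in> {a..b} \<Longrightarrow> (F has_real_derivative f x) (at x within {a..b})" "continuous_on {a..b} f"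
  shows "(LINT x:{a..b}|lborel. f x) = F b - F a"
  unfolding set_lebesgue_integral_def real_scaleR_def
  using integral_FTC_atLeastAtMost[of a b F f] assms
  by (simp add: has_real_derivative_iff_has_vector_derivative)

lemma int_cos_npi: "m \<noteq> 0 \<Longrightarrow> (LINT x:{0..1}|lborel. cos (real_of_int m * pi * x)) = 0"
proof -
  assume m: "m \<noteq> 0"
  have "(LINT x:{0..1}|lborel. cos (real_of_int m * pi * x)) =
     sin (real_of_int m * pi * 1) / (real_of_int m * pi) - sin (real_of_int m * pi * 0) / (real_of_int m * pi)"
    using m by (intro LINT_FTC_01) (auto intro!: derivative_eq_intros continuous_intros)
  also have "sin (real_of_int m * pi * 1) = 0" using sin_times_pi_eq_0[of "real_of_int m"] by simp
  finally show ?thesis by simp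
qed

lemma cos_integrable: "set_integrable lborel {0..1::real} (\<lambda>x. cos (c * x))"
  by (intro borel_integrable_atLeastAtMost' continuous_intros)

text \<open>All frequencies are multiples of \<pi>: the difference has the integer factor
  \<open>j - k\<close>, which vanishes only for equal indices, and the sum has the factor
  \<open>j + k + 2\<close>, which never vanishes. The product formulas for sines and for cosines
  both reduce to these two integrals.\<close>

lemma orthonormal_aux:
  "(LINT x:{0..1}|lborel. cos ((om j - om k) * x)) = (if j = k then 1 else 0)"
  "(LINT x:{0..1}|lborel. cos ((om j + om k) * x)) = 0"
proof -
  have 1: "(om j - om k) = real_of_int (int j - int k) * pi" "(om j + om k) = real_of_int (int j + int k + 2) * pi"
    by (simp_all add: om_def algebra_simps)
  show "(LINT x:{0..1}|lborel. cos ((om j - om k) * x)) = (if j = k then 1 else 0)"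
    using int_cos_npi[of "int j - int k"] unfolding 1
    by (auto simp: set_lebesgue_integral_def)
  show "(LINT x:{0..1}|lborel. cos ((om j + om k) * x)) = 0"
    using int_cos_npi[of "int j + int k + 2"] unfolding 1 by auto
qed

lemma es_orthonormal: "L2inner (es j) (es k) = (if j = k then 1 else 0)"
proof -
  have "es j x * es k x = cos ((om j - om k) * x) - cos ((om j + om k) * x)" for x
    by (simp add: es_def cos_diff cos_add algebra_simps)
  then have "L2inner (es j) (es k) =
     (LINT x:{0..1}|lborel. cos ((om j - om k) * x) - cos ((om j + om k) * x))"
    by (simp add: L2inner_def)
  also have "\<dots> = (LINT x:{0..1}|lborel. cos ((om j - om k) * x)) - (LINT x:{0..1}|lborel. cos ((om j + om k) * x))"
    by (intro set_integral_diff cos_integrable)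
  finally show ?thesis by (simp only: orthonormal_aux diff_zero)
qed

lemma ec_orthonormal: "L2inner (ec j) (ec k) = (if j = k then 1 else 0)"
proof -
  have "ec j x * ec k x = cos ((om j - om k) * x) + cos ((om j + om k) * x)" for x
    by (simp add: ec_def cos_diff cos_add algebra_simps)
  then have "L2inner (ec j) (ec k) =
     (LINT x:{0..1}|lborel. cos ((om j - om k) * x) + cos ((om j + om k) * x))"
    by (simp add: L2inner_def)
  also have "\<dots> = (LINT x:{0..1}|lborel. cos ((om j - om k) * x)) + (LINT x:{0..1}|lborel. cos ((om j + om k) * x))"
    by (intro set_integral_add cos_integrable)
  finally show ?thesis by (simp only: orthonormal_aux add_0_right)
qed

lemma cf_diff: "u \<in> L2 \<Longrightarrow> v \<in> L2 \<Longrightarrow> cf (\<lambda>x. u x - v x) k = cf u k - cf v k"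
  by (simp add: cf_def L2inner_diff_left)

lemma cf_le: "u \<in> L2 \<Longrightarrow> \<bar>cf u k\<bar> \<le> L2norm u"
  using L2_Cauchy_Schwarz[of u "es k"] by (simp add: cf_def L2norm_def es_orthonormal)

text \<open>Stated for an arbitrary orthonormal family, since it is needed for sines and cosines.\<close>

lemma inner_orthonormal_sums:
  assumes "\<And>k. e k \<in> L2" "\<And>j k. L2inner (e j) (e k) = (if j = k then 1 else 0)" "finite I"
  shows "L2inner (\<lambda>x. \<Sum>k\<in>I. a k * e k x) (\<lambda>x. \<Sum>k\<in>I. b k * e k x) = (\<Sum>k\<in>I. a k * b k)"
proof -
  have "L2inner (\<lambda>x. \<Sum>k\<in>I. a k * e k x) (\<lambda>x. \<Sum>k\<in>I. b k * e k x) =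
      (\<Sum>j\<in>I. \<Sum>k\<in>I. a j * (b k * L2inner (e j) (e k)))"
    using assms(1) by (simp add: L2inner_sum_left L2inner_sum_right L2_scale L2_sum
         L2inner_scale_left L2inner_scale_right sum_distrib_left)
  also have "\<dots> = (\<Sum>j\<in>I. a j * b j)"
    using assms(3) by (simp add: assms(2) if_distrib[of "\<lambda>x. _ * x"] sum.delta' cong: if_cong)
  finally show ?thesis .
qed

section \<open>Partial sums and Bessel's inequality\<close>

definition psum :: "(nat \<Rightarrow> real) \<Rightarrow> nat \<Rightarrow> real \<Rightarrow> real" where
  "psum a K x = (\<Sum>k<K. a k * es k x)"

lemma psum_continuous [continuous_intros]: "continuous_on A (psum a K)"
  unfolding psum_def by (intro continuous_intros)

lemma psum_L2 [simp, intro]: "psum a K \<in> L2"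
  by (auto intro: L2_continuous continuous_intros)

lemma psum_norm: "(L2norm (psum a K))\<^sup>2 = (\<Sum>k<K. (a k)\<^sup>2)"
  unfolding L2norm_power2 psum_def
  by (subst inner_orthonormal_sums) (auto simp: es_orthonormal power2_eq_square)

lemma psum_diff: "psum a K x - psum b K x = psum (\<lambda>k. a k - b k) K x"
  by (simp add: psum_def sum_subtractf left_diff_distrib)

lemma psum_inner: "u \<in> L2 \<Longrightarrow> L2inner (psum a K) u = (\<Sum>k<K. a k * cf u k)"
  unfolding psum_def cf_def by (subst L2inner_sum_left) (auto simp: L2inner_scale_left L2_scale L2inner_commute)

lemma psum_cf: "cf (psum a K) k = (if k < K then a k else 0)"
  unfolding cf_def by (subst psum_inner) (auto simp: cf_def es_orthonormal if_distrib[of "\<lambda>x. _ * x"] cong: if_cong)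

lemma cf_residual:
  assumes u: "u \<in> L2"
  shows "(L2norm (\<lambda>x. u x - psum (cf u) K x))\<^sup>2 = (L2norm u)\<^sup>2 - (\<Sum>k<K. (cf u k)\<^sup>2)"
proof -
  have "(L2norm (\<lambda>x. u x - psum (cf u) K x))\<^sup>2 = L2inner u u - 2 * L2inner (psum (cf u) K) u + (L2norm (psum (cf u) K))\<^sup>2"
    using u unfolding L2norm_power2
    by (simp add: L2inner_diff_left L2inner_diff_right L2_diff L2inner_commute[of u "psum _ _"])
  then show ?thesis using u by (simp add: psum_inner psum_norm L2norm_power2[of u]) (simp add: power2_eq_square)
qed

lemma Bessel: "u \<in> L2 \<Longrightarrow> (\<Sum>k<K. (cf u k)\<^sup>2) \<le> (L2norm u)\<^sup>2"
  using cf_residual[of u K] zero_le_power2[of "L2norm (\<lambda>x. u x - psum (cf u) K x)"] by linarith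

section \<open>Completeness of the sine basis\<close>

text \<open>Half-lines form an intersection-stable generator of the Borel sets, and the sets over
  which \<open>v\<close> integrates to zero form a Dynkin system; the vanishing total integral
  supplies the complements.\<close>

lemma AE_zero_if_halfline_integrals_zero:
  fixes v :: "real \<Rightarrow> real"
  assumes v: "integrable lborel v" and tot: "(\<integral>x. v x \<partial>lborel) = 0"
    and half: "\<And>b. (LINT x:{..b}|lborel. v x) = 0"
  shows "AE x in lborel. v x = 0"
proof (rule sigma_finite_measure.density_zero[OF lborel.sigma_finite_measure_axioms v])
  have si: "set_integrable lborel A v" if "A \<in> sets borel" for A
    unfolding set_integrable_def using v that by (intro integrable_mult_indicator) auto
  fix A :: "real set" assume "A \<in> sets lborel"
  have b: "B \<in> sets borel" if "B \<in> sigma_sets UNIV (range atMost)" for B :: "real set"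
    using that by (simp add: borel_eq_atMost)
  have "Int_stable (range (atMost :: real \<Rightarrow> real set))" "range (atMost :: real \<Rightarrow> real set) \<subseteq> Pow UNIV"
    by (auto simp: Int_stable_def)
  moreover have "A \<in> sigma_sets UNIV (range atMost)"
    using \<open>A \<in> sets lborel\<close> by (simp add: borel_eq_atMost)
  ultimately show "(LINT x:A|lborel. v x) = 0"
  proof (induction A rule: sigma_sets_induct_disjoint)
    case (basic A)
    then show ?case using half by auto
  next
    case (compl A)
    have "(LINT x:(UNIV - A) \<union> A|lborel. v x) = (LINT x:UNIV - A|lborel. v x) + (LINT x:A|lborel. v x)"
      using b[OF compl(1)] by (intro set_integral_Un si) auto
    moreover have "(LINT x:(UNIV - A) \<union> A|lborel. v x) = 0"
      using tot by (simp add: set_lebesgue_integral_def)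
    ultimately show ?case using compl by (auto simp: Compl_eq_Diff_UNIV)
  next
    case (union A)
    have bA: "A i \<in> sets lborel" for i using union b by auto
    have "(LINT x:(\<Union>i. A i)|lborel. v x) = (\<Sum>i. (LINT x:A i|lborel. v x))"
      using bA union(1) by (intro lebesgue_integral_countable_add si) (auto simp: disjoint_family_on_def)
    then show ?case using union(3) by simp
  qed (simp add: set_lebesgue_integral_def)
qed

lemma L2_cong_AE_zero:
  assumes "u \<in> L2" "AE x in lborel. x \<in> {0..1} \<longrightarrow> u x = 0" "v \<in> L2"
  shows "L2inner u v = 0"
proof -
  have "L2inner u v = (LINT (x::real)|lborel. (0::real))"
    unfolding L2inner_def set_lebesgue_integral_def
  proof (rule Bochner_Integration.integral_cong_AE)
    show "(\<lambda>x. indicator {0..1} x *\<^sub>R (u x * v x)) \<in> borel_measurable lborel"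
      using L2_mult_integrable[OF assms(1,3)] by (simp add: set_integrable_def borel_measurable_integrable)
    show "AE x in lborel. indicator {0..1} x *\<^sub>R (u x * v x) = 0"
      using assms(2) by eventually_elim (auto simp: indicator_def)
  qed simp
  then show ?thesis by simp
qed

text \<open>By the Weierstrass theorem polynomials in \<open>cos (\<pi> x)\<close> are dense in the continuous functions on
  \<open>[0,1]\<close>, so it suffices to produce these from products with the first sine.\<close>

lemma es_cos_power_orthogonal:
  assumes u: "u \<in> L2" and z: "\<And>k. cf u k = 0"
  shows "L2inner u (\<lambda>x. es k x * cos (pi * x) ^ n) = 0"
proof (induction n arbitrary: k)
  case 0
  then show ?case using z[of k] by (simp add: cf_def)
next
  case (Suc n)
  \<comment> \<open>The neighbour below in the product formula for sine times cosine. For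
    \<open>k = 0\<close> it would be the sine of frequency zero, hence the value 0.\<close>
  define s where "s = (\<lambda>x. if k = 0 then 0 else es (k - 1) x)"
  have s: "continuous_on A s" for A unfolding s_def by (cases "k = 0") (auto intro: continuous_intros)
  have id: "es k x * cos (pi * x) = (es (Suc k) x + s x) / 2" for x
  proof -
    have a: "om (Suc k) * x = om k * x + pi * x" by (simp add: om_def algebra_simps)
    show ?thesis
    proof (cases k)
      case 0
      then show ?thesis using sin_double[of "pi * x"] unfolding es_def a s_def by (simp add: sin_add om_def)
    next
      case (Suc m)
      then have b: "om (k - 1) * x = om k * x - pi * x" by (simp add: om_def algebra_simps)
      show ?thesis using Suc unfolding es_def s_def a b
        by (simp add: sin_add sin_diff algebra_simps del: of_nat_Suc)
    qed
  qed
  have "L2inner u (\<lambda>x. s x * cos (pi * x) ^ n) = 0"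
    using Suc.IH[of "k - 1"] unfolding s_def by (cases "k = 0") (auto simp: L2inner_commute[of u])
  moreover have "L2inner u (\<lambda>x. es k x * cos (pi * x) ^ Suc n) =
     L2inner u (\<lambda>x. (1/2) * (es (Suc k) x * cos (pi * x) ^ n + s x * cos (pi * x) ^ n))"
    unfolding power_Suc mult.assoc[symmetric] id by (simp add: algebra_simps add_divide_distrib)
  ultimately show ?case
    using u Suc.IH[of "Suc k"] s
    by (simp only: L2inner_scale_right, subst L2inner_add_right)
      (auto intro!: L2_continuous continuous_intros)
qed

text \<open>The product of \<open>u\<close> with the first sine is orthogonal to all polynomials in
  \<open>cos (pi * x)\<close>, hence to all continuous functions, hence integrates to zero over
  half-lines. The first sine is positive inside the interval, so it can be divided out.\<close>

lemma sine_coeffs_zero: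
  assumes u: "u \<in> L2" and z: "\<And>k. cf u k = 0"
  shows "AE x in lborel. x \<in> {0..1} \<longrightarrow> u x = 0"
proof -
  define v where "v = (\<lambda>x. indicator {0..1::real} x * (u x * es 0 x))"
  have vi: "integrable lborel v"
    using L2_mult_integrable[OF u, of "es 0"] by (simp add: v_def set_integrable_def)
  have p: "L2inner u (\<lambda>x. es 0 x * poly q (cos (pi * x))) = 0" for q
  proof -
    have "L2inner u (\<lambda>x. es 0 x * poly q (cos (pi * x))) =
       L2inner u (\<lambda>x. \<Sum>i\<le>degree q. coeff q i * (es 0 x * cos (pi * x) ^ i))"
      by (simp add: poly_altdef sum_distrib_left mult.left_commute)
    also have "\<dots> = (\<Sum>i\<le>degree q. L2inner u (\<lambda>x. coeff q i * (es 0 x * cos (pi * x) ^ i)))"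
      by (intro L2inner_sum_right L2_scale u) (auto intro!: L2_continuous continuous_intros)
    also have "\<dots> = 0" by (simp add: L2inner_scale_right es_cos_power_orthogonal[OF u z])
    finally show ?thesis .
  qed
  have c: "(LINT x|lborel. v x * \<phi> x) = 0" if \<phi>: "continuous_on {0..1} \<phi>" for \<phi>
  proof -
    have e: "(LINT x|lborel. v x * \<psi> x) = L2inner u (\<lambda>x. es 0 x * \<psi> x)" for \<psi>
      by (simp add: v_def L2inner_def set_lebesgue_integral_def mult.assoc)
    have i: "L2norm (\<lambda>x. es 0 x * \<psi> x) \<le> 2 * d"
      if "continuous_on {0..1} \<psi>" "\<And>x. x \<in> {0..1} \<Longrightarrow> \<bar>\<psi> x\<bar> \<le> d" for \<psi> d
    proof (rule L2norm_le_const)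
      show "(\<lambda>x. es 0 x * \<psi> x) \<in> L2" using that by (auto intro!: L2_continuous continuous_intros)
      show "\<bar>es 0 x * \<psi> x\<bar> \<le> 2 * d" if "x \<in> {0..1}" for x
        using es_le[of 0 x] \<open>x \<in> {0..1} \<Longrightarrow> \<bar>\<psi> x\<bar> \<le> d\<close> that unfolding abs_mult by (intro mult_mono) auto
    qed
    have "\<bar>L2inner u (\<lambda>x. es 0 x * \<phi> x)\<bar> \<le> L2norm u * (2 * d)" if "d > 0" for d
    proof -
      \<comment> \<open>Stone-Weierstrass applies because the cosine is injective on
        \<open>[0, pi]\<close>, so that these polynomials separate the points of the unit
        interval.\<close>
      obtain g where g: "\<exists>q. g = (\<lambda>x. poly q (cos (pi * x)))" and gd: "\<And>x. x \<in> {0..1} \<Longrightarrow> \<bar>\<phi> x - g x\<bar> < d"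
      proof (atomize_elim, rule ex_forward[OF Stone_Weierstrass_HOL[of "{0..1::real}" "\<lambda>g. \<exists>q. g = (\<lambda>x. poly q (cos (pi * x)))" \<phi> d]])
        fix c :: real show "\<exists>q. (\<lambda>x::real. c) = (\<lambda>x. poly q (cos (pi * x)))"
          by (rule exI[of _ "[:c:]"]) simp
      next
        fix f g :: "real \<Rightarrow> real"
        assume "(\<exists>q. f = (\<lambda>x. poly q (cos (pi * x)))) \<and> (\<exists>q. g = (\<lambda>x. poly q (cos (pi * x))))"
        then obtain q r where "f = (\<lambda>x. poly q (cos (pi * x)))" "g = (\<lambda>x. poly r (cos (pi * x)))" by blast
        then show "\<exists>q. (\<lambda>x. f x + g x) = (\<lambda>x. poly q (cos (pi * x)))"
          "\<exists>q. (\<lambda>x. f x * g x) = (\<lambda>x. poly q (cos (pi * x)))"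
          by (auto intro: exI[of _ "q + r"] exI[of _ "q * r"])
      next
        fix x y :: real assume "x \<in> {0..1} \<and> y \<in> {0..1} \<and> x \<noteq> y"
        then have "cos (pi * x) \<noteq> cos (pi * y)"
          using cos_inj_pi[of "pi * x" "pi * y"] by auto
        then show "\<exists>f. (\<exists>q. f = (\<lambda>x. poly q (cos (pi * x)))) \<and> f x \<noteq> f y"
          by (intro exI[of _ "\<lambda>x. poly [:0, 1:] (cos (pi * x))"] conjI exI[of _ "[:0, 1:]"]) auto
      qed (use \<phi> \<open>d > 0\<close> in \<open>auto intro!: continuous_intros\<close>)
      then obtain q where q: "g = (\<lambda>x. poly q (cos (pi * x)))" by blast
      have gc: "continuous_on {0..1} g" unfolding q by (intro continuous_intros)
      have "L2inner u (\<lambda>x. es 0 x * \<phi> x) = L2inner u (\<lambda>x. es 0 x * \<phi> x - es 0 x * g x)"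
        using p[of q] u \<phi> gc unfolding q
        by (subst L2inner_diff_right) (auto intro!: L2_continuous continuous_intros)
      also have "\<dots> = L2inner u (\<lambda>x. es 0 x * (\<phi> x - g x))" by (simp add: algebra_simps)
      also have "\<bar>\<dots>\<bar> \<le> L2norm u * L2norm (\<lambda>x. es 0 x * (\<phi> x - g x))"
        using u \<phi> gc by (intro L2_Cauchy_Schwarz) (auto intro!: L2_continuous continuous_intros)
      also have "\<dots> \<le> L2norm u * (2 * d)"
        using \<phi> gc gd by (intro mult_left_mono i) (auto intro!: continuous_intros less_imp_le)
      finally show ?thesis .
    qed
    then have "L2inner u (\<lambda>x. es 0 x * \<phi> x) = 0"
    proof -
      assume *: "\<And>d. d > 0 \<Longrightarrow> \<bar>L2inner u (\<lambda>x. es 0 x * \<phi> x)\<bar> \<le> L2norm u * (2 * d)"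
      have "((\<lambda>d. L2norm u * (2 * d)) \<longlongrightarrow> L2norm u * (2 * 0)) (at_right 0)"
        by (intro tendsto_intros)
      then have "\<bar>L2inner u (\<lambda>x. es 0 x * \<phi> x)\<bar> \<le> L2norm u * (2 * 0)"
        by (rule tendsto_lowerbound) (auto simp: eventually_at_right_less * intro: eventually_at_rightI[of 0 1])
      then show ?thesis by simp
    qed
    then show ?thesis by (simp add: e)
  qed
  have "AE x in lborel. v x = 0"
  proof (rule AE_zero_if_halfline_integrals_zero[OF vi])
    show "(\<integral>x. v x \<partial>lborel) = 0" using c[of "\<lambda>_. 1"] by simp
    fix b :: real
    \<comment> \<open>Piecewise linear cutoffs, equal to 1 on \<open>{..b}\<close> and, for
      \<open>n > 0\<close>, to 0 beyond \<open>b + 1/n\<close>; they tend to the indicator at every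
      point, \<open>b\<close> included.\<close>
    define \<phi> where "\<phi> n x = max 0 (min 1 (1 - real n * (x - b)))" for n x
    have "(\<lambda>n. LINT x|lborel. v x * \<phi> n x) \<longlonglongrightarrow> (LINT x|lborel. indicator {..b} x *\<^sub>R v x)"
    proof (rule integral_dominated_convergence[where w="\<lambda>x. \<bar>v x\<bar>"])
      show "(\<lambda>x. indicator {..b} x *\<^sub>R v x) \<in> borel_measurable lborel"
        using vi by (intro borel_measurable_scaleR) auto
      show "(\<lambda>x. v x * \<phi> n x) \<in> borel_measurable lborel" for n
        using vi unfolding \<phi>_def by (intro borel_measurable_times) auto
      show "AE x in lborel. (\<lambda>n. v x * \<phi> n x) \<longlonglongrightarrow> indicator {..b} x *\<^sub>R v x"
      proof (rule AE_I2)
        fix x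
        have "(\<lambda>n. \<phi> n x) \<longlonglongrightarrow> indicator {..b} x"
        proof (cases "x \<le> b")
          case True
          then have "real n * (x - b) \<le> 0" for n by (simp add: mult_nonneg_nonpos)
          then have "\<phi> n x = 1" for n unfolding \<phi>_def by (smt (verit))
          then show ?thesis using True by simp
        next
          case False
          then have "x - b > 0" by simp
          then obtain m where m: "real m * (x - b) > 1" using reals_Archimedean3 by blast
          have "\<phi> n x = 0" if "n \<ge> m" for n
          proof -
            have "real m * (x - b) \<le> real n * (x - b)" using that \<open>x - b > 0\<close> by (intro mult_right_mono) auto
            then show ?thesis using m unfolding \<phi>_def by simp
          qed
          then have "eventually (\<lambda>n. \<phi> n x = 0) sequentially" by (auto simp: eventually_sequentially)
          then show ?thesis using False by (simp add: tendsto_eventually)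
        qed
        from tendsto_mult_left[OF this, of "v x"]
        show "(\<lambda>n. v x * \<phi> n x) \<longlonglongrightarrow> indicator {..b} x *\<^sub>R v x" by (simp add: mult.commute)
      qed
      have "\<bar>\<phi> n x\<bar> \<le> 1" for n x unfolding \<phi>_def by auto
      then show "AE x in lborel. norm (v x * \<phi> n x) \<le> \<bar>v x\<bar>" for n
        by (auto simp: abs_mult intro!: mult_left_le)
    qed (use vi in auto)
    moreover have "(LINT x|lborel. v x * \<phi> n x) = 0" for n
      unfolding \<phi>_def by (intro c continuous_intros)
    ultimately show "(LINT x:{..b}|lborel. v x) = 0"
      using LIMSEQ_unique[OF tendsto_const] unfolding set_lebesgue_integral_def by force
  qed
  moreover have "AE x in lborel. x \<noteq> (0::real)" "AE x in lborel. x \<noteq> (1::real)"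
    by (rule AE_lborel_singleton)+
  ultimately show ?thesis
  proof eventually_elim
    case (elim x)
    show ?case
    proof
      assume x: "x \<in> {0..1}"
      with elim have "0 < pi * x" "pi * x < pi * 1" by (auto simp del: mult_1_right)
      then have "sin (pi * x) > 0" by (intro sin_gt_zero) auto
      then have "es 0 x \<noteq> 0" by (simp add: es_def om_def)
      then show "u x = 0" using elim x by (simp add: v_def)
    qed
  qed
qed

lemma L2norm_zero_if_cf_zero:
  assumes u: "u \<in> L2" and z: "\<And>k. cf u k = 0" shows "L2norm u = 0"
  using L2_cong_AE_zero[OF u sine_coeffs_zero[OF u z] u] by (simp add: L2norm_def)

text \<open>This is the passage from coefficients back to points: a continuous function that is
  nonzero somewhere is nonzero on an open set, which is not negligible.\<close>

lemma continuous_cf_zero: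
  assumes u: "continuous_on {0..1} u" and z: "\<And>k. cf u k = 0" and x: "x \<in> {0<..<1::real}"
  shows "u x = 0"
proof (rule ccontr)
  assume n: "u x \<noteq> 0"
  have "continuous_on {0<..<1} u" using u by (rule continuous_on_subset) auto
  then have "isCont u x" using x by (simp add: continuous_on_eq_continuous_at)
  then obtain S where S: "open S" "x \<in> S" "\<And>y. y \<in> S \<Longrightarrow> u y \<noteq> 0"
    using continuous_at_avoid[of x u 0] n by (metis dist_commute mem_ball open_ball centre_in_ball)
  define T where "T = S \<inter> {0<..<1}"
  have T: "open T" "x \<in> T" using S x by (auto simp: T_def)
  have "AE y in lborel. y \<in> {0..1} \<longrightarrow> u y = 0" using sine_coeffs_zero[OF L2_continuous[OF u] z] .
  then have "AE y in lborel. y \<notin> T" by eventually_elim (use S in \<open>auto simp: T_def\<close>)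
  then have "T \<in> null_sets lborel" using T by (subst (asm) AE_iff_null_sets[symmetric]) auto
  then have "negligible T" by (simp add: negligible_iff_null_sets null_sets_completionI)
  then show False using open_not_negligible[of T] T by auto
qed

text \<open>On the unit interval an L2-Cauchy sequence is also L1-Cauchy, so a subsequence converges
  almost everywhere. Fatou's lemma along that subsequence transfers the Cauchy bounds to the
  distance from the limit.\<close>

lemma L2_complete:
  assumes s: "\<And>n. s n \<in> L2"
    and C: "\<And>e. e > 0 \<Longrightarrow> \<exists>N. \<forall>i\<ge>N. \<forall>j\<ge>N. L2norm (\<lambda>x. s i x - s j x) < e"
  obtains v where "v \<in> L2" "(\<lambda>n. L2norm (\<lambda>x. s n x - v x)) \<longlonglongrightarrow> 0"
proof -
  define S where "S n x = indicator {0..1::real} x * s n x" for n x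
  have Si: "integrable lborel (S n)" for n
    using L2_set_integrable[OF s, of n] by (simp add: S_def[abs_def] set_integrable_def)
  have L1: "(LINT x|lborel. norm (S i x - S j x)) \<le> L2norm (\<lambda>x. s i x - s j x)" for i j
  proof -
    have "(LINT x|lborel. norm (S i x - S j x)) = L2inner (\<lambda>x. \<bar>s i x - s j x\<bar>) (\<lambda>x. 1)"
      unfolding L2inner_def set_lebesgue_integral_def
      by (rule Bochner_Integration.integral_cong) (auto simp: S_def indicator_def)
    also have "\<dots> \<le> L2norm (\<lambda>x. \<bar>s i x - s j x\<bar>) * L2norm (\<lambda>x. 1)"
    proof -
      have "(\<lambda>x. \<bar>S i x - S j x\<bar>) \<in> borel_measurable lborel"
        using Si[of i] Si[of j] by (intro borel_measurable_abs borel_measurable_diff borel_measurable_integrable)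
      moreover have "(\<lambda>x. \<bar>S i x - S j x\<bar>) = (\<lambda>x. indicator {0..1::real} x *\<^sub>R \<bar>s i x - s j x\<bar>)"
        by (auto simp: S_def indicator_def)
      ultimately have "set_borel_measurable lborel {0..1} (\<lambda>x. \<bar>s i x - s j x\<bar>)"
        by (simp add: set_borel_measurable_def)
      then have "(\<lambda>x. \<bar>s i x - s j x\<bar>) \<in> L2"
        using L2_diff[OF s s, of i j] by (auto simp: L2_def)
      then show ?thesis
        using L2_Cauchy_Schwarz[of "\<lambda>x. \<bar>s i x - s j x\<bar>" "\<lambda>_. 1"] by (auto simp: L2_continuous)
    qed
    also have "L2norm (\<lambda>x. \<bar>s i x - s j x\<bar>) = L2norm (\<lambda>x. s i x - s j x)"
      by (simp add: L2norm_def L2inner_def)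
    finally show ?thesis by simp
  qed
  obtain r where r: "strict_mono r" and Cr: "AE x in lborel. Cauchy (\<lambda>i. S (r i) x)"
  proof (rule cauchy_L1_AE_cauchy_subseq[of lborel S])
    fix e :: real assume "e > 0"
    from C[OF this] show "\<exists>N. \<forall>i\<ge>N. \<forall>j\<ge>N. (LINT x|lborel. norm (S i x - S j x)) < e"
      using L1 by (meson le_less_trans)
  qed (use Si in auto)
  define v where "v x = lim (\<lambda>i. S (r i) x)" for x
  have v_meas: "v \<in> borel_measurable lborel"
    unfolding v_def using Si by (intro borel_measurable_lim_metric) auto
  have lim: "AE x in lborel. (\<lambda>i. S (r i) x) \<longlonglongrightarrow> v x"
    using Cr by eventually_elim (auto simp: v_def Cauchy_convergent_iff convergent_LIMSEQ_iff)
  have fatou: "(\<integral>\<^sup>+x. ennreal ((S n x - v x)\<^sup>2 * indicator {0..1} x) \<partial>lborel) \<le> ennreal (e\<^sup>2)"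
    if e: "\<And>j. j \<ge> m \<Longrightarrow> L2norm (\<lambda>x. s n x - s j x) \<le> e" for n m e
  proof -
    have "(\<integral>\<^sup>+x. ennreal ((S n x - v x)\<^sup>2 * indicator {0..1} x) \<partial>lborel) \<le>
       (\<integral>\<^sup>+x. liminf (\<lambda>i. ennreal ((S n x - S (r i) x)\<^sup>2 * indicator {0..1} x)) \<partial>lborel)"
      using lim
    proof (intro nn_integral_mono_AE, eventually_elim)
      case (elim x)
      have "(\<lambda>i. ennreal ((S n x - S (r i) x)\<^sup>2 * indicator {0..1} x)) \<longlonglongrightarrow> ennreal ((S n x - v x)\<^sup>2 * indicator {0..1} x)"
        by (intro tendsto_ennrealI tendsto_intros elim)
      from lim_imp_Liminf[OF _ this] show ?case by simp
    qed
    also have "\<dots> \<le> liminf (\<lambda>i. \<integral>\<^sup>+x. ennreal ((S n x - S (r i) x)\<^sup>2 * indicator {0..1} x) \<partial>lborel)"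
      using Si by (intro nn_integral_liminf) auto
    also have "\<dots> \<le> ennreal (e\<^sup>2)"
    proof (rule Liminf_le)
      show "\<forall>\<^sub>F i in sequentially. (\<integral>\<^sup>+x. ennreal ((S n x - S (r i) x)\<^sup>2 * indicator {0..1} x) \<partial>lborel) \<le> ennreal (e\<^sup>2)"
      proof (rule eventually_sequentiallyI[of m])
        fix i assume "m \<le> i"
        then have ri: "r i \<ge> m" using seq_suble[OF r, of i] by linarith
        have eq: "(\<lambda>x. (S n x - S (r i) x)\<^sup>2 * indicator {0..1} x) =
           (\<lambda>x. indicator {0..1} x *\<^sub>R ((s n x - s (r i) x) * (s n x - s (r i) x)))"
          by (auto simp: S_def indicator_def power2_eq_square)
        have "(\<integral>\<^sup>+x. ennreal ((S n x - S (r i) x)\<^sup>2 * indicator {0..1} x) \<partial>lborel) =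
           ennreal ((L2norm (\<lambda>x. s n x - s (r i) x))\<^sup>2)"
          using L2_mult_integrable[OF L2_diff L2_diff, OF s s s s, of n "r i" n "r i"]
          unfolding fun_cong[OF eq] L2norm_power2 L2inner_def set_lebesgue_integral_def set_integrable_def
          by (intro nn_integral_eq_integral) auto
        also have "\<dots> \<le> ennreal (e\<^sup>2)"
          using e[OF ri] by (intro ennreal_leI power_mono) auto
        finally show "(\<integral>\<^sup>+x. ennreal ((S n x - S (r i) x)\<^sup>2 * indicator {0..1} x) \<partial>lborel) \<le> ennreal (e\<^sup>2)" .
      qed
    qed simp
    finally show ?thesis .
  qed
  \<comment> \<open>Any bound on the distances from \<open>s n\<close> to later terms survives in
    the limit. Finiteness of the integral also puts \<open>s n - v\<close>, and therefore
    \<open>v\<close>, into \<open>L2\<close>.\<close>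
  have vd: "(\<lambda>x. s n x - v x) \<in> L2 \<and> L2norm (\<lambda>x. s n x - v x) \<le> e"
    if e: "\<And>j. j \<ge> m \<Longrightarrow> L2norm (\<lambda>x. s n x - s j x) \<le> e" for n m e
  proof -
    have e0: "e \<ge> 0" using e[of m] L2norm_nonneg order_trans by blast
    have eq: "(S n x - v x)\<^sup>2 * indicator {0..1} x = indicator {0..1} x *\<^sub>R ((s n x - v x) * (s n x - v x))" for x
      by (auto simp: S_def indicator_def power2_eq_square)
    have m1: "set_borel_measurable lborel {0..1} (\<lambda>x. s n x - v x)"
    proof -
      have "(\<lambda>x. indicator {0..1::real} x * (S n x - v x)) \<in> borel_measurable lborel"
        using Si[of n] v_meas by auto
      moreover have "(\<lambda>x. indicator {0..1::real} x * (S n x - v x)) = (\<lambda>x. indicator {0..1::real} x *\<^sub>R (s n x - v x))"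
        by (auto simp: S_def indicator_def)
      ultimately show ?thesis by (simp add: set_borel_measurable_def)
    qed
    have m2: "(\<lambda>x. indicator {0..1} x *\<^sub>R ((s n x - v x) * (s n x - v x))) \<in> borel_measurable lborel"
      using set_borel_measurable_mult[OF m1 m1] by (simp add: set_borel_measurable_def)
    have le: "(\<integral>\<^sup>+x. ennreal (indicator {0..1} x *\<^sub>R ((s n x - v x) * (s n x - v x))) \<partial>lborel) \<le> ennreal (e\<^sup>2)"
      using fatou[OF e, of m] unfolding eq .
    have int: "integrable lborel (\<lambda>x. indicator {0..1} x *\<^sub>R ((s n x - v x) * (s n x - v x)))"
      using m2 le le_less_trans[OF le ennreal_less_top]
      by (intro integrableI_nonneg) (auto simp: top.not_eq_extremum)
    have L: "(\<lambda>x. s n x - v x) \<in> L2"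
      using m1 int by (simp add: L2_def set_integrable_def power2_eq_square)
    have "ennreal (L2inner (\<lambda>x. s n x - v x) (\<lambda>x. s n x - v x)) \<le> ennreal (e\<^sup>2)"
      using le unfolding L2inner_def set_lebesgue_integral_def
      by (subst (asm) nn_integral_eq_integral[OF int]) auto
    then have "(L2norm (\<lambda>x. s n x - v x))\<^sup>2 \<le> e\<^sup>2"
      unfolding L2norm_power2 by (simp add: ennreal_le_iff)
    then have "L2norm (\<lambda>x. s n x - v x) \<le> e" using e0 power2_le_imp_le by blast
    with L show ?thesis by blast
  qed
  obtain N1 where "\<forall>i\<ge>N1. \<forall>j\<ge>N1. L2norm (\<lambda>x. s i x - s j x) < 1" using C[of 1] by auto
  then have "(\<lambda>x. s N1 x - v x) \<in> L2" using vd[of N1 N1 1] by (auto intro: less_imp_le)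
  from L2_diff[OF s[of N1] this] have vL: "v \<in> L2" by simp
  show thesis
  proof (rule that[OF vL])
    show "(\<lambda>n. L2norm (\<lambda>x. s n x - v x)) \<longlonglongrightarrow> 0"
    proof (rule LIMSEQ_I)
      fix e :: real assume "e > 0"
      then obtain N where N: "\<forall>i\<ge>N. \<forall>j\<ge>N. L2norm (\<lambda>x. s i x - s j x) < e / 2"
        using C[of "e/2"] by auto
      have "norm (L2norm (\<lambda>x. s n x - v x) - 0) < e" if "n \<ge> N" for n
      proof -
        have "L2norm (\<lambda>x. s n x - v x) \<le> e / 2" using N that by (intro vd[THEN conjunct2, of N]) (auto intro: less_imp_le)
        then show ?thesis using \<open>e > 0\<close> by simp
      qed
      then show "\<exists>N. \<forall>n\<ge>N. norm (L2norm (\<lambda>x. s n x - v x) - 0) < e" by blast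
    qed
  qed
qed

lemma cf_tendsto:
  assumes "\<And>n. s n \<in> L2" "v \<in> L2" "(\<lambda>n. L2norm (\<lambda>x. s n x - v x)) \<longlonglongrightarrow> 0"
  shows "(\<lambda>n. cf (s n) k) \<longlonglongrightarrow> cf v k"
proof -
  have "norm (cf (s n) k - cf v k) \<le> L2norm (\<lambda>x. s n x - v x)" for n
    using cf_le[of "\<lambda>x. s n x - v x" k] assms by (simp add: cf_diff L2_diff)
  then have "(\<lambda>n. cf (s n) k - cf v k) \<longlonglongrightarrow> 0"
    using assms(3) by (rule Lim_null_comparison[OF always_eventually[OF allI]])
  then show ?thesis by (rule LIM_zero_cancel)
qed

text \<open>The difference of two partial sums is the partial sum of the sequence with its initial
  coefficients replaced by zero, so its squared norm is a block of the convergent series of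
  squares.\<close>

lemma Riesz_Fischer:
  assumes "summable (\<lambda>k. (a k)\<^sup>2)"
  obtains v where "v \<in> L2" "\<And>k. cf v k = a k" "(\<lambda>K. L2norm (\<lambda>x. psum a K x - v x)) \<longlonglongrightarrow> 0"
proof -
  have C: "\<exists>N. \<forall>i\<ge>N. \<forall>j\<ge>N. L2norm (\<lambda>x. psum a i x - psum a j x) < e" if "e > 0" for e
  proof -
    have n: "(L2norm (\<lambda>x. psum a i x - psum a j x))\<^sup>2 = \<bar>(\<Sum>k<i. (a k)\<^sup>2) - (\<Sum>k<j. (a k)\<^sup>2)\<bar>" for i j
    proof -
      have *: "(L2norm (\<lambda>x. psum a i x - psum a j x))\<^sup>2 = \<bar>(\<Sum>k<i. (a k)\<^sup>2) - (\<Sum>k<j. (a k)\<^sup>2)\<bar>" if "j \<le> i" for i j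
      proof -
        have "(\<lambda>x. psum a i x - psum a j x) = psum (\<lambda>k. if k < j then 0 else a k) i"
        proof
          fix x
          have "psum a i x = psum a j x + (\<Sum>k\<in>{j..<i}. a k * es k x)"
            using sum.atLeastLessThan_concat[of 0 j i "\<lambda>k. a k * es k x"] that
            unfolding psum_def by (simp add: atLeast0LessThan)
          moreover have "psum (\<lambda>k. if k < j then 0 else a k) i x = (\<Sum>k\<in>{j..<i}. a k * es k x)"
            unfolding psum_def by (rule sum.mono_neutral_cong_right) auto
          ultimately show "psum a i x - psum a j x = psum (\<lambda>k. if k < j then 0 else a k) i x" by simp
        qed
        then have "(L2norm (\<lambda>x. psum a i x - psum a j x))\<^sup>2 = (\<Sum>k<i. (if k < j then 0 else a k)\<^sup>2)"
          by (simp add: psum_norm)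
        also have "\<dots> = (\<Sum>k\<in>{j..<i}. (a k)\<^sup>2)"
          by (rule sum.mono_neutral_cong_right) auto
        also have "\<dots> = (\<Sum>k<i. (a k)\<^sup>2) - (\<Sum>k<j. (a k)\<^sup>2)"
          using that sum_diff_nat_ivl[of 0 j i "\<lambda>k. (a k)\<^sup>2"] by (simp add: atLeast0LessThan)
        finally have eq: "(L2norm (\<lambda>x. psum a i x - psum a j x))\<^sup>2 = (\<Sum>k<i. (a k)\<^sup>2) - (\<Sum>k<j. (a k)\<^sup>2)" .
        then have "0 \<le> (\<Sum>k<i. (a k)\<^sup>2) - (\<Sum>k<j. (a k)\<^sup>2)" by (metis zero_le_power2)
        with eq show ?thesis by simp
      qed
      show ?thesis using *[of i j] *[of j i] L2norm_minus_commute[of "psum a i" "psum a j"]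
        by (cases "j \<le> i") (auto simp: abs_minus_commute)
    qed
    have "Cauchy (\<lambda>n. \<Sum>k<n. (a k)\<^sup>2)"
      using assms by (simp add: Cauchy_convergent_iff summable_iff_convergent)
    then obtain N where N: "\<forall>i\<ge>N. \<forall>j\<ge>N. \<bar>(\<Sum>k<i. (a k)\<^sup>2) - (\<Sum>k<j. (a k)\<^sup>2)\<bar> < e\<^sup>2"
      using \<open>e > 0\<close> unfolding Cauchy_def dist_real_def by (meson zero_less_power)
    have "L2norm (\<lambda>x. psum a i x - psum a j x) < e" if "i \<ge> N" "j \<ge> N" for i j
      using N that \<open>e > 0\<close> by (intro power2_less_imp_less[of _ e]) (auto simp: n)
    then show ?thesis by blast
  qed
  obtain v where v: "v \<in> L2" "(\<lambda>n. L2norm (\<lambda>x. psum a n x - v x)) \<longlonglongrightarrow> 0"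
    using L2_complete[of "psum a", OF _ C] by auto
  have "cf v k = a k" for k
  proof (rule LIMSEQ_unique[of "\<lambda>n. cf (psum a n) k"])
    show "(\<lambda>n. cf (psum a n) k) \<longlonglongrightarrow> cf v k" using v by (intro cf_tendsto) auto
    show "(\<lambda>n. cf (psum a n) k) \<longlonglongrightarrow> a k"
      unfolding psum_cf by (rule tendsto_eventually, rule eventually_sequentiallyI[of "Suc k"]) auto
  qed
  with v that show thesis by blast
qed

lemma cf_summable: "u \<in> L2 \<Longrightarrow> summable (\<lambda>k. (cf u k)\<^sup>2)"
  using Bessel by (intro summableI_nonneg_bounded[where x="(L2norm u)\<^sup>2"]) auto

text \<open>Riesz-Fischer yields some limit of the partial sums with the coefficients of
  \<open>u\<close>; completeness of the sines shows that it differs from \<open>u\<close> by a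
  function of seminorm zero.\<close>

lemma psum_cf_tendsto:
  assumes u: "u \<in> L2"
  shows "(\<lambda>K. L2norm (\<lambda>x. psum (cf u) K x - u x)) \<longlonglongrightarrow> 0"
proof -
  obtain v where v: "v \<in> L2" "\<And>k. cf v k = cf u k" "(\<lambda>K. L2norm (\<lambda>x. psum (cf u) K x - v x)) \<longlonglongrightarrow> 0"
    using Riesz_Fischer[OF cf_summable[OF u]] by blast
  have z: "L2norm (\<lambda>x. v x - u x) = 0"
    using u v by (intro L2norm_zero_if_cf_zero) (auto simp: cf_diff L2_diff)
  have "L2norm (\<lambda>x. psum (cf u) K x - u x) = L2norm (\<lambda>x. psum (cf u) K x - v x)" for K
    using L2norm_diff_triangle[of "psum (cf u) K" v u] L2norm_diff_triangle[of "psum (cf u) K" u v]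
       u v(1) z L2norm_minus_commute[of u v] by auto
  with v show ?thesis by simp
qed

lemma Parseval:
  assumes u: "u \<in> L2"
  shows "(\<lambda>k. (cf u k)\<^sup>2) sums (L2norm u)\<^sup>2"
proof -
  have "(\<lambda>K. (L2norm (\<lambda>x. u x - psum (cf u) K x))\<^sup>2) \<longlonglongrightarrow> 0\<^sup>2"
    using tendsto_power[OF psum_cf_tendsto[OF u], of 2] by (simp only: L2norm_minus_commute[of u "psum _ _"])
  then have "(\<lambda>K. (L2norm u)\<^sup>2 - (L2norm (\<lambda>x. u x - psum (cf u) K x))\<^sup>2) \<longlonglongrightarrow> (L2norm u)\<^sup>2 - 0\<^sup>2"
    by (rule tendsto_diff[OF tendsto_const])
  then show ?thesis unfolding sums_def cf_residual[OF u] by simp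
qed

text \<open>The estimates below are made on finite sums of squared coefficients, so that no
  summability has to be known beforehand; Parseval converts them into norm bounds.\<close>

lemma L2norm_le_if_cf_le:
  assumes u: "u \<in> L2" and "\<And>K. (\<Sum>k<K. (cf u k)\<^sup>2) \<le> A\<^sup>2" "0 \<le> A"
  shows "L2norm u \<le> A"
proof (rule power2_le_imp_le)
  show "(L2norm u)\<^sup>2 \<le> A\<^sup>2"
    using Parseval[OF u] assms(2) unfolding sums_def by (intro LIMSEQ_le_const2) auto
qed fact

section \<open>Estimates for the heat semigroup\<close>

text \<open>Raise \<open>x / p \<le> exp (x / p)\<close> to the power \<open>p\<close>. The
  inequality yields both the smoothing of the heat kernel and the gain from an exponential weight in
  time.\<close>

lemma exp_le_powr:
  fixes x p :: real
  assumes "0 < x" "0 < p"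
  shows "exp (- x) \<le> p powr p * x powr (- p)"
proof -
  have "x / p \<le> exp (x / p)" using exp_ge_add_one_self[of "x / p"] by linarith
  then have "(x / p) powr p \<le> exp (x / p) powr p" using assms by (intro powr_mono2) auto
  also have "\<dots> = exp x" using assms by (simp add: powr_def)
  finally have "x powr p / p powr p \<le> exp x" using assms by (simp add: powr_divide)
  then show ?thesis using assms by (simp add: exp_minus powr_minus field_simps)
qed

lemma summable_om_powr:
  assumes "s < -1" shows "summable (\<lambda>k. om k powr s)"
proof (rule summable_comparison_test')
  show "summable (\<lambda>k. real (Suc k) powr s)"
    using assms summable_real_powr_iff[of s] by (subst summable_Suc_iff) simp
  show "norm (om k powr s) \<le> real (Suc k) powr s" for k
  proof -
    have "real (Suc k) \<le> om k" using pi_ge_two unfolding om_def by (simp add: mult_le_cancel_right1)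
    then show ?thesis using assms by (simp add: powr_mono2')
  qed
qed

text \<open>Applying \<open>exp_le_powr\<close> with exponent \<open>q\<close> to each mode leaves
  the series of \<open>om k powr (2 * \<beta> - 4 * q)\<close>, which converges exactly when
  \<open>\<beta> + 1/2 < 2 * q\<close>. The extra 1/2 is the price of an l2 sum over the modes;
  paired with square summable coefficients by Cauchy-Schwarz, it gives weighted l1 bounds.\<close>

lemma heat_sum:
  assumes "0 < q" "\<beta> + 1/2 < 2 * q"
  obtains C where "0 < C"
    "\<And>\<tau> K. 0 < \<tau> \<Longrightarrow> (\<Sum>k<K. (om k powr \<beta> * exp (- (om k)\<^sup>2 * \<tau>))\<^sup>2) \<le> (C * \<tau> powr (- q))\<^sup>2"
proof -
  define S where "S = (\<Sum>k. om k powr (2 * \<beta> - 4 * q))"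
  have sm: "summable (\<lambda>k. om k powr (2 * \<beta> - 4 * q))"
    using assms by (intro summable_om_powr) simp
  have S0: "0 \<le> S" unfolding S_def using sm by (intro suminf_nonneg) auto
  define C where "C = q powr q * sqrt S + 1"
  have "(\<Sum>k<K. (om k powr \<beta> * exp (- (om k)\<^sup>2 * \<tau>))\<^sup>2) \<le> (C * \<tau> powr (- q))\<^sup>2" if t: "0 < \<tau>" for \<tau> K
  proof -
    have "(om k powr \<beta> * exp (- (om k)\<^sup>2 * \<tau>))\<^sup>2 \<le> (q powr q * \<tau> powr (- q))\<^sup>2 * om k powr (2 * \<beta> - 4 * q)" for k
    proof -
      have "exp (- ((om k)\<^sup>2 * \<tau>)) \<le> q powr q * ((om k)\<^sup>2 * \<tau>) powr (- q)"
        using t assms by (intro exp_le_powr) auto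
      also have "((om k)\<^sup>2 * \<tau>) powr (- q) = om k powr (- 2 * q) * \<tau> powr (- q)"
        using t by (simp add: powr_mult powr_powr flip: powr_numeral)
      finally have "om k powr \<beta> * exp (- ((om k)\<^sup>2 * \<tau>)) \<le> q powr q * \<tau> powr (- q) * (om k powr \<beta> * om k powr (- 2 * q))"
        by (simp add: mult.commute mult.left_commute mult_left_mono)
      also have "om k powr \<beta> * om k powr (- 2 * q) = om k powr (\<beta> - 2 * q)"
        by (simp flip: powr_add)
      finally have "(om k powr \<beta> * exp (- ((om k)\<^sup>2 * \<tau>)))\<^sup>2 \<le> (q powr q * \<tau> powr (- q) * om k powr (\<beta> - 2 * q))\<^sup>2"
        by (intro power_mono) auto
      also have "\<dots> = (q powr q * \<tau> powr (- q))\<^sup>2 * om k powr (2 * \<beta> - 4 * q)"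
        by (simp add: power_mult_distrib power2_eq_square[of "om k powr _"] algebra_simps flip: powr_add)
      finally show ?thesis by simp
    qed
    then have "(\<Sum>k<K. (om k powr \<beta> * exp (- (om k)\<^sup>2 * \<tau>))\<^sup>2)
       \<le> (q powr q * \<tau> powr (- q))\<^sup>2 * (\<Sum>k<K. om k powr (2 * \<beta> - 4 * q))"
      unfolding sum_distrib_left by (rule sum_mono)
    also have "\<dots> \<le> (q powr q * \<tau> powr (- q))\<^sup>2 * S"
      unfolding S_def using sm by (intro mult_left_mono sum_le_suminf) auto
    also have "\<dots> = (q powr q * sqrt S * \<tau> powr (- q))\<^sup>2"
      using S0 by (simp add: power_mult_distrib)
    also have "\<dots> \<le> (C * \<tau> powr (- q))\<^sup>2"
      unfolding C_def using S0 by (intro power_mono mult_right_mono) auto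
    finally show ?thesis .
  qed
  moreover have "0 < C" unfolding C_def using S0 by (smt (verit) mult_nonneg_nonneg powr_ge_zero real_sqrt_ge_zero)
  ultimately show thesis by (rule that[rotated])
qed

section \<open>Time integrals with power singularities\<close>

definition beta_int :: "real \<Rightarrow> real \<Rightarrow> real" where
  "beta_int a b = (LINT x:{0<..<1}|lborel. (1 - x) powr (- a) * x powr (- b))"

lemma beta_int_nonneg [simp]: "0 \<le> beta_int a b"
  unfolding beta_int_def set_lebesgue_integral_def by (intro integral_nonneg_AE) (auto simp: indicator_def)

text \<open>The affine substitution \<open>s = s0 + c * x\<close> reduces everything to the unit
  interval, where \<open>beta_int a b\<close> is Euler's integral B(1 - b, 1 - a). Intervals are
  open because the integrand may be singular at both ends.\<close>

lemma
  assumes ab: "a < 1" "b < 1" and t: "s0 < t"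
  shows Beta_interval_integrable: "set_integrable lborel {s0<..<t} (\<lambda>s. D * (t - s) powr (- a) * (s - s0) powr (- b))"
    and Beta_interval: "(LINT s:{s0<..<t}|lborel. D * (t - s) powr (- a) * (s - s0) powr (- b)) = D * beta_int a b * (t - s0) powr (1 - a - b)"
proof -
  define F where "F s = indicator {s0<..<t} s *\<^sub>R (D * (t - s) powr (- a) * (s - s0) powr (- b))" for s
  define c where "c = t - s0"
  have c: "c > 0" using t by (simp add: c_def)
  have eq: "F (s0 + c * x) = (D * c powr (- a - b)) * (indicator {0<..<1} x *\<^sub>R ((1 - x) powr (- a) * x powr (- b)))" for x
  proof (cases "x \<in> {0<..<1}")
    case True
    have "c * x < c * 1" using True c by (intro mult_strict_left_mono) auto
    moreover have "t = s0 + c" by (simp add: c_def)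
    ultimately have "s0 + c * x \<in> {s0<..<t}" using True c mult_pos_pos[of c x] by simp
    moreover have "t - (s0 + c * x) = c * (1 - x)" by (simp add: c_def algebra_simps)
    moreover have "c powr (- a - b) = c powr (- a) * c powr (- b)" by (simp flip: powr_add)
    ultimately show ?thesis using True c
      by (simp add: F_def powr_mult)
  next
    case False
    have "s0 + c * x \<notin> {s0<..<t}"
    proof
      assume "s0 + c * x \<in> {s0<..<t}"
      moreover have "t = s0 + c" by (simp add: c_def)
      ultimately have "0 < c * x" "c * x < c * 1" by simp_all
      then have "0 < x" "x < 1" using c by (simp_all add: zero_less_mult_iff)
      with False show False by simp
    qed
    then show ?thesis using False by (simp add: F_def)
  qed
  have "set_integrable lborel {0..1} (\<lambda>x. x powr (- b) * (1 - x) powr (- a))"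
    using integrable_Beta[of "1 - b" "1 - a"] ab by simp
  then have "set_integrable lborel {0<..<1} (\<lambda>x. x powr (- b) * (1 - x) powr (- a))"
    by (rule set_integrable_subset) auto
  then have "set_integrable lborel {0<..<1} (\<lambda>x. (1 - x) powr (- a) * x powr (- b))"
    by (simp only: mult.commute[of "_ powr (- b)"])
  then have "integrable lborel (\<lambda>x. F (s0 + c * x))"
    unfolding eq set_integrable_def by (rule integrable_mult_right)
  then have "integrable lborel F" using c by (subst (asm) lborel_integrable_real_affine_iff) auto
  then show "set_integrable lborel {s0<..<t} (\<lambda>s. D * (t - s) powr (- a) * (s - s0) powr (- b))"
    by (simp add: F_def[abs_def] set_integrable_def)
  have "(\<integral>x. F x \<partial>lborel) = \<bar>c\<bar> *\<^sub>R (\<integral>x. F (s0 + c * x) \<partial>lborel)"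
    using c by (intro lborel_integral_real_affine) auto
  also have "\<dots> = c * (D * c powr (- a - b) * beta_int a b)"
    unfolding eq beta_int_def set_lebesgue_integral_def using c by (simp only: integral_mult_right_zero) simp
  also have "\<dots> = D * beta_int a b * c powr (1 - a - b)"
    using c powr_add[of c 1 "- a - b"] by (simp add: algebra_simps)
  finally show "(LINT s:{s0<..<t}|lborel. D * (t - s) powr (- a) * (s - s0) powr (- b)) = D * beta_int a b * (t - s0) powr (1 - a - b)"
    by (simp add: F_def[abs_def] set_lebesgue_integral_def c_def)
qed

lemma set_borel_measurable_cont:
  fixes g :: "real \<Rightarrow> real"
  assumes "continuous_on {a<..<b} g" shows "set_borel_measurable lborel {a<..<b} g"
  using set_measurable_continuous_on[OF _ assms] by (simp add: set_borel_measurable_def)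

lemma Beta_dominated_integrable:
  fixes g :: "real \<Rightarrow> real"
  assumes "a < 1" "b < 1" "s0 < t" "continuous_on {s0<..<t} g"
    and "\<And>s. s0 < s \<Longrightarrow> s < t \<Longrightarrow> \<bar>g s\<bar> \<le> D * (t - s) powr (- a) * (s - s0) powr (- b)"
  shows "set_integrable lborel {s0<..<t} g"
proof (rule set_integrable_bound[OF Beta_interval_integrable[OF assms(1-3)] set_borel_measurable_cont[OF assms(4)]])
  show "AE s in lborel. s \<in> {s0<..<t} \<longrightarrow> norm (g s) \<le> norm (D * (t - s) powr (- a) * (s - s0) powr (- b))"
    unfolding real_norm_def using assms(5) by (intro AE_I2 impI order_trans[OF _ abs_ge_self]) auto
qed

lemma LINT_abs_le:
  fixes g G :: "real \<Rightarrow> real"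
  assumes "set_integrable lborel A g" "set_integrable lborel A G" "\<And>s. s \<in> A \<Longrightarrow> \<bar>g s\<bar> \<le> G s"
  shows "\<bar>LINT s:A|lborel. g s\<bar> \<le> (LINT s:A|lborel. G s)"
proof -
  have "\<bar>LINT s:A|lborel. g s\<bar> \<le> (LINT s:A|lborel. \<bar>g s\<bar>)"
    using set_integral_norm_bound[OF assms(1)] by simp
  also have "\<dots> \<le> (LINT s:A|lborel. G s)"
    using assms by (intro set_integral_mono set_integrable_abs) auto
  finally show ?thesis .
qed

lemma set_integrable_sum:
  fixes \<phi> :: "nat \<Rightarrow> real \<Rightarrow> real"
  assumes "\<And>k. k \<in> I \<Longrightarrow> set_integrable lborel A (\<phi> k)"
  shows "set_integrable lborel A (\<lambda>s. \<Sum>k\<in>I. \<phi> k s)"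
  using Bochner_Integration.integrable_sum[of I lborel "\<lambda>k s. indicator A s *\<^sub>R \<phi> k s"] assms
  unfolding set_integrable_def by (simp add: sum_distrib_left)

lemma set_integral_sum:
  fixes \<phi> :: "nat \<Rightarrow> real \<Rightarrow> real"
  assumes "\<And>k. k \<in> I \<Longrightarrow> set_integrable lborel A (\<phi> k)"
  shows "(LINT s:A|lborel. \<Sum>k\<in>I. \<phi> k s) = (\<Sum>k\<in>I. LINT s:A|lborel. \<phi> k s)"
  using Bochner_Integration.integral_sum[of I lborel "\<lambda>k s. indicator A s *\<^sub>R \<phi> k s"] assms
  unfolding set_lebesgue_integral_def set_integrable_def by (simp add: sum_distrib_left)

lemma sum_mult_le:
  fixes a b :: "nat \<Rightarrow> real"
  assumes "(\<Sum>k<K. (a k)\<^sup>2) \<le> A\<^sup>2" "(\<Sum>k<K. (b k)\<^sup>2) \<le> B\<^sup>2" "0 \<le> A" "0 \<le> B"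
  shows "(\<Sum>k<K. \<bar>a k * b k\<bar>) \<le> A * B"
proof (rule power2_le_imp_le)
  have "(\<Sum>k<K. \<bar>a k * b k\<bar>)\<^sup>2 \<le> (\<Sum>k<K. \<bar>a k\<bar>\<^sup>2) * (\<Sum>k<K. \<bar>b k\<bar>\<^sup>2)"
    unfolding abs_mult by (rule Cauchy_Schwarz_ineq_sum)
  also have "\<dots> \<le> A\<^sup>2 * B\<^sup>2" using assms by (intro mult_mono) (auto intro: sum_nonneg)
  finally show "(\<Sum>k<K. \<bar>a k * b k\<bar>)\<^sup>2 \<le> (A * B)\<^sup>2" by (simp add: power_mult_distrib)
qed (use assms in auto)

text \<open>Minkowski's integral inequality for l2 by duality: testing the vector of integrals
  against itself gives \<open>S \<le> sqrt S * \<integral>G\<close>, and \<open>sqrt S\<close> is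
  cancelled.\<close>

lemma Minkowski_sum:
  fixes \<phi> :: "nat \<Rightarrow> real \<Rightarrow> real"
  assumes i: "\<And>k. k < K \<Longrightarrow> set_integrable lborel A (\<phi> k)" and G: "set_integrable lborel A G"
    and le: "\<And>s. s \<in> A \<Longrightarrow> (\<Sum>k<K. (\<phi> k s)\<^sup>2) \<le> (G s)\<^sup>2" and G0: "\<And>s. s \<in> A \<Longrightarrow> 0 \<le> G s"
  shows "(\<Sum>k<K. (LINT s:A|lborel. \<phi> k s)\<^sup>2) \<le> (LINT s:A|lborel. G s)\<^sup>2"
proof -
  define c where "c k = (LINT s:A|lborel. \<phi> k s)" for k
  define S where "S = (\<Sum>k<K. (c k)\<^sup>2)"
  have S0: "0 \<le> S" unfolding S_def by (rule sum_nonneg) auto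
  have "S = (LINT s:A|lborel. \<Sum>k<K. c k * \<phi> k s)"
    unfolding S_def using i by (subst set_integral_sum) (auto simp: c_def power2_eq_square)
  also have "\<dots> \<le> (LINT s:A|lborel. sqrt S * G s)"
  proof (rule set_integral_mono)
    show "set_integrable lborel A (\<lambda>s. \<Sum>k<K. c k * \<phi> k s)" using i by (intro set_integrable_sum) auto
    fix s assume s: "s \<in> A"
    have "(\<Sum>k<K. c k * \<phi> k s) \<le> (\<Sum>k<K. \<bar>c k * \<phi> k s\<bar>)" by (rule sum_mono) simp
    also have "\<dots> \<le> sqrt S * G s"
      using le[OF s] G0[OF s] S0 by (intro sum_mult_le) (auto simp: S_def)
    finally show "(\<Sum>k<K. c k * \<phi> k s) \<le> sqrt S * G s" .
  qed (use G in auto)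
  also have "\<dots> = sqrt S * (LINT s:A|lborel. G s)" by simp
  finally have *: "sqrt S * sqrt S \<le> sqrt S * (LINT s:A|lborel. G s)" using S0 by simp
  have I0: "0 \<le> (LINT s:A|lborel. G s)"
    unfolding set_lebesgue_integral_def using G0 by (intro integral_nonneg_AE) (auto simp: indicator_def)
  have "sqrt S \<le> (LINT s:A|lborel. G s)"
  proof (cases "S = 0")
    case False
    then have "0 < sqrt S" using S0 by simp
    with * show ?thesis by (rule mult_left_le_imp_le)
  qed (use I0 in auto)
  then have "(sqrt S)\<^sup>2 \<le> (LINT s:A|lborel. G s)\<^sup>2" using S0 by (intro power_mono) auto
  then show ?thesis using S0 by (simp add: S_def c_def)
qed

text \<open>The form in which Duhamel integrals are estimated in l2: \<open>a\<close> is the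
  singularity of the kernel at the final time, \<open>b\<close> that of the data at the initial
  time. Each component is integrable because a single square is at most the sum of squares.\<close>

lemma Beta_Minkowski:
  fixes \<phi> :: "nat \<Rightarrow> real \<Rightarrow> real"
  assumes "a < 1" "b < 1" "s0 < t" "\<And>k. continuous_on {s0<..<t} (\<phi> k)" "0 \<le> D"
    and le: "\<And>s K. s0 < s \<Longrightarrow> s < t \<Longrightarrow> (\<Sum>k<K. (\<phi> k s)\<^sup>2) \<le> (D * (t - s) powr (- a) * (s - s0) powr (- b))\<^sup>2"
  shows "set_integrable lborel {s0<..<t} (\<phi> k)"
    and "(\<Sum>k<K. (LINT s:{s0<..<t}|lborel. \<phi> k s)\<^sup>2) \<le> (D * beta_int a b * (t - s0) powr (1 - a - b))\<^sup>2"
proof -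
  have i: "set_integrable lborel {s0<..<t} (\<phi> k)" for k
  proof (rule Beta_dominated_integrable[OF assms(1-4)])
    fix s assume s: "s0 < s" "s < t"
    have "(\<phi> k s)\<^sup>2 \<le> (\<Sum>j<Suc k. (\<phi> j s)\<^sup>2)" by (simp add: sum_nonneg)
    with le[OF s, of "Suc k"] have "\<bar>\<phi> k s\<bar>\<^sup>2 \<le> (D * (t - s) powr (- a) * (s - s0) powr (- b))\<^sup>2" by simp
    then show "\<bar>\<phi> k s\<bar> \<le> D * (t - s) powr (- a) * (s - s0) powr (- b)"
      by (rule power2_le_imp_le) (use \<open>0 \<le> D\<close> in auto)
  qed
  then show "set_integrable lborel {s0<..<t} (\<phi> k)" .
  show "(\<Sum>k<K. (LINT s:{s0<..<t}|lborel. \<phi> k s)\<^sup>2) \<le> (D * beta_int a b * (t - s0) powr (1 - a - b))\<^sup>2"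
    unfolding Beta_interval[OF assms(1-3), symmetric]
    using i Beta_interval_integrable[OF assms(1-3)] le \<open>0 \<le> D\<close> by (intro Minkowski_sum) auto
qed

text \<open>The l1 counterpart, needed for the weighted half of \<open>wnorm_le\<close>, which is a
  sum of absolute values.\<close>

lemma Beta_sum_abs:
  fixes \<phi> :: "nat \<Rightarrow> real \<Rightarrow> real"
  assumes "a < 1" "b < 1" "s0 < t" "\<And>k. continuous_on {s0<..<t} (\<phi> k)"
    and le: "\<And>s K. s0 < s \<Longrightarrow> s < t \<Longrightarrow> (\<Sum>k<K. \<bar>\<phi> k s\<bar>) \<le> D * (t - s) powr (- a) * (s - s0) powr (- b)"
  shows "(\<Sum>k<K. \<bar>LINT s:{s0<..<t}|lborel. \<phi> k s\<bar>) \<le> D * beta_int a b * (t - s0) powr (1 - a - b)"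
proof -
  have i: "set_integrable lborel {s0<..<t} (\<phi> k)" for k
  proof (rule Beta_dominated_integrable[OF assms(1-4)])
    fix s assume s: "s0 < s" "s < t"
    have "\<bar>\<phi> k s\<bar> \<le> (\<Sum>j<Suc k. \<bar>\<phi> j s\<bar>)" by (simp add: sum_nonneg)
    also note le[OF s, of "Suc k"]
    finally show "\<bar>\<phi> k s\<bar> \<le> D * (t - s) powr (- a) * (s - s0) powr (- b)" .
  qed
  have "(\<Sum>k<K. \<bar>LINT s:{s0<..<t}|lborel. \<phi> k s\<bar>) \<le> (\<Sum>k<K. LINT s:{s0<..<t}|lborel. \<bar>\<phi> k s\<bar>)"
    using set_integral_norm_bound[OF i] by (intro sum_mono) simp
  also have "\<dots> = (LINT s:{s0<..<t}|lborel. \<Sum>k<K. \<bar>\<phi> k s\<bar>)"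
    using i by (subst set_integral_sum) (auto intro: set_integrable_abs)
  also have "\<dots> \<le> (LINT s:{s0<..<t}|lborel. D * (t - s) powr (- a) * (s - s0) powr (- b))"
    using i le by (intro set_integral_mono set_integrable_sum Beta_interval_integrable assms) (auto intro: set_integrable_abs)
  finally show ?thesis unfolding Beta_interval[OF assms(1-3)] .
qed

text \<open>The norm of the fixed point argument: the \<open>L\<^sup>2\<close> norm together with a weighted norm
  that controls the sine series and its first derivative uniformly. The exponents match: by
  \<open>heat_sum\<close> and Cauchy-Schwarz the heat semigroup maps the former into the latter with norm
  \<open>O(t powr (-15/16))\<close>, which is integrable at \<open>0\<close>.\<close>

definition wnorm_le :: "real \<Rightarrow> real \<Rightarrow> (nat \<Rightarrow> real) \<Rightarrow> bool" where
  "wnorm_le t A v \<longleftrightarrow> 0 \<le> A \<and> (\<forall>K. (\<Sum>k<K. (v k)\<^sup>2) \<le> A\<^sup>2 \<and>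
     (\<Sum>k<K. om k powr (5/4) * \<bar>v k\<bar>) \<le> A * t powr (- (15/16)))"

lemma wnorm_le_mono: "wnorm_le t A v \<Longrightarrow> A \<le> B \<Longrightarrow> wnorm_le t B v"
  unfolding wnorm_le_def by (meson order_trans power_mono mult_right_mono powr_ge_zero)

lemma wnorm_le_0: "wnorm_le t 0 (\<lambda>_. 0)" by (simp add: wnorm_le_def)

lemma wnorm_le_add:
  assumes "wnorm_le t A v" "wnorm_le t B w" shows "wnorm_le t (A + B) (\<lambda>k. v k + w k)"
  unfolding wnorm_le_def
proof (intro conjI allI)
  show "0 \<le> A + B" using assms by (simp add: wnorm_le_def)
  fix K
  have "L2_set v {..<K} \<le> A" "L2_set w {..<K} \<le> B"
    using assms unfolding wnorm_le_def L2_set_def by (auto intro: real_le_lsqrt sum_nonneg)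
  then have "L2_set (\<lambda>k. v k + w k) {..<K} \<le> A + B"
    using L2_set_triangle_ineq[of v w "{..<K}"] by linarith
  then have "(L2_set (\<lambda>k. v k + w k) {..<K})\<^sup>2 \<le> (A + B)\<^sup>2" by (intro power_mono) auto
  then show "(\<Sum>k<K. (v k + w k)\<^sup>2) \<le> (A + B)\<^sup>2"
    by (simp add: L2_set_def sum_nonneg)
  have "(\<Sum>k<K. om k powr (5/4) * \<bar>v k + w k\<bar>) \<le> (\<Sum>k<K. om k powr (5/4) * \<bar>v k\<bar> + om k powr (5/4) * \<bar>w k\<bar>)"
    unfolding distrib_left[symmetric] by (intro sum_mono mult_left_mono) auto
  also have "\<dots> \<le> A * t powr (- (15/16)) + B * t powr (- (15/16))"
    using assms unfolding sum.distrib wnorm_le_def by (intro add_mono) auto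
  finally show "(\<Sum>k<K. om k powr (5/4) * \<bar>v k + w k\<bar>) \<le> (A + B) * t powr (- (15/16))"
    by (simp add: algebra_simps)
qed

lemma wnorm_le_uminus: "wnorm_le t A (\<lambda>k. - v k) \<longleftrightarrow> wnorm_le t A v" by (simp add: wnorm_le_def)

lemma wnorm_le_diff: "wnorm_le t A v \<Longrightarrow> wnorm_le t B w \<Longrightarrow> wnorm_le t (A + B) (\<lambda>k. v k - w k)"
  using wnorm_le_add[of t A v B "\<lambda>k. - w k"] by (simp add: wnorm_le_uminus)

text \<open>Since \<open>wnorm_le\<close> constrains finite sums only, it is closed under
  convergence of each coefficient separately; bounds for iterates pass to their limit without
  further argument.\<close>

lemma wnorm_le_limit:
  assumes "\<And>n. wnorm_le t (A n) (v n)" "\<And>k. (\<lambda>n. v n k) \<longlonglongrightarrow> w k" "A \<longlonglongrightarrow> B"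
  shows "wnorm_le t B w"
  unfolding wnorm_le_def
proof (intro conjI allI)
  show "0 \<le> B" using assms(1,3) by (intro LIMSEQ_le_const[of A]) (auto simp: wnorm_le_def)
  fix K
  show "(\<Sum>k<K. (w k)\<^sup>2) \<le> B\<^sup>2"
    by (rule LIMSEQ_le[of "\<lambda>n. \<Sum>k<K. (v n k)\<^sup>2" _ "\<lambda>n. (A n)\<^sup>2"])
      (use assms(1) in \<open>auto simp: wnorm_le_def intro!: tendsto_intros assms\<close>)
  show "(\<Sum>k<K. om k powr (5/4) * \<bar>w k\<bar>) \<le> B * t powr (- (15/16))"
    by (rule LIMSEQ_le[of "\<lambda>n. \<Sum>k<K. om k powr (5/4) * \<bar>v n k\<bar>" _ "\<lambda>n. A n * t powr (- (15/16))"])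
      (use assms(1) in \<open>auto simp: wnorm_le_def intro!: tendsto_intros assms\<close>)
qed

lemma wnorm_le_abs_le: "wnorm_le t A v \<Longrightarrow> \<bar>v k\<bar> \<le> A"
proof -
  assume s: "wnorm_le t A v"
  have "(v k)\<^sup>2 \<le> (\<Sum>j<Suc k. (v j)\<^sup>2)" by (simp add: sum_nonneg)
  also have "\<dots> \<le> A\<^sup>2" using s by (simp only: wnorm_le_def)
  finally have "\<bar>v k\<bar>\<^sup>2 \<le> A\<^sup>2" by simp
  then show ?thesis by (rule power2_le_imp_le) (use s in \<open>simp add: wnorm_le_def\<close>)
qed

definition duhamel :: "(real \<Rightarrow> nat \<Rightarrow> real) \<Rightarrow> real \<Rightarrow> real \<Rightarrow> nat \<Rightarrow> real" where
  "duhamel g s0 t k = (LINT s:{s0<..<t}|lborel. exp (- (om k)\<^sup>2 * (t - s)) * g s k)"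

text \<open>The semigroup contracts l2, which accounts for the 1 in \<open>max 1 H\<close>; the
  weighted part comes from \<open>heat_sum\<close> with \<open>\<beta> = 5/4\<close> and
  \<open>q = 15/16\<close>.\<close>

lemma wnorm_le_semigroup:
  obtains C where "1 \<le> C" "\<And>v A t. 0 < t \<Longrightarrow> 0 \<le> A \<Longrightarrow> (\<And>K. (\<Sum>k<K. (v k)\<^sup>2) \<le> A\<^sup>2) \<Longrightarrow>
    wnorm_le t (C * A) (\<lambda>k. exp (- (om k)\<^sup>2 * t) * v k)"
proof -
  obtain H where H: "0 < H" "\<And>\<tau> K. 0 < \<tau> \<Longrightarrow> (\<Sum>k<K. (om k powr (5/4) * exp (- (om k)\<^sup>2 * \<tau>))\<^sup>2) \<le> (H * \<tau> powr (- (15/16)))\<^sup>2"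
    using heat_sum[of "15/16" "5/4"] by auto
  show thesis
  proof (rule that[of "max 1 H"])
    fix v :: "nat \<Rightarrow> real" and A t :: real
    assume t: "0 < t" and A: "0 \<le> A" and v: "\<And>K. (\<Sum>k<K. (v k)\<^sup>2) \<le> A\<^sup>2"
    show "wnorm_le t (max 1 H * A) (\<lambda>k. exp (- (om k)\<^sup>2 * t) * v k)"
      unfolding wnorm_le_def
    proof (intro conjI allI)
      fix K
      have "(exp (- (om k)\<^sup>2 * t) * v k)\<^sup>2 \<le> (v k)\<^sup>2" for k
        using t unfolding power_mult_distrib by (intro mult_left_le_one_le power_le_one) auto
      then have "(\<Sum>k<K. (exp (- (om k)\<^sup>2 * t) * v k)\<^sup>2) \<le> A\<^sup>2" using v[of K] by (meson order_trans sum_mono)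
      also have "\<dots> \<le> (max 1 H * A)\<^sup>2" using A by (intro power_mono) (auto simp: mult_le_cancel_right1)
      finally show "(\<Sum>k<K. (exp (- (om k)\<^sup>2 * t) * v k)\<^sup>2) \<le> (max 1 H * A)\<^sup>2" .
      have "(\<Sum>k<K. om k powr (5/4) * \<bar>exp (- (om k)\<^sup>2 * t) * v k\<bar>) = (\<Sum>k<K. \<bar>(om k powr (5/4) * exp (- (om k)\<^sup>2 * t)) * v k\<bar>)"
        by (simp add: abs_mult mult.assoc)
      also have "\<dots> \<le> H * t powr (- (15/16)) * A"
        using H t v A by (intro sum_mult_le) auto
      also have "\<dots> \<le> max 1 H * A * t powr (- (15/16))"
        using A mult_right_mono[of H "max 1 H" "A * t powr (- (15/16))"] by (simp add: mult_ac)
      finally show "(\<Sum>k<K. om k powr (5/4) * \<bar>exp (- (om k)\<^sup>2 * t) * v k\<bar>) \<le> max 1 H * A * t powr (- (15/16))" .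
    qed (use A in auto)
  qed auto
qed

text \<open>The factor \<open>\<mu> powr (- (1/32))\<close> is the point: data growing like
  \<open>exp (\<mu> * s)\<close> produce a Duhamel term of the same growth with a constant that is
  small for large \<open>\<mu>\<close>. This makes the fixed point map contract on an arbitrarily
  long time interval.\<close>

lemma wnorm_le_duhamel:
  obtains C where "0 < C" "\<And>g D \<mu> (t::real). 0 < t \<Longrightarrow> 0 < (\<mu>::real) \<Longrightarrow> 0 \<le> D \<Longrightarrow> (\<And>k. continuous_on {0<..<t} (\<lambda>s. g s k)) \<Longrightarrow>
     (\<And>s K. 0 < s \<Longrightarrow> s < t \<Longrightarrow> (\<Sum>k<K. (g s k)\<^sup>2) \<le> (D * exp (\<mu> * s) * s powr (- (15/16)))\<^sup>2) \<Longrightarrow>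
    wnorm_le t (C * D * exp (\<mu> * t) * \<mu> powr (- (1/32)) * t powr (1/32)) (duhamel g 0 t)"
proof -
  obtain H where H: "0 < H" "\<And>\<tau> K. 0 < \<tau> \<Longrightarrow> (\<Sum>k<K. (om k powr (5/4) * exp (- (om k)\<^sup>2 * \<tau>))\<^sup>2) \<le> (H * \<tau> powr (- (15/16)))\<^sup>2"
    using heat_sum[of "15/16" "5/4"] by auto
  define I1 where "I1 = beta_int (1/32) (15/16)"
  define I2 where "I2 = beta_int (31/32) (15/16)"
  define C where "C = I1 + H * I2 + 1"
  have nn: "0 \<le> I1" "0 \<le> I2" by (auto simp: I1_def I2_def)
  show thesis
  proof (rule that[of C])
    show "0 < C" using nn H(1) by (simp add: C_def add_nonneg_pos)
    fix g :: "real \<Rightarrow> nat \<Rightarrow> real" and D \<mu> t :: real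
    assume t: "0 < t" and mu: "0 < \<mu>" and D: "0 \<le> D" and cg: "\<And>k. continuous_on {0<..<t} (\<lambda>s. g s k)"
      and g: "\<And>s K. 0 < s \<Longrightarrow> s < t \<Longrightarrow> (\<Sum>k<K. (g s k)\<^sup>2) \<le> (D * exp (\<mu> * s) * s powr (- (15/16)))\<^sup>2"
    define E where "E = exp (\<mu> * t) * \<mu> powr (- (1/32))"
    have E0: "0 \<le> E" by (simp add: E_def)
    define \<phi> where "\<phi> k s = exp (- (om k)\<^sup>2 * (t - s)) * g s k" for k s
    have c\<phi>: "continuous_on {0<..<t} (\<phi> k)" for k unfolding \<phi>_def by (intro continuous_intros cg)
    \<comment> \<open>Part of the decay of \<open>exp (- \<mu> * (t - s))\<close> is exchanged for a
      negative power of \<open>\<mu>\<close>. It costs a singularity of order 1/32, and 15/16 + 1/32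
      = 31/32 is still below 1.\<close>
    have ex: "exp (\<mu> * s) \<le> E * (t - s) powr (- (1/32))" if "s < t" for s
    proof -
      have "exp (- (\<mu> * (t - s))) \<le> (1/32) powr (1/32) * (\<mu> * (t - s)) powr (- (1/32))"
        using that mu by (intro exp_le_powr) auto
      also have "\<dots> \<le> 1 * (\<mu> * (t - s)) powr (- (1/32))"
        by (intro mult_right_mono powr_le1) auto
      also have "\<dots> = \<mu> powr (- (1/32)) * (t - s) powr (- (1/32))" using that mu by (simp add: powr_mult)
      finally have "exp (\<mu> * t) * exp (- (\<mu> * (t - s))) \<le> E * (t - s) powr (- (1/32))"
        unfolding E_def by (simp add: mult.assoc)
      then show ?thesis by (simp add: right_diff_distrib flip: exp_add)
    qed
    have gK: "(\<Sum>k<K. (g s k)\<^sup>2) \<le> (D * E * (t - s) powr (- (1/32)) * s powr (- (15/16)))\<^sup>2" if "0 < s" "s < t" for s K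
    proof -
      have "D * exp (\<mu> * s) * s powr (- (15/16)) \<le> D * (E * (t - s) powr (- (1/32))) * s powr (- (15/16))"
        using ex that D by (intro mult_right_mono mult_left_mono) auto
      then have "(D * exp (\<mu> * s) * s powr (- (15/16)))\<^sup>2 \<le> (D * (E * (t - s) powr (- (1/32))) * s powr (- (15/16)))\<^sup>2"
        using D by (intro power_mono) auto
      with g[OF that, of K] show ?thesis by (simp add: mult.assoc)
    qed
    have T1: "t powr (1/32) * t powr (- (15/16)) = t powr (1 - 31/32 - 15/16)"
      by (simp flip: powr_add)
    show "wnorm_le t (C * D * exp (\<mu> * t) * \<mu> powr (- (1/32)) * t powr (1/32)) (duhamel g 0 t)"
      unfolding wnorm_le_def
    proof (intro conjI allI)
      fix K
      have "(\<Sum>k<K. (LINT s:{0<..<t}|lborel. \<phi> k s)\<^sup>2) \<le> (D * E * beta_int (1/32) (15/16) * (t - 0) powr (1 - 1/32 - 15/16))\<^sup>2"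
      proof (rule Beta_Minkowski(2))
        fix s K assume s: "(0::real) < s" "s < t"
        have "(\<phi> k s)\<^sup>2 \<le> (g s k)\<^sup>2" for k
          using s unfolding \<phi>_def power_mult_distrib by (intro mult_left_le_one_le power_le_one) auto
        then have "(\<Sum>k<K. (\<phi> k s)\<^sup>2) \<le> (\<Sum>k<K. (g s k)\<^sup>2)" by (rule sum_mono)
        also note gK[OF s]
        finally show "(\<Sum>k<K. (\<phi> k s)\<^sup>2) \<le> (D * E * (t - s) powr (- (1/32)) * (s - 0) powr (- (15/16)))\<^sup>2" by simp
      qed (use t c\<phi> D E0 in auto)
      also have "\<dots> \<le> (C * D * exp (\<mu> * t) * \<mu> powr (- (1/32)) * t powr (1/32))\<^sup>2"
      proof (rule power_mono)
        have "D * E * I1 * t powr (1/32) \<le> D * E * C * t powr (1/32)"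
          unfolding C_def using nn H(1) D E0 by (intro mult_right_mono mult_left_mono) auto
        then show "D * E * beta_int (1/32) (15/16) * (t - 0) powr (1 - 1/32 - 15/16) \<le> C * D * exp (\<mu> * t) * \<mu> powr (- (1/32)) * t powr (1/32)"
          by (simp add: I1_def E_def mult_ac)
      qed (use D E0 in auto)
      finally show "(\<Sum>k<K. (duhamel g 0 t k)\<^sup>2) \<le> (C * D * exp (\<mu> * t) * \<mu> powr (- (1/32)) * t powr (1/32))\<^sup>2"
        by (simp add: duhamel_def \<phi>_def)
      have "(\<Sum>k<K. \<bar>LINT s:{0<..<t}|lborel. om k powr (5/4) * \<phi> k s\<bar>) \<le> (H * (D * E)) * beta_int (31/32) (15/16) * (t - 0) powr (1 - 31/32 - 15/16)"
      proof (rule Beta_sum_abs)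
        fix s K assume s: "(0::real) < s" "s < t"
        have "(\<Sum>k<K. \<bar>om k powr (5/4) * \<phi> k s\<bar>) = (\<Sum>k<K. \<bar>(om k powr (5/4) * exp (- (om k)\<^sup>2 * (t - s))) * g s k\<bar>)"
          by (simp add: \<phi>_def mult.assoc)
        also have "\<dots> \<le> (H * (t - s) powr (- (15/16))) * (D * E * (t - s) powr (- (1/32)) * s powr (- (15/16)))"
          using H(1) D E0 s by (intro sum_mult_le H(2) gK) auto
        also have "\<dots> = (H * (D * E)) * ((t - s) powr (- (15/16)) * (t - s) powr (- (1/32))) * (s - 0) powr (- (15/16))"
          by (simp add: mult_ac)
        also have "(t - s) powr (- (15/16)) * (t - s) powr (- (1/32)) = (t - s) powr (- (31/32))"
          by (simp flip: powr_add)
        finally show "(\<Sum>k<K. \<bar>om k powr (5/4) * \<phi> k s\<bar>) \<le> (H * (D * E)) * (t - s) powr (- (31/32)) * (s - 0) powr (- (15/16))" .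
      qed (use t c\<phi> in \<open>auto intro: continuous_intros\<close>)
      also have "\<dots> = (H * I2) * (D * E * t powr (1/32) * t powr (- (15/16)))"
        unfolding mult.assoc T1 by (simp add: I2_def mult_ac)
      also have "\<dots> \<le> C * (D * E * t powr (1/32) * t powr (- (15/16)))"
        unfolding C_def using nn H(1) D E0 by (intro mult_right_mono) auto
      also have "\<dots> = C * D * exp (\<mu> * t) * \<mu> powr (- (1/32)) * t powr (1/32) * t powr (- (15/16))"
        by (simp add: E_def mult_ac)
      finally show "(\<Sum>k<K. om k powr (5/4) * \<bar>duhamel g 0 t k\<bar>) \<le> C * D * exp (\<mu> * t) * \<mu> powr (- (1/32)) * t powr (1/32) * t powr (- (15/16))"
        by (simp add: duhamel_def \<phi>_def abs_mult)
    qed (use D nn H(1) in \<open>auto simp: C_def\<close>)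
  qed
qed

section \<open>Weighted sine and cosine series\<close>

lemma om_mono: "j \<le> k \<Longrightarrow> om j \<le> om k"
  by (simp add: om_def)

lemma om_tendsto: "filterlim om at_top sequentially"
  unfolding om_def using pi_gt_zero
  by (intro filterlim_tendsto_pos_mult_at_top[OF tendsto_const] filterlim_compose[OF filterlim_real_sequentially] filterlim_Suc) auto

lemma om_powr_neg_tendsto: "0 < \<delta> \<Longrightarrow> (\<lambda>K. om K powr (- \<delta>)) \<longlonglongrightarrow> 0"
  using tendsto_neg_powr[OF _ om_tendsto, of "- \<delta>"] by simp

text \<open>For \<open>k \<ge> K\<close> one has
  \<open>1 \<le> om K powr (- \<delta>) * om k powr \<delta>\<close>, so any positive power in the
  weight buys an explicit tail bound. It depends on the coefficients only through \<open>B\<close>,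
  hence it is uniform in all parameters. The 2 bounds the normalised sines and cosines.\<close>

lemma weighted_series:
  fixes c \<phi> :: "nat \<Rightarrow> real"
  assumes d: "0 < \<delta>" and B: "\<And>K. (\<Sum>k<K. om k powr \<delta> * \<bar>c k\<bar>) \<le> B" and \<phi>: "\<And>k. \<bar>\<phi> k\<bar> \<le> 2"
  shows "summable (\<lambda>k. c k * \<phi> k)"
    and "\<bar>(\<Sum>k. c k * \<phi> k) - (\<Sum>k<K. c k * \<phi> k)\<bar> \<le> 2 * B * om K powr (- \<delta>)"
    and "\<bar>\<Sum>k. c k * \<phi> k\<bar> \<le> 2 * B"
proof -
  have sw: "summable (\<lambda>k. om k powr \<delta> * \<bar>c k\<bar>)"
    by (rule summableI_nonneg_bounded[OF _ B]) auto
  have sB: "(\<Sum>k. om k powr \<delta> * \<bar>c k\<bar>) \<le> B"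
    by (rule suminf_le_const[OF sw B])
  have le: "norm (c k * \<phi> k) \<le> 2 * om j powr (- \<delta>) * (om k powr \<delta> * \<bar>c k\<bar>)" if "j \<le> k" for j k
  proof -
    have "1 = om j powr (- \<delta>) * om j powr \<delta>" by (simp flip: powr_add)
    also have "\<dots> \<le> om j powr (- \<delta>) * om k powr \<delta>"
      using d om_mono[OF that] by (intro mult_left_mono powr_mono2) auto
    finally have "1 * (\<bar>c k\<bar> * \<bar>\<phi> k\<bar>) \<le> (om j powr (- \<delta>) * om k powr \<delta>) * (\<bar>c k\<bar> * 2)"
      using \<phi>[of k] by (intro mult_mono) auto
    then show ?thesis by (simp add: abs_mult mult_ac)
  qed
  show s: "summable (\<lambda>k. c k * \<phi> k)"
    by (rule summable_comparison_test'[OF summable_mult[OF sw, of "2 * om 0 powr (- \<delta>)"]]) (rule le, simp)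
  have tail: "\<bar>(\<Sum>k. c k * \<phi> k) - (\<Sum>k<K. c k * \<phi> k)\<bar> \<le> 2 * B * om K powr (- \<delta>)" for K
  proof -
    have sw': "summable (\<lambda>k. om (k + K) powr \<delta> * \<bar>c (k + K)\<bar>)"
      using summable_iff_shift[of "\<lambda>k. om k powr \<delta> * \<bar>c k\<bar>" K] sw by blast
    have "(\<Sum>k. c k * \<phi> k) - (\<Sum>k<K. c k * \<phi> k) = (\<Sum>k. c (k + K) * \<phi> (k + K))"
      using suminf_split_initial_segment[OF s, of K] by simp
    also have "\<bar>\<dots>\<bar> \<le> (\<Sum>k. 2 * om K powr (- \<delta>) * (om (k + K) powr \<delta> * \<bar>c (k + K)\<bar>))"
      using norm_suminf_le[OF _ summable_mult[OF sw'], of "\<lambda>k. c (k + K) * \<phi> (k + K)" "2 * om K powr (- \<delta>)"] le[of K] by simp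
    also have "\<dots> = 2 * om K powr (- \<delta>) * (\<Sum>k. om (k + K) powr \<delta> * \<bar>c (k + K)\<bar>)"
      by (rule suminf_mult[OF sw'])
    also have "\<dots> \<le> 2 * om K powr (- \<delta>) * B"
    proof (rule mult_left_mono)
      have "(\<Sum>k. om (k + K) powr \<delta> * \<bar>c (k + K)\<bar>) \<le> (\<Sum>k. om k powr \<delta> * \<bar>c k\<bar>)"
        using suminf_split_initial_segment[OF sw, of K] by (simp add: sum_nonneg)
      with sB show "(\<Sum>k. om (k + K) powr \<delta> * \<bar>c (k + K)\<bar>) \<le> B" by linarith
    qed simp
    finally show ?thesis by (simp add: mult_ac)
  qed
  show "\<bar>(\<Sum>k. c k * \<phi> k) - (\<Sum>k<K. c k * \<phi> k)\<bar> \<le> 2 * B * om K powr (- \<delta>)" by (rule tail)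
  have "0 \<le> B" using B[of 0] by simp
  have "om 0 powr (- \<delta>) \<le> 1" using om_ge_1[of 0] d powr_mono2'[of "- \<delta>" 1 "om 0"] by simp
  then have "2 * B * om 0 powr (- \<delta>) \<le> 2 * B * 1" using \<open>0 \<le> B\<close> by (intro mult_left_mono) auto
  with tail[of 0] show "\<bar>\<Sum>k. c k * \<phi> k\<bar> \<le> 2 * B" by simp
qed

lemma weighted_series_uniform_limit:
  fixes c :: "'p \<Rightarrow> nat \<Rightarrow> real"
  assumes d: "0 < \<delta>" and B: "\<And>p K. p \<in> S \<Longrightarrow> (\<Sum>k<K. om k powr \<delta> * \<bar>c p k\<bar>) \<le> B" and \<phi>: "\<And>p k. p \<in> S \<Longrightarrow> \<bar>\<phi> p k\<bar> \<le> 2"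
  shows "uniform_limit S (\<lambda>K p. \<Sum>k<K. c p k * \<phi> p k) (\<lambda>p. \<Sum>k. c p k * \<phi> p k) sequentially"
proof (rule uniform_limitI)
  fix e :: real assume "e > 0"
  have "(\<lambda>K. 2 * B * om K powr (- \<delta>)) \<longlonglongrightarrow> 2 * B * 0"
    by (intro tendsto_intros om_powr_neg_tendsto d)
  then have "\<forall>\<^sub>F K in sequentially. 2 * B * om K powr (- \<delta>) < e"
    using \<open>e > 0\<close> by (intro order_tendstoD) auto
  then show "\<forall>\<^sub>F K in sequentially. \<forall>p\<in>S. dist (\<Sum>k<K. c p k * \<phi> p k) (\<Sum>k. c p k * \<phi> p k) < e"
  proof eventually_elim
    case (elim K)
    show ?case
    proof
      fix p assume p: "p \<in> S"
      from weighted_series(2)[where K=K and \<phi>="\<phi> p", OF d B[OF p] \<phi>[OF p]] elim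
      show "dist (\<Sum>k<K. c p k * \<phi> p k) (\<Sum>k. c p k * \<phi> p k) < e"
        by (simp add: dist_real_def abs_minus_commute)
    qed
  qed
qed

text \<open>Bounds are asked for only on time intervals away from zero, since the weighted sums may
  blow up there; continuity is local, so a neighbourhood of each positive time suffices.\<close>

lemma weighted_series_continuous:
  fixes c :: "real \<Rightarrow> nat \<Rightarrow> real" and \<phi> :: "nat \<Rightarrow> real \<Rightarrow> real"
  assumes d: "0 < \<delta>" and cc: "\<And>k. continuous_on {0<..} (\<lambda>t. c t k)" and c\<phi>: "\<And>k. continuous_on UNIV (\<phi> k)"
    and \<phi>: "\<And>k x. \<bar>\<phi> k x\<bar> \<le> 2"
    and B: "\<And>a b. 0 < a \<Longrightarrow> a < b \<Longrightarrow> \<exists>B. \<forall>t\<in>{a<..<b}. \<forall>K. (\<Sum>k<K. om k powr \<delta> * \<bar>c t k\<bar>) \<le> B"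
  shows "continuous_on (UNIV \<times> {0<..}) (\<lambda>(x,t). \<Sum>k. c t k * \<phi> k x)"
proof -
  have "isCont (\<lambda>(x,t). \<Sum>k. c t k * \<phi> k x) p" if p: "p \<in> UNIV \<times> {0<..}" for p
  proof -
    define a b where "a = snd p / 2" and "b = 2 * snd p"
    have ab: "0 < a" "a < b" using p by (auto simp: a_def b_def)
    obtain B where B: "\<And>t K. t \<in> {a<..<b} \<Longrightarrow> (\<Sum>k<K. om k powr \<delta> * \<bar>c t k\<bar>) \<le> B" using B[OF ab] by blast
    have "uniform_limit (UNIV \<times> {a<..<b}) (\<lambda>K p. \<Sum>k<K. c (snd p) k * \<phi> k (fst p)) (\<lambda>p. \<Sum>k. c (snd p) k * \<phi> k (fst p)) sequentially"
      using d \<phi> by (intro weighted_series_uniform_limit) (auto intro!: B)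
    moreover have "continuous_on (UNIV \<times> {a<..<b}) (\<lambda>p. \<Sum>k<K. c (snd p) k * \<phi> k (fst p))" for K
      by (intro continuous_intros continuous_on_compose2[OF cc] continuous_on_compose2[OF c\<phi>]) (use ab in auto)
    ultimately have "continuous_on (UNIV \<times> {a<..<b}) (\<lambda>p. \<Sum>k. c (snd p) k * \<phi> k (fst p))"
      by (intro uniform_limit_theorem[of _ "\<lambda>K p. \<Sum>k<K. c (snd p) k * \<phi> k (fst p)"]) auto
    moreover have "open (UNIV \<times> {a<..<b} :: (real \<times> real) set)" by (intro open_Times) auto
    moreover have "p \<in> UNIV \<times> {a<..<b}" using p by (cases p) (auto simp: a_def b_def)
    ultimately have "isCont (\<lambda>p. \<Sum>k. c (snd p) k * \<phi> k (fst p)) p"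
      using continuous_on_eq_continuous_at by blast
    then show ?thesis by (simp add: case_prod_beta')
  qed
  then show ?thesis by (rule continuous_at_imp_continuous_on[OF ballI])
qed

definition ser :: "(nat \<Rightarrow> real) \<Rightarrow> real \<Rightarrow> real" where "ser v x = (\<Sum>k. v k * es k x)"
definition serx :: "(nat \<Rightarrow> real) \<Rightarrow> real \<Rightarrow> real" where "serx v x = (\<Sum>k. (v k * om k) * ec k x)"

text \<open>The exponent 5/4 is split as 1 + 1/4: one power of the frequency is used up by the
  derivative, and the remaining 1/4 still gives uniform convergence of the differentiated
  series.\<close>

lemma wnorm_le_weights:
  assumes "wnorm_le t A v"
  shows "(\<Sum>k<K. om k powr (5/4) * \<bar>v k\<bar>) \<le> A * t powr (- (15/16))"
    and "(\<Sum>k<K. om k powr (1/4) * \<bar>v k * om k\<bar>) \<le> A * t powr (- (15/16))"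
proof -
  show *: "(\<Sum>k<K. om k powr (5/4) * \<bar>v k\<bar>) \<le> A * t powr (- (15/16))" using assms by (simp add: wnorm_le_def)
  have "om k powr (5/4) = om k powr (1/4) * om k powr 1" for k by (simp only: flip: powr_add) simp
  then have "om k powr (1/4) * \<bar>v k * om k\<bar> = om k powr (5/4) * \<bar>v k\<bar>" for k by (simp add: abs_mult)
  with * show "(\<Sum>k<K. om k powr (1/4) * \<bar>v k * om k\<bar>) \<le> A * t powr (- (15/16))" by simp
qed

lemma wnorm_le_summable:
  assumes "wnorm_le t A v"
  shows "summable (\<lambda>k. v k * es k x)" "summable (\<lambda>k. (v k * om k) * ec k x)"
  using weighted_series(1)[OF _ wnorm_le_weights(1)[OF assms], of "\<lambda>k. es k x"]
    weighted_series(1)[OF _ wnorm_le_weights(2)[OF assms], of "\<lambda>k. ec k x"] es_le ec_le by auto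

lemma ser_le: "wnorm_le t A v \<Longrightarrow> \<bar>ser v x\<bar> \<le> 2 * (A * t powr (- (15/16)))"
  unfolding ser_def by (rule weighted_series(3)[OF _ wnorm_le_weights(1)]) (auto simp: es_le)

lemma serx_le: "wnorm_le t A v \<Longrightarrow> \<bar>serx v x\<bar> \<le> 2 * (A * t powr (- (15/16)))"
  unfolding serx_def by (rule weighted_series(3)[OF _ wnorm_le_weights(2)]) (auto simp: ec_le)

lemma ser_diff:
  assumes "wnorm_le t A v" "wnorm_le t B w"
  shows "ser (\<lambda>k. v k - w k) x = ser v x - ser w x" "serx (\<lambda>k. v k - w k) x = serx v x - serx w x"
  unfolding ser_def serx_def left_diff_distrib
  using suminf_diff[OF wnorm_le_summable(1)[OF assms(1)] wnorm_le_summable(1)[OF assms(2)], of x x]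
    suminf_diff[OF wnorm_le_summable(2)[OF assms(1)] wnorm_le_summable(2)[OF assms(2)], of x x]
  by simp_all

lemma ser_uniform_limit:
  assumes "wnorm_le t A v" shows "uniform_limit UNIV (psum v) (ser v) sequentially"
proof -
  have "uniform_limit UNIV (\<lambda>K x. \<Sum>k<K. v k * es k x) (\<lambda>x. \<Sum>k. v k * es k x) sequentially"
    by (rule weighted_series_uniform_limit[of "5/4", OF _ wnorm_le_weights(1)[OF assms] es_le]) simp
  then show ?thesis by (simp only: psum_def[abs_def] ser_def[abs_def])
qed

lemma serx_uniform_limit:
  assumes "wnorm_le t A v" shows "uniform_limit UNIV (\<lambda>K x. \<Sum>k<K. (v k * om k) * ec k x) (serx v) sequentially"
proof -
  have "uniform_limit UNIV (\<lambda>K x. \<Sum>k<K. (v k * om k) * ec k x) (\<lambda>x. \<Sum>k. (v k * om k) * ec k x) sequentially"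
    by (rule weighted_series_uniform_limit[of "1/4", OF _ wnorm_le_weights(2)[OF assms] ec_le]) simp
  then show ?thesis by (simp only: serx_def[abs_def])
qed

lemma ser_deriv:
  assumes "wnorm_le t A v"
  shows "(ser v has_real_derivative serx v x) (at x)"
proof -
  have "((\<lambda>x. \<Sum>k. v k * es k x) has_field_derivative (\<Sum>k. (v k * om k) * ec k x)) (at x)"
  proof (rule has_field_derivative_series'(2)[of UNIV])
    show "uniformly_convergent_on UNIV (\<lambda>n x. \<Sum>k<n. (v k * om k) * ec k x)"
      using serx_uniform_limit[OF assms] unfolding uniformly_convergent_on_def by blast
    show "summable (\<lambda>k. v k * es k 0)" by simp
    show "((\<lambda>x. v k * es k x) has_field_derivative v k * om k * ec k x) (at x within UNIV)" for k x
      by (auto intro!: derivative_eq_intros)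
  qed auto
  then show ?thesis by (simp add: ser_def[abs_def] serx_def)
qed

lemma ser_continuous: "wnorm_le t A v \<Longrightarrow> continuous_on S (ser v)"
  by (rule DERIV_continuous_on[OF has_field_derivative_at_within[OF ser_deriv]])

lemma serx_continuous: "wnorm_le t A v \<Longrightarrow> continuous_on S (serx v)"
  by (rule continuous_on_subset[OF uniform_limit_theorem[OF _ serx_uniform_limit]])
    (auto intro!: always_eventually continuous_intros)

lemma ser_01: "ser v 0 = 0" "ser v 1 = 0"
  by (simp_all add: ser_def)

lemma ser_L2: "wnorm_le t A v \<Longrightarrow> ser v \<in> L2" and serx_L2: "wnorm_le t A v \<Longrightarrow> serx v \<in> L2"
  by (auto intro!: L2_continuous ser_continuous serx_continuous)

lemma uniform_limit_imp_L2:
  assumes "uniform_limit UNIV f g sequentially" "\<And>n. f n \<in> L2" "g \<in> L2"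
  shows "(\<lambda>n. L2norm (\<lambda>x. f n x - g x)) \<longlonglongrightarrow> 0"
proof (rule LIMSEQ_I)
  fix e :: real assume "e > 0"
  then have "\<forall>\<^sub>F n in sequentially. \<forall>x. dist (f n x) (g x) < e / 2"
    using uniform_limitD[OF assms(1), of "e/2"] by simp
  then obtain N where N: "\<And>n x. n \<ge> N \<Longrightarrow> dist (f n x) (g x) < e / 2"
    by (auto simp: eventually_sequentially)
  have "L2norm (\<lambda>x. f n x - g x) \<le> e / 2" if "n \<ge> N" for n
    using N[OF that] assms by (intro L2norm_le_const) (auto simp: dist_real_def intro: less_imp_le)
  then show "\<exists>N. \<forall>n\<ge>N. norm (L2norm (\<lambda>x. f n x - g x) - 0) < e"
    using \<open>e > 0\<close> by (intro exI[of _ N]) force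
qed

lemma L2norm_tendsto:
  assumes "\<And>n. f n \<in> L2" "g \<in> L2" "(\<lambda>n. L2norm (\<lambda>x. f n x - g x)) \<longlonglongrightarrow> 0"
  shows "(\<lambda>n. L2norm (f n)) \<longlonglongrightarrow> L2norm g"
proof -
  have "(\<lambda>n. L2norm (f n) - L2norm g) \<longlonglongrightarrow> 0"
    by (rule Lim_null_comparison[OF always_eventually assms(3)]) (use L2norm_rev_triangle assms(1,2) in auto)
  then show ?thesis by (rule LIM_zero_cancel)
qed

lemma cf_ser:
  assumes "wnorm_le t A v" shows "cf (ser v) k = v k"
proof (rule LIMSEQ_unique)
  show "(\<lambda>K. cf (psum v K) k) \<longlonglongrightarrow> cf (ser v) k"
    using assms by (intro cf_tendsto uniform_limit_imp_L2 ser_uniform_limit ser_L2) auto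
  show "(\<lambda>n. cf (psum v n) k) \<longlonglongrightarrow> v k"
    unfolding psum_cf by (rule tendsto_eventually, rule eventually_sequentiallyI[of "Suc k"]) auto
qed

lemma ser_norm_sums: "wnorm_le t A v \<Longrightarrow> (\<lambda>k. (v k)\<^sup>2) sums (L2norm (ser v))\<^sup>2"
  using Parseval[OF ser_L2] by (simp add: cf_ser)

lemma ser_norm_le: "wnorm_le t A v \<Longrightarrow> L2norm (ser v) \<le> A"
  by (rule L2norm_le_if_cf_le) (auto simp: ser_L2 cf_ser wnorm_le_def)

text \<open>The cosines \<open>ec k\<close> are orthonormal but omit the constants, so the identity
  is obtained from the uniform convergence of the differentiated series rather than from
  completeness.\<close>

lemma serx_norm_tendsto:
  assumes "wnorm_le t A v"
  shows "(\<lambda>K. \<Sum>k<K. (om k * v k)\<^sup>2) \<longlonglongrightarrow> (L2norm (serx v))\<^sup>2"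
proof -
  have c: "(\<lambda>x. \<Sum>k<K. (v k * om k) * ec k x) \<in> L2" for K by (auto intro!: L2_continuous continuous_intros)
  have "(L2norm (\<lambda>x. \<Sum>k<K. (v k * om k) * ec k x))\<^sup>2 = (\<Sum>k<K. (om k * v k)\<^sup>2)" for K
    unfolding L2norm_power2 by (subst inner_orthonormal_sums) (auto simp: ec_orthonormal power2_eq_square mult.commute)
  moreover have "(\<lambda>K. (L2norm (\<lambda>x. \<Sum>k<K. (v k * om k) * ec k x))\<^sup>2) \<longlonglongrightarrow> (L2norm (serx v))\<^sup>2"
    using assms c by (intro tendsto_power L2norm_tendsto uniform_limit_imp_L2 serx_uniform_limit serx_L2) auto
  ultimately show ?thesis by simp
qed

text \<open>The class in which the fixed point is sought. Continuity is imposed coefficient by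
  coefficient; joint continuity in space and time then follows from the uniform weights.\<close>

definition admissible :: "(real \<Rightarrow> nat \<Rightarrow> real) \<Rightarrow> bool" where
  "admissible a \<longleftrightarrow> (\<forall>k. continuous_on {0<..} (\<lambda>t. a t k)) \<and> (\<forall>T>0. \<exists>B. \<forall>t. 0 < t \<longrightarrow> t \<le> T \<longrightarrow> wnorm_le t B (a t))"

lemma admissible_continuous:
  assumes "admissible a"
  shows "continuous_on (UNIV \<times> {0<..}) (\<lambda>(x,t). ser (a t) x)"
    and "continuous_on (UNIV \<times> {0<..}) (\<lambda>(x,t). serx (a t) x)"
proof -
  have c: "continuous_on {0<..} (\<lambda>t. a t k)" for k using assms by (simp add: admissible_def)
  have b: "\<exists>B. \<forall>t\<in>{\<alpha><..<\<beta>}. wnorm_le t B (a t) \<and> B * t powr (- (15/16)) \<le> B * \<alpha> powr (- (15/16))" if "0 < \<alpha>" "\<alpha> < \<beta>" for \<alpha> \<beta>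
  proof -
    obtain B where B: "\<And>t. 0 < t \<Longrightarrow> t \<le> \<beta> \<Longrightarrow> wnorm_le t B (a t)" using assms \<open>0 < \<alpha>\<close> \<open>\<alpha> < \<beta>\<close> unfolding admissible_def by (meson less_trans)
    then have "0 \<le> B" using \<open>0 < \<alpha>\<close> \<open>\<alpha> < \<beta>\<close> by (auto simp: wnorm_le_def dest: less_imp_le)
    then show ?thesis using B \<open>0 < \<alpha>\<close> by (intro exI[of _ B]) (auto intro!: mult_left_mono powr_mono2')
  qed
  show "continuous_on (UNIV \<times> {0<..}) (\<lambda>(x,t). ser (a t) x)"
    unfolding ser_def
  proof (rule weighted_series_continuous[of "5/4"])
    fix \<alpha> \<beta> :: real assume "0 < \<alpha>" "\<alpha> < \<beta>"
    from b[OF this] show "\<exists>B. \<forall>t\<in>{\<alpha><..<\<beta>}. \<forall>K. (\<Sum>k<K. om k powr (5/4) * \<bar>a t k\<bar>) \<le> B"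
      by (elim exE, intro exI ballI allI) (blast intro: order_trans wnorm_le_weights(1))
  qed (auto intro: c continuous_intros es_le)
  show "continuous_on (UNIV \<times> {0<..}) (\<lambda>(x,t). serx (a t) x)"
    unfolding serx_def
  proof (rule weighted_series_continuous[of "1/4"])
    fix \<alpha> \<beta> :: real assume "0 < \<alpha>" "\<alpha> < \<beta>"
    from b[OF this] show "\<exists>B. \<forall>t\<in>{\<alpha><..<\<beta>}. \<forall>K. (\<Sum>k<K. om k powr (1/4) * \<bar>a t k * om k\<bar>) \<le> B"
      by (elim exE, intro exI ballI allI) (blast intro: order_trans wnorm_le_weights(2))
  qed (auto intro: c continuous_intros ec_le)
qed

section \<open>Integrals depending on a parameter\<close>

lemma continuous_slice:
  fixes h :: "real \<Rightarrow> real \<Rightarrow> real"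
  assumes "continuous_on (S \<times> U) (\<lambda>(x,t). h x t)" "t \<in> U"
  shows "continuous_on S (\<lambda>x. h x t)"
proof -
  have "continuous_on S ((\<lambda>(x,t). h x t) \<circ> (\<lambda>x. (x, t)))"
    by (intro continuous_on_compose continuous_on_subset[OF assms(1)]) (use assms(2) in \<open>auto intro!: continuous_intros\<close>)
  then show ?thesis by (simp add: o_def)
qed

lemma LINT_continuous_param:
  fixes h :: "real \<Rightarrow> real \<Rightarrow> real"
  assumes "continuous_on ({0..1} \<times> U) (\<lambda>(x,t). h x t)"
  shows "continuous_on U (\<lambda>t. LINT x:{0..1}|lborel. h x t)"
proof -
  have "continuous_on (U \<times> cbox 0 1) ((\<lambda>(x,t). h x t) \<circ> (\<lambda>p. (snd p, fst p)))"
    by (intro continuous_on_compose continuous_on_subset[OF assms]) (auto intro!: continuous_intros)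
  then have "continuous_on (U \<times> cbox 0 1) (\<lambda>(t,x). h x t)"
    by (simp add: o_def case_prod_beta')
  then have "continuous_on U (\<lambda>t. integral (cbox 0 1) (\<lambda>x. h x t))"
    by (rule integral_continuous_on_param)
  moreover have "(LINT x:{0..1}|lborel. h x t) = integral (cbox 0 1) (\<lambda>x. h x t)" if "t \<in> U" for t
  proof -
    have "continuous_on {0..1} (\<lambda>x. h x t)" by (rule continuous_slice[OF assms that])
    then show ?thesis
      using set_borel_integral_eq_integral(2)[OF borel_integrable_atLeastAtMost'] by simp
  qed
  ultimately show ?thesis by (simp cong: continuous_on_cong)
qed

lemma L2norm_continuous_param:
  fixes h :: "real \<Rightarrow> real \<Rightarrow> real"
  assumes "continuous_on ({0..1} \<times> U) (\<lambda>(x,t). h x t)"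
  shows "continuous_on U (\<lambda>t. L2norm (\<lambda>x. h x t))"
  unfolding L2norm_def L2inner_def
  using assms by (intro continuous_on_real_sqrt LINT_continuous_param) (auto intro!: continuous_intros simp: case_prod_beta')

lemma cf_continuous_param:
  fixes h :: "real \<Rightarrow> real \<Rightarrow> real"
  assumes "continuous_on ({0..1} \<times> U) (\<lambda>(x,t). h x t)"
  shows "continuous_on U (\<lambda>t. cf (\<lambda>x. h x t) k)"
  unfolding cf_def L2inner_def
  using assms by (intro LINT_continuous_param)
    (auto intro!: continuous_intros continuous_on_compose2[OF es_continuous[of UNIV]] simp: case_prod_beta')

lemma LINT_open_closed:
  fixes a b :: real
  shows "(LINT s:{a<..<b}|lborel. h s) = (LINT s:{a..b}|lborel. (h s :: real))"
  by (rule set_integral_discrete_difference[of "{a, b}"]) auto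

lemma LINT_split:
  fixes h :: "real \<Rightarrow> real"
  assumes "a < b" "b \<le> c" "set_integrable lborel {a<..<c} h"
  shows "(LINT s:{a<..<c}|lborel. h s) = (LINT s:{a<..<b}|lborel. h s) + (LINT s:{b<..<c}|lborel. h s)"
proof (cases "b = c")
  case False
  with assms have bc: "b < c" by simp
  have s: "set_integrable lborel {a<..<b} h" "set_integrable lborel {b<..<c} h"
    by (rule set_integrable_subset[OF assms(3)]; use assms bc in auto)+
  have "AE x in lborel. x \<noteq> b" by (rule AE_lborel_singleton)
  have e: "(LINT s:{a<..<c}|lborel. h s) = (LINT s:{a<..<b} \<union> {b<..<c}|lborel. h s)"
    unfolding set_lebesgue_integral_def
  proof (rule Bochner_Integration.integral_cong_AE)
    show "AE x in lborel. indicator {a<..<c} x *\<^sub>R h x = indicator ({a<..<b} \<union> {b<..<c}) x *\<^sub>R h x"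
      using \<open>AE x in lborel. x \<noteq> b\<close> by eventually_elim (use assms bc in \<open>auto simp: indicator_def\<close>)
    show "(\<lambda>x. indicator {a<..<c} x *\<^sub>R h x) \<in> borel_measurable lborel" "(\<lambda>x. indicator ({a<..<b} \<union> {b<..<c}) x *\<^sub>R h x) \<in> borel_measurable lborel"
      using assms(3) set_integrable_Un[OF s] unfolding set_integrable_def by (auto intro: borel_measurable_integrable)
  qed
  show ?thesis unfolding e by (rule set_integral_Un) (use s in auto)
qed (auto simp: set_lebesgue_integral_def)

text \<open>The integrand may be singular at \<open>s0\<close>, so the integral is split at a point
  \<open>a\<close> strictly between: the first piece is constant in the upper limit and the second
  is covered by the theorem for continuous functions.\<close>

lemma FTC_open:
  fixes h :: "real \<Rightarrow> real"
  assumes "continuous_on {s0<..} h" "\<And>T. s0 < T \<Longrightarrow> set_integrable lborel {s0<..<T} h" "s0 < t"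
  shows "((\<lambda>t. LINT s:{s0<..<t}|lborel. h s) has_real_derivative h t) (at t)"
proof -
  define a b where "a = (s0 + t) / 2" and "b = t + 1"
  have ab: "s0 < a" "a < t" "t < b" using assms(3) by (auto simp: a_def b_def)
  have c: "continuous_on {a..b} h" by (rule continuous_on_subset[OF assms(1)]) (use ab in auto)
  have "((\<lambda>x. integral {a..x} h) has_real_derivative h t) (at t within {a..b})"
    using integral_has_real_derivative[OF c] ab by simp
  moreover have "at t within {a..b} = at t" using ab by (intro at_within_interior) simp
  ultimately have "((\<lambda>x. (LINT s:{s0<..<a}|lborel. h s) + integral {a..x} h) has_real_derivative 0 + h t) (at t)"
    by (intro derivative_intros) auto
  then have "((\<lambda>x. (LINT s:{s0<..<a}|lborel. h s) + integral {a..x} h) has_real_derivative h t) (at t)" by simp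
  then show ?thesis
  proof (rule DERIV_cong_ev[THEN iffD1, rotated -1])
    have "\<forall>\<^sub>F x in nhds t. x \<in> {a<..<b}" using ab by (intro eventually_nhds_in_open) auto
    then show "\<forall>\<^sub>F x in nhds t. (LINT s:{s0<..<a}|lborel. h s) + integral {a..x} h = (LINT s:{s0<..<x}|lborel. h s)"
    proof eventually_elim
      case (elim x)
      have "continuous_on {a..x} h" by (rule continuous_on_subset[OF c]) (use elim in auto)
      then have "(LINT s:{a..x}|lborel. h s) = integral {a..x} h"
        by (intro set_borel_integral_eq_integral(2) borel_integrable_atLeastAtMost')
      then have "integral {a..x} h = (LINT s:{a<..<x}|lborel. h s)"
        unfolding LINT_open_closed by simp
      then show ?case using LINT_split[of s0 a x h] ab elim assms(2)[of x] by simp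
    qed
  qed auto
qed

text \<open>The factor \<open>exp (- (om k)\<^sup>2 * t)\<close> is pulled out, so that the
  remaining integrand does not depend on \<open>t\<close>; this is why integrability is assumed with
  the factor \<open>exp ((om k)\<^sup>2 * s)\<close>.\<close>

lemma duhamel_deriv:
  assumes c: "continuous_on {s0<..} (\<lambda>s. g s k)" and i: "\<And>T. s0 < T \<Longrightarrow> set_integrable lborel {s0<..<T} (\<lambda>s. exp ((om k)\<^sup>2 * s) * g s k)" and t: "s0 < t"
  shows "((\<lambda>t. duhamel g s0 t k) has_real_derivative (g t k - (om k)\<^sup>2 * duhamel g s0 t k)) (at t)"
proof -
  have e: "duhamel g s0 t k = exp (- (om k)\<^sup>2 * t) * (LINT s:{s0<..<t}|lborel. exp ((om k)\<^sup>2 * s) * g s k)" for t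
  proof -
    have "exp (- (om k)\<^sup>2 * (t - s)) = exp (- (om k)\<^sup>2 * t) * exp ((om k)\<^sup>2 * s)" for s
      by (simp only: exp_add[symmetric]) (simp add: algebra_simps)
    then show ?thesis unfolding duhamel_def by (simp only: mult.assoc set_integral_mult_right)
  qed
  have "((\<lambda>t. LINT s:{s0<..<t}|lborel. exp ((om k)\<^sup>2 * s) * g s k) has_real_derivative exp ((om k)\<^sup>2 * t) * g t k) (at t)"
    by (rule FTC_open) (auto intro!: continuous_intros c i t)
  then have "((\<lambda>t. duhamel g s0 t k) has_real_derivative
     - (om k)\<^sup>2 * exp (- (om k)\<^sup>2 * t) * (LINT s:{s0<..<t}|lborel. exp ((om k)\<^sup>2 * s) * g s k) +
       exp (- (om k)\<^sup>2 * t) * (exp ((om k)\<^sup>2 * t) * g t k)) (at t)"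
    unfolding e by (auto intro!: derivative_eq_intros)
  then show ?thesis
  proof (rule DERIV_cong)
    show "- (om k)\<^sup>2 * exp (- (om k)\<^sup>2 * t) * (LINT s:{s0<..<t}|lborel. exp ((om k)\<^sup>2 * s) * g s k) +
       exp (- (om k)\<^sup>2 * t) * (exp ((om k)\<^sup>2 * t) * g t k) = g t k - (om k)\<^sup>2 * duhamel g s0 t k"
      unfolding e by (simp add: exp_minus)
  qed
qed

section \<open>The truncated equation\<close>

lemma L2norm_affine_le:
  assumes "\<phi> \<in> L2" "\<psi> \<in> L2" "0 \<le> c" "0 \<le> d" "\<And>x. x \<in> {0..1} \<Longrightarrow> \<bar>\<phi> x\<bar> \<le> c + d * \<bar>\<psi> x\<bar>"
  shows "L2norm \<phi> \<le> c + d * L2norm \<psi>"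
proof -
  have m: "set_borel_measurable lborel {0..1} (\<lambda>x. \<bar>\<psi> x\<bar>)"
    using assms(2) borel_measurable_abs[of "\<lambda>x. indicator {0..1} x *\<^sub>R \<psi> x" lborel]
    by (simp add: L2_def set_borel_measurable_def abs_mult)
  then have a: "(\<lambda>x. \<bar>\<psi> x\<bar>) \<in> L2" using assms(2) by (simp add: L2_def)
  have "L2norm \<phi> \<le> L2norm (\<lambda>x. c + d * \<bar>\<psi> x\<bar>)"
  proof (rule L2norm_mono[OF assms(1)])
    show "(\<lambda>x. c + d * \<bar>\<psi> x\<bar>) \<in> L2" using a by (intro L2_add L2_scale) (auto intro!: L2_continuous)
    show "\<bar>\<phi> x\<bar> \<le> \<bar>c + d * \<bar>\<psi> x\<bar>\<bar>" if "x \<in> {0..1}" for x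
      using assms(5)[OF that] by linarith
  qed
  also have "\<dots> \<le> L2norm (\<lambda>x. c) + L2norm (\<lambda>x. d * \<bar>\<psi> x\<bar>)"
    using a by (intro L2norm_triangle L2_scale) (auto intro!: L2_continuous)
  also have "\<dots> = c + d * L2norm (\<lambda>x. \<bar>\<psi> x\<bar>)" using assms by (simp add: L2norm_scale)
  also have "L2norm (\<lambda>x. \<bar>\<psi> x\<bar>) = L2norm \<psi>" by (simp add: L2norm_def L2inner_def)
  finally show ?thesis .
qed

lemma L2norm_le_scaled:
  assumes "\<phi> \<in> L2" "\<psi> \<in> L2" "0 \<le> d" "\<And>x. x \<in> {0..1} \<Longrightarrow> \<bar>\<phi> x\<bar> \<le> d * \<bar>\<psi> x\<bar>"
  shows "L2norm \<phi> \<le> d * L2norm \<psi>"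
  using L2norm_affine_le[of \<phi> \<psi> 0 d] assms by simp

lemma lipschitz_continuous_on:
  fixes h :: "real \<Rightarrow> real"
  assumes "\<And>a b. \<bar>h a - h b\<bar> \<le> L * \<bar>a - b\<bar>" "0 \<le> L" shows "continuous_on S h"
proof -
  have "L-lipschitz_on S h" using assms by (intro lipschitz_onI) (auto simp: dist_real_def)
  then show ?thesis by (rule lipschitz_on_continuous_on)
qed

text \<open>Selects the exponential weight: 1/32 is the exponent gained in
  \<open>wnorm_le_duhamel\<close>, and the \<open>+ 1\<close> keeps \<mu> positive when
  \<open>X = 0\<close>.\<close>

lemma small_powr:
  assumes "0 \<le> (X::real)" "0 < e" obtains \<mu> :: real where "0 < \<mu>" "X * \<mu> powr (- (1/32)) \<le> e"
proof (rule that[of "((X + 1) / e) powr 32"])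
  have "(((X + 1) / e) powr 32) powr (- (1/32)) = ((X + 1) / e) powr (- 1)" by (simp add: powr_powr)
  also have "\<dots> = e / (X + 1)" using assms by (subst powr_neg_one) auto
  finally show "X * (((X + 1) / e) powr 32) powr (- (1/32)) \<le> e"
    using assms by (simp only:) (simp add: field_simps)
qed (use assms in auto)

text \<open>Lets bounded terms be absorbed into the singular factor
  \<open>t powr (- (15/16))\<close> on a bounded time interval, so that all parts of the
  nonlinearity share one time profile.\<close>

lemma powr_time_le:
  assumes "0 < t" "t \<le> T" shows "1 \<le> T powr (15/16) * t powr (- (15/16 :: real))"
proof -
  have "1 = T powr (15/16) * T powr (- (15/16))" using assms by (simp flip: powr_add)
  also have "\<dots> \<le> T powr (15/16) * t powr (- (15/16))" using assms by (intro mult_left_mono powr_mono2') auto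
  finally show ?thesis .
qed

definition trunc :: "real \<Rightarrow> (nat \<Rightarrow> real) \<Rightarrow> real" where
  "trunc M v = M / max M (L2norm (ser v))"

lemma trunc_bounds:
  assumes "0 < M" shows "0 < trunc M v" "trunc M v \<le> 1" "trunc M v * L2norm (ser v) \<le> M"
proof -
  show "0 < trunc M v" "trunc M v \<le> 1" using assms by (auto simp: trunc_def field_simps)
  have "L2norm (ser v) / max M (L2norm (ser v)) \<le> 1" using assms by (simp add: field_simps)
  then have "M * (L2norm (ser v) / max M (L2norm (ser v))) \<le> M * 1" using assms by (intro mult_left_mono) auto
  then show "trunc M v * L2norm (ser v) \<le> M" by (simp add: trunc_def)
qed

text \<open>One unit of the constant comes from the difference of the series with a common factor at
  most 1, the other from the difference of the factors, which is controlled by the reverse triangle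
  inequality for the norms.\<close>

lemma trunc_lipschitz:
  assumes M: "0 < M" and wnorm_le: "wnorm_le t A v" "wnorm_le t B w"
  shows "L2norm (\<lambda>x. trunc M v * ser v x - trunc M w * ser w x) \<le> 2 * L2norm (\<lambda>x. ser v x - ser w x)"
proof -
  note L = ser_L2[OF wnorm_le(1)] ser_L2[OF wnorm_le(2)]
  define n where "n = L2norm (\<lambda>x. ser v x - ser w x)"
  have "L2norm (\<lambda>x. trunc M v * ser v x - trunc M w * ser w x)
     = L2norm (\<lambda>x. trunc M v * (ser v x - ser w x) + (trunc M v - trunc M w) * ser w x)"
    by (simp add: algebra_simps)
  also have "\<dots> \<le> trunc M v * n + \<bar>trunc M v - trunc M w\<bar> * L2norm (ser w)"
    using L2norm_triangle[OF L2_scale[OF L2_diff[OF L], of "trunc M v"] L2_scale[OF L(2), of "trunc M v - trunc M w"]]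
      trunc_bounds(1)[OF M, of v] by (simp add: L2norm_scale n_def)
  also have "trunc M v * n \<le> 1 * n" using trunc_bounds[OF M, of v] by (intro mult_right_mono) (auto simp: n_def)
  also have "\<bar>trunc M v - trunc M w\<bar> * L2norm (ser w) \<le> n"
  proof -
    define p q where "p = max M (L2norm (ser v))" and "q = max M (L2norm (ser w))"
    have pq: "M \<le> p" "M \<le> q" "L2norm (ser w) \<le> q" "0 < p" "0 < q" using M by (auto simp: p_def q_def)
    have "\<bar>q - p\<bar> \<le> \<bar>L2norm (ser v) - L2norm (ser w)\<bar>" by (auto simp: p_def q_def max_def)
    also have "\<dots> \<le> n" unfolding n_def by (rule L2norm_rev_triangle[OF L])
    finally have d: "\<bar>q - p\<bar> \<le> n" .
    have "\<bar>trunc M v - trunc M w\<bar> * L2norm (ser w) = (M / p) * (L2norm (ser w) / q) * \<bar>q - p\<bar>"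
    proof -
      have "trunc M v - trunc M w = M / p * (q - p) / q" using pq by (simp add: trunc_def p_def[symmetric] q_def[symmetric] field_simps)
      then show ?thesis using pq M by (simp add: abs_mult)
    qed
    also have "\<dots> \<le> 1 * 1 * n" using pq M d by (intro mult_mono) (auto simp: field_simps)
    finally show ?thesis by simp
  qed
  finally show ?thesis by (simp add: n_def)
qed

lemma admissible_bound:
  assumes "admissible a" "0 < T"
  obtains B where "0 \<le> B" "\<And>t. 0 < t \<Longrightarrow> t \<le> T \<Longrightarrow> wnorm_le t B (a t)"
proof -
  obtain B where B: "\<forall>t. 0 < t \<longrightarrow> t \<le> T \<longrightarrow> wnorm_le t B (a t)" using assms unfolding admissible_def by blast
  then have "0 \<le> B" using assms(2) by (auto simp: wnorm_le_def)
  with B that show thesis by blast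
qed

text \<open>\<open>fp\<close> plays the role of \<open>deriv f\<close>; the fixed point argument
  sees the flux only through this Lipschitz function, and one constant \<open>L\<close> serves both
  nonlinear terms.\<close>

locale reaction =
  fixes fp r :: "real \<Rightarrow> real" and L :: real
  assumes L0: "0 \<le> L" and r_lip: "\<And>a b. \<bar>r a - r b\<bar> \<le> L * \<bar>a - b\<bar>" and fp_lip: "\<And>a b. \<bar>fp a - fp b\<bar> \<le> L * \<bar>a - b\<bar>"
begin

lemma r_cont: "continuous_on S r" and fp_cont: "continuous_on S fp"
  using lipschitz_continuous_on r_lip fp_lip L0 by blast+

lemma r_comp [continuous_intros]: "continuous_on S h \<Longrightarrow> continuous_on S (\<lambda>x. r (h x))"
  and fp_comp [continuous_intros]: "continuous_on S h \<Longrightarrow> continuous_on S (\<lambda>x. fp (h x))"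
  by (rule continuous_on_compose2[OF r_cont[of UNIV]], auto)
    (rule continuous_on_compose2[OF fp_cont[of UNIV]], auto)

lemma r_le: "\<bar>r a\<bar> \<le> \<bar>r 0\<bar> + L * \<bar>a\<bar>" and fp_le: "\<bar>fp a\<bar> \<le> \<bar>fp 0\<bar> + L * \<bar>a\<bar>"
  using r_lip[of a 0] fp_lip[of a 0] by auto

text \<open>The nonlinearity \<open>r(y) - f'(y) y\<^sub>x\<close>, with the argument of \<open>f'\<close> projected to the
  \<open>L\<^sup>2\<close>-ball of radius \<open>M\<close>. The projection multiplies \<open>y\<close> by a factor that does not depend on \<open>x\<close>,
  hence it does not contribute to the energy balance.\<close>

definition nonlin :: "real \<Rightarrow> (nat \<Rightarrow> real) \<Rightarrow> real \<Rightarrow> real" where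
  "nonlin M v x = r (ser v x) - fp (trunc M v * ser v x) * serx v x"

lemma nonlin_continuous: "wnorm_le t A v \<Longrightarrow> continuous_on S (nonlin M v)"
  unfolding nonlin_def by (intro continuous_intros ser_continuous serx_continuous) auto

lemma fp_norm:
  assumes "0 < M" "wnorm_le t A v"
  shows "L2norm (\<lambda>x. fp (trunc M v * ser v x)) \<le> \<bar>fp 0\<bar> + L * M"
proof -
  have "L2norm (\<lambda>x. fp (trunc M v * ser v x)) \<le> \<bar>fp 0\<bar> + L * L2norm (\<lambda>x. trunc M v * ser v x)"
    using assms L0 fp_le by (intro L2norm_affine_le L2_scale ser_L2 L2_continuous continuous_intros ser_continuous) auto
  also have "\<dots> \<le> \<bar>fp 0\<bar> + L * M"
    using trunc_bounds[OF assms(1), of v] L0 by (simp add: L2norm_scale mult_left_mono)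
  finally show ?thesis .
qed

text \<open>The bound is affine in \<open>A\<close>, which is what the truncation buys: the factor
  \<open>fp\<close> is measured in L2, where the projected argument has norm at most
  \<open>M\<close>, and the factor \<open>serx v\<close> in the sup norm.\<close>

lemma nonlin_norm:
  assumes M: "0 < M" and wnorm_le: "wnorm_le t A v"
  shows "L2norm (nonlin M v) \<le> \<bar>r 0\<bar> + L * A + (\<bar>fp 0\<bar> + L * M) * (2 * (A * t powr (- (15/16))))"
proof -
  note c = ser_continuous[OF wnorm_le] serx_continuous[OF wnorm_le]
  have 1: "L2norm (nonlin M v) \<le> L2norm (\<lambda>x. r (ser v x)) + L2norm (\<lambda>x. fp (trunc M v * ser v x) * serx v x)"
    unfolding nonlin_def by (intro L2norm_diff_le L2_continuous continuous_intros c)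
  have 2: "L2norm (\<lambda>x. r (ser v x)) \<le> \<bar>r 0\<bar> + L * L2norm (ser v)"
    using L0 r_le by (intro L2norm_affine_le L2_continuous continuous_intros c) auto
  have 3: "L * L2norm (ser v) \<le> L * A" by (rule mult_left_mono[OF ser_norm_le[OF wnorm_le] L0])
  have "L2norm (\<lambda>x. fp (trunc M v * ser v x) * serx v x) \<le> (2 * (A * t powr (- (15/16)))) * L2norm (\<lambda>x. fp (trunc M v * ser v x))"
    using serx_le[OF wnorm_le] wnorm_le unfolding wnorm_le_def
    by (intro L2norm_le_scaled L2_continuous continuous_intros c) (auto simp: abs_mult mult.commute[of "\<bar>fp _\<bar>"] intro!: mult_right_mono)
  also have "\<dots> \<le> (2 * (A * t powr (- (15/16)))) * (\<bar>fp 0\<bar> + L * M)"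
    using fp_norm[OF M wnorm_le] wnorm_le unfolding wnorm_le_def by (intro mult_left_mono) auto
  finally show ?thesis using 1 2 3 by (simp only: mult.commute[of "2 * (A * t powr (- (15/16)))"])
qed

lemma nonlin_diff:
  assumes M: "0 < M" and szv: "wnorm_le t B' v" and szw: "wnorm_le t B w" and szd: "wnorm_le t D (\<lambda>k. v k - w k)"
  shows "L2norm (\<lambda>x. nonlin M v x - nonlin M w x) \<le>
    L * D + (\<bar>fp 0\<bar> + L * M) * (2 * (D * t powr (- (15/16)))) + 4 * L * B * D * t powr (- (15/16))"
proof -
  define \<tau> where "\<tau> = t powr (- (15/16))"
  have \<tau>: "0 \<le> \<tau>" by (simp add: \<tau>_def)
  note c = ser_continuous[OF szv] serx_continuous[OF szv] ser_continuous[OF szw] serx_continuous[OF szw]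
  have D: "0 \<le> D" and B: "0 \<le> B" using szd szw by (auto simp: wnorm_le_def)
  have nd: "L2norm (\<lambda>x. ser v x - ser w x) \<le> D"
    using ser_norm_le[OF szd] ext[of "ser (\<lambda>k. v k - w k)" "\<lambda>x. ser v x - ser w x", OF ser_diff(1)[OF szv szw]] by simp
  \<comment> \<open>Each of the three differences is linear in \<open>v - w\<close> up to a
    controlled factor. The last one combines the sup bound \<open>2 * B * \<tau>\<close> of
    \<open>serx w\<close> with the constant 2 of the projection, hence the 4 in the
    statement.\<close>
  have e: "nonlin M v x - nonlin M w x = ((r (ser v x) - r (ser w x)) - fp (trunc M v * ser v x) * (serx v x - serx w x))
     - (fp (trunc M v * ser v x) - fp (trunc M w * ser w x)) * serx w x" for x
    by (simp add: nonlin_def algebra_simps)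
  have "L2norm (\<lambda>x. nonlin M v x - nonlin M w x) \<le> L2norm (\<lambda>x. (r (ser v x) - r (ser w x)) - fp (trunc M v * ser v x) * (serx v x - serx w x))
     + L2norm (\<lambda>x. (fp (trunc M v * ser v x) - fp (trunc M w * ser w x)) * serx w x)"
    unfolding e by (intro L2norm_diff_le L2_continuous continuous_intros c)
  also have "L2norm (\<lambda>x. (r (ser v x) - r (ser w x)) - fp (trunc M v * ser v x) * (serx v x - serx w x)) \<le>
      L2norm (\<lambda>x. r (ser v x) - r (ser w x)) + L2norm (\<lambda>x. fp (trunc M v * ser v x) * (serx v x - serx w x))"
    by (intro L2norm_diff_le L2_continuous continuous_intros c)
  also have "L2norm (\<lambda>x. r (ser v x) - r (ser w x)) \<le> L * L2norm (\<lambda>x. ser v x - ser w x)"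
    using L0 r_lip by (intro L2norm_le_scaled L2_continuous continuous_intros c) auto
  also have "\<dots> \<le> L * D" using nd L0 by (rule mult_left_mono)
  also have "L2norm (\<lambda>x. fp (trunc M v * ser v x) * (serx v x - serx w x)) \<le> (2 * (D * \<tau>)) * L2norm (\<lambda>x. fp (trunc M v * ser v x))"
    using serx_le[OF szd] ser_diff(2)[OF szv szw] D unfolding \<tau>_def
    by (intro L2norm_le_scaled L2_continuous continuous_intros c) (auto simp: abs_mult mult.commute[of "\<bar>fp _\<bar>"] intro!: mult_right_mono)
  also have "\<dots> \<le> (2 * (D * \<tau>)) * (\<bar>fp 0\<bar> + L * M)"
    using fp_norm[OF M szv] D \<tau> by (intro mult_left_mono) auto
  also have "L2norm (\<lambda>x. (fp (trunc M v * ser v x) - fp (trunc M w * ser w x)) * serx w x)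
     \<le> (L * (2 * (B * \<tau>))) * L2norm (\<lambda>x. trunc M v * ser v x - trunc M w * ser w x)"
  proof (intro L2norm_le_scaled L2_continuous continuous_intros c)
    fix x
    have "\<bar>(fp (trunc M v * ser v x) - fp (trunc M w * ser w x)) * serx w x\<bar> \<le> (L * \<bar>trunc M v * ser v x - trunc M w * ser w x\<bar>) * (2 * (B * \<tau>))"
      using fp_lip serx_le[OF szw, of x] L0 unfolding abs_mult \<tau>_def by (intro mult_mono) auto
    then show "\<bar>(fp (trunc M v * ser v x) - fp (trunc M w * ser w x)) * serx w x\<bar> \<le> L * (2 * (B * \<tau>)) * \<bar>trunc M v * ser v x - trunc M w * ser w x\<bar>"
      by (simp add: mult_ac)
  qed (use L0 B \<tau> in auto)
  also have "\<dots> \<le> (L * (2 * (B * \<tau>))) * (2 * D)"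
    using trunc_lipschitz[OF M szv szw] nd L0 B \<tau> by (intro mult_left_mono) auto
  finally show ?thesis by (simp add: \<tau>_def algebra_simps)
qed

lemma cf_nonlin_bound:
  assumes "wnorm_le t A v" shows "(\<Sum>k<K. (cf (nonlin M v) k)\<^sup>2) \<le> (L2norm (nonlin M v))\<^sup>2"
  by (rule Bessel[OF L2_continuous[OF nonlin_continuous[OF assms]]])

lemma cf_nonlin_diff_bound:
  assumes "wnorm_le t A v" "wnorm_le t B w"
  shows "(\<Sum>k<K. (cf (nonlin M v) k - cf (nonlin M w) k)\<^sup>2) \<le> (L2norm (\<lambda>x. nonlin M v x - nonlin M w x))\<^sup>2"
proof -
  note L = L2_continuous[OF nonlin_continuous[OF assms(1)]] L2_continuous[OF nonlin_continuous[OF assms(2)]]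
  show ?thesis using Bessel[OF L2_diff[OF L, of M M], of K] by (simp add: cf_diff[OF L])
qed

end

text \<open>The radius depends on time because the energy it has to exceed grows with time.
  Monotonicity allows constants on \<open>(0,T]\<close> to be written with \<open>M T\<close>;
  continuity keeps the truncated nonlinearity jointly continuous.\<close>

locale truncated = reaction +
  fixes M :: "real \<Rightarrow> real" and u :: "real \<Rightarrow> real"
  assumes M_cont: "continuous_on {0<..} M" and M_pos: "\<And>t. 0 < M t" and M_mono: "\<And>s t. 0 < s \<Longrightarrow> s \<le> t \<Longrightarrow> M s \<le> M t"
    and u_L2: "u \<in> L2"
begin

definition Phi :: "(real \<Rightarrow> nat \<Rightarrow> real) \<Rightarrow> real \<Rightarrow> nat \<Rightarrow> real" where
  "Phi a t k = exp (- (om k)\<^sup>2 * t) * cf u k + duhamel (\<lambda>s. cf (nonlin (M s) (a s))) 0 t k"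

lemma trunc_continuous:
  assumes a: "admissible a"
  shows "continuous_on {0<..} (\<lambda>t. trunc (M t) (a t))"
proof -
  have "continuous_on ({0..1} \<times> {0<..}) (\<lambda>(x,t). ser (a t) x)"
    by (rule continuous_on_subset[OF admissible_continuous(1)[OF a]]) auto
  then have "continuous_on {0<..} (\<lambda>t. L2norm (ser (a t)))" by (rule L2norm_continuous_param)
  moreover have "max (M t) n \<noteq> 0" for t n using M_pos[of t] by (auto simp: max_def)
  ultimately show ?thesis unfolding trunc_def by (intro continuous_intros M_cont) auto
qed

lemma nonlin_joint_continuous:
  assumes a: "admissible a"
  shows "continuous_on (UNIV \<times> {0<..}) (\<lambda>(x,t). nonlin (M t) (a t) x)"
proof -
  have "continuous_on (UNIV \<times> {0<..}) (\<lambda>p. trunc (M (snd p)) (a (snd p)))"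
    by (rule continuous_on_compose2[OF trunc_continuous[OF a]]) (auto intro!: continuous_intros)
  then show ?thesis
    using admissible_continuous[OF a] unfolding nonlin_def case_prod_beta' by (intro continuous_intros)
qed

lemma cf_nonlin_continuous:
  assumes a: "admissible a"
  shows "continuous_on {0<..} (\<lambda>t. cf (nonlin (M t) (a t)) k)"
  by (rule cf_continuous_param, rule continuous_on_subset[OF nonlin_joint_continuous[OF a]]) auto

lemma nonlin_time:
  assumes T: "0 < T"
  obtains C where "0 \<le> C" "\<And>t A v. 0 < t \<Longrightarrow> t \<le> T \<Longrightarrow> wnorm_le t A v \<Longrightarrow> L2norm (nonlin (M t) v) \<le> C * (1 + A) * t powr (- (15/16))"
proof (rule that)
  let ?C = "(\<bar>r 0\<bar> + L) * T powr (15/16) + 2 * (\<bar>fp 0\<bar> + L * M T)"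
  show "0 \<le> ?C" using L0 M_pos[of T] by simp
  fix t A v assume t: "0 < t" "t \<le> T" and wnorm_le: "wnorm_le t A v"
  define \<tau> where "\<tau> = t powr (- (15/16))"
  have A: "0 \<le> A" using wnorm_le by (simp add: wnorm_le_def)
  have \<tau>: "0 \<le> \<tau>" "1 \<le> T powr (15/16) * \<tau>" using powr_time_le[OF t] by (auto simp: \<tau>_def)
  have "L2norm (nonlin (M t) v) \<le> \<bar>r 0\<bar> + L * A + (\<bar>fp 0\<bar> + L * M t) * (2 * (A * \<tau>))"
    unfolding \<tau>_def by (rule nonlin_norm[OF M_pos wnorm_le])
  also have "\<dots> \<le> ((\<bar>r 0\<bar> + L) * (1 + A)) * (T powr (15/16) * \<tau>) + (\<bar>fp 0\<bar> + L * M T) * (2 * ((1 + A) * \<tau>))"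
  proof (rule add_mono)
    have "\<bar>r 0\<bar> + L * A \<le> ((\<bar>r 0\<bar> + L) * (1 + A)) * 1" using L0 A by (simp add: algebra_simps)
    also have "\<dots> \<le> ((\<bar>r 0\<bar> + L) * (1 + A)) * (T powr (15/16) * \<tau>)" using \<tau> L0 A by (intro mult_left_mono) auto
    finally show "\<bar>r 0\<bar> + L * A \<le> ((\<bar>r 0\<bar> + L) * (1 + A)) * (T powr (15/16) * \<tau>)" .
    show "(\<bar>fp 0\<bar> + L * M t) * (2 * (A * \<tau>)) \<le> (\<bar>fp 0\<bar> + L * M T) * (2 * ((1 + A) * \<tau>))"
      using M_mono[OF t] M_pos[of T] L0 A \<tau> by (intro mult_mono add_mono mult_left_mono) auto
  qed
  also have "\<dots> = ?C * (1 + A) * \<tau>" by (simp add: algebra_simps)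
  finally show "L2norm (nonlin (M t) v) \<le> ?C * (1 + A) * t powr (- (15/16))" by (simp add: \<tau>_def)
qed

lemma nonlin_time_diff:
  assumes T: "0 < T" and B: "0 \<le> B"
  obtains C where "0 \<le> C" "\<And>t D v w. 0 < t \<Longrightarrow> t \<le> T \<Longrightarrow> wnorm_le t B v \<Longrightarrow> wnorm_le t B w \<Longrightarrow> wnorm_le t D (\<lambda>k. v k - w k) \<Longrightarrow>
    L2norm (\<lambda>x. nonlin (M t) v x - nonlin (M t) w x) \<le> C * D * t powr (- (15/16))"
proof (rule that)
  let ?C = "L * T powr (15/16) + 2 * (\<bar>fp 0\<bar> + L * M T) + 4 * L * B"
  show "0 \<le> ?C" using L0 M_pos[of T] B by simp
  fix t D v w assume t: "0 < t" "t \<le> T" and wnorm_le: "wnorm_le t B v" "wnorm_le t B w" "wnorm_le t D (\<lambda>k. v k - w k)"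
  define \<tau> where "\<tau> = t powr (- (15/16))"
  have D: "0 \<le> D" using wnorm_le by (simp add: wnorm_le_def)
  have \<tau>: "0 \<le> \<tau>" "1 \<le> T powr (15/16) * \<tau>" using powr_time_le[OF t] by (auto simp: \<tau>_def)
  have "L2norm (\<lambda>x. nonlin (M t) v x - nonlin (M t) w x) \<le> L * D + (\<bar>fp 0\<bar> + L * M t) * (2 * (D * \<tau>)) + 4 * L * B * D * \<tau>"
    unfolding \<tau>_def by (rule nonlin_diff[OF M_pos wnorm_le])
  also have "\<dots> \<le> (L * D) * (T powr (15/16) * \<tau>) + (\<bar>fp 0\<bar> + L * M T) * (2 * (D * \<tau>)) + 4 * L * B * D * \<tau>"
  proof (intro add_mono order_refl)
    show "L * D \<le> (L * D) * (T powr (15/16) * \<tau>)"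
      using mult_left_mono[OF \<tau>(2), of "L * D"] L0 D by simp
    show "(\<bar>fp 0\<bar> + L * M t) * (2 * (D * \<tau>)) \<le> (\<bar>fp 0\<bar> + L * M T) * (2 * (D * \<tau>))"
      using M_mono[OF t] M_pos[of T] L0 D \<tau> by (intro mult_right_mono add_mono mult_left_mono) auto
  qed
  also have "\<dots> = ?C * D * \<tau>" by (simp add: algebra_simps)
  finally show "L2norm (\<lambda>x. nonlin (M t) v x - nonlin (M t) w x) \<le> ?C * D * t powr (- (15/16))" by (simp add: \<tau>_def)
qed

lemma cf_nonlin_time:
  assumes a: "admissible a" and T: "0 < T"
  obtains C where "0 \<le> C" "\<And>t. 0 < t \<Longrightarrow> t \<le> T \<Longrightarrow> L2norm (nonlin (M t) (a t)) \<le> C * t powr (- (15/16))"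
    "\<And>t K. 0 < t \<Longrightarrow> t \<le> T \<Longrightarrow> (\<Sum>k<K. (cf (nonlin (M t) (a t)) k)\<^sup>2) \<le> (C * t powr (- (15/16)))\<^sup>2"
proof -
  obtain C where C: "0 \<le> C" "\<And>t A v. 0 < t \<Longrightarrow> t \<le> T \<Longrightarrow> wnorm_le t A v \<Longrightarrow> L2norm (nonlin (M t) v) \<le> C * (1 + A) * t powr (- (15/16))"
    by (rule nonlin_time[OF T]) (rule that)
  obtain B where B: "\<And>t. 0 < t \<Longrightarrow> t \<le> T \<Longrightarrow> wnorm_le t B (a t)" and "0 \<le> B" using admissible_bound[OF a T] by blast
  have n: "L2norm (nonlin (M t) (a t)) \<le> C * (1 + B) * t powr (- (15/16))" if "0 < t" "t \<le> T" for t
    using C(2)[OF that B[OF that]] .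
  have "(\<Sum>k<K. (cf (nonlin (M t) (a t)) k)\<^sup>2) \<le> (C * (1 + B) * t powr (- (15/16)))\<^sup>2" if "0 < t" "t \<le> T" for t K
    using cf_nonlin_bound[OF B[OF that], of "M t" K] power_mono[OF n[OF that], of 2] by simp
  then show thesis using n C(1) \<open>0 \<le> B\<close> that[of "C * (1 + B)"] by simp
qed

lemma duhamel_nonlin_integrable:
  assumes a: "admissible a" and T: "0 < T"
  shows "set_integrable lborel {0<..<T} (\<lambda>s. exp ((om k)\<^sup>2 * s) * cf (nonlin (M s) (a s)) k)"
proof -
  obtain C where C: "0 \<le> C" "\<And>t. 0 < t \<Longrightarrow> t \<le> T \<Longrightarrow> L2norm (nonlin (M t) (a t)) \<le> C * t powr (- (15/16))"
     "\<And>t K. 0 < t \<Longrightarrow> t \<le> T \<Longrightarrow> (\<Sum>k<K. (cf (nonlin (M t) (a t)) k)\<^sup>2) \<le> (C * t powr (- (15/16)))\<^sup>2"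
    by (rule cf_nonlin_time[OF a T]) (rule that)
  show ?thesis
  proof (rule Beta_dominated_integrable[of 0 "15/16"])
    show "continuous_on {0<..<T} (\<lambda>s. exp ((om k)\<^sup>2 * s) * cf (nonlin (M s) (a s)) k)"
      by (intro continuous_intros continuous_on_subset[OF cf_nonlin_continuous[OF a]]) auto
    fix s assume s: "0 < s" "s < T"
    obtain B where "wnorm_le s B (a s)" using admissible_bound[OF a, of s] s by blast
    then have "\<bar>cf (nonlin (M s) (a s)) k\<bar> \<le> C * s powr (- (15/16))"
      using cf_le[OF L2_continuous[OF nonlin_continuous], of s B "a s" "M s" k] C(2)[of s] s by simp
    moreover have "exp ((om k)\<^sup>2 * s) \<le> exp ((om k)\<^sup>2 * T)" using s by (simp add: mult_left_mono)
    ultimately have "\<bar>exp ((om k)\<^sup>2 * s) * cf (nonlin (M s) (a s)) k\<bar> \<le> exp ((om k)\<^sup>2 * T) * (C * s powr (- (15/16)))"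
      unfolding abs_mult by (intro mult_mono) auto
    then show "\<bar>exp ((om k)\<^sup>2 * s) * cf (nonlin (M s) (a s)) k\<bar> \<le> (exp ((om k)\<^sup>2 * T) * C) * (T - s) powr (- 0) * (s - 0) powr (- (15/16))"
      using s by (simp add: mult.assoc)
  qed (use T in auto)
qed

lemma Phi_deriv:
  assumes a: "admissible a" and t: "0 < t"
  shows "((\<lambda>t. Phi a t k) has_real_derivative cf (nonlin (M t) (a t)) k - (om k)\<^sup>2 * Phi a t k) (at t)"
proof -
  have "((\<lambda>t. duhamel (\<lambda>s. cf (nonlin (M s) (a s))) 0 t k) has_real_derivative
      (cf (nonlin (M t) (a t)) k - (om k)\<^sup>2 * duhamel (\<lambda>s. cf (nonlin (M s) (a s))) 0 t k)) (at t)"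
    by (rule duhamel_deriv[where g="\<lambda>s. cf (nonlin (M s) (a s))"]) (use cf_nonlin_continuous[OF a] duhamel_nonlin_integrable[OF a] t in auto)
  then have "((\<lambda>t. Phi a t k) has_real_derivative (- (om k)\<^sup>2) * exp (- (om k)\<^sup>2 * t) * cf u k +
      (cf (nonlin (M t) (a t)) k - (om k)\<^sup>2 * duhamel (\<lambda>s. cf (nonlin (M s) (a s))) 0 t k)) (at t)"
    unfolding Phi_def by (auto intro!: derivative_eq_intros)
  then show ?thesis by (rule DERIV_cong) (simp add: Phi_def algebra_simps)
qed

lemma Phi_continuous:
  assumes a: "admissible a"
  shows "continuous_on {0<..} (\<lambda>t. Phi a t k)"
  by (rule DERIV_continuous_on[OF has_field_derivative_at_within[OF Phi_deriv[OF a]]]) auto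

text \<open>The Lipschitz constant of the nonlinearity depends on the bound \<open>B\<close>, so
  \<open>B\<close> is fixed before \<open>\<mu>\<close>; then \<open>\<mu>\<close> is taken large
  enough for the Duhamel term to halve the weighted distance.\<close>

lemma Phi_diff_wnorm_le:
  assumes T: "0 < T" and B: "0 \<le> B"
  obtains \<mu> where "0 < \<mu>"
    "\<And>a b d. admissible a \<Longrightarrow> admissible b \<Longrightarrow> 0 \<le> d \<Longrightarrow>
      (\<And>t. 0 < t \<Longrightarrow> t \<le> T \<Longrightarrow> wnorm_le t B (a t) \<and> wnorm_le t B (b t) \<and> wnorm_le t (d * exp (\<mu> * t)) (\<lambda>k. a t k - b t k)) \<Longrightarrow>
      (\<And>t. 0 < t \<Longrightarrow> t \<le> T \<Longrightarrow> wnorm_le t (d / 2 * exp (\<mu> * t)) (\<lambda>k. Phi a t k - Phi b t k))"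
proof -
  obtain C1 where C1: "0 < C1" "\<And>g D \<mu> (t::real). 0 < t \<Longrightarrow> 0 < (\<mu>::real) \<Longrightarrow> 0 \<le> D \<Longrightarrow> (\<And>k. continuous_on {0<..<t} (\<lambda>s. g s k)) \<Longrightarrow>
     (\<And>s K. 0 < s \<Longrightarrow> s < t \<Longrightarrow> (\<Sum>k<K. (g s k)\<^sup>2) \<le> (D * exp (\<mu> * s) * s powr (- (15/16)))\<^sup>2) \<Longrightarrow>
    wnorm_le t (C1 * D * exp (\<mu> * t) * \<mu> powr (- (1/32)) * t powr (1/32)) (duhamel g 0 t)"
    by (rule wnorm_le_duhamel) (rule that; blast)
  obtain C where C: "0 \<le> C" "\<And>t D v w. 0 < t \<Longrightarrow> t \<le> T \<Longrightarrow> wnorm_le t B v \<Longrightarrow> wnorm_le t B w \<Longrightarrow> wnorm_le t D (\<lambda>k. v k - w k) \<Longrightarrow>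
    L2norm (\<lambda>x. nonlin (M t) v x - nonlin (M t) w x) \<le> C * D * t powr (- (15/16))"
    by (rule nonlin_time_diff[OF T B]) (rule that)
  obtain \<mu> :: real where mu: "0 < \<mu>" "(C1 * C * T powr (1/32)) * \<mu> powr (- (1/32)) \<le> 1/2"
    by (rule small_powr[of "C1 * C * T powr (1/32)" "1/2"]) (use C1 C in auto)
  show thesis
  proof (rule that[OF mu(1)])
    fix a b d t
    assume a: "admissible a" and b: "admissible b" and d: "0 \<le> d" and t: "0 < t" "t \<le> T"
      and s: "\<And>t. 0 < t \<Longrightarrow> t \<le> T \<Longrightarrow> wnorm_le t B (a t) \<and> wnorm_le t B (b t) \<and> wnorm_le t (d * exp (\<mu> * t)) (\<lambda>k. a t k - b t k)"
    define g where "g = (\<lambda>s k. cf (nonlin (M s) (a s)) k - cf (nonlin (M s) (b s)) k)"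
    have "wnorm_le t (C1 * (C * d) * exp (\<mu> * t) * \<mu> powr (- (1/32)) * t powr (1/32)) (duhamel g 0 t)"
    proof (rule C1(2))
      show "continuous_on {0<..<t} (\<lambda>s. g s k)" for k
        unfolding g_def by (intro continuous_intros continuous_on_subset[OF cf_nonlin_continuous] a b) auto
      fix s' K assume s': "0 < s'" "s' < t"
      then have sT: "0 < s'" "s' \<le> T" using t by auto
      have "(\<Sum>k<K. (g s' k)\<^sup>2) \<le> (L2norm (\<lambda>x. nonlin (M s') (a s') x - nonlin (M s') (b s') x))\<^sup>2"
        unfolding g_def using s[OF sT] by (intro cf_nonlin_diff_bound) auto
      also have "\<dots> \<le> (C * (d * exp (\<mu> * s')) * s' powr (- (15/16)))\<^sup>2"
        using C(2)[OF sT, of "a s'" "b s'" "d * exp (\<mu> * s')"] s[OF sT] by (intro power_mono) auto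
      finally show "(\<Sum>k<K. (g s' k)\<^sup>2) \<le> (C * d * exp (\<mu> * s') * s' powr (- (15/16)))\<^sup>2" by (simp add: mult.assoc)
    qed (use t mu C d in auto)
    moreover have "duhamel g 0 t = (\<lambda>k. Phi a t k - Phi b t k)"
    proof
      fix k
      have i: "set_integrable lborel {0<..<t} (\<lambda>s. exp (- (om k)\<^sup>2 * (t - s)) * cf (nonlin (M s) (c s)) k)" if "admissible c" for c
      proof -
        have "exp (- (om k)\<^sup>2 * (t - s)) = exp (- (om k)\<^sup>2 * t) * exp ((om k)\<^sup>2 * s)" for s
          by (simp only: exp_add[symmetric]) (simp add: algebra_simps)
        then show ?thesis
          using set_integrable_mult_right[of "exp (- (om k)\<^sup>2 * t)" lborel "{0<..<t}", OF duhamel_nonlin_integrable[OF that t(1), of k]]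
          by (simp only: mult.assoc)
      qed
      show "duhamel g 0 t k = Phi a t k - Phi b t k"
        using set_integral_diff(2)[OF i[OF a] i[OF b]] unfolding Phi_def duhamel_def g_def
        by (simp add: right_diff_distrib)
    qed
    moreover have "C1 * (C * d) * exp (\<mu> * t) * \<mu> powr (- (1/32)) * t powr (1/32) \<le> d / 2 * exp (\<mu> * t)"
    proof -
      have "C1 * C * t powr (1/32) * \<mu> powr (- (1/32)) \<le> C1 * C * T powr (1/32) * \<mu> powr (- (1/32))"
        using t C C1 by (intro mult_right_mono mult_left_mono powr_mono2) auto
      with mu(2) have "C1 * C * t powr (1/32) * \<mu> powr (- (1/32)) \<le> 1/2" by linarith
      then have "(C1 * C * t powr (1/32) * \<mu> powr (- (1/32))) * (d * exp (\<mu> * t)) \<le> 1/2 * (d * exp (\<mu> * t))"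
        using d by (intro mult_right_mono) auto
      then show ?thesis by (simp add: mult_ac)
    qed
    ultimately show "wnorm_le t (d / 2 * exp (\<mu> * t)) (\<lambda>k. Phi a t k - Phi b t k)"
      using wnorm_le_mono by metis
  qed
qed

text \<open>Invariance of a ball in the exponentially weighted norm. It relies on the affine growth
  of the truncated nonlinearity, and its constants are uniform over all admissible
  arguments.\<close>

lemma Phi_bound_wnorm_le:
  assumes T: "0 < T"
  obtains A \<mu> where "0 < \<mu>" "0 \<le> A"
    "\<And>a. admissible a \<Longrightarrow> (\<And>t. 0 < t \<Longrightarrow> t \<le> T \<Longrightarrow> wnorm_le t (A * exp (\<mu> * t)) (a t)) \<Longrightarrow>
      (\<And>t. 0 < t \<Longrightarrow> t \<le> T \<Longrightarrow> wnorm_le t (A * exp (\<mu> * t)) (Phi a t))"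
proof -
  obtain C0 where C0: "1 \<le> C0" "\<And>v A t. 0 < t \<Longrightarrow> 0 \<le> A \<Longrightarrow> (\<And>K. (\<Sum>k<K. (v k)\<^sup>2) \<le> A\<^sup>2) \<Longrightarrow>
    wnorm_le t (C0 * A) (\<lambda>k. exp (- (om k)\<^sup>2 * t) * v k)" by (rule wnorm_le_semigroup) (rule that; blast)
  obtain C1 where C1: "0 < C1" "\<And>g D \<mu> (t::real). 0 < t \<Longrightarrow> 0 < (\<mu>::real) \<Longrightarrow> 0 \<le> D \<Longrightarrow> (\<And>k. continuous_on {0<..<t} (\<lambda>s. g s k)) \<Longrightarrow>
     (\<And>s K. 0 < s \<Longrightarrow> s < t \<Longrightarrow> (\<Sum>k<K. (g s k)\<^sup>2) \<le> (D * exp (\<mu> * s) * s powr (- (15/16)))\<^sup>2) \<Longrightarrow>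
    wnorm_le t (C1 * D * exp (\<mu> * t) * \<mu> powr (- (1/32)) * t powr (1/32)) (duhamel g 0 t)"
    by (rule wnorm_le_duhamel) (rule that; blast)
  obtain C where C: "0 \<le> C" "\<And>t A v. 0 < t \<Longrightarrow> t \<le> T \<Longrightarrow> wnorm_le t A v \<Longrightarrow> L2norm (nonlin (M t) v) \<le> C * (1 + A) * t powr (- (15/16))"
    by (rule nonlin_time[OF T]) (rule that)
  \<comment> \<open>The semigroup part contributes \<open>C0 * L2norm u\<close>; the 1 is the room
    left for the Duhamel part, which is forced below \<open>exp (\<mu> * t)\<close> by choosing
    \<open>\<mu>\<close> after \<open>A\<close>.\<close>
  define A where "A = C0 * L2norm u + 1"
  have A: "0 \<le> A" using C0(1) by (simp add: A_def)
  obtain \<mu> :: real where mu: "0 < \<mu>" "(C1 * (C * (1 + A)) * T powr (1/32)) * \<mu> powr (- (1/32)) \<le> 1"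
    by (rule small_powr[of "C1 * (C * (1 + A)) * T powr (1/32)" 1]) (use C1 C A in auto)
  show thesis
  proof (rule that[OF mu(1) A])
    fix a t assume a: "admissible a" and t: "0 < t" "t \<le> T" and s: "\<And>t. 0 < t \<Longrightarrow> t \<le> T \<Longrightarrow> wnorm_le t (A * exp (\<mu> * t)) (a t)"
    have 1: "wnorm_le t (C1 * (C * (1 + A)) * exp (\<mu> * t) * \<mu> powr (- (1/32)) * t powr (1/32)) (duhamel (\<lambda>s. cf (nonlin (M s) (a s))) 0 t)"
    proof (rule C1(2))
      show "continuous_on {0<..<t} (\<lambda>s. cf (nonlin (M s) (a s)) k)" for k
        by (intro continuous_intros continuous_on_subset[OF cf_nonlin_continuous] a) auto
      fix s' K assume s': "0 < s'" "s' < t"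
      then have sT: "0 < s'" "s' \<le> T" using t by auto
      have "C * (1 + A * exp (\<mu> * s')) \<le> C * ((1 + A) * exp (\<mu> * s'))"
        using mu s' A C by (intro mult_left_mono) (auto simp: distrib_right)
      then have 2: "C * (1 + A * exp (\<mu> * s')) * s' powr (- (15/16)) \<le> C * ((1 + A) * exp (\<mu> * s')) * s' powr (- (15/16))"
        by (rule mult_right_mono) simp
      have "(\<Sum>k<K. (cf (nonlin (M s') (a s')) k)\<^sup>2) \<le> (L2norm (nonlin (M s') (a s')))\<^sup>2"
        by (rule cf_nonlin_bound[OF s[OF sT]])
      also have "\<dots> \<le> (C * ((1 + A) * exp (\<mu> * s')) * s' powr (- (15/16)))\<^sup>2"
        using C(2)[OF sT s[OF sT]] 2 by (intro power_mono) auto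
      finally show "(\<Sum>k<K. (cf (nonlin (M s') (a s')) k)\<^sup>2) \<le> (C * (1 + A) * exp (\<mu> * s') * s' powr (- (15/16)))\<^sup>2" by (simp add: mult.assoc)
    qed (use t mu C A in auto)
    have le: "C1 * (C * (1 + A)) * exp (\<mu> * t) * \<mu> powr (- (1/32)) * t powr (1/32) \<le> exp (\<mu> * t)"
    proof -
      have "C1 * (C * (1 + A)) * t powr (1/32) * \<mu> powr (- (1/32)) \<le> C1 * (C * (1 + A)) * T powr (1/32) * \<mu> powr (- (1/32))"
        using t C C1 A by (intro mult_right_mono mult_left_mono powr_mono2) auto
      with mu(2) have "C1 * (C * (1 + A)) * t powr (1/32) * \<mu> powr (- (1/32)) \<le> 1" by linarith
      then have "(C1 * (C * (1 + A)) * t powr (1/32) * \<mu> powr (- (1/32))) * exp (\<mu> * t) \<le> 1 * exp (\<mu> * t)"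
        by (intro mult_right_mono) auto
      then show ?thesis by (simp add: mult_ac)
    qed
    have "wnorm_le t (C0 * L2norm u) (\<lambda>k. exp (- (om k)\<^sup>2 * t) * cf u k)"
      by (rule C0(2)[OF t(1) _ Bessel[OF u_L2]]) simp
    from wnorm_le_add[OF this wnorm_le_mono[OF 1 le]] have 3: "wnorm_le t (C0 * L2norm u + exp (\<mu> * t)) (Phi a t)"
      unfolding Phi_def[abs_def] .
    have "C0 * L2norm u * 1 \<le> C0 * L2norm u * exp (\<mu> * t)" using C0(1) mu t by (intro mult_left_mono) auto
    then have "C0 * L2norm u + exp (\<mu> * t) \<le> A * exp (\<mu> * t)" by (simp add: A_def distrib_right)
    with 3 show "wnorm_le t (A * exp (\<mu> * t)) (Phi a t)" by (rule wnorm_le_mono)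
  qed
qed

end

section \<open>Picard iteration\<close>

context truncated
begin

definition picard :: "nat \<Rightarrow> real \<Rightarrow> nat \<Rightarrow> real" where
  "picard n = (Phi ^^ n) (\<lambda>_ _. 0)"

lemma picard_0: "picard 0 = (\<lambda>_ _. 0)" and picard_Suc: "picard (Suc n) = Phi (picard n)"
  by (simp_all add: picard_def)

text \<open>The two claims need each other: the bound for the next iterate requires admissibility of
  the present one, and admissibility requires a bound up to every \<open>T\<close>. Invariance of
  the ball enters the second claim as a premise, so that it can be used with the constants belonging
  to each \<open>T\<close>.\<close>

lemma admissible_picard: "admissible (picard n)"
  and picard_bound: "\<lbrakk>0 \<le> A; 0 < \<mu>; 0 < T; \<And>a. admissible a \<Longrightarrow> (\<And>t. 0 < t \<Longrightarrow> t \<le> T \<Longrightarrow> wnorm_le t (A * exp (\<mu> * t)) (a t)) \<Longrightarrow>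
      (\<And>t. 0 < t \<Longrightarrow> t \<le> T \<Longrightarrow> wnorm_le t (A * exp (\<mu> * t)) (Phi a t)); 0 < t; t \<le> T\<rbrakk> \<Longrightarrow> wnorm_le t (A * exp (\<mu> * t)) (picard n t)"
proof (induction n arbitrary: A \<mu> T t)
  case 0
  {
    case 1
    show ?case unfolding picard_0 admissible_def using wnorm_le_0 by (auto intro!: exI[of _ 0])
  next
    case (2 A \<mu> T t)
    show ?case unfolding picard_0 by (rule wnorm_le_mono[OF wnorm_le_0]) (use 2 in auto)
  }
next
  case (Suc n)
  {
    case 1
    have "\<exists>B. \<forall>t. 0 < t \<longrightarrow> t \<le> T \<longrightarrow> wnorm_le t B (picard (Suc n) t)" if T: "0 < T" for T
    proof -
      obtain A \<mu> :: real where A: "0 < \<mu>" "0 \<le> A" and *: "\<And>a t. admissible a \<Longrightarrow> (\<And>t. 0 < t \<Longrightarrow> t \<le> T \<Longrightarrow> wnorm_le t (A * exp (\<mu> * t)) (a t)) \<Longrightarrow>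
        0 < t \<Longrightarrow> t \<le> T \<Longrightarrow> wnorm_le t (A * exp (\<mu> * t)) (Phi a t)" by (rule Phi_bound_wnorm_le[OF T]) (rule that; blast)
      have "wnorm_le t (A * exp (\<mu> * t)) (picard (Suc n) t)" if "0 < t" "t \<le> T" for t
        unfolding picard_Suc by (rule *[OF Suc(1) Suc(2)[OF A(2,1) T *] that])
      moreover have "A * exp (\<mu> * t) \<le> A * exp (\<mu> * T)" if "0 < t" "t \<le> T" for t
        using A that by (intro mult_left_mono) auto
      ultimately show ?thesis by (meson wnorm_le_mono)
    qed
    then show ?case unfolding admissible_def using Phi_continuous[OF Suc(1)] by (auto simp: picard_Suc)
  next
    case (2 A \<mu> T t)
    show ?case unfolding picard_Suc
      by (rule 2(4)[OF Suc(1) Suc(2)[OF 2(1-4)] 2(5,6)])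
  }
qed

lemma picard_bounded:
  assumes T: "0 < T"
  obtains B where "0 \<le> B" "\<And>n t. 0 < t \<Longrightarrow> t \<le> T \<Longrightarrow> wnorm_le t B (picard n t)"
proof -
  obtain A \<mu> :: real where A: "0 < \<mu>" "0 \<le> A" and *: "\<And>a t. admissible a \<Longrightarrow> (\<And>t. 0 < t \<Longrightarrow> t \<le> T \<Longrightarrow> wnorm_le t (A * exp (\<mu> * t)) (a t)) \<Longrightarrow>
    0 < t \<Longrightarrow> t \<le> T \<Longrightarrow> wnorm_le t (A * exp (\<mu> * t)) (Phi a t)" by (rule Phi_bound_wnorm_le[OF T]) (rule that; blast)
  have "wnorm_le t (A * exp (\<mu> * T)) (picard n t)" if "0 < t" "t \<le> T" for n t
    by (rule wnorm_le_mono[OF picard_bound[OF A(2,1) T * that]]) (use A that in \<open>auto intro!: mult_left_mono\<close>)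
  then show thesis using A by (intro that[of "A * exp (\<mu> * T)"]) auto
qed

lemma picard_contract:
  assumes T: "0 < T"
  obtains \<mu> d where "0 < \<mu>" "0 \<le> d" "\<And>n t. 0 < t \<Longrightarrow> t \<le> T \<Longrightarrow> wnorm_le t (d * (1/2)^n * exp (\<mu> * t)) (\<lambda>k. picard (Suc n) t k - picard n t k)"
proof -
  obtain B where B: "0 \<le> B" "\<And>n t. 0 < t \<Longrightarrow> t \<le> T \<Longrightarrow> wnorm_le t B (picard n t)" using picard_bounded[OF T] by blast
  obtain \<mu> :: real where mu: "0 < \<mu>" and *: "\<And>a b d t. admissible a \<Longrightarrow> admissible b \<Longrightarrow> 0 \<le> d \<Longrightarrow>
      (\<And>t. 0 < t \<Longrightarrow> t \<le> T \<Longrightarrow> wnorm_le t B (a t) \<and> wnorm_le t B (b t) \<and> wnorm_le t (d * exp (\<mu> * t)) (\<lambda>k. a t k - b t k)) \<Longrightarrow>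
      0 < t \<Longrightarrow> t \<le> T \<Longrightarrow> wnorm_le t (d / 2 * exp (\<mu> * t)) (\<lambda>k. Phi a t k - Phi b t k)"
    by (rule Phi_diff_wnorm_le[OF T B(1)]) (rule that; blast)
  have "wnorm_le t (B * (1/2)^n * exp (\<mu> * t)) (\<lambda>k. picard (Suc n) t k - picard n t k)" if "0 < t" "t \<le> T" for n t
    using that
  proof (induction n arbitrary: t)
    case 0
    \<comment> \<open>Iteration starts at zero, so the first difference is the first iterate itself
      and the uniform bound \<open>B\<close> serves as initial distance.\<close>
    have "B \<le> B * exp (\<mu> * t)" using B(1) mu 0 by (simp add: mult_le_cancel_left1)
    then show ?case using wnorm_le_mono[OF B(2)[OF 0, of "Suc 0"]] by (simp add: picard_0)
  next
    case (Suc n)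
    have "wnorm_le t (B * (1/2)^n / 2 * exp (\<mu> * t)) (\<lambda>k. Phi (picard (Suc n)) t k - Phi (picard n) t k)"
      by (rule *[OF admissible_picard admissible_picard]) (use Suc B in auto)
    then show ?case by (simp add: picard_Suc)
  qed
  then show thesis using mu B(1) that[of \<mu> B] by blast
qed

definition sol :: "real \<Rightarrow> nat \<Rightarrow> real" where "sol t k = lim (\<lambda>n. picard n t k)"

lemma picard_tendsto_sol:
  assumes T: "0 < T"
  obtains \<mu> d where "0 < \<mu>" "0 \<le> d" "\<And>n t k. 0 < t \<Longrightarrow> t \<le> T \<Longrightarrow> (\<lambda>n. picard n t k) \<longlonglongrightarrow> sol t k"
     "\<And>n t. 0 < t \<Longrightarrow> t \<le> T \<Longrightarrow> wnorm_le t (d * (1/2)^n * exp (\<mu> * t)) (\<lambda>k. sol t k - picard n t k)"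
proof -
  obtain \<mu> d where mu: "0 < \<mu>" "0 \<le> d" and c: "\<And>n t. 0 < t \<Longrightarrow> t \<le> T \<Longrightarrow> wnorm_le t (d * (1/2)^n * exp (\<mu> * t)) (\<lambda>k. picard (Suc n) t k - picard n t k)"
    using picard_contract[OF T] by blast
  \<comment> \<open>Summing the geometric series in closed form keeps the induction exact: the block
    from \<open>n\<close> to \<open>n + m\<close> contributes twice the difference of the two
    powers.\<close>
  have dist: "wnorm_le t (2 * d * exp (\<mu> * t) * ((1/2)^n - (1/2)^(n+m))) (\<lambda>k. picard (n + m) t k - picard n t k)" if t: "0 < t" "t \<le> T" for n m t
  proof (induction m)
    case 0
    show ?case by (simp add: wnorm_le_0)
  next
    case (Suc m)
    have "2 * d * exp (\<mu> * t) * ((1/2)^n - (1/2)^(n+m)) + d * (1/2)^(n+m) * exp (\<mu> * t)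
        = 2 * d * exp (\<mu> * t) * ((1/2)^n - (1/2)^(n + Suc m))" by (simp add: algebra_simps)
    with wnorm_le_add[OF Suc c[OF t, of "n + m"]] show ?case by simp
  qed
  have lim: "(\<lambda>n. picard n t k) \<longlonglongrightarrow> sol t k" if t: "0 < t" "t \<le> T" for t k
  proof -
    have "norm (picard (n + m) t k - picard n t k) \<le> 2 * d * exp (\<mu> * t) * (1/2)^n" for n m
    proof -
      have "norm (picard (n + m) t k - picard n t k) \<le> 2 * d * exp (\<mu> * t) * ((1/2)^n - (1/2)^(n+m))"
        using wnorm_le_abs_le[OF dist[OF t, of n m], of k] by simp
      also have "\<dots> \<le> 2 * d * exp (\<mu> * t) * (1/2)^n" using mu by (intro mult_left_mono) auto
      finally show ?thesis .
    qed
    note le = this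
    have "Cauchy (\<lambda>n. picard n t k)"
    proof (rule CauchyI')
      fix e :: real assume e: "e > 0"
      have "(\<lambda>n. 2 * d * exp (\<mu> * t) * (1/2)^n) \<longlonglongrightarrow> 2 * d * exp (\<mu> * t) * 0"
        by (intro tendsto_intros LIMSEQ_realpow_zero) auto
      then have "\<forall>\<^sub>F n in sequentially. 2 * d * exp (\<mu> * t) * (1/2)^n < e" using e by (intro order_tendstoD) auto
      then obtain N where N: "\<And>n. n \<ge> N \<Longrightarrow> 2 * d * exp (\<mu> * t) * (1/2)^n < e" by (auto simp: eventually_sequentially)
      have "dist (picard m t k) (picard n t k) < e" if "m \<ge> N" "n > m" for m n
        using le[of m "n - m"] N[OF that(1)] that(2) by (simp add: dist_real_def abs_minus_commute)
      then show "\<exists>M. \<forall>m\<ge>M. \<forall>n>m. dist (picard m t k) (picard n t k) < e" by blast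
    qed
    then show ?thesis unfolding sol_def by (simp add: Cauchy_convergent_iff convergent_LIMSEQ_iff)
  qed
  have "wnorm_le t (2 * d * (1/2)^n * exp (\<mu> * t)) (\<lambda>k. sol t k - picard n t k)" if t: "0 < t" "t \<le> T" for n t
  proof (rule wnorm_le_limit[OF dist[OF t, of n]])
    show "(\<lambda>m. picard (n + m) t k - picard n t k) \<longlonglongrightarrow> sol t k - picard n t k" for k
      using LIMSEQ_ignore_initial_segment[OF lim[OF t, of k], of n] by (intro tendsto_intros) (simp add: add.commute)
    have "(\<lambda>m. (1/2::real)^(n+m)) \<longlonglongrightarrow> 0"
      using LIMSEQ_ignore_initial_segment[OF LIMSEQ_realpow_zero[of "1/2::real"], of n] by (simp add: add.commute)
    then have "(\<lambda>m. 2 * d * exp (\<mu> * t) * ((1/2)^n - (1/2)^(n+m))) \<longlonglongrightarrow> 2 * d * exp (\<mu> * t) * ((1/2)^n - 0)"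
      by (intro tendsto_intros)
    then show "(\<lambda>m. 2 * d * exp (\<mu> * t) * ((1/2)^n - (1/2)^(n+m))) \<longlonglongrightarrow> 2 * d * (1/2)^n * exp (\<mu> * t)"
      by (simp add: mult_ac)
  qed
  then show thesis using mu lim by (intro that[of \<mu> "2 * d"]) auto
qed

lemma admissible_sol: "admissible sol"
  unfolding admissible_def
proof (intro conjI allI impI)
  fix T :: real assume T: "0 < T"
  obtain B where B: "0 \<le> B" "\<And>n t. 0 < t \<Longrightarrow> t \<le> T \<Longrightarrow> wnorm_le t B (picard n t)" using picard_bounded[OF T] by blast
  obtain \<mu> d where lim: "0 < \<mu>" "0 \<le> d" "\<And>n t k. 0 < t \<Longrightarrow> t \<le> T \<Longrightarrow> (\<lambda>n. picard n t k) \<longlonglongrightarrow> sol t k"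
     "\<And>n t. 0 < t \<Longrightarrow> t \<le> T \<Longrightarrow> wnorm_le t (d * (1/2)^n * exp (\<mu> * t)) (\<lambda>k. sol t k - picard n t k)"
    using picard_tendsto_sol[OF T] by blast
  show "\<exists>B. \<forall>t>0. t \<le> T \<longrightarrow> wnorm_le t B (sol t)"
    using wnorm_le_limit[OF B(2) lim(3) tendsto_const] by blast
next
  fix k
  have "isCont (\<lambda>t. sol t k) t" if t: "0 < t" for t
  proof -
    define T where "T = t + 1"
    have T: "0 < T" using t by (simp add: T_def)
    obtain \<mu> d where mu: "0 < \<mu>" "0 \<le> d" and lim: "\<And>n t k. 0 < t \<Longrightarrow> t \<le> T \<Longrightarrow> (\<lambda>n. picard n t k) \<longlonglongrightarrow> sol t k"
      and s: "\<And>n t. 0 < t \<Longrightarrow> t \<le> T \<Longrightarrow> wnorm_le t (d * (1/2)^n * exp (\<mu> * t)) (\<lambda>k. sol t k - picard n t k)"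
      using picard_tendsto_sol[OF T] by blast
    have "uniform_limit {0<..<T} (\<lambda>n t. picard n t k) (\<lambda>t. sol t k) sequentially"
    proof (rule uniform_limitI)
      fix e :: real assume e: "e > 0"
      have "(\<lambda>n. d * exp (\<mu> * T) * (1/2)^n) \<longlonglongrightarrow> d * exp (\<mu> * T) * 0"
        by (intro tendsto_intros LIMSEQ_realpow_zero) auto
      then have "\<forall>\<^sub>F n in sequentially. d * exp (\<mu> * T) * (1/2)^n < e" using e by (intro order_tendstoD) auto
      then show "\<forall>\<^sub>F n in sequentially. \<forall>t\<in>{0<..<T}. dist (picard n t k) (sol t k) < e"
      proof eventually_elim
        case (elim n)
        show ?case
        proof
          fix t assume t: "t \<in> {0<..<T}"
          have "\<bar>sol t k - picard n t k\<bar> \<le> d * (1/2)^n * exp (\<mu> * t)" using wnorm_le_abs_le[OF s[of t n], of k] t by simp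
          also have "\<dots> \<le> d * (1/2)^n * exp (\<mu> * T)" using t mu by (intro mult_left_mono) auto
          also have "\<dots> < e" using elim by (simp add: mult_ac)
          finally show "dist (picard n t k) (sol t k) < e" by (simp add: dist_real_def abs_minus_commute)
        qed
      qed
    qed
    moreover have "continuous_on {0<..<T} (\<lambda>t. picard n t k)" for n
      using admissible_picard[of n] unfolding admissible_def by (auto intro: continuous_on_subset)
    ultimately have "continuous_on {0<..<T} (\<lambda>t. sol t k)"
      by (intro uniform_limit_theorem[of _ "\<lambda>n t. picard n t k"]) auto
    then show ?thesis using t by (simp add: continuous_on_eq_continuous_at T_def)
  qed
  then show "continuous_on {0<..} (\<lambda>t. sol t k)" by (intro continuous_at_imp_continuous_on) auto
qed

lemma sol_fixed: 
  assumes t: "0 < t" shows "sol t k = Phi sol t k"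
proof -
  obtain B1 where B1: "0 \<le> B1" "\<And>n s. 0 < s \<Longrightarrow> s \<le> t \<Longrightarrow> wnorm_le s B1 (picard n s)" using picard_bounded[OF t] by blast
  obtain \<mu>1 d where mu1: "0 < \<mu>1" "0 \<le> d" and lim: "\<And>n s k. 0 < s \<Longrightarrow> s \<le> t \<Longrightarrow> (\<lambda>n. picard n s k) \<longlonglongrightarrow> sol s k"
    and s: "\<And>n s. 0 < s \<Longrightarrow> s \<le> t \<Longrightarrow> wnorm_le s (d * (1/2)^n * exp (\<mu>1 * s)) (\<lambda>k. sol s k - picard n s k)"
    using picard_tendsto_sol[OF t] by blast
  have B2: "wnorm_le s B1 (sol s)" if "0 < s" "s \<le> t" for s using wnorm_le_limit[OF B1(2) lim tendsto_const, OF that that] .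
  obtain \<mu> :: real where mu: "0 < \<mu>" and *: "\<And>a b d s. admissible a \<Longrightarrow> admissible b \<Longrightarrow> 0 \<le> d \<Longrightarrow>
      (\<And>s. 0 < s \<Longrightarrow> s \<le> t \<Longrightarrow> wnorm_le s B1 (a s) \<and> wnorm_le s B1 (b s) \<and> wnorm_le s (d * exp (\<mu> * s)) (\<lambda>k. a s k - b s k)) \<Longrightarrow>
      0 < s \<Longrightarrow> s \<le> t \<Longrightarrow> wnorm_le s (d / 2 * exp (\<mu> * s)) (\<lambda>k. Phi a s k - Phi b s k)"
    by (rule Phi_diff_wnorm_le[OF t B1(1)]) (rule that; blast)
  have "wnorm_le t (d * exp (\<mu>1 * t) * (1/2)^n / 2 * exp (\<mu> * t)) (\<lambda>k. Phi sol t k - Phi (picard n) t k)" for n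
  proof (rule *[OF admissible_sol admissible_picard])
    fix s' assume s': "0 < s'" "s' \<le> t"
    \<comment> \<open>Two exponential weights occur: \<open>\<mu>1\<close> from the convergence of
      the iterates and \<open>\<mu>\<close> from the contraction. The first is frozen at the final
      time \<open>t\<close> and becomes part of the constant.\<close>
    have "d * (1/2)^n * exp (\<mu>1 * s') \<le> d * (1/2)^n * exp (\<mu>1 * t)" using s' mu1 by (intro mult_left_mono) auto
    also have "\<dots> * 1 \<le> d * (1/2)^n * exp (\<mu>1 * t) * exp (\<mu> * s')" using s' mu mu1 by (intro mult_left_mono) auto
    finally have "d * (1/2)^n * exp (\<mu>1 * s') \<le> d * exp (\<mu>1 * t) * (1/2)^n * exp (\<mu> * s')" by (simp add: mult_ac)
    then show "wnorm_le s' B1 (sol s') \<and> wnorm_le s' B1 (picard n s') \<and> wnorm_le s' (d * exp (\<mu>1 * t) * (1/2)^n * exp (\<mu> * s')) (\<lambda>k. sol s' k - picard n s' k)"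
      using B2[OF s'] B1(2)[OF s'] wnorm_le_mono[OF s[OF s']] by blast
  qed (use t mu1 in auto)
  then have "\<bar>Phi sol t k - picard (Suc n) t k\<bar> \<le> d * exp (\<mu>1 * t) * (1/2)^n / 2 * exp (\<mu> * t)" for n
    unfolding picard_Suc by (rule wnorm_le_abs_le)
  then have le: "norm (picard (Suc n) t k - Phi sol t k) \<le> d * exp (\<mu>1 * t) / 2 * exp (\<mu> * t) * (1/2)^n" for n
    by (simp add: abs_minus_commute mult_ac)
  have "(\<lambda>n. d * exp (\<mu>1 * t) / 2 * exp (\<mu> * t) * (1/2)^n) \<longlonglongrightarrow> d * exp (\<mu>1 * t) / 2 * exp (\<mu> * t) * 0"
    by (intro tendsto_intros LIMSEQ_realpow_zero) auto
  then have "(\<lambda>n. picard (Suc n) t k - Phi sol t k) \<longlonglongrightarrow> 0"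
    by (intro Lim_null_comparison[OF always_eventually[OF allI[OF le]]]) simp
  then have "(\<lambda>n. picard (Suc n) t k) \<longlonglongrightarrow> Phi sol t k" by (rule LIM_zero_cancel)
  moreover have "(\<lambda>n. picard (Suc n) t k) \<longlonglongrightarrow> sol t k" using lim[OF t order_refl] by (rule LIMSEQ_Suc)
  ultimately show ?thesis using LIMSEQ_unique by blast
qed

end

section \<open>The energy estimate\<close>

text \<open>Finitely many modes converge by continuity, and the tail is at most the tail of the
  series of squared coefficients because
  \<open>\<bar>exp (- (om k)\<^sup>2 * s) - 1\<bar> \<le> 1\<close>. Uniformity in \<open>J\<close>
  is what turns this into a statement about norms.\<close>

lemma semigroup_initial:
  assumes u: "u \<in> L2" and e: "0 < e"
  shows "\<forall>\<^sub>F s in at_right 0. \<forall>J. (\<Sum>k<J. ((exp (- (om k)\<^sup>2 * s) - 1) * cf u k)\<^sup>2) \<le> e\<^sup>2"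
proof -
  have "(\<lambda>K. (L2norm u)\<^sup>2 - (\<Sum>k<K. (cf u k)\<^sup>2)) \<longlonglongrightarrow> (L2norm u)\<^sup>2 - (L2norm u)\<^sup>2"
    using Parseval[OF u] unfolding sums_def by (intro tendsto_intros)
  then have "\<forall>\<^sub>F K in sequentially. (L2norm u)\<^sup>2 - (\<Sum>k<K. (cf u k)\<^sup>2) < e\<^sup>2 / 2"
    using e by (intro order_tendstoD) auto
  then obtain K where K: "(L2norm u)\<^sup>2 - (\<Sum>k<K. (cf u k)\<^sup>2) < e\<^sup>2 / 2"
    by (auto simp: eventually_sequentially)
  have "((\<lambda>s. \<Sum>k<K. ((exp (- (om k)\<^sup>2 * s) - 1) * cf u k)\<^sup>2) \<longlongrightarrow> (\<Sum>k<K. ((exp (- (om k)\<^sup>2 * 0) - 1) * cf u k)\<^sup>2)) (at_right 0)"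
    by (intro tendsto_intros)
  then have "\<forall>\<^sub>F s in at_right 0. (\<Sum>k<K. ((exp (- (om k)\<^sup>2 * s) - 1) * cf u k)\<^sup>2) < e\<^sup>2 / 2"
    using e by (intro order_tendstoD) auto
  moreover have "\<forall>\<^sub>F s::real in at_right 0. 0 < s" by (rule eventually_at_right_less)
  ultimately show ?thesis
  proof eventually_elim
    case (elim s)
    have c: "((exp (- (om k)\<^sup>2 * s) - 1) * cf u k)\<^sup>2 \<le> (cf u k)\<^sup>2" for k
    proof -
      have "\<bar>exp (- (om k)\<^sup>2 * s) - 1\<bar> \<le> 1" using elim by auto
      then have "(exp (- (om k)\<^sup>2 * s) - 1)\<^sup>2 \<le> 1" by (simp add: abs_square_le_1)
      then show ?thesis unfolding power_mult_distrib by (intro mult_left_le_one_le) auto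
    qed
    show ?case
    proof
      fix J
      have "(\<Sum>k<J. ((exp (- (om k)\<^sup>2 * s) - 1) * cf u k)\<^sup>2) \<le> (\<Sum>k<K + J. ((exp (- (om k)\<^sup>2 * s) - 1) * cf u k)\<^sup>2)"
        by (rule sum_mono2) auto
      also have "\<dots> = (\<Sum>k<K. ((exp (- (om k)\<^sup>2 * s) - 1) * cf u k)\<^sup>2) + (\<Sum>k\<in>{K..<K+J}. ((exp (- (om k)\<^sup>2 * s) - 1) * cf u k)\<^sup>2)"
        unfolding lessThan_atLeast0 by (rule sum.atLeastLessThan_concat[symmetric]) auto
      also have "(\<Sum>k\<in>{K..<K+J}. ((exp (- (om k)\<^sup>2 * s) - 1) * cf u k)\<^sup>2) \<le> (\<Sum>k\<in>{K..<K+J}. (cf u k)\<^sup>2)"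
        by (rule sum_mono) (rule c)
      also have "\<dots> = (\<Sum>k<K+J. (cf u k)\<^sup>2) - (\<Sum>k<K. (cf u k)\<^sup>2)"
        unfolding lessThan_atLeast0 using sum.atLeastLessThan_concat[of 0 K "K + J" "\<lambda>k. (cf u k)\<^sup>2"] by simp
      also have "\<dots> \<le> e\<^sup>2 / 2" using Bessel[OF u, of "K + J"] K by linarith
      finally show "(\<Sum>k<J. ((exp (- (om k)\<^sup>2 * s) - 1) * cf u k)\<^sup>2) \<le> e\<^sup>2" using elim by linarith
    qed
  qed
qed

lemma L2_set_add_le:
  assumes "(\<Sum>k<K. (v k)\<^sup>2) \<le> A\<^sup>2" "(\<Sum>k<K. (w k)\<^sup>2) \<le> B\<^sup>2" "0 \<le> A" "0 \<le> B"
  shows "(\<Sum>k<(K::nat). (v k + w k :: real)\<^sup>2) \<le> (A + B)\<^sup>2"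
proof -
  have "L2_set v {..<K} \<le> A" "L2_set w {..<K} \<le> B"
    using assms unfolding L2_set_def by (auto intro: real_le_lsqrt sum_nonneg)
  then have "L2_set (\<lambda>k. v k + w k) {..<K} \<le> A + B"
    using L2_set_triangle_ineq[of v w "{..<K}"] by linarith
  then have "(L2_set (\<lambda>k. v k + w k) {..<K})\<^sup>2 \<le> (A + B)\<^sup>2" by (intro power_mono) auto
  then show ?thesis by (simp add: L2_set_def sum_nonneg)
qed

text \<open>The integrand is the derivative of \<open>G (ser v x)\<close> for an antiderivative
  \<open>G\<close> of \<open>g\<close>, and the series vanishes at both end points.\<close>

lemma flux_zero:
  assumes wnorm_le: "wnorm_le t A v" and g: "continuous_on UNIV g"
  shows "(LINT x:{0..1}|lborel. g (ser v x) * serx v x) = 0"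
proof -
  \<comment> \<open>The \<open>+ 1\<close> keeps the values of the series in the open interval,
    where the antiderivative built on \<open>{-B..B}\<close> has a two-sided derivative.\<close>
  define B where "B = 2 * (A * t powr (- (15/16))) + 1"
  have y: "ser v x \<in> {-B<..<B}" for x using ser_le[OF wnorm_le, of x] by (auto simp: B_def abs_le_iff)
  obtain G where G: "\<And>x. x \<in> {-B..B} \<Longrightarrow> (G has_vector_derivative g x) (at x within {-B..B})"
    using antiderivative_continuous[of "-B" B g] continuous_on_subset[OF g] by auto
  have G': "(G has_real_derivative g x) (at x)" if "x \<in> {-B<..<B}" for x
    using G[of x] that at_within_interior[of x "{-B..B}"] by (simp add: has_real_derivative_iff_has_vector_derivative)
  have "(LINT x:{0..1}|lborel. g (ser v x) * serx v x) = G (ser v 1) - G (ser v 0)"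
  proof (rule LINT_FTC_01)
    show "((\<lambda>x. G (ser v x)) has_real_derivative g (ser v x) * serx v x) (at x within {0..1})" for x
      using DERIV_chain2[OF G'[OF y] has_field_derivative_at_within[OF ser_deriv[OF wnorm_le]]] .
    show "continuous_on {0..1} (\<lambda>x. g (ser v x) * serx v x)"
      by (intro continuous_intros continuous_on_compose2[OF g] ser_continuous[OF wnorm_le] serx_continuous[OF wnorm_le]) auto
  qed auto
  then show ?thesis by (simp add: ser_01)
qed

context reaction
begin

text \<open>The flux term is of the form treated by \<open>flux_zero\<close> with
  \<open>g z = z * fp (c * z)\<close>, because the truncation factor \<open>c\<close> is constant in
  \<open>x\<close>. The linear growth of \<open>r\<close> gives the rest; note that \<open>M\<close>
  does not enter the bound.\<close>

lemma energy_flux: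
  assumes wnorm_le: "wnorm_le t A v"
  shows "2 * L2inner (ser v) (nonlin M v) \<le> \<bar>r 0\<bar>\<^sup>2 + (1 + 2 * L) * (L2norm (ser v))\<^sup>2"
proof -
  note c = ser_continuous[OF wnorm_le] serx_continuous[OF wnorm_le]
  have "L2inner (ser v) (nonlin M v) = L2inner (ser v) (\<lambda>x. r (ser v x)) - L2inner (ser v) (\<lambda>x. fp (trunc M v * ser v x) * serx v x)"
    unfolding nonlin_def by (intro L2inner_diff_right L2_continuous continuous_intros c)
  also have "L2inner (ser v) (\<lambda>x. fp (trunc M v * ser v x) * serx v x) = 0"
    using flux_zero[OF wnorm_le, of "\<lambda>z. z * fp (trunc M v * z)"] unfolding L2inner_def
    by (simp add: mult.assoc continuous_intros)
  finally have "2 * L2inner (ser v) (nonlin M v) \<le> 2 * (L2norm (ser v) * L2norm (\<lambda>x. r (ser v x)))"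
    using L2_Cauchy_Schwarz[of "ser v" "\<lambda>x. r (ser v x)"] c by (force intro: L2_continuous continuous_intros)
  also have "L2norm (\<lambda>x. r (ser v x)) \<le> \<bar>r 0\<bar> + L * L2norm (ser v)"
    using L0 r_le by (intro L2norm_affine_le L2_continuous continuous_intros c) auto
  also have "2 * (L2norm (ser v) * (\<bar>r 0\<bar> + L * L2norm (ser v))) \<le> \<bar>r 0\<bar>\<^sup>2 + (1 + 2 * L) * (L2norm (ser v))\<^sup>2"
    using sum_squares_bound[of "\<bar>r 0\<bar>" "L2norm (ser v)"] by (simp add: algebra_simps power2_eq_square)
  finally show ?thesis by (simp add: mult_left_mono)
qed

end

section \<open>A priori bounds for the truncated solution\<close>

context truncated
begin

lemma sol_deriv:
  assumes t: "0 < t"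
  shows "((\<lambda>t. sol t k) has_real_derivative cf (nonlin (M t) (sol t)) k - (om k)\<^sup>2 * sol t k) (at t)"
proof -
  have "((\<lambda>t. Phi sol t k) has_real_derivative cf (nonlin (M t) (sol t)) k - (om k)\<^sup>2 * sol t k) (at t)"
    using Phi_deriv[OF admissible_sol t, of k] by (simp add: sol_fixed[OF t])
  then show ?thesis
  proof (rule DERIV_cong_ev[THEN iffD1, rotated -1])
    have "\<forall>\<^sub>F s in nhds t. s \<in> {0<..}" using t by (intro eventually_nhds_in_open) auto
    then show "\<forall>\<^sub>F s in nhds t. Phi sol s k = sol s k" by eventually_elim (simp add: sol_fixed)
  qed auto
qed

text \<open>Here the kernel is bounded by 1 only, so integrating \<open>s powr (- (15/16))\<close>
  leaves the positive power 1/16. The Duhamel term thus vanishes initially, and attainment of the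
  datum reduces to the semigroup.\<close>

lemma duhamel_small:
  assumes T: "0 < T"
  obtains C where "0 \<le> C" "\<And>t K. 0 < t \<Longrightarrow> t \<le> T \<Longrightarrow> (\<Sum>k<K. (duhamel (\<lambda>s. cf (nonlin (M s) (sol s))) 0 t k)\<^sup>2) \<le> (C * t powr (1/16))\<^sup>2"
proof -
  obtain C where C: "0 \<le> C" "\<And>t. 0 < t \<Longrightarrow> t \<le> T \<Longrightarrow> L2norm (nonlin (M t) (sol t)) \<le> C * t powr (- (15/16))"
     "\<And>t K. 0 < t \<Longrightarrow> t \<le> T \<Longrightarrow> (\<Sum>k<K. (cf (nonlin (M t) (sol t)) k)\<^sup>2) \<le> (C * t powr (- (15/16)))\<^sup>2"
    by (rule cf_nonlin_time[OF admissible_sol T]) (rule that)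
  have "(\<Sum>k<K. (duhamel (\<lambda>s. cf (nonlin (M s) (sol s))) 0 t k)\<^sup>2) \<le> (C * beta_int 0 (15/16) * (t - 0) powr (1 - 0 - 15/16))\<^sup>2" if t: "0 < t" "t \<le> T" for t K
    unfolding duhamel_def
  proof (rule Beta_Minkowski(2))
    show "continuous_on {0<..<t} (\<lambda>s. exp (- (om k)\<^sup>2 * (t - s)) * cf (nonlin (M s) (sol s)) k)" for k
      by (intro continuous_intros continuous_on_subset[OF cf_nonlin_continuous[OF admissible_sol]]) auto
    fix s K assume s: "0 < s" "s < t"
    have "(exp (- (om k)\<^sup>2 * (t - s)) * cf (nonlin (M s) (sol s)) k)\<^sup>2 \<le> (cf (nonlin (M s) (sol s)) k)\<^sup>2" for k
      using s unfolding power_mult_distrib by (intro mult_left_le_one_le power_le_one) auto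
    then have "(\<Sum>k<K. (exp (- (om k)\<^sup>2 * (t - s)) * cf (nonlin (M s) (sol s)) k)\<^sup>2) \<le> (\<Sum>k<K. (cf (nonlin (M s) (sol s)) k)\<^sup>2)"
      by (rule sum_mono)
    also have "\<dots> \<le> (C * s powr (- (15/16)))\<^sup>2" using C(3)[of s K] s t by simp
    finally show "(\<Sum>k<K. (exp (- (om k)\<^sup>2 * (t - s)) * cf (nonlin (M s) (sol s)) k)\<^sup>2) \<le> (C * (t - s) powr (- 0) * (s - 0) powr (- (15/16)))\<^sup>2"
      using s by simp
  qed (use t C in auto)
  then show thesis using C(1) by (intro that[of "C * beta_int 0 (15/16)"]) auto
qed

lemma sol_initial: "((\<lambda>t. L2norm (\<lambda>x. ser (sol t) x - u x)) \<longlongrightarrow> 0) (at_right 0)"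
proof (rule tendstoI)
  fix e :: real assume e: "0 < e"
  obtain C where C: "0 \<le> C" "\<And>t K. 0 < t \<Longrightarrow> t \<le> 1 \<Longrightarrow> (\<Sum>k<K. (duhamel (\<lambda>s. cf (nonlin (M s) (sol s))) 0 t k)\<^sup>2) \<le> (C * t powr (1/16))\<^sup>2"
    by (rule duhamel_small[of 1]) (auto intro: that)
  have "((\<lambda>t::real. C * t powr (1/16)) \<longlongrightarrow> C * 0 powr (1/16)) (at_right 0)"
    by (intro tendsto_intros tendsto_powr') (auto intro: eventually_mono[OF eventually_at_right_less])
  then have "\<forall>\<^sub>F t in at_right 0. C * t powr (1/16) < e / 3" using e by (intro order_tendstoD) auto
  moreover have "\<forall>\<^sub>F t in at_right 0. \<forall>J. (\<Sum>k<J. ((exp (- (om k)\<^sup>2 * t) - 1) * cf u k)\<^sup>2) \<le> (e/3)\<^sup>2"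
    using e by (intro semigroup_initial u_L2) auto
  moreover have "\<forall>\<^sub>F t::real in at_right 0. 0 < t \<and> t < 1" by (rule eventually_at_rightI[of 0 1]) auto
  ultimately show "\<forall>\<^sub>F t in at_right 0. dist (L2norm (\<lambda>x. ser (sol t) x - u x)) 0 < e"
  proof eventually_elim
    case (elim t)
    then have t: "0 < t" "t \<le> 1" by auto
    obtain B where B: "wnorm_le t B (sol t)" using admissible_bound[OF admissible_sol t(1)] t(1) by blast
    have L: "(\<lambda>x. ser (sol t) x - u x) \<in> L2" by (intro L2_diff ser_L2[OF B] u_L2)
    have "L2norm (\<lambda>x. ser (sol t) x - u x) \<le> e/3 + e/3"
    proof (rule L2norm_le_if_cf_le[OF L])
      fix K
      have "cf (\<lambda>x. ser (sol t) x - u x) k = (exp (- (om k)\<^sup>2 * t) - 1) * cf u k + duhamel (\<lambda>s. cf (nonlin (M s) (sol s))) 0 t k" for k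
        using sol_fixed[OF t(1), of k] by (simp add: cf_diff[OF ser_L2[OF B] u_L2] cf_ser[OF B] Phi_def algebra_simps)
      moreover have "(\<Sum>k<K. (duhamel (\<lambda>s. cf (nonlin (M s) (sol s))) 0 t k)\<^sup>2) \<le> (e/3)\<^sup>2"
        by (rule order_trans[OF C(2)[OF t] power_mono]) (use elim C(1) in auto)
      ultimately show "(\<Sum>k<K. (cf (\<lambda>x. ser (sol t) x - u x) k)\<^sup>2) \<le> (e/3 + e/3)\<^sup>2"
        using elim e by (simp only:) (intro L2_set_add_le; simp)
    qed (use e in auto)
    then show ?case using e by simp
  qed
qed

lemma sol_norm_initial: "((\<lambda>t. L2norm (ser (sol t))) \<longlongrightarrow> L2norm u) (at_right 0)"
proof -
  have "\<forall>\<^sub>F t in at_right 0. norm (L2norm (ser (sol t)) - L2norm u) \<le> L2norm (\<lambda>x. ser (sol t) x - u x)"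
    using eventually_at_right_less[of 0]
  proof eventually_elim
    case (elim t)
    obtain B where "wnorm_le t B (sol t)" using admissible_bound[OF admissible_sol elim] elim by blast
    then show ?case using L2norm_rev_triangle[OF ser_L2 u_L2] by simp
  qed
  from Lim_null_comparison[OF this sol_initial] show ?thesis by (rule LIM_zero_cancel)
qed

lemma psum_ser_uniform:
  assumes T: "0 < T"
  obtains B where "0 \<le> B" "\<And>t. 0 < t \<Longrightarrow> t \<le> T \<Longrightarrow> wnorm_le t B (sol t)"
    "\<And>t K. 0 < t \<Longrightarrow> t \<le> T \<Longrightarrow> L2norm (\<lambda>x. psum (sol t) K x - ser (sol t) x) \<le> B * t powr (- (15/16)) * om K powr (- (5/4))"
proof -
  obtain B where B: "0 \<le> B" "\<And>t. 0 < t \<Longrightarrow> t \<le> T \<Longrightarrow> wnorm_le t B (sol t)" using admissible_bound[OF admissible_sol T] by blast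
  have "L2norm (\<lambda>x. psum (sol t) K x - ser (sol t) x) \<le> 2 * B * t powr (- (15/16)) * om K powr (- (5/4))" if t: "0 < t" "t \<le> T" for t K
  proof (rule L2norm_le_const)
    fix x :: real
    show "\<bar>psum (sol t) K x - ser (sol t) x\<bar> \<le> 2 * B * t powr (- (15/16)) * om K powr (- (5/4))"
      using weighted_series(2)[OF _ wnorm_le_weights(1)[OF B(2)[OF t]], of "\<lambda>k. es k x" K] es_le
      by (simp add: ser_def psum_def abs_minus_commute mult.assoc)
  qed (use B t in \<open>auto intro!: L2_diff ser_L2\<close>)
  moreover have "wnorm_le t (2 * B) (sol t)" if "0 < t" "t \<le> T" for t using wnorm_le_mono[OF B(2)[OF that]] B(1) by simp
  ultimately show thesis using B(1) by (intro that[of "2 * B"]) auto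
qed

text \<open>The partial sums of the energy satisfy the energy inequality up to an error that is uniform
  on compact time intervals.\<close>

lemma energy_partial_deriv:
  assumes s: "0 < s" "s < T" and e: "0 < e"
  shows "\<forall>\<^sub>F K in sequentially. \<forall>t\<in>{s..T}. \<exists>D. ((\<lambda>t. \<Sum>k<K. (sol t k)\<^sup>2) has_real_derivative D) (at t) \<and>
     D + 2 * (\<Sum>k<K. (om k * sol t k)\<^sup>2) \<le> \<bar>r 0\<bar>\<^sup>2 + (1 + 2 * L) * (L2norm (ser (sol t)))\<^sup>2 + e"
proof -
  have T: "0 < T" using s by simp
  obtain B where B: "0 \<le> B" "\<And>t. 0 < t \<Longrightarrow> t \<le> T \<Longrightarrow> wnorm_le t B (sol t)"
    "\<And>t K. 0 < t \<Longrightarrow> t \<le> T \<Longrightarrow> L2norm (\<lambda>x. psum (sol t) K x - ser (sol t) x) \<le> B * t powr (- (15/16)) * om K powr (- (5/4))"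
    by (rule psum_ser_uniform[OF T]) (rule that)
  obtain C where C: "0 \<le> C" "\<And>t. 0 < t \<Longrightarrow> t \<le> T \<Longrightarrow> L2norm (nonlin (M t) (sol t)) \<le> C * t powr (- (15/16))"
     "\<And>t K. 0 < t \<Longrightarrow> t \<le> T \<Longrightarrow> (\<Sum>k<K. (cf (nonlin (M t) (sol t)) k)\<^sup>2) \<le> (C * t powr (- (15/16)))\<^sup>2"
    by (rule cf_nonlin_time[OF admissible_sol T]) (rule that)
  define \<tau> where "\<tau> = s powr (- (15/16))"
  have "(\<lambda>K. 2 * ((B * \<tau> * om K powr (- (5/4))) * (C * \<tau>))) \<longlonglongrightarrow> 2 * ((B * \<tau> * 0) * (C * \<tau>))"
    by (intro tendsto_intros om_powr_neg_tendsto) auto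
  then have "\<forall>\<^sub>F K in sequentially. 2 * ((B * \<tau> * om K powr (- (5/4))) * (C * \<tau>)) < e"
    using e by (intro order_tendstoD) auto
  then show ?thesis
  proof eventually_elim
    case (elim K)
    show ?case
    proof
      fix t assume "t \<in> {s..T}"
      then have t: "0 < t" "t \<le> T" "s \<le> t" using s by auto
      let ?a = "sol t" and ?N = "nonlin (M t) (sol t)"
      have NL: "?N \<in> L2" by (rule L2_continuous[OF nonlin_continuous[OF B(2)[OF t(1,2)]]])
      have yL: "ser ?a \<in> L2" by (rule ser_L2[OF B(2)[OF t(1,2)]])
      have \<tau>: "t powr (- (15/16)) \<le> \<tau>" unfolding \<tau>_def using s t by (intro powr_mono2') auto
      have d: "((\<lambda>t. \<Sum>k<K. (sol t k)\<^sup>2) has_real_derivative (\<Sum>k<K. 2 * (sol t k * (cf ?N k - (om k)\<^sup>2 * sol t k)))) (at t)"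
      proof (rule DERIV_sum)
        show "((\<lambda>t. (sol t k)\<^sup>2) has_real_derivative 2 * (sol t k * (cf ?N k - (om k)\<^sup>2 * sol t k))) (at t)" for k
          by (rule DERIV_cong[OF DERIV_power[where n=2, OF sol_deriv[OF t(1)]]]) simp
      qed
      have "(\<Sum>k<K. 2 * (sol t k * (cf ?N k - (om k)\<^sup>2 * sol t k))) + 2 * (\<Sum>k<K. (om k * sol t k)\<^sup>2) = 2 * (\<Sum>k<K. sol t k * cf ?N k)"
        unfolding sum_distrib_left sum.distrib[symmetric] by (rule sum.cong) (auto simp: algebra_simps power2_eq_square)
      also have "(\<Sum>k<K. sol t k * cf ?N k) = L2inner (psum ?a K) ?N" using NL by (simp add: psum_inner)
      \<comment> \<open>The cancellation of the flux holds for the full series, not for a partial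
        sum tested against the nonlinearity of the full series; the mismatch is small because
        partial sums converge uniformly on the interval.\<close>
      also have "L2inner (psum ?a K) ?N = L2inner (ser ?a) ?N + L2inner (\<lambda>x. psum ?a K x - ser ?a x) ?N"
        using yL NL by (simp add: L2inner_diff_left)
      also have "2 * (L2inner (ser ?a) ?N + L2inner (\<lambda>x. psum ?a K x - ser ?a x) ?N) \<le>
         \<bar>r 0\<bar>\<^sup>2 + (1 + 2 * L) * (L2norm (ser ?a))\<^sup>2 + e"
      proof -
        have "L2inner (\<lambda>x. psum ?a K x - ser ?a x) ?N \<le> L2norm (\<lambda>x. psum ?a K x - ser ?a x) * L2norm ?N"
          using L2_Cauchy_Schwarz[OF L2_diff[OF psum_L2 yL] NL, of ?a K] by linarith
        also have "\<dots> \<le> (B * \<tau> * om K powr (- (5/4))) * (C * \<tau>)"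
        proof (rule mult_mono)
          show "L2norm (\<lambda>x. psum ?a K x - ser ?a x) \<le> B * \<tau> * om K powr (- (5/4))"
            by (rule order_trans[OF B(3)[OF t(1,2)]]) (intro mult_right_mono mult_left_mono \<tau> B(1), simp)
          show "L2norm ?N \<le> C * \<tau>"
            by (rule order_trans[OF C(2)[OF t(1,2)]]) (intro mult_left_mono \<tau> C(1))
        qed (use B C in \<open>auto simp: \<tau>_def\<close>)
        finally have "2 * L2inner (\<lambda>x. psum ?a K x - ser ?a x) ?N \<le> 2 * ((B * \<tau> * om K powr (- (5/4))) * (C * \<tau>))"
          by (rule mult_left_mono) simp
        also note elim
        finally have "2 * L2inner (\<lambda>x. psum ?a K x - ser ?a x) ?N < e" .
        then show ?thesis unfolding distrib_left[of 2]
          by (rule add_mono[OF energy_flux[OF B(2)[OF t(1,2)]] less_imp_le])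
      qed
      finally show "\<exists>D. ((\<lambda>t. \<Sum>k<K. (sol t k)\<^sup>2) has_real_derivative D) (at t) \<and>
        D + 2 * (\<Sum>k<K. (om k * sol t k)\<^sup>2) \<le> \<bar>r 0\<bar>\<^sup>2 + (1 + 2 * L) * (L2norm (ser (sol t)))\<^sup>2 + e"
        using d by blast
    qed
  qed
qed

lemma energy_psum_tendsto:
  assumes "0 < t" shows "(\<lambda>K. \<Sum>k<K. (sol t k)\<^sup>2) \<longlonglongrightarrow> (L2norm (ser (sol t)))\<^sup>2"
proof -
  obtain B where "wnorm_le t B (sol t)" using admissible_bound[OF admissible_sol assms] assms by blast
  then show ?thesis using ser_norm_sums unfolding sums_def by blast
qed

lemma energy_psum_le:
  assumes "0 < t" shows "(\<Sum>k<K. (sol t k)\<^sup>2) \<le> (L2norm (ser (sol t)))\<^sup>2"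
proof -
  obtain B where B: "wnorm_le t B (sol t)" using admissible_bound[OF admissible_sol assms] assms by blast
  show ?thesis using Bessel[OF ser_L2[OF B], of K] by (simp add: cf_ser[OF B])
qed

text \<open>Allows the full norm on the right of the energy inequality to be replaced by the partial
  sum, so that the Gronwall argument can be run on a differentiable finite sum.\<close>

lemma energy_psum_uniform:
  assumes s: "0 < s" "s < T" and e: "0 < e"
  shows "\<forall>\<^sub>F K in sequentially. \<forall>t\<in>{s..T}. (L2norm (ser (sol t)))\<^sup>2 \<le> (\<Sum>k<K. (sol t k)\<^sup>2) + e"
proof -
  have T: "0 < T" using s by simp
  obtain B where B: "0 \<le> B" "\<And>t. 0 < t \<Longrightarrow> t \<le> T \<Longrightarrow> wnorm_le t B (sol t)"
    "\<And>t K. 0 < t \<Longrightarrow> t \<le> T \<Longrightarrow> L2norm (\<lambda>x. psum (sol t) K x - ser (sol t) x) \<le> B * t powr (- (15/16)) * om K powr (- (5/4))"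
    by (rule psum_ser_uniform[OF T]) (rule that)
  define \<tau> where "\<tau> = s powr (- (15/16))"
  have "(\<lambda>K. (B * \<tau> * om K powr (- (5/4)))\<^sup>2) \<longlonglongrightarrow> (B * \<tau> * 0)\<^sup>2"
    by (intro tendsto_intros om_powr_neg_tendsto) auto
  then have "\<forall>\<^sub>F K in sequentially. (B * \<tau> * om K powr (- (5/4)))\<^sup>2 < e"
    using e by (intro order_tendstoD) auto
  then show ?thesis
  proof eventually_elim
    case (elim K)
    show ?case
    proof
      fix t assume "t \<in> {s..T}"
      then have t: "0 < t" "t \<le> T" "s \<le> t" using s by auto
      have yL: "ser (sol t) \<in> L2" and c: "cf (ser (sol t)) = sol t" using ser_L2[OF B(2)[OF t(1,2)]] cf_ser[OF B(2)[OF t(1,2)]] by auto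
      have \<tau>: "t powr (- (15/16)) \<le> \<tau>" unfolding \<tau>_def using s t by (intro powr_mono2') auto
      have "L2norm (\<lambda>x. psum (sol t) K x - ser (sol t) x) \<le> B * \<tau> * om K powr (- (5/4))"
        by (rule order_trans[OF B(3)[OF t(1,2)]]) (intro mult_right_mono mult_left_mono \<tau> B(1), simp)
      then have "(L2norm (\<lambda>x. ser (sol t) x - psum (sol t) K x))\<^sup>2 \<le> (B * \<tau> * om K powr (- (5/4)))\<^sup>2"
        unfolding L2norm_minus_commute[of "psum (sol t) K"] by (intro power_mono) auto
      then show "(L2norm (ser (sol t)))\<^sup>2 \<le> (\<Sum>k<K. (sol t k)\<^sup>2) + e"
        using cf_residual[OF yL, of K] elim unfolding c by linarith
    qed
  qed
qed

text \<open>Gronwall for the partial sums: the mean value theorem is applied to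
  \<open>exp (- b * t)\<close> times the partial energy, the dissipation is dropped because of its
  sign, and \<open>K\<close> tends to infinity at the end.\<close>

lemma energy_bound_between:
  assumes s: "0 < s" "s < t"
  shows "exp (- (1 + 2 * L) * t) * (L2norm (ser (sol t)))\<^sup>2 \<le> exp (- (1 + 2 * L) * s) * (L2norm (ser (sol s)))\<^sup>2 + \<bar>r 0\<bar>\<^sup>2 * (t - s)"
proof (rule field_le_epsilon)
  fix e' :: real assume e': "0 < e'"
  define b where "b = 1 + 2 * L"
  have b: "0 < b" using L0 by (simp add: b_def)
  \<comment> \<open>Both approximation errors enter at rate \<open>(1 + b) * e\<close> over a time
    \<open>t - s\<close>; this choice makes their total equal to \<open>e'\<close>.\<close>
  define e where "e = e' / ((1 + b) * (t - s))"
  have e: "0 < e" using e' s b by (simp add: e_def)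
  define E where "E K t = (\<Sum>k<K. (sol t k)\<^sup>2)" for K t
  have "\<forall>\<^sub>F K in sequentially. exp (- b * t) * E K t \<le> exp (- b * s) * E K s + (\<bar>r 0\<bar>\<^sup>2 * (t - s) + e')"
    using energy_partial_deriv[OF s e] energy_psum_uniform[OF s e]
  proof eventually_elim
    case (elim K)
    obtain D where "\<forall>z\<in>{s..t}. ((\<lambda>t. \<Sum>k<K. (sol t k)\<^sup>2) has_real_derivative D z) (at z) \<and>
       D z + 2 * (\<Sum>k<K. (om k * sol z k)\<^sup>2) \<le> \<bar>r 0\<bar>\<^sup>2 + (1 + 2 * L) * (L2norm (ser (sol z)))\<^sup>2 + e"
      using bchoice[OF elim(1)] by blast
    then have D: "\<And>z. z \<in> {s..t} \<Longrightarrow> (E K has_real_derivative D z) (at z)"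
      "\<And>z. z \<in> {s..t} \<Longrightarrow> D z + 2 * (\<Sum>k<K. (om k * sol z k)\<^sup>2) \<le> \<bar>r 0\<bar>\<^sup>2 + b * (L2norm (ser (sol z)))\<^sup>2 + e"
      unfolding E_def[abs_def] b_def by blast+
    have "\<exists>z. s < z \<and> z < t \<and> exp (- b * t) * E K t - exp (- b * s) * E K s = (t - s) * (exp (- b * z) * (D z - b * E K z))"
    proof (rule MVT2)
      fix z assume "s \<le> z" "z \<le> t"
      then show "((\<lambda>z. exp (- b * z) * E K z) has_real_derivative exp (- b * z) * (D z - b * E K z)) (at z)"
        by (auto intro!: derivative_eq_intros D simp: algebra_simps)
    qed (use s in auto)
    then obtain z where z: "s < z" "z < t" and eq: "exp (- b * t) * E K t - exp (- b * s) * E K s = (t - s) * (exp (- b * z) * (D z - b * E K z))" by blast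
    have "0 \<le> (\<Sum>k<K. (om k * sol z k)\<^sup>2)" by (rule sum_nonneg) auto
    then have "D z \<le> \<bar>r 0\<bar>\<^sup>2 + b * (L2norm (ser (sol z)))\<^sup>2 + e" using D(2)[of z] z by auto
    also have "b * (L2norm (ser (sol z)))\<^sup>2 \<le> b * (E K z + e)" using elim(2) z b unfolding E_def by (intro mult_left_mono) auto
    finally have le: "D z - b * E K z \<le> \<bar>r 0\<bar>\<^sup>2 + (1 + b) * e" by (simp add: algebra_simps)
    have ez: "exp (- b * z) \<le> 1" using b z s by simp
    have "exp (- b * z) * (D z - b * E K z) \<le> exp (- b * z) * (\<bar>r 0\<bar>\<^sup>2 + (1 + b) * e)" using le by (intro mult_left_mono) auto
    also have "\<dots> \<le> 1 * (\<bar>r 0\<bar>\<^sup>2 + (1 + b) * e)" using ez e b by (intro mult_right_mono) auto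
    finally have "(t - s) * (exp (- b * z) * (D z - b * E K z)) \<le> (t - s) * (\<bar>r 0\<bar>\<^sup>2 + (1 + b) * e)"
      using s by (intro mult_left_mono) auto
    moreover have "(t - s) * ((1 + b) * e) = e'" using s b by (simp add: e_def)
    ultimately show ?case using eq by (simp add: algebra_simps)
  qed
  then have "exp (- b * t) * (L2norm (ser (sol t)))\<^sup>2 \<le> exp (- b * s) * (L2norm (ser (sol s)))\<^sup>2 + (\<bar>r 0\<bar>\<^sup>2 * (t - s) + e')"
  proof (rule tendsto_le[OF sequentially_bot, rotated 2])
    have "0 < t" using s by simp
    from energy_psum_tendsto[OF this] show "(\<lambda>K. exp (- b * t) * E K t) \<longlonglongrightarrow> exp (- b * t) * (L2norm (ser (sol t)))\<^sup>2"
      unfolding E_def by (rule tendsto_mult_left)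
    show "(\<lambda>K. exp (- b * s) * E K s + (\<bar>r 0\<bar>\<^sup>2 * (t - s) + e')) \<longlonglongrightarrow> exp (- b * s) * (L2norm (ser (sol s)))\<^sup>2 + (\<bar>r 0\<bar>\<^sup>2 * (t - s) + e')"
      unfolding E_def by (intro tendsto_add tendsto_mult_left energy_psum_tendsto[OF s(1)] tendsto_const)
  qed
  then show "exp (- (1 + 2 * L) * t) * (L2norm (ser (sol t)))\<^sup>2 \<le> exp (- (1 + 2 * L) * s) * (L2norm (ser (sol s)))\<^sup>2 + \<bar>r 0\<bar>\<^sup>2 * (t - s) + e'"
    by (simp add: b_def)
qed

text \<open>The case of starting time tending to zero. The bound is free of \<open>M\<close>, which
  is why a radius function can afterwards be chosen above it.\<close>

lemma energy_bound:
  assumes t: "0 < t"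
  shows "(L2norm (ser (sol t)))\<^sup>2 \<le> exp ((1 + 2 * L) * t) * ((L2norm u)\<^sup>2 + \<bar>r 0\<bar>\<^sup>2 * t)"
proof -
  have "exp (- (1 + 2 * L) * t) * (L2norm (ser (sol t)))\<^sup>2 \<le> exp (- (1 + 2 * L) * 0) * (L2norm u)\<^sup>2 + \<bar>r 0\<bar>\<^sup>2 * (t - 0)"
  proof (rule tendsto_lowerbound)
    show "((\<lambda>s. exp (- (1 + 2 * L) * s) * (L2norm (ser (sol s)))\<^sup>2 + \<bar>r 0\<bar>\<^sup>2 * (t - s)) \<longlongrightarrow> exp (- (1 + 2 * L) * 0) * (L2norm u)\<^sup>2 + \<bar>r 0\<bar>\<^sup>2 * (t - 0)) (at_right 0)"
      by (intro tendsto_intros sol_norm_initial)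
    show "\<forall>\<^sub>F s in at_right 0. exp (- (1 + 2 * L) * t) * (L2norm (ser (sol t)))\<^sup>2 \<le> exp (- (1 + 2 * L) * s) * (L2norm (ser (sol s)))\<^sup>2 + \<bar>r 0\<bar>\<^sup>2 * (t - s)"
      by (rule eventually_at_rightI[of 0 t]) (use energy_bound_between t in auto)
  qed simp
  then have "exp ((1 + 2 * L) * t) * (exp (- (1 + 2 * L) * t) * (L2norm (ser (sol t)))\<^sup>2) \<le> exp ((1 + 2 * L) * t) * ((L2norm u)\<^sup>2 + \<bar>r 0\<bar>\<^sup>2 * t)"
    by (intro mult_left_mono) auto
  moreover have "exp ((1 + 2 * L) * t) * exp (- (1 + 2 * L) * t) = 1" by (simp only: exp_add[symmetric]) (simp add: algebra_simps)
  ultimately show ?thesis by (simp only: mult.assoc[symmetric] mult_1_left)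
qed

text \<open>The term dropped in the energy bound is now kept and integrated in time. The constant
  does not depend on \<open>s\<close>, which prepares the limit at time zero; Fatou's lemma passes
  from partial sums to \<open>serx\<close>.\<close>

lemma dissipation_between:
  assumes T: "0 < T"
  obtains C where "0 \<le> C" "\<And>s. 0 < s \<Longrightarrow> s < T \<Longrightarrow> (\<integral>\<^sup>+t. ennreal ((L2norm (serx (sol t)))\<^sup>2) * indicator {s..T} t \<partial>lborel) \<le> ennreal C"
proof -
  define E1 where "E1 = exp ((1 + 2 * L) * T) * ((L2norm u)\<^sup>2 + \<bar>r 0\<bar>\<^sup>2 * T)"
  have E1: "(L2norm (ser (sol t)))\<^sup>2 \<le> E1" if "0 < t" "t \<le> T" for t
  proof -
    have "exp ((1 + 2 * L) * t) * ((L2norm u)\<^sup>2 + \<bar>r 0\<bar>\<^sup>2 * t) \<le> E1"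
      unfolding E1_def using that L0 by (intro mult_mono add_mono mult_left_mono) auto
    then show ?thesis using energy_bound[OF that(1)] by linarith
  qed
  have E1_0: "0 \<le> E1" using E1[OF T order_refl] order_trans zero_le_power2 by blast
  define c where "c = \<bar>r 0\<bar>\<^sup>2 + (1 + 2 * L) * E1 + 1"
  have c0: "0 \<le> c" using E1_0 L0 by (simp add: c_def)
  define C where "C = E1 + c * T"
  have C0: "0 \<le> C" using E1_0 c0 T by (simp add: C_def)
  have "(\<integral>\<^sup>+t. ennreal ((L2norm (serx (sol t)))\<^sup>2) * indicator {s..T} t \<partial>lborel) \<le> ennreal C" if s: "0 < s" "s < T" for s
  proof -
    define D where "D K t = (\<Sum>k<K. (om k * sol t k)\<^sup>2)" for K t
    have Dc: "continuous_on {s..T} (D K)" for K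
      unfolding D_def using admissible_sol s by (auto simp: admissible_def intro!: continuous_intros intro: continuous_on_subset)
    have D0: "0 \<le> D K t" for K t unfolding D_def by (rule sum_nonneg) auto
    have lim: "(\<lambda>K. D K t) \<longlonglongrightarrow> (L2norm (serx (sol t)))\<^sup>2" if pos: "0 < t" for t
    proof -
      obtain B where B: "wnorm_le t B (sol t)" using admissible_bound[OF admissible_sol pos] pos by blast
      show ?thesis using serx_norm_tendsto[OF B] by (simp only: D_def)
    qed
    have intD: "\<forall>\<^sub>F K in sequentially. (\<integral>\<^sup>+t. ennreal (D K t) * indicator {s..T} t \<partial>lborel) \<le> ennreal C"
      using energy_partial_deriv[OF s zero_less_one]
    proof eventually_elim
      case (elim K)
      \<comment> \<open>The partial energy plus twice the accumulated dissipation minus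
        \<open>c * t\<close> is nonincreasing: \<open>c\<close> collects the right side of the
        energy inequality, including its error, which is taken to be 1.\<close>
      have "(\<Sum>k<K. (sol T k)\<^sup>2) + 2 * integral {s..T} (D K) - c * T \<le> (\<Sum>k<K. (sol s k)\<^sup>2) + 2 * integral {s..s} (D K) - c * s"
      proof (rule DERIV_nonpos_imp_decreasing_open[of s T "\<lambda>t. (\<Sum>k<K. (sol t k)\<^sup>2) + 2 * integral {s..t} (D K) - c * t"])
        fix t assume t: "s < t" "t < T"
        then obtain F where F: "((\<lambda>t. \<Sum>k<K. (sol t k)\<^sup>2) has_real_derivative F) (at t)"
          "F + 2 * D K t \<le> \<bar>r 0\<bar>\<^sup>2 + (1 + 2 * L) * (L2norm (ser (sol t)))\<^sup>2 + 1"
          using elim unfolding D_def by force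
        have "(1 + 2 * L) * (L2norm (ser (sol t)))\<^sup>2 \<le> (1 + 2 * L) * E1" using E1 t s L0 by (intro mult_left_mono) auto
        with F(2) have le: "F + 2 * D K t - c \<le> 0" by (simp add: c_def)
        have "((\<lambda>t. integral {s..t} (D K)) has_real_derivative D K t) (at t within {s..T})"
          using integral_has_real_derivative[OF Dc] t by simp
        then have "((\<lambda>t. integral {s..t} (D K)) has_real_derivative D K t) (at t)"
          using t at_within_interior[of t "{s..T}"] by simp
        then have "((\<lambda>t. (\<Sum>k<K. (sol t k)\<^sup>2) + 2 * integral {s..t} (D K) - c * t) has_real_derivative (F + 2 * D K t - c)) (at t)"
          using DERIV_diff[OF DERIV_add[OF F(1) DERIV_cmult[of _ _ _ _ 2]] DERIV_cmult_Id[of c]] by blast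
        then show "\<exists>y. ((\<lambda>t. (\<Sum>k<K. (sol t k)\<^sup>2) + 2 * integral {s..t} (D K) - c * t) has_real_derivative y) (at t) \<and> y \<le> 0"
          using le by blast
      next
        have "continuous_on {s..T} (\<lambda>t. integral {s..t} (D K))"
          by (rule indefinite_integral_continuous_1) (rule integrable_continuous_real[OF Dc])
        moreover have "continuous_on {s..T} (\<lambda>t. sol t k)" for k using admissible_sol s by (auto simp: admissible_def intro: continuous_on_subset)
        ultimately show "continuous_on {s..T} (\<lambda>t. (\<Sum>k<K. (sol t k)\<^sup>2) + 2 * integral {s..t} (D K) - c * t)"
          by (intro continuous_intros)
      qed (use s in auto)
      moreover have "(\<Sum>k<K. (sol s k)\<^sup>2) \<le> E1" using energy_psum_le[OF s(1), of K] E1[of s] s by linarith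
      moreover have "0 \<le> (\<Sum>k<K. (sol T k)\<^sup>2)" by (rule sum_nonneg) auto
      moreover have "0 \<le> integral {s..T} (D K)" by (rule integral_nonneg[OF integrable_continuous_real[OF Dc]]) (rule D0)
      moreover have "0 \<le> c * s" using c0 s by simp
      ultimately have le: "integral {s..T} (D K) \<le> C" unfolding C_def by simp
      have i: "set_integrable lborel {s..T} (D K)" by (rule borel_integrable_atLeastAtMost'[OF Dc])
      have "(\<integral>\<^sup>+t. ennreal (D K t) * indicator {s..T} t \<partial>lborel) = (\<integral>\<^sup>+t. ennreal (indicator {s..T} t *\<^sub>R D K t) \<partial>lborel)"
        by (intro nn_integral_cong) (auto simp: indicator_def)
      also have "\<dots> = ennreal (LINT t:{s..T}|lborel. D K t)"
        unfolding set_lebesgue_integral_def using i D0 by (intro nn_integral_eq_integral) (auto simp: set_integrable_def)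
      also have "(LINT t:{s..T}|lborel. D K t) = integral {s..T} (D K)" by (rule set_borel_integral_eq_integral(2)[OF i])
      finally show ?case using le by (simp add: ennreal_leI)
    qed
    have m: "(\<lambda>t. ennreal (D K t) * indicator {s..T} t) \<in> borel_measurable lborel" for K
    proof -
      have "(\<lambda>t. indicator {s..T} t *\<^sub>R D K t) \<in> borel_measurable lborel"
        using borel_integrable_atLeastAtMost'[OF Dc] unfolding set_integrable_def by (rule borel_measurable_integrable)
      then have "(\<lambda>t. ennreal (indicator {s..T} t *\<^sub>R D K t)) \<in> borel_measurable lborel" by (rule measurable_compose[OF _ measurable_ennreal])
      moreover have "(\<lambda>t. ennreal (indicator {s..T} t *\<^sub>R D K t)) = (\<lambda>t. ennreal (D K t) * indicator {s..T} t)"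
        by (auto simp: indicator_def)
      ultimately show ?thesis by (simp only:)
    qed
    have "(\<integral>\<^sup>+t. ennreal ((L2norm (serx (sol t)))\<^sup>2) * indicator {s..T} t \<partial>lborel) \<le>
       (\<integral>\<^sup>+t. liminf (\<lambda>K. ennreal (D K t) * indicator {s..T} t) \<partial>lborel)"
    proof (rule nn_integral_mono)
      fix t
      show "ennreal ((L2norm (serx (sol t)))\<^sup>2) * indicator {s..T} t \<le> liminf (\<lambda>K. ennreal (D K t) * indicator {s..T} t)"
      proof (cases "t \<in> {s..T}")
        case True
        then have "(\<lambda>K. ennreal (D K t)) \<longlonglongrightarrow> ennreal ((L2norm (serx (sol t)))\<^sup>2)" using lim[of t] s by (intro tendsto_ennrealI) auto
        from lim_imp_Liminf[OF _ this] show ?thesis using True by simp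
      qed simp
    qed
    also have "\<dots> \<le> liminf (\<lambda>K. \<integral>\<^sup>+t. ennreal (D K t) * indicator {s..T} t \<partial>lborel)"
      by (rule nn_integral_liminf[OF m])
    also have "\<dots> \<le> ennreal C" using intD by (intro Liminf_le) auto
    finally show ?thesis .
  qed
  with C0 show thesis by (rule that)
qed

text \<open>Exhausting \<open>(0,T)\<close> by the intervals from \<open>T / (n + 2)\<close>, which
  is strictly below \<open>T\<close> for every \<open>n\<close>, and applying Fatou's lemma once
  more gives the square integrability of the spatial derivative down to the initial time.\<close>

lemma dissipation:
  assumes T: "0 < T"
  shows "(\<integral>\<^sup>+t. ennreal ((L2norm (serx (sol t)))\<^sup>2) * indicator {0<..<T} t \<partial>lborel) < \<infinity>"
proof -
  obtain C where C: "0 \<le> C" "\<And>s. 0 < s \<Longrightarrow> s < T \<Longrightarrow> (\<integral>\<^sup>+t. ennreal ((L2norm (serx (sol t)))\<^sup>2) * indicator {s..T} t \<partial>lborel) \<le> ennreal C"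
    by (rule dissipation_between[OF T]) (rule that)
  define F where "F = (\<lambda>t. ennreal ((L2norm (serx (sol t)))\<^sup>2))"
  have c: "continuous_on {0<..} (\<lambda>t. L2norm (serx (sol t)))"
    by (rule L2norm_continuous_param, rule continuous_on_subset[OF admissible_continuous(2)[OF admissible_sol]]) auto
  have m: "(\<lambda>t. F t * indicator {T / (real n + 2)..T} t) \<in> borel_measurable lborel" for n
  proof -
    have "continuous_on {T / (real n + 2)..T} (\<lambda>t. (L2norm (serx (sol t)))\<^sup>2)"
      by (intro continuous_intros continuous_on_subset[OF c]) (use T in \<open>auto intro: less_le_trans[of 0 "T / (real n + 2)"]\<close>)
    then have "(\<lambda>t. indicator {T / (real n + 2)..T} t *\<^sub>R (L2norm (serx (sol t)))\<^sup>2) \<in> borel_measurable lborel"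
      using borel_integrable_atLeastAtMost' unfolding set_integrable_def by (blast intro: borel_measurable_integrable)
    then have "(\<lambda>t. ennreal (indicator {T / (real n + 2)..T} t *\<^sub>R (L2norm (serx (sol t)))\<^sup>2)) \<in> borel_measurable lborel"
      by (rule measurable_compose[OF _ measurable_ennreal])
    moreover have "(\<lambda>t. ennreal (indicator {T / (real n + 2)..T} t *\<^sub>R (L2norm (serx (sol t)))\<^sup>2)) = (\<lambda>t. F t * indicator {T / (real n + 2)..T} t)"
      by (auto simp: indicator_def F_def)
    ultimately show ?thesis by (simp only:)
  qed
  have "(\<integral>\<^sup>+t. F t * indicator {0<..<T} t \<partial>lborel) \<le> (\<integral>\<^sup>+t. liminf (\<lambda>n. F t * indicator {T / (real n + 2)..T} t) \<partial>lborel)"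
  proof (rule nn_integral_mono)
    fix t
    show "F t * indicator {0<..<T} t \<le> liminf (\<lambda>n. F t * indicator {T / (real n + 2)..T} t)"
    proof (cases "t \<in> {0<..<T}")
      case True
      have "(\<lambda>n. T * inverse (real (Suc (Suc n)))) \<longlonglongrightarrow> T * 0"
        by (intro tendsto_mult_left LIMSEQ_Suc[OF LIMSEQ_inverse_real_of_nat])
      then have "(\<lambda>n. T / (real n + 2)) \<longlonglongrightarrow> 0" by (simp add: field_simps)
      then have "\<forall>\<^sub>F n in sequentially. T / (real n + 2) < t" using True by (intro order_tendstoD) auto
      then have "\<forall>\<^sub>F n in sequentially. F t * indicator {T / (real n + 2)..T} t = F t" by eventually_elim (use True in auto)
      then have "(\<lambda>n. F t * indicator {T / (real n + 2)..T} t) \<longlonglongrightarrow> F t" by (rule tendsto_eventually)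
      from lim_imp_Liminf[OF _ this] show ?thesis using True by simp
    qed simp
  qed
  also have "\<dots> \<le> liminf (\<lambda>n. \<integral>\<^sup>+t. F t * indicator {T / (real n + 2)..T} t \<partial>lborel)"
    by (rule nn_integral_liminf[OF m])
  also have "\<dots> \<le> ennreal C"
  proof (rule Liminf_le)
    have "(\<integral>\<^sup>+t. F t * indicator {T / (real n + 2)..T} t \<partial>lborel) \<le> ennreal C" for n
          proof -
      have "T * 1 < T * (real n + 2)" using T by (intro mult_strict_left_mono) auto
      then show ?thesis unfolding F_def using T by (intro C) (auto simp: divide_less_eq)
    qed
    then show "\<forall>\<^sub>F n in sequentially. (\<integral>\<^sup>+t. F t * indicator {T / (real n + 2)..T} t \<partial>lborel) \<le> ennreal C" by simp
  qed simp
  finally show ?thesis unfolding F_def by (rule le_less_trans) simp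
qed

end

section \<open>Regularity and existence\<close>

text \<open>The bound for a single mode. In contrast to \<open>heat_sum\<close> nothing is lost to
  summation over modes, which makes it the right tool for maps from l2 to weighted l2.\<close>

lemma om_powr_exp_le:
  assumes "0 < q" "0 < \<tau>"
  shows "om k powr (2 * q) * exp (- (om k)\<^sup>2 * \<tau>) \<le> q powr q * \<tau> powr (- q)"
proof -
  have "exp (- ((om k)\<^sup>2 * \<tau>)) \<le> q powr q * ((om k)\<^sup>2 * \<tau>) powr (- q)"
    using assms by (intro exp_le_powr) auto
  also have "((om k)\<^sup>2 * \<tau>) powr (- q) = om k powr (- (2 * q)) * \<tau> powr (- q)"
    using assms by (simp add: powr_mult powr_powr flip: powr_numeral)
  finally have "om k powr (2 * q) * exp (- ((om k)\<^sup>2 * \<tau>)) \<le> om k powr (2 * q) * (q powr q * (om k powr (- (2 * q)) * \<tau> powr (- q)))"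
    by (rule mult_left_mono) simp
  also have "\<dots> = (om k powr (2 * q) * om k powr (- (2 * q))) * (q powr q * \<tau> powr (- q))" by simp
  also have "om k powr (2 * q) * om k powr (- (2 * q)) = 1" by (simp flip: powr_add)
  finally show ?thesis by simp
qed

text \<open>Interpolates between the bounds \<open>x\<close> and 1; used to convert spatial
  regularity into Hoelder continuity in time.\<close>

lemma one_minus_exp_le_powr:
  assumes "0 \<le> (x::real)" "0 < p" "p \<le> 1" shows "1 - exp (- x) \<le> x powr p"
proof (cases "x \<le> 1")
  case True
  have "1 - exp (- x) \<le> x" using exp_ge_add_one_self[of "-x"] by linarith
  also have "x \<le> x powr p"
  proof (cases "x = 0")
    case False
    then have "x powr 1 \<le> x powr p" using True assms by (intro powr_mono') auto
    then show ?thesis using False assms by simp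
  qed simp
  finally show ?thesis .
next
  case False
  then have "1 \<le> x powr p" using assms by (intro ge_one_powr_ge_zero) auto
  then show ?thesis using exp_gt_zero[of "-x"] by linarith
qed

lemma sum_le_scaled:
  assumes "\<And>k. \<bar>v k\<bar> \<le> c * \<bar>w k\<bar>" "(\<Sum>k<(K::nat). (w k)\<^sup>2) \<le> (A::real)\<^sup>2" "0 \<le> c"
  shows "(\<Sum>k<K. (v k)\<^sup>2) \<le> (c * A)\<^sup>2"
proof -
  have "(v k)\<^sup>2 \<le> c\<^sup>2 * (w k)\<^sup>2" for k
    using power_mono[OF assms(1)[of k], of 2] by (simp add: power_mult_distrib)
  then have "(\<Sum>k<K. (v k)\<^sup>2) \<le> (\<Sum>k<K. c\<^sup>2 * (w k)\<^sup>2)" by (rule sum_mono)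
  also have "\<dots> = c\<^sup>2 * (\<Sum>k<K. (w k)\<^sup>2)" by (simp add: sum_distrib_left)
  also have "\<dots> \<le> c\<^sup>2 * A\<^sup>2" using assms by (intro mult_left_mono) auto
  finally show ?thesis by (simp add: power_mult_distrib)
qed

lemma wnorm_le_time_mono:
  assumes "wnorm_le t A v" "0 < s" "s \<le> t" shows "wnorm_le s A v"
proof -
  have "A * t powr (- (15/16)) \<le> A * s powr (- (15/16))"
    using assms by (intro mult_left_mono powr_mono2') (auto simp: wnorm_le_def)
  then show ?thesis using assms(1) unfolding wnorm_le_def by (meson order_trans)
qed

text \<open>The second bound is Poincare's inequality: all frequencies are at least 1.\<close>

lemma serx_norm_le:
  assumes "wnorm_le t A v" "\<And>K. (\<Sum>k<K. (om k * v k)\<^sup>2) \<le> B\<^sup>2" "0 \<le> B"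
  shows "L2norm (serx v) \<le> B" "L2norm (ser v) \<le> B"
proof -
  have "(L2norm (serx v))\<^sup>2 \<le> B\<^sup>2" using serx_norm_tendsto[OF assms(1)] assms(2) by (intro LIMSEQ_le_const2) auto
  then show "L2norm (serx v) \<le> B" using assms(3) power2_le_imp_le by blast
  show "L2norm (ser v) \<le> B"
  proof (rule L2norm_le_if_cf_le[OF ser_L2[OF assms(1)] _ assms(3)])
    fix K
    have "(v k)\<^sup>2 \<le> (om k * v k)\<^sup>2" for k
    proof -
      have "1 * \<bar>v k\<bar> \<le> om k * \<bar>v k\<bar>" using om_ge_1[of k] by (intro mult_right_mono) auto
      then have "\<bar>v k\<bar> \<le> \<bar>om k * v k\<bar>" by (simp add: abs_mult)
      then show ?thesis by (simp add: abs_le_square_iff)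
    qed
    then have "(\<Sum>k<K. (v k)\<^sup>2) \<le> (\<Sum>k<K. (om k * v k)\<^sup>2)" by (rule sum_mono)
    then show "(\<Sum>k<K. (cf (ser v) k)\<^sup>2) \<le> B\<^sup>2" using assms(2)[of K] by (simp add: cf_ser[OF assms(1)])
  qed
qed

lemma duhamel_restart:
  assumes i: "set_integrable lborel {s0<..<t} (\<lambda>s. exp ((om k)\<^sup>2 * s) * g s k)" and s: "s0 < s" "s < t"
  shows "duhamel g s0 t k = exp (- (om k)\<^sup>2 * (t - s)) * duhamel g s0 s k + duhamel g s t k"
proof -
  have e: "duhamel g a b k = exp (- (om k)\<^sup>2 * b) * (LINT s:{a<..<b}|lborel. exp ((om k)\<^sup>2 * s) * g s k)" for a b
  proof -
    have "exp (- (om k)\<^sup>2 * (b - s)) = exp (- (om k)\<^sup>2 * b) * exp ((om k)\<^sup>2 * s)" for s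
      by (simp only: exp_add[symmetric]) (simp add: algebra_simps)
    then show ?thesis unfolding duhamel_def by (simp only: mult.assoc set_integral_mult_right)
  qed
  have "exp (- (om k)\<^sup>2 * (t - s)) * exp (- (om k)\<^sup>2 * s) = exp (- (om k)\<^sup>2 * t)"
    by (simp only: exp_add[symmetric]) (simp add: algebra_simps)
  then have "exp (- (om k)\<^sup>2 * (t - s)) * duhamel g s0 s k = exp (- (om k)\<^sup>2 * t) * (LINT s:{s0<..<s}|lborel. exp ((om k)\<^sup>2 * s) * g s k)"
    unfolding e by (simp only: mult.assoc[symmetric])
  then show ?thesis
    unfolding e[of s0 t] e[of s t] LINT_split[OF s(1) less_imp_le[OF s(2)] i] by (simp add: distrib_left)
qed

lemma LINT_exp_decay:
  assumes "s < t"
  shows "(om k)\<^sup>2 * (LINT \<sigma>:{s<..<t}|lborel. exp (- (om k)\<^sup>2 * (t - \<sigma>))) = 1 - exp (- (om k)\<^sup>2 * (t - s))"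
proof -
  define c where "c = (om k)\<^sup>2"
  have c: "c \<noteq> 0" by (simp add: c_def)
  have "(LINT \<sigma>:{s..t}|lborel. exp (- c * (t - \<sigma>))) = exp (- c * (t - t)) / c - exp (- c * (t - s)) / c"
    using assms c by (intro LINT_FTC_01) (auto intro!: derivative_eq_intros continuous_intros)
  then show ?thesis unfolding LINT_open_closed c_def[symmetric] using c by (simp add: field_simps)
qed

text \<open>Gives the second derivative without differentiating the sine series twice. Integrating
  \<open>g\<close> twice with Dirichlet conditions yields \<open>w\<close>; two integrations by
  parts show that \<open>w\<close> has the sine coefficients of \<open>y\<close>, hence
  \<open>w = y\<close> inside and \<open>p = G - c\<close> there.\<close>

lemma dirichlet_primitive:
  assumes g: "continuous_on {0..1} g" and y: "continuous_on {0..1} y"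
    and cf: "\<And>k. cf g k = - (om k)\<^sup>2 * cf y k"
    and p: "\<And>x. x \<in> {0<..<1} \<Longrightarrow> (y has_real_derivative p x) (at x)" and x: "x \<in> {0<..<1}"
  shows "(p has_real_derivative g x) (at x)"
proof -
  define G where "G x = integral {0..x} g" for x
  have G: "(G has_real_derivative g x) (at x within {0..1})" if "x \<in> {0..1}" for x
    unfolding G_def using integral_has_real_derivative[OF g that] .
  have Gc: "continuous_on {0..1} G" by (rule DERIV_continuous_on[OF G])
  \<comment> \<open>The integration constant that makes \<open>w\<close> vanish at 1 as well as at
    0.\<close>
  define c where "c = integral {0..1} G"
  define w where "w x = integral {0..x} G - c * x" for x
  have w: "(w has_real_derivative G x - c) (at x within {0..1})" if "x \<in> {0..1}" for x
    unfolding w_def using integral_has_real_derivative[OF Gc that] by (auto intro!: derivative_eq_intros)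
  have wc: "continuous_on {0..1} w" by (rule DERIV_continuous_on[OF w])
  have w01: "w 0 = 0" "w 1 = 0" by (auto simp: w_def c_def)
  have "cf w k = cf y k" for k
  proof -
    have "(LINT x:{0..1}|lborel. g x * es k x + (om k)\<^sup>2 * (w x * es k x)) =
        ((G 1 - c) * es k 1 - w 1 * (om k * ec k 1)) - ((G 0 - c) * es k 0 - w 0 * (om k * ec k 0))"
    proof (rule LINT_FTC_01)
      fix x :: real assume x: "x \<in> {0..1}"
      have "((\<lambda>x. (G x - c) * es k x - w x * (om k * ec k x)) has_real_derivative
         (g x - 0) * es k x + om k * ec k x * (G x - c) - ((G x - c) * (om k * ec k x) + om k * - (om k * es k x) * w x)) (at x within {0..1})"
        by (intro DERIV_diff DERIV_mult DERIV_cmult G w x es_deriv ec_deriv DERIV_const)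
      then show "((\<lambda>x. (G x - c) * es k x - w x * (om k * ec k x)) has_real_derivative g x * es k x + (om k)\<^sup>2 * (w x * es k x)) (at x within {0..1})"
        by (rule DERIV_cong) (simp add: algebra_simps power2_eq_square)
    qed (auto intro!: continuous_intros g wc)
    also have "\<dots> = 0" by (simp add: w01)
    also have "(LINT x:{0..1}|lborel. g x * es k x + (om k)\<^sup>2 * (w x * es k x)) = cf g k + (om k)\<^sup>2 * cf w k"
      unfolding cf_def L2inner_def
      by (subst set_integral_add) (auto intro!: borel_integrable_atLeastAtMost' continuous_intros g wc)
    finally have "(om k)\<^sup>2 * cf w k = (om k)\<^sup>2 * cf y k" using cf[of k] by simp
    then show ?thesis by simp
  qed
  note cfw = this
  have z: "y x - w x = 0" if "x \<in> {0<..<1}" for x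
  proof (rule continuous_cf_zero[OF _ _ that])
    show "continuous_on {0..1} (\<lambda>x. y x - w x)" by (intro continuous_intros y wc)
    show "cf (\<lambda>x. y x - w x) k = 0" for k
      using cfw by (simp add: cf_diff[OF L2_continuous[OF y] L2_continuous[OF wc]])
  qed
  have int: "at x within {0..1} = at x" if "x \<in> {0<..<1}" for x :: real
    using that by (intro at_within_interior) simp
  have pG: "p x = G x - c" if x: "x \<in> {0<..<1}" for x
  proof -
    have "(w has_real_derivative p x) (at x)"
    proof (rule DERIV_cong_ev[THEN iffD1, rotated -1, OF p[OF x]])
      have "\<forall>\<^sub>F x in nhds x. x \<in> {0<..<1}" using x by (intro eventually_nhds_in_open) auto
      then show "\<forall>\<^sub>F x in nhds x. y x = w x" by eventually_elim (use z in force)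
    qed auto
    moreover have "(w has_real_derivative G x - c) (at x)" using w[of x] int[OF x] x by simp
    ultimately show ?thesis by (rule DERIV_unique)
  qed
  have "((\<lambda>x. G x - c) has_real_derivative g x) (at x)"
    using G[of x] int[OF x] x by (auto intro!: derivative_eq_intros)
  then show ?thesis
  proof (rule DERIV_cong_ev[THEN iffD1, rotated -1])
    have "\<forall>\<^sub>F x in nhds x. x \<in> {0<..<1}" using x by (intro eventually_nhds_in_open) auto
    then show "\<forall>\<^sub>F x in nhds x. G x - c = p x" by eventually_elim (simp add: pG)
  qed auto
qed

text \<open>For such \<open>M\<close> the energy estimate gives \<open>\<parallel>y(t)\<parallel> \<le> M t\<close>, so the truncation is inactive.\<close>

locale untruncated = truncated +
  assumes M_big: "\<And>t. 0 < t \<Longrightarrow> exp ((1 + 2 * L) * t) * ((L2norm u)\<^sup>2 + \<bar>r 0\<bar>\<^sup>2 * t) \<le> (M t)\<^sup>2"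
begin

definition gs :: "real \<Rightarrow> nat \<Rightarrow> real" where "gs t = cf (nonlin (M t) (sol t))"

lemma nonlin_sol:
  assumes t: "0 < t" shows "nonlin (M t) (sol t) x = r (ser (sol t) x) - fp (ser (sol t) x) * serx (sol t) x"
proof -
  have "(L2norm (ser (sol t)))\<^sup>2 \<le> (M t)\<^sup>2" using energy_bound[OF t] M_big[OF t] by linarith
  then have "L2norm (ser (sol t)) \<le> M t" using M_pos[of t] power2_le_imp_le less_imp_le by blast
  then have "trunc (M t) (sol t) = 1" using M_pos[of t] by (simp add: trunc_def max_def)
  then show ?thesis by (simp add: nonlin_def)
qed

lemma gs_continuous: "continuous_on {0<..} (\<lambda>t. gs t k)"
  unfolding gs_def by (rule cf_nonlin_continuous[OF admissible_sol])

lemma gs_bound: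
  assumes T: "0 < T"
  obtains C where "0 \<le> C" "\<And>t K. 0 < t \<Longrightarrow> t \<le> T \<Longrightarrow> (\<Sum>k<K. (gs t k)\<^sup>2) \<le> (C * t powr (- (15/16)))\<^sup>2"
proof -
  obtain C where C: "0 \<le> C" "\<And>t. 0 < t \<Longrightarrow> t \<le> T \<Longrightarrow> L2norm (nonlin (M t) (sol t)) \<le> C * t powr (- (15/16))"
     "\<And>t K. 0 < t \<Longrightarrow> t \<le> T \<Longrightarrow> (\<Sum>k<K. (cf (nonlin (M t) (sol t)) k)\<^sup>2) \<le> (C * t powr (- (15/16)))\<^sup>2"
    by (rule cf_nonlin_time[OF admissible_sol T]) (rule that)
  show thesis by (rule that[OF C(1)]) (simp only: gs_def C(3))
qed

lemma sol_formula: "0 < t \<Longrightarrow> sol t k = exp (- (om k)\<^sup>2 * t) * cf u k + duhamel gs 0 t k"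
  using sol_fixed[of t k] by (simp add: Phi_def gs_def[abs_def])

lemma gs_integrable: "0 < T \<Longrightarrow> set_integrable lborel {0<..<T} (\<lambda>s. exp ((om k)\<^sup>2 * s) * gs s k)"
  unfolding gs_def by (rule duhamel_nonlin_integrable[OF admissible_sol])

lemma sol_restart:
  assumes s: "0 < s" "s < t" shows "sol t k = exp (- (om k)\<^sup>2 * (t - s)) * sol s k + duhamel gs s t k"
proof -
  have "exp (- (om k)\<^sup>2 * (t - s)) * exp (- (om k)\<^sup>2 * s) = exp (- (om k)\<^sup>2 * t)"
    by (simp only: exp_add[symmetric]) (simp add: algebra_simps)
  then show ?thesis
    using sol_formula[of t k] sol_formula[of s k] duhamel_restart[of 0 t k gs s, OF gs_integrable s] s
    by (simp add: distrib_left flip: mult.assoc)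
qed

text \<open>An exponent below 2 is chosen so that the kernel singularity 9/10 stays integrable. The
  resulting power of time, 1 - 9/10 - 15/16, is negative, whence the restriction to times at least
  \<open>s0\<close>.\<close>

lemma sol_higher_norm:
  assumes s0: "0 < s0" "s0 < T"
  obtains C where "0 \<le> C" "\<And>t K. s0 \<le> t \<Longrightarrow> t \<le> T \<Longrightarrow> (\<Sum>k<K. (om k powr (9/5) * sol t k)\<^sup>2) \<le> C\<^sup>2"
proof -
  have T: "0 < T" using s0 by simp
  obtain C where C: "0 \<le> C" "\<And>t K. 0 < t \<Longrightarrow> t \<le> T \<Longrightarrow> (\<Sum>k<K. (gs t k)\<^sup>2) \<le> (C * t powr (- (15/16)))\<^sup>2"
    by (rule gs_bound[OF T]) (rule that)
  define q where "q = (9/10 :: real) powr (9/10)"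
  have q: "0 \<le> q" "om k powr (9/5) * exp (- (om k)\<^sup>2 * \<tau>) \<le> q * \<tau> powr (- (9/10))" if "0 < \<tau>" for \<tau> k
    using om_powr_exp_le[of "9/10" \<tau> k] that by (auto simp: q_def)
  define A where "A = q * s0 powr (- (9/10)) * L2norm u"
  define B where "B = q * C * beta_int (9/10) (15/16) * s0 powr (1 - 9/10 - 15/16)"
  have q0: "0 \<le> q" by (simp add: q_def)
  have AB: "0 \<le> A" "0 \<le> B" using q0 C by (auto simp: A_def B_def)
  have "(\<Sum>k<K. (om k powr (9/5) * sol t k)\<^sup>2) \<le> (A + B)\<^sup>2" if t: "s0 \<le> t" "t \<le> T" for t K
  proof -
    have t0: "0 < t" using s0 t by simp
    have "(\<Sum>k<K. (om k powr (9/5) * (exp (- (om k)\<^sup>2 * t) * cf u k))\<^sup>2) \<le> A\<^sup>2"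
      unfolding A_def
    proof (rule sum_le_scaled[OF _ Bessel[OF u_L2]])
      fix k
      have "om k powr (9/5) * exp (- (om k)\<^sup>2 * t) \<le> q * s0 powr (- (9/10))"
        by (rule order_trans[OF q(2)[OF t0]]) (intro mult_left_mono powr_mono2', use s0 t q0 in auto)
      then show "\<bar>om k powr (9/5) * (exp (- (om k)\<^sup>2 * t) * cf u k)\<bar> \<le> q * s0 powr (- (9/10)) * \<bar>cf u k\<bar>"
        by (simp add: abs_mult mult_right_mono flip: mult.assoc)
    qed (use q0 in auto)
    moreover have "(\<Sum>k<K. (om k powr (9/5) * duhamel gs 0 t k)\<^sup>2) \<le> B\<^sup>2"
    proof -
      have "(\<Sum>k<K. (LINT s:{0<..<t}|lborel. om k powr (9/5) * (exp (- (om k)\<^sup>2 * (t - s)) * gs s k))\<^sup>2)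
          \<le> (q * C * beta_int (9/10) (15/16) * (t - 0) powr (1 - 9/10 - 15/16))\<^sup>2"
      proof (rule Beta_Minkowski(2))
        show "continuous_on {0<..<t} (\<lambda>s. om k powr (9/5) * (exp (- (om k)\<^sup>2 * (t - s)) * gs s k))" for k
          by (intro continuous_intros continuous_on_subset[OF gs_continuous]) auto
        fix s K assume s: "0 < s" "s < t"
        have "(\<Sum>k<K. (om k powr (9/5) * (exp (- (om k)\<^sup>2 * (t - s)) * gs s k))\<^sup>2) \<le> ((q * (t - s) powr (- (9/10))) * (C * s powr (- (15/16))))\<^sup>2"
        proof (rule sum_le_scaled)
          show "\<bar>om k powr (9/5) * (exp (- (om k)\<^sup>2 * (t - s)) * gs s k)\<bar> \<le> q * (t - s) powr (- (9/10)) * \<bar>gs s k\<bar>" for k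
            using mult_right_mono[OF q(2)[of "t - s" k], of "\<bar>gs s k\<bar>"] s by (simp add: abs_mult flip: mult.assoc)
        qed (use C(2)[of s] s t q0 in auto)
        then show "(\<Sum>k<K. (om k powr (9/5) * (exp (- (om k)\<^sup>2 * (t - s)) * gs s k))\<^sup>2) \<le> (q * C * (t - s) powr (- (9/10)) * (s - 0) powr (- (15/16)))\<^sup>2"
          by (simp add: mult_ac)
      qed (use t0 q0 C in auto)
      also have "\<dots> \<le> B\<^sup>2"
        unfolding B_def by (intro power_mono mult_left_mono powr_mono2') (use s0 t q0 C in auto)
      finally show ?thesis by (simp add: duhamel_def)
    qed
    ultimately have "(\<Sum>k<K. (om k powr (9/5) * (exp (- (om k)\<^sup>2 * t) * cf u k) + om k powr (9/5) * duhamel gs 0 t k)\<^sup>2) \<le> (A + B)\<^sup>2"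
      using AB by (intro L2_set_add_le)
    then show ?thesis by (simp only: sol_formula[OF t0] distrib_left)
  qed
  then show thesis using AB by (intro that[of "A + B"]) auto
qed

text \<open>For the semigroup part \<open>om k * (1 - exp (- (om k)\<^sup>2 * h))\<close> is at most
  \<open>om k powr (9/5) * h powr (2/5)\<close>, so the previous bound supplies the rate 2/5. The
  Duhamel part on the short interval has rate 1/2, of which 1/10 is absorbed into a power of
  \<open>T\<close>.\<close>

lemma sol_holder:
  assumes s0: "0 < s0" "s0 < T"
  obtains C where "0 \<le> C" "\<And>s t K. s0 \<le> s \<Longrightarrow> s < t \<Longrightarrow> t \<le> T \<Longrightarrow> (\<Sum>k<K. (om k * (sol t k - sol s k))\<^sup>2) \<le> (C * (t - s) powr (2/5))\<^sup>2"
proof -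
  have T: "0 < T" using s0 by simp
  obtain A where A: "0 \<le> A" "\<And>t K. s0 \<le> t \<Longrightarrow> t \<le> T \<Longrightarrow> (\<Sum>k<K. (om k powr (9/5) * sol t k)\<^sup>2) \<le> A\<^sup>2"
    by (rule sol_higher_norm[OF s0]) (rule that)
  obtain C where C: "0 \<le> C" "\<And>t K. 0 < t \<Longrightarrow> t \<le> T \<Longrightarrow> (\<Sum>k<K. (gs t k)\<^sup>2) \<le> (C * t powr (- (15/16)))\<^sup>2"
    by (rule gs_bound[OF T]) (rule that)
  define G where "G = C * s0 powr (- (15/16))"
  have G0: "0 \<le> G" using C by (simp add: G_def)
  have G: "(\<Sum>k<K. (gs t k)\<^sup>2) \<le> G\<^sup>2" if "s0 \<le> t" "t \<le> T" for t K
    by (rule order_trans[OF C(2)[of t K] power_mono]) (use that s0 C in \<open>auto simp: G_def intro!: mult_left_mono powr_mono2'\<close>)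
  define q where "q = (1/2 :: real) powr (1/2)"
  have q0: "0 \<le> q" by (simp add: q_def)
  have q: "om k * exp (- (om k)\<^sup>2 * \<tau>) \<le> q * \<tau> powr (- (1/2))" if "0 < \<tau>" for \<tau> k
    using om_powr_exp_le[of "1/2" \<tau> k] that by (auto simp: q_def)
  define B where "B = q * G * beta_int (1/2) 0 * T powr (1/10)"
  have B0: "0 \<le> B" using q0 G0 by (simp add: B_def)
  have "(\<Sum>k<K. (om k * (sol t k - sol s k))\<^sup>2) \<le> ((A + B) * (t - s) powr (2/5))\<^sup>2" if st: "s0 \<le> s" "s < t" "t \<le> T" for s t K
  proof -
    have s: "0 < s" "s \<le> T" using st s0 by auto
    define h where "h = t - s"
    have h: "0 < h" using st by (simp add: h_def)
    have 1: "(\<Sum>k<K. (om k * ((exp (- (om k)\<^sup>2 * h) - 1) * sol s k))\<^sup>2) \<le> (h powr (2/5) * A)\<^sup>2"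
    proof (rule sum_le_scaled[OF _ A(2)[OF st(1) s(2)]])
      fix k
      have "1 - exp (- ((om k)\<^sup>2 * h)) \<le> ((om k)\<^sup>2 * h) powr (2/5)" using h by (intro one_minus_exp_le_powr) auto
      also have "\<dots> = om k powr (4/5) * h powr (2/5)"
        using h by (simp add: powr_mult powr_powr flip: powr_numeral)
      finally have "om k * (1 - exp (- ((om k)\<^sup>2 * h))) \<le> om k * (om k powr (4/5) * h powr (2/5))"
        by (rule mult_left_mono) simp
      also have "\<dots> = (om k powr 1 * om k powr (4/5)) * h powr (2/5)" by simp
      also have "om k powr 1 * om k powr (4/5) = om k powr (9/5)" by (simp only: powr_add[symmetric]) simp
      finally have "om k * (1 - exp (- ((om k)\<^sup>2 * h))) * \<bar>sol s k\<bar> \<le> om k powr (9/5) * h powr (2/5) * \<bar>sol s k\<bar>"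
        by (rule mult_right_mono) simp
      moreover have "\<bar>exp (- (om k)\<^sup>2 * h) - 1\<bar> = 1 - exp (- ((om k)\<^sup>2 * h))" using h by simp
      ultimately show "\<bar>om k * ((exp (- (om k)\<^sup>2 * h) - 1) * sol s k)\<bar> \<le> h powr (2/5) * \<bar>om k powr (9/5) * sol s k\<bar>"
        by (simp add: abs_mult mult_ac)
    qed simp
    have 2: "(\<Sum>k<K. (om k * duhamel gs s t k)\<^sup>2) \<le> (B * h powr (2/5))\<^sup>2"
    proof -
      have "(\<Sum>k<K. (LINT \<sigma>:{s<..<t}|lborel. om k * (exp (- (om k)\<^sup>2 * (t - \<sigma>)) * gs \<sigma> k))\<^sup>2)
          \<le> (q * G * beta_int (1/2) 0 * (t - s) powr (1 - 1/2 - 0))\<^sup>2"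
      proof (rule Beta_Minkowski(2))
        show "continuous_on {s<..<t} (\<lambda>\<sigma>. om k * (exp (- (om k)\<^sup>2 * (t - \<sigma>)) * gs \<sigma> k))" for k
          by (intro continuous_intros continuous_on_subset[OF gs_continuous]) (use s in auto)
        fix \<sigma> K assume \<sigma>: "s < \<sigma>" "\<sigma> < t"
        have "(\<Sum>k<K. (om k * (exp (- (om k)\<^sup>2 * (t - \<sigma>)) * gs \<sigma> k))\<^sup>2) \<le> ((q * (t - \<sigma>) powr (- (1/2))) * G)\<^sup>2"
        proof (rule sum_le_scaled)
          show "\<bar>om k * (exp (- (om k)\<^sup>2 * (t - \<sigma>)) * gs \<sigma> k)\<bar> \<le> q * (t - \<sigma>) powr (- (1/2)) * \<bar>gs \<sigma> k\<bar>" for k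
            using mult_right_mono[OF q[of "t - \<sigma>" k], of "\<bar>gs \<sigma> k\<bar>"] \<sigma> by (simp add: abs_mult flip: mult.assoc)
        qed (use G[of \<sigma>] \<sigma> st q0 in auto)
        then show "(\<Sum>k<K. (om k * (exp (- (om k)\<^sup>2 * (t - \<sigma>)) * gs \<sigma> k))\<^sup>2) \<le> (q * G * (t - \<sigma>) powr (- (1/2)) * (\<sigma> - s) powr (- 0))\<^sup>2"
          using \<sigma> by (simp add: mult_ac)
      qed (use st q0 G0 in auto)
      also have "\<dots> \<le> (B * h powr (2/5))\<^sup>2"
      proof (rule power_mono)
        have "(t - s) powr (1 - 1/2 - 0) = h powr (1/10) * h powr (2/5)" by (simp add: h_def flip: powr_add)
        also have "\<dots> \<le> T powr (1/10) * h powr (2/5)" using h st s by (intro mult_right_mono powr_mono2) (auto simp: h_def)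
        finally have "q * G * beta_int (1/2) 0 * (t - s) powr (1 - 1/2 - 0) \<le> q * G * beta_int (1/2) 0 * (T powr (1/10) * h powr (2/5))"
          using q0 G0 by (intro mult_left_mono) auto
        then show "q * G * beta_int (1/2) 0 * (t - s) powr (1 - 1/2 - 0) \<le> B * h powr (2/5)" by (simp add: B_def mult.assoc)
      qed (use q0 G0 in auto)
      finally show ?thesis by (simp add: duhamel_def)
    qed
    have "om k * (sol t k - sol s k) = om k * ((exp (- (om k)\<^sup>2 * h) - 1) * sol s k) + om k * duhamel gs s t k" for k
      unfolding sol_restart[OF s(1) st(2)] h_def by (simp add: algebra_simps)
    then have "(\<Sum>k<K. (om k * (sol t k - sol s k))\<^sup>2) \<le> (h powr (2/5) * A + B * h powr (2/5))\<^sup>2"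
      using 1 2 A(1) B0 by (simp only:) (intro L2_set_add_le; simp)
    then show ?thesis by (simp add: h_def algebra_simps)
  qed
  then show thesis using A(1) B0 by (intro that[of "A + B"]) auto
qed

end

section \<open>Time regularity and the classical derivatives\<close>

context untruncated
begin

text \<open>The rate of \<open>sol_holder\<close> controls both the series and its derivative in L2.
  With the truncation inactive, \<open>fp\<close> acts on the series itself, so every remaining
  factor can be bounded in the sup norm away from time zero.\<close>

lemma nonlin_holder:
  assumes s0: "0 < s0" "s0 < T"
  obtains C where "0 \<le> C" "\<And>s t. s0 \<le> s \<Longrightarrow> s < t \<Longrightarrow> t \<le> T \<Longrightarrow>
    L2norm (\<lambda>x. nonlin (M t) (sol t) x - nonlin (M s) (sol s) x) \<le> C * (t - s) powr (2/5)"
proof -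
  have T: "0 < T" using s0 by simp
  obtain B where B: "0 \<le> B" "\<And>t. 0 < t \<Longrightarrow> t \<le> T \<Longrightarrow> wnorm_le t B (sol t)" using admissible_bound[OF admissible_sol T] by blast
  obtain H where H: "0 \<le> H" "\<And>s t K. s0 \<le> s \<Longrightarrow> s < t \<Longrightarrow> t \<le> T \<Longrightarrow> (\<Sum>k<K. (om k * (sol t k - sol s k))\<^sup>2) \<le> (H * (t - s) powr (2/5))\<^sup>2"
    by (rule sol_holder[OF s0]) (rule that)
  define Y where "Y = 2 * (B * s0 powr (- (15/16)))"
  have Y0: "0 \<le> Y" using B by (simp add: Y_def)
  define C where "C = L * H + (\<bar>fp 0\<bar> + L * Y) * H + L * Y * H"
  have "L2norm (\<lambda>x. nonlin (M t) (sol t) x - nonlin (M s) (sol s) x) \<le> C * (t - s) powr (2/5)"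
    if st: "s0 \<le> s" "s < t" "t \<le> T" for s t
  proof -
    have pos: "0 < s" "0 < t" "s \<le> T" using st s0 by auto
    \<comment> \<open>Both times are measured by the weight at \<open>s0\<close>, so that the
      difference of the coefficient vectors is covered by one \<open>wnorm_le\<close>
      statement.\<close>
    have szs: "wnorm_le s0 B (sol s)" and szt: "wnorm_le s0 B (sol t)"
      using wnorm_le_time_mono[OF B(2)] st s0 pos by auto
    let ?d = "H * (t - s) powr (2/5)"
    have d0: "0 \<le> ?d" using H by simp
    define y p y' p' where "y = ser (sol t)" and "p = serx (sol t)" and "y' = ser (sol s)" and "p' = serx (sol s)"
    have c: "continuous_on {0..1} y" "continuous_on {0..1} p" "continuous_on {0..1} y'" "continuous_on {0..1} p'"
      unfolding y_def p_def y'_def p'_def using szs szt by (auto intro: ser_continuous serx_continuous)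
    have n: "L2norm (\<lambda>x. y x - y' x) \<le> ?d" "L2norm (\<lambda>x. p x - p' x) \<le> ?d"
      using serx_norm_le[OF wnorm_le_diff[OF szt szs] H(2)[OF st] d0]
        ext[of "ser (\<lambda>k. sol t k - sol s k)" "\<lambda>x. y x - y' x"] ser_diff(1)[OF szt szs]
        ext[of "serx (\<lambda>k. sol t k - sol s k)" "\<lambda>x. p x - p' x"] ser_diff(2)[OF szt szs]
      unfolding y_def p_def y'_def p'_def by auto
    have yY: "\<bar>y x\<bar> \<le> Y" "\<bar>p' x\<bar> \<le> Y" for x
      using ser_le[OF szt, of x] serx_le[OF szs, of x] by (auto simp: y_def p'_def Y_def)
    have fY: "\<bar>fp (y x)\<bar> \<le> \<bar>fp 0\<bar> + L * Y" for x
      using fp_le[of "y x"] mult_left_mono[OF yY(1)[of x] L0] by linarith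
    have e: "nonlin (M t) (sol t) x - nonlin (M s) (sol s) x = ((r (y x) - r (y' x)) - fp (y x) * (p x - p' x)) - (fp (y x) - fp (y' x)) * p' x" for x
      by (simp add: nonlin_sol[OF pos(1)] nonlin_sol[OF pos(2)] y_def p_def y'_def p'_def algebra_simps)
    have "L2norm (\<lambda>x. nonlin (M t) (sol t) x - nonlin (M s) (sol s) x) \<le>
        L2norm (\<lambda>x. (r (y x) - r (y' x)) - fp (y x) * (p x - p' x)) + L2norm (\<lambda>x. (fp (y x) - fp (y' x)) * p' x)"
      unfolding e by (intro L2norm_diff_le L2_continuous continuous_intros c)
    moreover have "L2norm (\<lambda>x. (r (y x) - r (y' x)) - fp (y x) * (p x - p' x)) \<le> L2norm (\<lambda>x. r (y x) - r (y' x)) + L2norm (\<lambda>x. fp (y x) * (p x - p' x))"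
      by (intro L2norm_diff_le L2_continuous continuous_intros c)
    moreover have "L2norm (\<lambda>x. r (y x) - r (y' x)) \<le> L * L2norm (\<lambda>x. y x - y' x)"
      using L0 r_lip by (intro L2norm_le_scaled L2_continuous continuous_intros c) auto
    moreover have "L2norm (\<lambda>x. fp (y x) * (p x - p' x)) \<le> (\<bar>fp 0\<bar> + L * Y) * L2norm (\<lambda>x. p x - p' x)"
      using L0 Y0 fY by (intro L2norm_le_scaled L2_continuous continuous_intros c) (auto simp: abs_mult intro!: mult_right_mono)
    moreover have "L2norm (\<lambda>x. (fp (y x) - fp (y' x)) * p' x) \<le> (L * Y) * L2norm (\<lambda>x. y x - y' x)"
    proof (intro L2norm_le_scaled L2_continuous continuous_intros c)
      fix x
      have "\<bar>(fp (y x) - fp (y' x)) * p' x\<bar> \<le> (L * \<bar>y x - y' x\<bar>) * Y"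
        unfolding abs_mult using fp_lip yY L0 by (intro mult_mono) auto
      then show "\<bar>(fp (y x) - fp (y' x)) * p' x\<bar> \<le> L * Y * \<bar>y x - y' x\<bar>" by (simp add: mult_ac)
    qed (use L0 Y0 in auto)
    moreover have "L * L2norm (\<lambda>x. y x - y' x) \<le> L * ?d" "(L * Y) * L2norm (\<lambda>x. y x - y' x) \<le> (L * Y) * ?d"
      "(\<bar>fp 0\<bar> + L * Y) * L2norm (\<lambda>x. p x - p' x) \<le> (\<bar>fp 0\<bar> + L * Y) * ?d"
      using n L0 Y0 by (auto intro!: mult_left_mono)
    moreover have "C * (t - s) powr (2/5) = L * ?d + (\<bar>fp 0\<bar> + L * Y) * ?d + (L * Y) * ?d"
      by (simp add: C_def algebra_simps)
    ultimately show ?thesis by linarith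
  qed
  moreover have "0 \<le> C" using L0 H Y0 by (simp add: C_def)
  ultimately show thesis by (intro that[of C]) auto
qed

text \<open>The sine coefficients of the time derivative, read off from the ordinary differential
  equation of each mode.\<close>

definition bs :: "real \<Rightarrow> nat \<Rightarrow> real" where "bs t k = gs t k - (om k)\<^sup>2 * sol t k"

lemma bs_continuous: "continuous_on {0<..} (\<lambda>t. bs t k)"
  unfolding bs_def using admissible_sol by (intro continuous_intros gs_continuous) (simp add: admissible_def)

lemma sol_has_deriv: "0 < t \<Longrightarrow> ((\<lambda>t. sol t k) has_real_derivative bs t k) (at t)"
  using sol_deriv[of t k] by (simp add: bs_def gs_def)

text \<open>Multiplying the Duhamel integral by \<open>(om k)\<^sup>2\<close> would give a
  non-integrable kernel. Subtracting the value of the source at the final time, whose contribution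
  is an explicit integral, leaves increments \<open>gs t - gs \<sigma>\<close> whose Hoelder bound
  compensates the kernel.\<close>

lemma bs_formula:
  assumes s: "0 < s" "s < t"
  shows "bs t k = exp (- (om k)\<^sup>2 * (t - s)) * (gs t k - (om k)\<^sup>2 * sol s k) +
    (LINT \<sigma>:{s<..<t}|lborel. (om k)\<^sup>2 * (exp (- (om k)\<^sup>2 * (t - \<sigma>)) * (gs t k - gs \<sigma> k)))"
proof -
  have i1: "set_integrable lborel {s<..<t} (\<lambda>\<sigma>. exp (- (om k)\<^sup>2 * (t - \<sigma>)) * gs t k)"
    by (rule set_integrable_subset[of _ "{s..t}"]) (auto intro!: borel_integrable_atLeastAtMost' continuous_intros)
  have i2: "set_integrable lborel {s<..<t} (\<lambda>\<sigma>. exp (- (om k)\<^sup>2 * (t - \<sigma>)) * gs \<sigma> k)"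
    by (rule set_integrable_subset[of _ "{s..t}"])
      (use s in \<open>auto intro!: borel_integrable_atLeastAtMost' continuous_intros continuous_on_subset[OF gs_continuous]\<close>)
  have "(LINT \<sigma>:{s<..<t}|lborel. (om k)\<^sup>2 * (exp (- (om k)\<^sup>2 * (t - \<sigma>)) * (gs t k - gs \<sigma> k)))
     = (om k)\<^sup>2 * (LINT \<sigma>:{s<..<t}|lborel. exp (- (om k)\<^sup>2 * (t - \<sigma>)) * gs t k - exp (- (om k)\<^sup>2 * (t - \<sigma>)) * gs \<sigma> k)"
    unfolding set_integral_mult_right by (simp only: right_diff_distrib[of "exp _"])
  also have "\<dots> = (om k)\<^sup>2 * ((LINT \<sigma>:{s<..<t}|lborel. exp (- (om k)\<^sup>2 * (t - \<sigma>)) * gs t k) - duhamel gs s t k)"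
    using i1 i2 unfolding duhamel_def by (subst set_integral_diff) auto
  also have "\<dots> = ((om k)\<^sup>2 * (LINT \<sigma>:{s<..<t}|lborel. exp (- (om k)\<^sup>2 * (t - \<sigma>)))) * gs t k - (om k)\<^sup>2 * duhamel gs s t k"
    by (simp add: algebra_simps)
  also have "\<dots> = (1 - exp (- (om k)\<^sup>2 * (t - s))) * gs t k - (om k)\<^sup>2 * duhamel gs s t k"
    by (simp only: LINT_exp_decay[OF s(2)])
  finally show ?thesis unfolding bs_def sol_restart[OF s] by (simp add: algebra_simps)
qed

text \<open>Any positive weight suffices for uniform convergence of the series of the time
  derivative. The weight 1/8 is small enough for the Hoelder exponent 2/5 of the nonlinearity to
  make the compensated kernel integrable.\<close>

lemma bs_bound:
  assumes t0: "0 < t0" "t0 < T"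
  obtains B where "\<And>t K. t0 \<le> t \<Longrightarrow> t \<le> T \<Longrightarrow> (\<Sum>k<K. om k powr (1/8) * \<bar>bs t k\<bar>) \<le> B"
proof -
  \<comment> \<open>Restarting at half the minimal time keeps both \<open>s0\<close> and
    \<open>t - s0\<close> bounded below by \<open>t0 / 2\<close>.\<close>
  define s0 where "s0 = t0 / 2"
  have s0: "0 < s0" "s0 < T" "s0 < t0" and T: "0 < T" using t0 by (auto simp: s0_def)
  obtain C where C: "0 \<le> C" "\<And>t K. 0 < t \<Longrightarrow> t \<le> T \<Longrightarrow> (\<Sum>k<K. (gs t k)\<^sup>2) \<le> (C * t powr (- (15/16)))\<^sup>2"
    by (rule gs_bound[OF T]) (rule that)
  obtain B where B: "0 \<le> B" "\<And>t. 0 < t \<Longrightarrow> t \<le> T \<Longrightarrow> wnorm_le t B (sol t)" using admissible_bound[OF admissible_sol T] by blast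
  obtain N where N: "0 \<le> N" "\<And>s t. s0 \<le> s \<Longrightarrow> s < t \<Longrightarrow> t \<le> T \<Longrightarrow>
    L2norm (\<lambda>x. nonlin (M t) (sol t) x - nonlin (M s) (sol s) x) \<le> N * (t - s) powr (2/5)"
    by (rule nonlin_holder[OF s0(1,2)]) (rule that)
  obtain H1 where H1: "0 < H1" "\<And>\<tau> K. 0 < \<tau> \<Longrightarrow> (\<Sum>k<K. (om k powr (1/8) * exp (- (om k)\<^sup>2 * \<tau>))\<^sup>2) \<le> (H1 * \<tau> powr (- 1))\<^sup>2"
    using heat_sum[of 1 "1/8"] by auto
  \<comment> \<open>Here 17/8 is 2 + 1/8; \<open>heat_sum\<close> requires an exponent above 21/16,
    and 27/20 - 2/5 = 19/20 is below 1 after use of the Hoelder bound.\<close>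
  obtain H2 where H2: "0 < H2" "\<And>\<tau> K. 0 < \<tau> \<Longrightarrow> (\<Sum>k<K. (om k powr (17/8) * exp (- (om k)\<^sup>2 * \<tau>))\<^sup>2) \<le> (H2 * \<tau> powr (- (27/20)))\<^sup>2"
    using heat_sum[of "27/20" "17/8"] by auto
  have w: "om k powr (1/8) * (om k)\<^sup>2 = om k powr (17/8)" for k
  proof -
    have "om k powr (1/8) * om k powr 2 = om k powr (17/8)" by (simp only: powr_add[symmetric]) simp
    then show ?thesis by (simp add: powr_numeral)
  qed
  define R where "R = H1 * s0 powr (- 1) * (C * s0 powr (- (15/16))) + H2 * s0 powr (- (27/20)) * B + H2 * N * beta_int (19/20) 0 * T powr (1/20)"
  have "(\<Sum>k<K. om k powr (1/8) * \<bar>bs t k\<bar>) \<le> R" if t: "t0 \<le> t" "t \<le> T" for t K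
  proof -
    have st: "s0 < t" "0 < t" "s0 \<le> t - s0" using t s0 by (auto simp: s0_def)
    let ?E = "\<lambda>k. exp (- (om k)\<^sup>2 * (t - s0))"
    let ?I = "\<lambda>k. LINT \<sigma>:{s0<..<t}|lborel. om k powr (1/8) * ((om k)\<^sup>2 * (exp (- (om k)\<^sup>2 * (t - \<sigma>)) * (gs t k - gs \<sigma> k)))"
    have pw: "(t - s0) powr (- q) \<le> s0 powr (- q)" if "0 < q" for q
      using st s0 that by (intro powr_mono2') auto
    have "(\<Sum>k<K. \<bar>(om k powr (1/8) * ?E k) * gs t k\<bar>) \<le> (H1 * (t - s0) powr (- 1)) * (C * t powr (- (15/16)))"
      using H1 C st t by (intro sum_mult_le H1(2) C(2)) auto
    also have "\<dots> \<le> H1 * s0 powr (- 1) * (C * s0 powr (- (15/16)))"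
      using pw[of 1] H1(1) C(1) st s0 by (intro mult_mono mult_left_mono powr_mono2') auto
    finally have 1: "(\<Sum>k<K. \<bar>(om k powr (1/8) * ?E k) * gs t k\<bar>) \<le> H1 * s0 powr (- 1) * (C * s0 powr (- (15/16)))" .
    have "(\<Sum>k<K. \<bar>(om k powr (17/8) * ?E k) * sol s0 k\<bar>) \<le> (H2 * (t - s0) powr (- (27/20))) * B"
      using H2 B st t B(2)[of s0] s0 by (intro sum_mult_le H2(2)) (auto simp: wnorm_le_def)
    also have "\<dots> \<le> H2 * s0 powr (- (27/20)) * B"
      using pw[of "27/20"] H2(1) B(1) by (intro mult_right_mono mult_left_mono) auto
    finally have 2: "(\<Sum>k<K. \<bar>(om k powr (17/8) * ?E k) * sol s0 k\<bar>) \<le> H2 * s0 powr (- (27/20)) * B" .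
    have "(\<Sum>k<K. \<bar>?I k\<bar>) \<le> (H2 * N) * beta_int (19/20) 0 * (t - s0) powr (1 - 19/20 - 0)"
    proof (rule Beta_sum_abs)
      show "continuous_on {s0<..<t} (\<lambda>\<sigma>. om k powr (1/8) * ((om k)\<^sup>2 * (exp (- (om k)\<^sup>2 * (t - \<sigma>)) * (gs t k - gs \<sigma> k))))" for k
        by (intro continuous_intros continuous_on_subset[OF gs_continuous]) (use s0 in auto)
      fix \<sigma> K assume \<sigma>: "s0 < \<sigma>" "\<sigma> < t"
      have "(\<Sum>k<K. \<bar>om k powr (1/8) * ((om k)\<^sup>2 * (exp (- (om k)\<^sup>2 * (t - \<sigma>)) * (gs t k - gs \<sigma> k)))\<bar>) =
         (\<Sum>k<K. \<bar>(om k powr (17/8) * exp (- (om k)\<^sup>2 * (t - \<sigma>))) * (gs t k - gs \<sigma> k)\<bar>)"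
        unfolding w[symmetric] by (simp only: mult.assoc)
      also have "\<dots> \<le> (H2 * (t - \<sigma>) powr (- (27/20))) * (N * (t - \<sigma>) powr (2/5))"
      proof (intro sum_mult_le H2(2))
        have "(\<Sum>k<K. (gs t k - gs \<sigma> k)\<^sup>2) \<le> (L2norm (\<lambda>x. nonlin (M t) (sol t) x - nonlin (M \<sigma>) (sol \<sigma>) x))\<^sup>2"
        proof -
          have L: "nonlin (M t) (sol t) \<in> L2" "nonlin (M \<sigma>) (sol \<sigma>) \<in> L2"
            using B(2)[of t] B(2)[of \<sigma>] \<sigma> st s0 t by (auto intro!: L2_continuous nonlin_continuous)
          show ?thesis using Bessel[OF L2_diff[OF L], of K] by (simp add: cf_diff[OF L] gs_def)
        qed
        also have "\<dots> \<le> (N * (t - \<sigma>) powr (2/5))\<^sup>2" using N(2)[of \<sigma> t] \<sigma> t by (intro power_mono) auto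
        finally show "(\<Sum>k<K. (gs t k - gs \<sigma> k)\<^sup>2) \<le> (N * (t - \<sigma>) powr (2/5))\<^sup>2" .
      qed (use \<sigma> H2 N in auto)
      also have "\<dots> = (H2 * N) * ((t - \<sigma>) powr (- (27/20)) * (t - \<sigma>) powr (2/5)) * (\<sigma> - s0) powr (- 0)"
        using \<sigma> by (simp add: mult_ac)
      also have "(t - \<sigma>) powr (- (27/20)) * (t - \<sigma>) powr (2/5) = (t - \<sigma>) powr (- (19/20))"
        by (simp flip: powr_add)
      finally show "(\<Sum>k<K. \<bar>om k powr (1/8) * ((om k)\<^sup>2 * (exp (- (om k)\<^sup>2 * (t - \<sigma>)) * (gs t k - gs \<sigma> k)))\<bar>)
         \<le> (H2 * N) * (t - \<sigma>) powr (- (19/20)) * (\<sigma> - s0) powr (- 0)" .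
    qed (use st in auto)
    also have "\<dots> \<le> H2 * N * beta_int (19/20) 0 * T powr (1/20)"
      using H2(1) N(1) st s0 t by (intro mult_left_mono) (auto intro!: powr_mono2)
    finally have 3: "(\<Sum>k<K. \<bar>?I k\<bar>) \<le> H2 * N * beta_int (19/20) 0 * T powr (1/20)" .
    have "om k powr (1/8) * \<bar>bs t k\<bar> \<le> \<bar>(om k powr (1/8) * ?E k) * gs t k\<bar> + \<bar>(om k powr (17/8) * ?E k) * sol s0 k\<bar> + \<bar>?I k\<bar>" for k
    proof -
      have "om k powr (1/8) * bs t k = (om k powr (1/8) * ?E k) * gs t k - (om k powr (17/8) * ?E k) * sol s0 k + ?I k"
      proof -
        define J where "J = (LINT \<sigma>:{s0<..<t}|lborel. (om k)\<^sup>2 * (exp (- (om k)\<^sup>2 * (t - \<sigma>)) * (gs t k - gs \<sigma> k)))"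
        have I: "?I k = om k powr (1/8) * J" unfolding J_def by (rule set_integral_mult_right)
        show ?thesis
          unfolding I bs_formula[OF s0(1) st(1)] J_def[symmetric] w[symmetric] by (simp add: algebra_simps)
      qed
      then have "\<bar>om k powr (1/8) * bs t k\<bar> \<le> \<bar>(om k powr (1/8) * ?E k) * gs t k\<bar> + \<bar>(om k powr (17/8) * ?E k) * sol s0 k\<bar> + \<bar>?I k\<bar>"
        by linarith
      then show ?thesis by (simp add: abs_mult)
    qed
    then have "(\<Sum>k<K. om k powr (1/8) * \<bar>bs t k\<bar>) \<le>
       (\<Sum>k<K. \<bar>(om k powr (1/8) * ?E k) * gs t k\<bar> + \<bar>(om k powr (17/8) * ?E k) * sol s0 k\<bar> + \<bar>?I k\<bar>)"
      by (rule sum_mono)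
    then show ?thesis using 1 2 3 unfolding R_def sum.distrib by linarith
  qed
  then show thesis by (rule that)
qed

definition yt :: "real \<Rightarrow> real \<Rightarrow> real" where "yt x t = (\<Sum>k. bs t k * es k x)"

lemma yt_continuous: "continuous_on (UNIV \<times> {0<..}) (\<lambda>(x,t). yt x t)"
  unfolding yt_def
proof (rule weighted_series_continuous[of "1/8"])
  fix a b :: real assume ab: "0 < a" "a < b"
  obtain B where "\<And>t K. a \<le> t \<Longrightarrow> t \<le> b \<Longrightarrow> (\<Sum>k<K. om k powr (1/8) * \<bar>bs t k\<bar>) \<le> B"
    by (rule bs_bound[OF ab]) (rule that)
  then show "\<exists>B. \<forall>t\<in>{a<..<b}. \<forall>K. (\<Sum>k<K. om k powr (1/8) * \<bar>bs t k\<bar>) \<le> B" by (intro exI[of _ B]) auto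
qed (auto intro: bs_continuous continuous_intros es_le)

lemma ser_time_deriv:
  assumes t: "0 < t"
  shows "((\<lambda>t. ser (sol t) x) has_real_derivative yt x t) (at t)"
proof -
  define a b where "a = t / 2" and "b = t + 1"
  have ab: "0 < a" "a < b" "a < t" "t < b" using t by (auto simp: a_def b_def)
  obtain B where B: "\<And>t K. a \<le> t \<Longrightarrow> t \<le> b \<Longrightarrow> (\<Sum>k<K. om k powr (1/8) * \<bar>bs t k\<bar>) \<le> B"
    by (rule bs_bound[OF ab(1,2)]) (rule that)
  obtain A where A: "wnorm_le t A (sol t)" using admissible_bound[OF admissible_sol t] t by blast
  have "((\<lambda>t. \<Sum>k. sol t k * es k x) has_field_derivative (\<Sum>k. bs t k * es k x)) (at t)"
  proof (rule has_field_derivative_series'(2)[of "{a..b}"])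
    show "uniformly_convergent_on {a..b} (\<lambda>n t. \<Sum>k<n. bs t k * es k x)"
      unfolding uniformly_convergent_on_def
      by (rule exI, rule weighted_series_uniform_limit[of "1/8", OF _ B]) (auto intro: es_le)
    show "((\<lambda>t. sol t k * es k x) has_field_derivative bs s k * es k x) (at s within {a..b})" if "s \<in> {a..b}" for k s
      using that ab by (intro DERIV_cmult_right has_field_derivative_at_within[OF sol_has_deriv]) auto
    show "summable (\<lambda>k. sol t k * es k x)" by (rule wnorm_le_summable(1)[OF A])
  qed (use ab in auto)
  then show ?thesis by (simp add: ser_def yt_def)
qed

lemma cf_yt:
  assumes t: "0 < t" shows "cf (\<lambda>x. yt x t) k = bs t k"
proof (rule LIMSEQ_unique)
  obtain B where B: "\<And>s K. t \<le> s \<Longrightarrow> s \<le> t + 1 \<Longrightarrow> (\<Sum>k<K. om k powr (1/8) * \<bar>bs s k\<bar>) \<le> B"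
    by (rule bs_bound[of t "t + 1"]) (use t that in auto)
  have c: "continuous_on {0..1} (\<lambda>x. yt x t)"
    by (rule continuous_slice[of _ "{0<..}"], rule continuous_on_subset[OF yt_continuous]) (use t in auto)
  have "uniform_limit UNIV (\<lambda>K x. \<Sum>k<K. bs t k * es k x) (\<lambda>x. \<Sum>k. bs t k * es k x) sequentially"
    by (rule weighted_series_uniform_limit[of "1/8", OF _ B es_le]) auto
  then have "uniform_limit UNIV (psum (bs t)) (\<lambda>x. yt x t) sequentially"
    by (simp only: psum_def[abs_def] yt_def)
  then show "(\<lambda>K. cf (psum (bs t) K) k) \<longlonglongrightarrow> cf (\<lambda>x. yt x t) k"
    by (intro cf_tendsto uniform_limit_imp_L2 L2_continuous[OF c]) auto
  show "(\<lambda>n. cf (psum (bs t) n) k) \<longlonglongrightarrow> bs t k"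
    unfolding psum_cf by (rule tendsto_eventually, rule eventually_sequentiallyI[of "Suc k"]) auto
qed

text \<open>The time derivative minus the nonlinearity is continuous and has coefficients
  \<open>- (om k)\<^sup>2 * sol t k\<close>, so \<open>dirichlet_primitive\<close> identifies it as
  the second space derivative.\<close>

lemma serx_deriv:
  assumes t: "0 < t" and x: "x \<in> {0<..<1}"
  shows "(serx (sol t) has_real_derivative (yt x t + fp (ser (sol t) x) * serx (sol t) x - r (ser (sol t) x))) (at x)"
proof -
  obtain A where A: "wnorm_le t A (sol t)" using admissible_bound[OF admissible_sol t] t by blast
  have c: "continuous_on {0..1} (\<lambda>x. yt x t)"
    by (rule continuous_slice[of _ "{0<..}"], rule continuous_on_subset[OF yt_continuous]) (use t in auto)
  note cN = nonlin_continuous[OF A]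
  have "(serx (sol t) has_real_derivative (yt x t - nonlin (M t) (sol t) x)) (at x)"
  proof (rule dirichlet_primitive[OF _ ser_continuous[OF A] _ ser_deriv[OF A] x])
    show "continuous_on {0..1} (\<lambda>x. yt x t - nonlin (M t) (sol t) x)" by (intro continuous_intros c cN)
    show "cf (\<lambda>x. yt x t - nonlin (M t) (sol t) x) k = - (om k)\<^sup>2 * cf (ser (sol t)) k" for k
      by (simp add: cf_diff[OF L2_continuous[OF c] L2_continuous[OF cN]] cf_yt[OF t] cf_ser[OF A] bs_def gs_def)
  qed
  then show ?thesis by (simp add: nonlin_sol[OF t] algebra_simps)
qed

end

section \<open>Assembly and existence of the classical solution\<close>

context untruncated
begin

definition ysol :: "real \<Rightarrow> real \<Rightarrow> real" where
  "ysol x t = (if x \<in> {0..1} \<and> 0 < t then ser (sol t) x else 0)"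

text \<open>Tonelli turns the integral over the rectangle into the time integral of the squared L2
  norms, which is finite by \<open>dissipation\<close>.\<close>

lemma serx_square_integrable:
  assumes T: "0 < T"
  shows "set_integrable lborel ({0<..<1} \<times> {0<..<T}) (\<lambda>p. (serx (sol (snd p)) (fst p))\<^sup>2)"
  unfolding set_integrable_def
proof (rule integrableI_nonneg)
  let ?S = "{0<..<1::real} \<times> {0<..<T}"
  let ?f = "\<lambda>p. indicator ?S p *\<^sub>R (serx (sol (snd p)) (fst p))\<^sup>2"
  have c: "continuous_on ?S (\<lambda>p. (serx (sol (snd p)) (fst p))\<^sup>2)"
    by (intro continuous_on_power continuous_on_subset[OF admissible_continuous(2)[OF admissible_sol, unfolded case_prod_beta']]) auto
  have "?S \<in> sets borel" by (intro borel_open open_Times) auto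
  from borel_measurable_continuous_on_indicator[OF this c]
  show m: "?f \<in> borel_measurable lborel" by simp
  have m2: "(\<lambda>p. ennreal (?f p)) \<in> borel_measurable (lborel \<Otimes>\<^sub>M lborel)"
    unfolding lborel_prod using m by (rule measurable_compose[OF _ measurable_ennreal])
  have "(\<integral>\<^sup>+p. ennreal (?f p) \<partial>lborel) = (\<integral>\<^sup>+t. (\<integral>\<^sup>+x. ennreal (?f (x, t)) \<partial>lborel) \<partial>lborel)"
    unfolding lborel_prod[symmetric] using lborel_pair.nn_integral_snd[OF m2] by simp
  also have "\<dots> \<le> (\<integral>\<^sup>+t. ennreal ((L2norm (serx (sol t)))\<^sup>2) * indicator {0<..<T} t \<partial>lborel)"
  proof (rule nn_integral_mono)
    fix t
    show "(\<integral>\<^sup>+x. ennreal (?f (x, t)) \<partial>lborel) \<le> ennreal ((L2norm (serx (sol t)))\<^sup>2) * indicator {0<..<T} t"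
    proof (cases "t \<in> {0<..<T}")
      case True
      then obtain A where A: "wnorm_le t A (sol t)" using admissible_bound[OF admissible_sol, of t] by auto
      have i: "set_integrable lborel {0..1} (\<lambda>x. serx (sol t) x * serx (sol t) x)"
        by (rule L2_mult_integrable[OF serx_L2[OF A] serx_L2[OF A]])
      have "(\<integral>\<^sup>+x. ennreal (?f (x, t)) \<partial>lborel) \<le> (\<integral>\<^sup>+x. ennreal (indicator {0..1} x *\<^sub>R (serx (sol t) x * serx (sol t) x)) \<partial>lborel)"
        by (intro nn_integral_mono ennreal_leI) (auto simp: indicator_def power2_eq_square)
      also have "\<dots> = ennreal ((L2norm (serx (sol t)))\<^sup>2)"
        unfolding L2norm_power2 L2inner_def set_lebesgue_integral_def
        using i by (intro nn_integral_eq_integral) (auto simp: set_integrable_def)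
      finally show ?thesis using True by simp
    next
      case False
      then have "indicator ?S (x, t) = (0 :: real)" for x by (auto simp: indicator_def)
      then show ?thesis by simp
    qed
  qed
  also have "\<dots> < \<infinity>" by (rule dissipation[OF T])
  finally show "(\<integral>\<^sup>+p. ennreal (?f p) \<partial>lborel) < \<infinity>" .
qed auto

lemma ysol_evolution:
  assumes fp: "fp = deriv f"
  shows "evolution_solution f r u ysol"
  unfolding evolution_solution_def
proof (intro conjI)
  show "\<forall>x t. x \<notin> {0..1} \<or> t \<le> 0 \<longrightarrow> ysol x t = 0" by (auto simp: ysol_def)
  have "continuous_on ({0..1} \<times> {0<..}) (\<lambda>(x,t). ser (sol t) x)"
    by (rule continuous_on_subset[OF admissible_continuous(1)[OF admissible_sol]]) auto
  then show "continuous_on ({0..1} \<times> {0<..}) (\<lambda>(x, t). ysol x t)"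
    by (rule continuous_on_eq) (auto simp: ysol_def)
  show "\<forall>t>0. ysol 0 t = 0 \<and> ysol 1 t = 0" by (auto simp: ysol_def ser_01)
  have "\<forall>\<^sub>F t in at_right 0. L2norm (\<lambda>x. ser (sol t) x - u x) = L2norm (\<lambda>x. ysol x t - u x)"
    using eventually_at_right_less[of 0] by eventually_elim (auto intro!: L2norm_cong simp: ysol_def)
  from sol_initial this show "((\<lambda>t. L2norm (\<lambda>x. ysol x t - u x)) \<longlongrightarrow> 0) (at_right 0)"
    by (rule Lim_transform_eventually)
  let ?S = "{0<..<1::real} \<times> {0<..}"
  define px where "px = (\<lambda>x t. serx (sol t) x)"
  define pxx where "pxx = (\<lambda>x t. yt x t + fp (ser (sol t) x) * serx (sol t) x - r (ser (sol t) x))"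
  have c: "continuous_on ?S (\<lambda>(x,t). ser (sol t) x)" "continuous_on ?S (\<lambda>(x,t). serx (sol t) x)" "continuous_on ?S (\<lambda>(x,t). yt x t)"
    using admissible_continuous[OF admissible_sol] yt_continuous by (auto elim!: continuous_on_subset)
  show "\<exists>yx yxx yt.
        continuous_on ?S (\<lambda>(x,t). yx x t) \<and>
        continuous_on ?S (\<lambda>(x,t). yxx x t) \<and>
        continuous_on ?S (\<lambda>(x,t). yt x t) \<and>
        (\<forall>x \<in> {0<..<1}. \<forall>t > 0.
            ((\<lambda>s. ysol s t) has_real_derivative yx x t) (at x) \<and>
            ((\<lambda>s. yx s t) has_real_derivative yxx x t) (at x) \<and>
            ((\<lambda>\<tau>. ysol x \<tau>) has_real_derivative yt x t) (at t) \<and>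
            yt x t + deriv f (ysol x t) * yx x t = yxx x t + r (ysol x t)) \<and>
        (\<forall>T>0. set_integrable lborel ({0<..<1} \<times> {0<..<T}) (\<lambda>p. (yx (fst p) (snd p))\<^sup>2))"
  proof (rule exI[of _ px], rule exI[of _ pxx], rule exI[of _ yt], intro conjI ballI allI impI)
    show "continuous_on ?S (\<lambda>(x,t). px x t)" using c(2) by (simp add: px_def)
    show "continuous_on ?S (\<lambda>(x,t). pxx x t)"
      using c unfolding pxx_def case_prod_beta' by (intro continuous_intros)
    show "continuous_on ?S (\<lambda>(x,t). yt x t)" by (rule c(3))
    show "set_integrable lborel ({0<..<1} \<times> {0<..<T}) (\<lambda>p. (px (fst p) (snd p))\<^sup>2)" if "0 < T" for T
      unfolding px_def by (rule serx_square_integrable[OF that])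
    fix x t :: real assume x: "x \<in> {0<..<1}" and t: "0 < t"
    obtain A where A: "wnorm_le t A (sol t)" using admissible_bound[OF admissible_sol t] t by blast
    show "((\<lambda>s. ysol s t) has_real_derivative px x t) (at x)"
    proof (rule DERIV_cong_ev[THEN iffD1, rotated -1])
      show "(ser (sol t) has_real_derivative px x t) (at x)" unfolding px_def by (rule ser_deriv[OF A])
      have "\<forall>\<^sub>F s in nhds x. s \<in> {0<..<1}" using x by (intro eventually_nhds_in_open) auto
      then show "\<forall>\<^sub>F s in nhds x. ser (sol t) s = ysol s t" by eventually_elim (use t in \<open>auto simp: ysol_def\<close>)
    qed auto
    show "((\<lambda>s. px s t) has_real_derivative pxx x t) (at x)"
      unfolding px_def pxx_def by (rule serx_deriv[OF t x])
    show "((\<lambda>\<tau>. ysol x \<tau>) has_real_derivative yt x t) (at t)"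
    proof (rule DERIV_cong_ev[THEN iffD1, rotated -1])
      show "((\<lambda>\<tau>. ser (sol \<tau>) x) has_real_derivative yt x t) (at t)" by (rule ser_time_deriv[OF t])
      have "\<forall>\<^sub>F s in nhds t. s \<in> {0<..}" using t by (intro eventually_nhds_in_open) auto
      then show "\<forall>\<^sub>F s in nhds t. ser (sol s) x = ysol x s" by eventually_elim (use x in \<open>auto simp: ysol_def\<close>)
    qed auto
    show "yt x t + deriv f (ysol x t) * px x t = pxx x t + r (ysol x t)"
    proof -
      have "ysol x t = ser (sol t) x" using x t by (simp add: ysol_def)
      then show ?thesis by (simp add: px_def pxx_def flip: fp)
    qed
  qed
qed

lemma ysol_bound:
  assumes "0 < t" shows "(L2norm (\<lambda>x. ysol x t))\<^sup>2 \<le> exp ((1 + 2 * L) * t) * ((L2norm u)\<^sup>2 + \<bar>r 0\<bar>\<^sup>2 * t)"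
proof -
  have "L2norm (\<lambda>x. ysol x t) = L2norm (ser (sol t))" by (rule L2norm_cong) (use assms in \<open>auto simp: ysol_def\<close>)
  then show ?thesis using energy_bound[OF assms] by simp
qed

end

lemma evolution_exists:
  assumes u: "u \<in> L2" and L: "0 \<le> L" "\<And>a b. \<bar>r a - r b\<bar> \<le> L * \<bar>a - b\<bar>" "\<And>a b. \<bar>deriv f a - deriv f b\<bar> \<le> L * \<bar>a - b\<bar>"
  obtains y where "evolution_solution f r u y"
    "\<And>t. 0 < t \<Longrightarrow> (L2norm (\<lambda>x. y x t))\<^sup>2 \<le> exp ((1 + 2 * L) * t) * ((L2norm u)\<^sup>2 + \<bar>r 0\<bar>\<^sup>2 * t)"
proof -
  \<comment> \<open>Its square dominates the energy bound: the root of the bracket is at most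
    \<open>L2norm u + \<bar>r 0\<bar> * (1 + t)\<close>, and squaring the exponential only increases
    it. The \<open>+ 1\<close> gives positivity for zero data, and \<open>max 0 t\<close> for
    negative times.\<close>
  define M where "M t = exp ((1 + 2 * L) * max 0 t) * (L2norm u + \<bar>r 0\<bar> * (1 + max 0 t) + 1)" for t
  interpret untruncated "deriv f" r L M u
  proof unfold_locales
    show "continuous_on {0<..} M" unfolding M_def by (intro continuous_intros)
    show "0 < M t" for t unfolding M_def by (intro mult_pos_pos add_nonneg_pos) auto
    show "M s \<le> M t" if "0 < s" "s \<le> t" for s t
      unfolding M_def using that L(1) by (intro mult_mono add_mono mult_left_mono) auto
    show "exp ((1 + 2 * L) * t) * ((L2norm u)\<^sup>2 + \<bar>r 0\<bar>\<^sup>2 * t) \<le> (M t)\<^sup>2" if t: "0 < t" for t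
    proof -
      define E where "E = exp ((1 + 2 * L) * t)"
      have E: "1 \<le> E" using L(1) t by (simp add: E_def)
      define n R where "n = L2norm u" and "R = \<bar>r 0\<bar>"
      have nR: "0 \<le> n" "0 \<le> R" by (auto simp: n_def R_def)
      have "R\<^sup>2 * t \<le> R\<^sup>2 * (1 + t)\<^sup>2" using t by (intro mult_left_mono) (auto simp: power2_eq_square algebra_simps)
      then have "n\<^sup>2 + R\<^sup>2 * t \<le> n\<^sup>2 + (R * (1 + t))\<^sup>2" by (simp add: power_mult_distrib)
      also have "\<dots> \<le> (n + R * (1 + t))\<^sup>2" using nR t by (simp add: power2_sum)
      also have "\<dots> \<le> (n + R * (1 + t) + 1)\<^sup>2" using nR t by (intro power_mono) auto
      finally have 1: "n\<^sup>2 + R\<^sup>2 * t \<le> (n + R * (1 + t) + 1)\<^sup>2" .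
      have "E * (n\<^sup>2 + R\<^sup>2 * t) \<le> E\<^sup>2 * (n + R * (1 + t) + 1)\<^sup>2"
        using 1 E nR t by (intro mult_mono) (auto simp: power2_eq_square)
      then show ?thesis using t by (simp add: M_def E_def n_def R_def power_mult_distrib max_def)
    qed
  qed (use u L in auto)
  show thesis by (rule that[OF ysol_evolution[OF refl] ysol_bound])
qed

section \<open>Uniqueness and continuous dependence\<close>

text \<open>The derivatives of a classical solution are only controlled inside \<open>(0,1)\<close>. Integration by parts
  is therefore carried out on \<open>[shrink n, 1 - shrink n]\<close>, against sines that vanish at its end points.\<close>

definition shrink :: "nat \<Rightarrow> real" where "shrink n = 1 / (real n + 4)"

lemma shrink_bounds: "0 < shrink n" "shrink n \<le> 1/4" "shrink n < 1 - shrink n" "{shrink n..1 - shrink n} \<subseteq> {0<..<1}"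
proof -
  have 1: "0 < shrink n" "shrink n \<le> 1/4" by (auto simp: shrink_def field_simps)
  then show "0 < shrink n" "shrink n \<le> 1/4" "shrink n < 1 - shrink n" "{shrink n..1 - shrink n} \<subseteq> {0<..<1}" by auto
qed

lemma shrink_tendsto: "shrink \<longlonglongrightarrow> 0"
proof -
  have "(\<lambda>n. inverse (real (Suc (Suc (Suc (Suc n)))))) \<longlonglongrightarrow> 0"
    by (rule LIMSEQ_Suc[OF LIMSEQ_Suc[OF LIMSEQ_Suc[OF LIMSEQ_inverse_real_of_nat]]])
  then show ?thesis by (simp add: shrink_def[abs_def] field_simps)
qed

text \<open>The frequency is divided by the length of the shortened interval. Since
  \<open>shrink n \<le> 1/4\<close>, this length is at least 1/2, so the modified frequencies stay
  below \<open>2 * om k\<close> for all \<open>n\<close>.\<close>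

definition kap :: "nat \<Rightarrow> nat \<Rightarrow> real" where "kap k n = om k / (1 - 2 * shrink n)"
definition ss :: "nat \<Rightarrow> nat \<Rightarrow> real \<Rightarrow> real" where "ss k n x = sqrt 2 * sin (kap k n * (x - shrink n))"
definition sc :: "nat \<Rightarrow> nat \<Rightarrow> real \<Rightarrow> real" where "sc k n x = sqrt 2 * cos (kap k n * (x - shrink n))"

lemma kap_bounds: "0 \<le> kap k n" "kap k n \<le> 2 * om k"
proof -
  have s: "1/2 \<le> 1 - 2 * shrink n" using shrink_bounds(2)[of n] by simp
  then show "0 \<le> kap k n" by (simp add: kap_def)
  have "om k * 1 \<le> om k * (2 * (1 - 2 * shrink n))" using s by (intro mult_left_mono) auto
  then show "kap k n \<le> 2 * om k" using s by (simp add: kap_def divide_le_eq mult_ac)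
qed

lemma kap_tendsto: "kap k \<longlonglongrightarrow> om k"
proof -
  have "(\<lambda>n. om k / (1 - 2 * shrink n)) \<longlonglongrightarrow> om k / (1 - 2 * 0)"
    by (intro tendsto_intros shrink_tendsto) simp
  then show ?thesis by (simp add: kap_def[abs_def])
qed

lemma ss_ends: "ss k n (shrink n) = 0" "ss k n (1 - shrink n) = 0"
proof -
  show "ss k n (shrink n) = 0" by (simp add: ss_def)
  have "kap k n * (1 - shrink n - shrink n) = om k" using shrink_bounds(2)[of n] by (simp add: kap_def field_simps)
  then show "ss k n (1 - shrink n) = 0" by (simp add: ss_def)
qed

lemma sqrt2_trig_le: "\<bar>sqrt 2 * sin z\<bar> \<le> 2" "\<bar>sqrt 2 * cos z\<bar> \<le> 2"
proof -
  have "sqrt 2 \<le> 2" using real_sqrt_le_mono[of 2 4] by simp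
  then have "sqrt 2 * \<bar>sin z\<bar> \<le> 2 * 1" "sqrt 2 * \<bar>cos z\<bar> \<le> 2 * 1" by (intro mult_mono; simp)+
  then show "\<bar>sqrt 2 * sin z\<bar> \<le> 2" "\<bar>sqrt 2 * cos z\<bar> \<le> 2" by (simp_all add: abs_mult)
qed

lemma ss_le: "\<bar>ss k n x\<bar> \<le> 2" and sc_le: "\<bar>sc k n x\<bar> \<le> 2"
  unfolding ss_def sc_def by (rule sqrt2_trig_le)+

lemma
  fixes h :: "'a::t2_space \<Rightarrow> real"
  shows ss_cont [continuous_intros]: "continuous_on S h \<Longrightarrow> continuous_on S (\<lambda>x. ss k n (h x))"
  and sc_cont [continuous_intros]: "continuous_on S h \<Longrightarrow> continuous_on S (\<lambda>x. sc k n (h x))"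
  unfolding ss_def sc_def by (auto intro!: continuous_intros)

lemma ss_deriv: "(ss k n has_real_derivative kap k n * sc k n x) (at x within A)"
  and sc_deriv: "(sc k n has_real_derivative - (kap k n * ss k n x)) (at x within A)"
  unfolding ss_def sc_def by (auto intro!: derivative_eq_intros)

lemma ss_tendsto: "(\<lambda>n. ss k n x) \<longlonglongrightarrow> es k x" and sc_tendsto: "(\<lambda>n. sc k n x) \<longlonglongrightarrow> ec k x"
proof -
  have "(\<lambda>n. kap k n * (x - shrink n)) \<longlonglongrightarrow> om k * (x - 0)"
    by (intro tendsto_intros kap_tendsto shrink_tendsto)
  then have "(\<lambda>n. kap k n * (x - shrink n)) \<longlonglongrightarrow> om k * x" by simp
  then show "(\<lambda>n. ss k n x) \<longlonglongrightarrow> es k x" "(\<lambda>n. sc k n x) \<longlonglongrightarrow> ec k x"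
    unfolding ss_def sc_def es_def ec_def by (auto intro!: tendsto_intros)
qed

lemma shrink_integral_tendsto:
  assumes g: "continuous_on {0..1} g" and E: "\<And>n. continuous_on UNIV (E n)" "\<And>n x. \<bar>E n x\<bar> \<le> 2" "\<And>x. (\<lambda>n. E n x) \<longlonglongrightarrow> F x"
  shows "(\<lambda>n. integral {shrink n..1 - shrink n} (\<lambda>x. E n x * g x)) \<longlonglongrightarrow> L2inner g F"
proof -
  let ?I = "\<lambda>n x. indicator {shrink n..1 - shrink n} x *\<^sub>R (E n x * g x)"
  have sub: "{shrink n..1 - shrink n} \<subseteq> {0..1}" for n using shrink_bounds[of n] by auto
  have i: "set_integrable lborel {shrink n..1 - shrink n} (\<lambda>x. E n x * g x)" for n
    by (intro borel_integrable_atLeastAtMost' continuous_intros continuous_on_subset[OF g sub] continuous_on_subset[OF E(1)]) auto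
  have gi: "set_integrable lborel {0..1} g" by (rule borel_integrable_atLeastAtMost'[OF g])
  have lim: "(\<lambda>n. ?I n x) \<longlonglongrightarrow> indicator {0<..<1} x *\<^sub>R (g x * F x)" for x
  proof (cases "x \<in> {0<..<1}")
    case True
    have "\<forall>\<^sub>F n in sequentially. shrink n < x" "\<forall>\<^sub>F n in sequentially. shrink n < 1 - x"
      using True by (auto intro!: order_tendstoD[OF shrink_tendsto])
    then have "\<forall>\<^sub>F n in sequentially. E n x * g x = ?I n x"
      by eventually_elim auto
    moreover have "(\<lambda>n. E n x * g x) \<longlonglongrightarrow> F x * g x" by (intro tendsto_intros E(3))
    ultimately have "(\<lambda>n. ?I n x) \<longlonglongrightarrow> F x * g x" by (rule Lim_transform_eventually[rotated])
    then show ?thesis using True by (simp add: mult.commute)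
  next
    case False
    then have "x \<notin> {shrink n..1 - shrink n}" for n using shrink_bounds(4)[of n] by blast
    then have "?I n x = 0" for n by (subst indicator_simps(2)) auto
    then show ?thesis using False by (simp del: scaleR_eq_0_iff real_scaleR_def)
  qed
  have "(\<lambda>n. LINT x|lborel. ?I n x) \<longlonglongrightarrow> (LINT x|lborel. indicator {0<..<1} x *\<^sub>R (g x * F x))"
  proof (rule integral_dominated_convergence[where w="\<lambda>x. 2 * \<bar>indicator {0..1} x *\<^sub>R g x\<bar>"])
    show m: "?I n \<in> borel_measurable lborel" for n using i unfolding set_integrable_def by (rule borel_measurable_integrable)
    show "(\<lambda>x. indicator {0<..<1} x *\<^sub>R (g x * F x)) \<in> borel_measurable lborel"
      by (rule borel_measurable_LIMSEQ_real[OF lim m])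
    show "integrable lborel (\<lambda>x. 2 * \<bar>indicator {0..1} x *\<^sub>R g x\<bar>)"
      using gi unfolding set_integrable_def by (intro integrable_mult_right integrable_abs)
    show "AE x in lborel. (\<lambda>n. ?I n x) \<longlonglongrightarrow> indicator {0<..<1} x *\<^sub>R (g x * F x)" using lim by simp
    show "AE x in lborel. norm (?I n x) \<le> 2 * \<bar>indicator {0..1} x *\<^sub>R g x\<bar>" for n
    proof (rule AE_I2)
      fix x
      have "\<bar>E n x\<bar> * \<bar>g x\<bar> \<le> 2 * \<bar>g x\<bar>" using E(2) by (intro mult_right_mono) auto
      then show "norm (?I n x) \<le> 2 * \<bar>indicator {0..1} x *\<^sub>R g x\<bar>"
        using sub[of n] by (auto simp: indicator_def abs_mult)
    qed
  qed
  moreover have "(LINT x|lborel. ?I n x) = integral {shrink n..1 - shrink n} (\<lambda>x. E n x * g x)" for n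
    using set_borel_integral_eq_integral(2)[OF i[of n]] by (simp add: set_lebesgue_integral_def)
  moreover have "(LINT x|lborel. indicator {0<..<1} x *\<^sub>R (g x * F x)) = L2inner g F"
    using LINT_open_closed[of 0 1 "\<lambda>x. g x * F x"] by (simp add: L2inner_def set_lebesgue_integral_def)
  ultimately show ?thesis by simp
qed

lemma continuous_bounded_rectangle:
  fixes h :: "real \<Rightarrow> real \<Rightarrow> real"
  assumes "continuous_on ({0..1} \<times> {0<..}) (\<lambda>(x,t). h x t)" "0 < s"
  obtains B where "0 \<le> B" "\<And>x \<tau>. x \<in> {0..1} \<Longrightarrow> \<tau> \<in> {s..t} \<Longrightarrow> \<bar>h x \<tau>\<bar> \<le> B"
proof -
  have "compact ((\<lambda>(x,t). h x t) ` ({0..1} \<times> {s..t}))"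
    by (intro compact_continuous_image compact_Times continuous_on_subset[OF assms(1)]) (use assms(2) in \<open>auto intro: less_le_trans\<close>)
  then obtain B where "\<forall>z\<in>(\<lambda>(x,t). h x t) ` ({0..1} \<times> {s..t}). norm z \<le> B"
    using compact_imp_bounded bounded_iff by blast
  then have "\<bar>h x \<tau>\<bar> \<le> max 0 B" if "x \<in> {0..1}" "\<tau> \<in> {s..t}" for x \<tau>
    using that by (force simp: le_max_iff_disj)
  then show thesis by (intro that[of "max 0 B"]) auto
qed

section \<open>Sine coefficients of an arbitrary classical solution\<close>

locale solution =
  fixes f r u y and L :: real
  assumes sol: "evolution_solution f r u y" and u: "u \<in> L2"
    and L0: "0 \<le> L" and r_lip: "\<And>a b. \<bar>r a - r b\<bar> \<le> L * \<bar>a - b\<bar>" and fp_lip: "\<And>a b. \<bar>deriv f a - deriv f b\<bar> \<le> L * \<bar>a - b\<bar>"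
    and f_deriv: "\<And>x. (f has_real_derivative deriv f x) (at x)"
begin

lemma y_cont: "continuous_on ({0..1} \<times> {0<..}) (\<lambda>(x,t). y x t)"
  using sol by (simp add: evolution_solution_def)

lemma y_01: "0 < t \<Longrightarrow> y 0 t = 0" "0 < t \<Longrightarrow> y 1 t = 0"
  using sol by (auto simp: evolution_solution_def)

lemma f_cont: "continuous_on S f"
  by (rule DERIV_continuous_on[OF has_field_derivative_at_within[OF f_deriv]])

lemma r_cont: "continuous_on S r" by (rule lipschitz_continuous_on[OF r_lip L0])

lemma fp_cont: "continuous_on S (deriv f)" by (rule lipschitz_continuous_on[OF fp_lip L0])

lemma fy_cont: "continuous_on ({0..1} \<times> {0<..}) (\<lambda>(x,t). f (y x t))"
  and ry_cont: "continuous_on ({0..1} \<times> {0<..}) (\<lambda>(x,t). r (y x t))"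
  using continuous_on_compose2[OF f_cont[of UNIV] y_cont] continuous_on_compose2[OF r_cont[of UNIV] y_cont]
  by (auto simp: case_prod_beta')

lemma slice:
  assumes "0 < t"
  shows "continuous_on {0..1} (\<lambda>x. y x t)" "continuous_on {0..1} (\<lambda>x. f (y x t))" "continuous_on {0..1} (\<lambda>x. r (y x t))"
  using continuous_slice[OF y_cont] continuous_slice[OF fy_cont] continuous_slice[OF ry_cont] assms by auto

text \<open>The coefficient of \<open>r(y) - f(y)\<^sub>x\<close> in weak form: the derivative has
  been moved to the sine, so no space derivative of the solution occurs.\<close>

definition hs :: "real \<Rightarrow> nat \<Rightarrow> real" where
  "hs t k = L2inner (\<lambda>x. r (y x t)) (es k) + om k * L2inner (\<lambda>x. f (y x t)) (ec k)"

definition Jn :: "nat \<Rightarrow> nat \<Rightarrow> real \<Rightarrow> real" where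
  "Jn k n t = integral {shrink n..1 - shrink n} (\<lambda>x. ss k n x * y x t)"

text \<open>What two integrations by parts leave of the time derivative of \<open>Jn\<close>.
  Boundary terms with the space derivative drop out because \<open>ss k n\<close> vanishes at the
  end points; those with \<open>y\<close> remain and tend to zero by the Dirichlet
  condition.\<close>

definition Pn :: "nat \<Rightarrow> nat \<Rightarrow> real \<Rightarrow> real" where
  "Pn k n t = kap k n * (sc k n (shrink n) * y (shrink n) t - sc k n (1 - shrink n) * y (1 - shrink n) t)
     - (kap k n)\<^sup>2 * Jn k n t + kap k n * integral {shrink n..1 - shrink n} (\<lambda>x. sc k n x * f (y x t))
     + integral {shrink n..1 - shrink n} (\<lambda>x. ss k n x * r (y x t))"

lemma Jn_deriv:
  assumes t: "0 < t"
  shows "(Jn k n has_real_derivative Pn k n t) (at t)"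
proof -
  obtain yx yxx yt where c: "continuous_on ({0<..<1} \<times> {0<..}) (\<lambda>(x,t). yx x t)"
        "continuous_on ({0<..<1} \<times> {0<..}) (\<lambda>(x,t). yxx x t)"
        "continuous_on ({0<..<1} \<times> {0<..}) (\<lambda>(x,t). yt x t)"
    and d: "\<And>x t. x \<in> {0<..<1} \<Longrightarrow> 0 < t \<Longrightarrow> ((\<lambda>s. y s t) has_real_derivative yx x t) (at x)"
        "\<And>x t. x \<in> {0<..<1} \<Longrightarrow> 0 < t \<Longrightarrow> ((\<lambda>s. yx s t) has_real_derivative yxx x t) (at x)"
        "\<And>x t. x \<in> {0<..<1} \<Longrightarrow> 0 < t \<Longrightarrow> ((\<lambda>\<tau>. y x \<tau>) has_real_derivative yt x t) (at t)"
        "\<And>x t. x \<in> {0<..<1} \<Longrightarrow> 0 < t \<Longrightarrow> yt x t + deriv f (y x t) * yx x t = yxx x t + r (y x t)"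
    using sol unfolding evolution_solution_def by blast
  define a b where "a = shrink n" and "b = 1 - shrink n"
  have ab: "0 < a" "a < b" "{a..b} \<subseteq> {0<..<1}" "{a..b} \<subseteq> {0..1}"
    using shrink_bounds[of n] by (auto simp: a_def b_def)
  have y': "continuous_on {a..b} (\<lambda>x. y x t)" "continuous_on {a..b} (\<lambda>x. f (y x t))" "continuous_on {a..b} (\<lambda>x. r (y x t))"
    using slice[OF t] ab(4) by (auto intro: continuous_on_subset)
  have sx: "continuous_on {a..b} (\<lambda>x. yx x t)" "continuous_on {a..b} (\<lambda>x. yxx x t)" "continuous_on {a..b} (\<lambda>x. yt x t)"
    using c by (auto intro!: continuous_on_subset[OF continuous_slice[of "{0<..<1}" "{0<..}"] ab(3)] simp: t)
  define l h where "l = t / 2" and "h = t + 1"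
  have lh: "0 < l" "l < t" "t < h" using t by (auto simp: l_def h_def)
  have "((\<lambda>t. integral (cbox a b) (\<lambda>x. ss k n x * y x t)) has_field_derivative integral (cbox a b) (\<lambda>x. ss k n x * yt x t)) (at t within {l..h})"
  proof (rule leibniz_rule_field_derivative)
    fix s x assume "s \<in> {l..h}" "x \<in> cbox a b"
    then show "((\<lambda>s. ss k n x * y x s) has_field_derivative ss k n x * yt x s) (at s within {l..h})"
      using lh ab by (intro DERIV_cmult has_field_derivative_at_within[OF d(3)]) auto
  next
    fix s assume "s \<in> {l..h}"
    then show "(\<lambda>x. ss k n x * y x s) integrable_on cbox a b"
      using lh slice(1)[of s] ab(4) by (intro integrable_continuous continuous_intros) (auto intro: continuous_on_subset)
  next
    have "continuous_on ({l..h} \<times> cbox a b) ((\<lambda>(x,t). yt x t) \<circ> (\<lambda>p. (snd p, fst p)))"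
      by (intro continuous_on_compose continuous_on_subset[OF c(3)]) (use lh ab in \<open>auto intro!: continuous_intros\<close>)
    then have "continuous_on ({l..h} \<times> cbox a b) (\<lambda>p. yt (snd p) (fst p))" by (simp add: o_def case_prod_beta')
    then show "continuous_on ({l..h} \<times> cbox a b) (\<lambda>(s, x). ss k n x * yt x s)"
      unfolding case_prod_beta' by (intro continuous_intros)
  qed (use lh in auto)
  moreover have "at t within {l..h} = at t" using lh by (intro at_within_interior) simp
  ultimately have "(Jn k n has_real_derivative integral {a..b} (\<lambda>x. ss k n x * yt x t)) (at t)"
    by (simp add: Jn_def[abs_def] a_def b_def)
  moreover have "integral {a..b} (\<lambda>x. ss k n x * yt x t) = Pn k n t"
  proof -
    \<comment> \<open>\<open>?F\<close> collects all boundary expressions, so that both integrations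
      by parts for the diffusion term and the one for the flux become a single application of the
      fundamental theorem.\<close>
    let ?F = "\<lambda>x. ss k n x * yx x t - kap k n * sc k n x * y x t - ss k n x * f (y x t)"
    let ?G = "\<lambda>x. ss k n x * yxx x t + (kap k n)\<^sup>2 * (ss k n x * y x t) - kap k n * (sc k n x * f (y x t)) - ss k n x * (deriv f (y x t) * yx x t)"
    have "(?G has_integral (?F b - ?F a)) {a..b}"
    proof (rule fundamental_theorem_of_calculus)
      fix x assume x: "x \<in> {a..b}"
      then have x': "x \<in> {0<..<1}" using ab by blast
      have "((\<lambda>x. f (y x t)) has_real_derivative deriv f (y x t) * yx x t) (at x)"
        by (rule DERIV_chain2[OF f_deriv d(1)[OF x' t]])
      then have "(?F has_real_derivative ?G x) (at x)"
        by (auto intro!: derivative_eq_intros ss_deriv sc_deriv d(1,2)[OF x' t] simp: algebra_simps power2_eq_square)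
      then show "(?F has_vector_derivative ?G x) (at x within {a..b})"
        by (simp add: has_real_derivative_iff_has_vector_derivative has_vector_derivative_at_within)
    qed (use ab in auto)
    then have I: "integral {a..b} ?G = ?F b - ?F a" by (rule integral_unique)
    have e: "ss k n x * yt x t = ?G x + (- (kap k n)\<^sup>2 * (ss k n x * y x t) + kap k n * (sc k n x * f (y x t)) + ss k n x * r (y x t))"
      if "x \<in> {a..b}" for x
    proof -
      have "x \<in> {0<..<1}" using that ab by blast
      from d(4)[OF this t] have yt: "yt x t = yxx x t + r (y x t) - deriv f (y x t) * yx x t" by linarith
      show ?thesis unfolding yt by (simp add: algebra_simps)
    qed
    have ci: "continuous_on {a..b} (\<lambda>x. deriv f (y x t))" by (rule continuous_on_compose2[OF fp_cont[of UNIV] y'(1)]) auto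
    have "integral {a..b} (\<lambda>x. ss k n x * yt x t) = integral {a..b} (\<lambda>x. ?G x + (- (kap k n)\<^sup>2 * (ss k n x * y x t) + kap k n * (sc k n x * f (y x t)) + ss k n x * r (y x t)))"
      by (rule Henstock_Kurzweil_Integration.integral_cong) (rule e)
    also have "\<dots> = integral {a..b} ?G + integral {a..b} (\<lambda>x. - (kap k n)\<^sup>2 * (ss k n x * y x t) + kap k n * (sc k n x * f (y x t)) + ss k n x * r (y x t))"
      by (intro Henstock_Kurzweil_Integration.integral_add integrable_continuous_real continuous_intros y' sx ci)
    also have "integral {a..b} (\<lambda>x. - (kap k n)\<^sup>2 * (ss k n x * y x t) + kap k n * (sc k n x * f (y x t)) + ss k n x * r (y x t))
        = integral {a..b} (\<lambda>x. - (kap k n)\<^sup>2 * (ss k n x * y x t) + kap k n * (sc k n x * f (y x t))) + integral {a..b} (\<lambda>x. ss k n x * r (y x t))"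
      by (intro Henstock_Kurzweil_Integration.integral_add integrable_continuous_real continuous_intros y')
    also have "integral {a..b} (\<lambda>x. - (kap k n)\<^sup>2 * (ss k n x * y x t) + kap k n * (sc k n x * f (y x t)))
        = integral {a..b} (\<lambda>x. - (kap k n)\<^sup>2 * (ss k n x * y x t)) + integral {a..b} (\<lambda>x. kap k n * (sc k n x * f (y x t)))"
      by (intro Henstock_Kurzweil_Integration.integral_add integrable_continuous_real continuous_intros y')
    finally have "integral {a..b} (\<lambda>x. ss k n x * yt x t) = (?F b - ?F a) +
        (integral {a..b} (\<lambda>x. - (kap k n)\<^sup>2 * (ss k n x * y x t)) + integral {a..b} (\<lambda>x. kap k n * (sc k n x * f (y x t))) + integral {a..b} (\<lambda>x. ss k n x * r (y x t)))"
      by (simp only: I)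
    then show ?thesis by (simp add: Pn_def Jn_def a_def b_def ss_ends right_diff_distrib)
  qed
  ultimately show ?thesis by simp
qed

lemma Jn_tendsto: "0 < t \<Longrightarrow> (\<lambda>n. Jn k n t) \<longlonglongrightarrow> cf (\<lambda>x. y x t) k"
  unfolding Jn_def cf_def
  by (rule shrink_integral_tendsto[OF slice(1)]) (auto intro: ss_le ss_tendsto continuous_intros)

lemma Pn_tendsto:
  assumes t: "0 < t"
  shows "(\<lambda>n. Pn k n t) \<longlonglongrightarrow> hs t k - (om k)\<^sup>2 * cf (\<lambda>x. y x t) k"
proof -
  have f: "(\<lambda>n. integral {shrink n..1 - shrink n} (\<lambda>x. sc k n x * f (y x t))) \<longlonglongrightarrow> L2inner (\<lambda>x. f (y x t)) (ec k)"
    by (rule shrink_integral_tendsto[OF slice(2)[OF t]]) (auto intro: sc_le sc_tendsto continuous_intros)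
  have r: "(\<lambda>n. integral {shrink n..1 - shrink n} (\<lambda>x. ss k n x * r (y x t))) \<longlonglongrightarrow> L2inner (\<lambda>x. r (y x t)) (es k)"
    by (rule shrink_integral_tendsto[OF slice(3)[OF t]]) (auto intro: ss_le ss_tendsto continuous_intros)
  have b1: "(\<lambda>n. y (shrink n) t) \<longlonglongrightarrow> y 0 t"
    using slice(1)[OF t] shrink_tendsto shrink_bounds
    by (intro continuous_on_tendsto_compose[where f="\<lambda>x. y x t"]) (auto intro!: always_eventually less_imp_le order_trans[OF shrink_bounds(2)])
  have b2: "(\<lambda>n. y (1 - shrink n) t) \<longlonglongrightarrow> y (1 - 0) t"
    using slice(1)[OF t] shrink_bounds
    by (intro continuous_on_tendsto_compose[where f="\<lambda>x. y x t"] tendsto_intros shrink_tendsto) (auto intro!: always_eventually less_imp_le order_trans[OF shrink_bounds(2)])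
  have bz: "(\<lambda>n. sc k n (g n) * z n) \<longlonglongrightarrow> 0" if "z \<longlonglongrightarrow> (0::real)" for g z
  proof (rule Lim_null_comparison)
    show "\<forall>\<^sub>F n in sequentially. norm (sc k n (g n) * z n) \<le> 2 * \<bar>z n\<bar>"
      using sc_le by (intro always_eventually) (auto simp: abs_mult intro!: mult_right_mono)
    show "(\<lambda>n. 2 * \<bar>z n\<bar>) \<longlonglongrightarrow> 0" using tendsto_mult_left[OF tendsto_rabs_zero[OF that], of 2] by simp
  qed
  have "(\<lambda>n. Pn k n t) \<longlonglongrightarrow> om k * (0 - 0) - (om k)\<^sup>2 * cf (\<lambda>x. y x t) k + om k * L2inner (\<lambda>x. f (y x t)) (ec k) + L2inner (\<lambda>x. r (y x t)) (es k)"
    unfolding Pn_def using b1 b2 y_01[OF t]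
    by (intro tendsto_intros kap_tendsto bz f r Jn_tendsto[OF t]) auto
  then show ?thesis by (simp add: hs_def algebra_simps)
qed

lemma integral_abs_le:
  assumes "continuous_on {a..b} g" "0 \<le> B" "\<And>x. x \<in> {a..b} \<Longrightarrow> \<bar>g x\<bar> \<le> B" "0 \<le> a" "a \<le> b" "b \<le> (1::real)"
  shows "\<bar>integral {a..b} g :: real\<bar> \<le> B"
proof -
  have "norm (integral {a..b} g) \<le> B * (b - a)"
    using assms by (intro integral_bound) auto
  also have "\<dots> \<le> B * 1" using assms by (intro mult_left_mono) auto
  finally show ?thesis by simp
qed

lemma Pn_bounded:
  assumes s: "0 < s"
  obtains B where "\<And>n \<tau>. \<tau> \<in> {s..t} \<Longrightarrow> \<bar>Pn k n \<tau>\<bar> \<le> B"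
proof -
  obtain Y where Y: "0 \<le> Y" "\<And>x \<tau>. x \<in> {0..1} \<Longrightarrow> \<tau> \<in> {s..t} \<Longrightarrow> \<bar>y x \<tau>\<bar> \<le> Y"
    by (rule continuous_bounded_rectangle[OF y_cont s]) (rule that)
  obtain F where F: "0 \<le> F" "\<And>x \<tau>. x \<in> {0..1} \<Longrightarrow> \<tau> \<in> {s..t} \<Longrightarrow> \<bar>f (y x \<tau>)\<bar> \<le> F"
    by (rule continuous_bounded_rectangle[OF fy_cont s]) (rule that)
  obtain R where R: "0 \<le> R" "\<And>x \<tau>. x \<in> {0..1} \<Longrightarrow> \<tau> \<in> {s..t} \<Longrightarrow> \<bar>r (y x \<tau>)\<bar> \<le> R"
    by (rule continuous_bounded_rectangle[OF ry_cont s]) (rule that)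
  define W where "W = 2 * om k"
  have W: "0 \<le> W" "kap k n \<le> W" "0 \<le> kap k n" for n using kap_bounds by (auto simp: W_def)
  have "\<bar>Pn k n \<tau>\<bar> \<le> W * (4 * Y) + W\<^sup>2 * (2 * Y) + W * (2 * F) + 2 * R" if \<tau>: "\<tau> \<in> {s..t}" for n \<tau>
  proof -
    have t0: "0 < \<tau>" using \<tau> s by auto
    have ab: "0 \<le> shrink n" "shrink n \<le> 1 - shrink n" "1 - shrink n \<le> 1" using shrink_bounds[of n] by auto
    have sub: "{shrink n..1 - shrink n} \<subseteq> {0..1}" using ab by auto
    have c: "continuous_on {shrink n..1 - shrink n} (\<lambda>x. y x \<tau>)" "continuous_on {shrink n..1 - shrink n} (\<lambda>x. f (y x \<tau>))" "continuous_on {shrink n..1 - shrink n} (\<lambda>x. r (y x \<tau>))"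
      using slice[OF t0] sub by (auto intro: continuous_on_subset)
    have m: "\<bar>e * z\<bar> \<le> 2 * B" if "\<bar>e\<bar> \<le> 2" "\<bar>z\<bar> \<le> B" for e z B :: real
      using that unfolding abs_mult by (intro mult_mono) auto
    have J: "\<bar>Jn k n \<tau>\<bar> \<le> 2 * Y"
      unfolding Jn_def using ab Y sub by (intro integral_abs_le continuous_intros c m ss_le Y(2)[OF _ \<tau>]) auto
    have I1: "\<bar>integral {shrink n..1 - shrink n} (\<lambda>x. sc k n x * f (y x \<tau>))\<bar> \<le> 2 * F"
      using ab F sub by (intro integral_abs_le continuous_intros c m sc_le F(2)[OF _ \<tau>]) auto
    have I2: "\<bar>integral {shrink n..1 - shrink n} (\<lambda>x. ss k n x * r (y x \<tau>))\<bar> \<le> 2 * R"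
      using ab R sub by (intro integral_abs_le continuous_intros c m ss_le R(2)[OF _ \<tau>]) auto
    have "\<bar>sc k n (shrink n) * y (shrink n) \<tau>\<bar> \<le> 2 * Y" "\<bar>sc k n (1 - shrink n) * y (1 - shrink n) \<tau>\<bar> \<le> 2 * Y"
      using ab by (auto intro!: m sc_le Y(2)[OF _ \<tau>])
    then have b: "\<bar>sc k n (shrink n) * y (shrink n) \<tau> - sc k n (1 - shrink n) * y (1 - shrink n) \<tau>\<bar> \<le> 4 * Y" by linarith
    have t1: "\<bar>kap k n * (sc k n (shrink n) * y (shrink n) \<tau> - sc k n (1 - shrink n) * y (1 - shrink n) \<tau>)\<bar> \<le> W * (4 * Y)"
      using b W unfolding abs_mult[of "kap k n"] by (intro mult_mono) auto
    have t2: "\<bar>(kap k n)\<^sup>2 * Jn k n \<tau>\<bar> \<le> W\<^sup>2 * (2 * Y)"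
      using J W unfolding abs_mult by (intro mult_mono) (auto intro: power_mono)
    have t3: "\<bar>kap k n * integral {shrink n..1 - shrink n} (\<lambda>x. sc k n x * f (y x \<tau>))\<bar> \<le> W * (2 * F)"
      using I1 W unfolding abs_mult[of "kap k n"] by (intro mult_mono) auto
    show ?thesis unfolding Pn_def using t1 t2 t3 I2 by linarith
  qed
  then show thesis by (rule that)
qed

lemma hs_cont: "continuous_on {0<..} (\<lambda>t. hs t k)"
  unfolding hs_def L2inner_def
  by (intro continuous_intros LINT_continuous_param)
    (use fy_cont ry_cont in \<open>auto intro!: continuous_intros continuous_on_compose2[OF es_continuous[of UNIV]] continuous_on_compose2[OF ec_continuous[of UNIV]] simp: case_prod_beta'\<close>)

lemma cfy_cont: "continuous_on {0<..} (\<lambda>t. cf (\<lambda>x. y x t) k)"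
  by (rule cf_continuous_param[OF y_cont])

text \<open>The limit is taken in integrated form: \<open>Pn\<close> converges pointwise in time and
  is bounded uniformly in \<open>n\<close> on compact time intervals, which is exactly what
  dominated convergence asks for.\<close>

lemma coeff_identity:
  assumes st: "0 < s" "s < t"
  shows "cf (\<lambda>x. y x t) k - cf (\<lambda>x. y x s) k = integral {s..t} (\<lambda>\<tau>. hs \<tau> k - (om k)\<^sup>2 * cf (\<lambda>x. y x \<tau>) k)"
proof (rule LIMSEQ_unique)
  show "(\<lambda>n. Jn k n t - Jn k n s) \<longlonglongrightarrow> cf (\<lambda>x. y x t) k - cf (\<lambda>x. y x s) k"
    using st by (intro tendsto_intros Jn_tendsto) auto
  obtain B where B: "\<And>n \<tau>. \<tau> \<in> {s..t} \<Longrightarrow> \<bar>Pn k n \<tau>\<bar> \<le> B"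
    by (rule Pn_bounded[OF st(1)]) (rule that)
  have hi: "(Pn k n has_integral (Jn k n t - Jn k n s)) {s..t}" for n
  proof (rule fundamental_theorem_of_calculus)
    show "(Jn k n has_vector_derivative Pn k n \<tau>) (at \<tau> within {s..t})" if "\<tau> \<in> {s..t}" for \<tau>
      using Jn_deriv[of \<tau> k n] that st
      by (simp add: has_real_derivative_iff_has_vector_derivative has_vector_derivative_at_within)
  qed (use st in auto)
  have "(\<lambda>n. integral {s..t} (Pn k n)) \<longlonglongrightarrow> integral {s..t} (\<lambda>\<tau>. hs \<tau> k - (om k)\<^sup>2 * cf (\<lambda>x. y x \<tau>) k)"
  proof (rule dominated_convergence(2)[where h="\<lambda>_. B"])
    show "Pn k n integrable_on {s..t}" for n using hi[of n] by blast
    show "norm (Pn k n \<tau>) \<le> B" if "\<tau> \<in> {s..t}" for n \<tau> using B[OF that] by simp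
    show "(\<lambda>n. Pn k n \<tau>) \<longlonglongrightarrow> hs \<tau> k - (om k)\<^sup>2 * cf (\<lambda>x. y x \<tau>) k" if "\<tau> \<in> {s..t}" for \<tau>
      using that st by (intro Pn_tendsto) auto
  qed auto
  then show "(\<lambda>n. Jn k n t - Jn k n s) \<longlonglongrightarrow> integral {s..t} (\<lambda>\<tau>. hs \<tau> k - (om k)\<^sup>2 * cf (\<lambda>x. y x \<tau>) k)"
    using integral_unique[OF hi] by simp
qed

lemma cfy_deriv:
  assumes t: "0 < t"
  shows "((\<lambda>t. cf (\<lambda>x. y x t) k) has_real_derivative hs t k - (om k)\<^sup>2 * cf (\<lambda>x. y x t) k) (at t)"
proof -
  define a b where "a = t / 2" and "b = t + 1"
  have ab: "0 < a" "a < t" "t < b" using t by (auto simp: a_def b_def)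
  let ?g = "\<lambda>\<tau>. hs \<tau> k - (om k)\<^sup>2 * cf (\<lambda>x. y x \<tau>) k"
  have c: "continuous_on {a..b} ?g"
    by (rule continuous_on_subset[of "{0<..}"]) (use ab in \<open>auto intro!: continuous_intros hs_cont cfy_cont\<close>)
  have "((\<lambda>\<tau>. integral {a..\<tau>} ?g) has_real_derivative ?g t) (at t within {a..b})"
    using integral_has_real_derivative[OF c] ab by simp
  moreover have "at t within {a..b} = at t" using ab by (intro at_within_interior) simp
  ultimately have "((\<lambda>\<tau>. cf (\<lambda>x. y x a) k + integral {a..\<tau>} ?g) has_real_derivative 0 + ?g t) (at t)"
    by (intro derivative_intros) auto
  then have "((\<lambda>\<tau>. cf (\<lambda>x. y x a) k + integral {a..\<tau>} ?g) has_real_derivative ?g t) (at t)" by simp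
  then show ?thesis
  proof (rule DERIV_cong_ev[THEN iffD1, rotated -1])
    have "\<forall>\<^sub>F \<tau> in nhds t. \<tau> \<in> {a<..}" using ab by (intro eventually_nhds_in_open) auto
    then show "\<forall>\<^sub>F \<tau> in nhds t. cf (\<lambda>x. y x a) k + integral {a..\<tau>} ?g = cf (\<lambda>x. y x \<tau>) k"
    proof eventually_elim
      case (elim \<tau>)
      then show ?case using coeff_identity[OF ab(1), of \<tau> k] by simp
    qed
  qed auto
qed

text \<open>The formula starts at a positive time \<open>s\<close>, where everything is continuous;
  the limit of \<open>s\<close> to zero is postponed until norms are estimated.\<close>

lemma cfy_restart:
  assumes st: "0 < s" "s < t"
  shows "cf (\<lambda>x. y x t) k = exp (- (om k)\<^sup>2 * (t - s)) * cf (\<lambda>x. y x s) k + duhamel hs s t k"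
proof -
  have "(LINT \<tau>:{s..t}|lborel. exp (- (om k)\<^sup>2 * (t - \<tau>)) * hs \<tau> k) =
     exp (- (om k)\<^sup>2 * (t - t)) * cf (\<lambda>x. y x t) k - exp (- (om k)\<^sup>2 * (t - s)) * cf (\<lambda>x. y x s) k"
  proof (rule LINT_FTC_01)
    fix \<tau> assume \<tau>: "\<tau> \<in> {s..t}"
    have "((\<lambda>\<tau>. exp (- (om k)\<^sup>2 * (t - \<tau>)) * cf (\<lambda>x. y x \<tau>) k) has_real_derivative
       (exp (- (om k)\<^sup>2 * (t - \<tau>)) * (om k)\<^sup>2) * cf (\<lambda>x. y x \<tau>) k + (hs \<tau> k - (om k)\<^sup>2 * cf (\<lambda>x. y x \<tau>) k) * exp (- (om k)\<^sup>2 * (t - \<tau>))) (at \<tau> within {s..t})"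
      by (rule DERIV_mult) (use \<tau> st in \<open>auto intro!: derivative_eq_intros has_field_derivative_at_within[OF cfy_deriv]\<close>)
    then show "((\<lambda>\<tau>. exp (- (om k)\<^sup>2 * (t - \<tau>)) * cf (\<lambda>x. y x \<tau>) k) has_real_derivative exp (- (om k)\<^sup>2 * (t - \<tau>)) * hs \<tau> k) (at \<tau> within {s..t})"
      by (rule DERIV_cong) (simp add: algebra_simps)
  next
    show "continuous_on {s..t} (\<lambda>\<tau>. exp (- (om k)\<^sup>2 * (t - \<tau>)) * hs \<tau> k)"
      by (intro continuous_intros continuous_on_subset[OF hs_cont]) (use st in auto)
  qed (use st in auto)
  then show ?thesis unfolding duhamel_def LINT_open_closed by simp
qed

end

section \<open>Dependence on the initial datum\<close>

context solution
begin

lemma norm_cont: "continuous_on {0<..} (\<lambda>t. L2norm (\<lambda>x. y x t))"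
  by (rule L2norm_continuous_param[OF y_cont])

lemma y_L2: "0 < t \<Longrightarrow> (\<lambda>x. y x t) \<in> L2"
  by (rule L2_continuous[OF slice(1)])

lemma initial: "((\<lambda>t. L2norm (\<lambda>x. y x t - u x)) \<longlongrightarrow> 0) (at_right 0)"
  using sol by (simp add: evolution_solution_def)

lemma norm_bounded:
  assumes T: "0 < T"
  obtains B where "0 \<le> B" "\<And>t. 0 < t \<Longrightarrow> t \<le> T \<Longrightarrow> L2norm (\<lambda>x. y x t) \<le> B"
proof -
  have "\<forall>\<^sub>F t in at_right 0. L2norm (\<lambda>x. y x t - u x) < 1"
    using initial by (rule order_tendstoD) simp
  then obtain d where d: "0 < d" "\<And>t. 0 < t \<Longrightarrow> t < d \<Longrightarrow> L2norm (\<lambda>x. y x t - u x) < 1"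
    by (auto simp: eventually_at_right_field)
  have "compact ((\<lambda>t. L2norm (\<lambda>x. y x t)) ` {d..T})"
    by (intro compact_continuous_image continuous_on_subset[OF norm_cont]) (use d in auto)
  then obtain C where C: "\<forall>z\<in>(\<lambda>t. L2norm (\<lambda>x. y x t)) ` {d..T}. norm z \<le> C"
    using compact_imp_bounded bounded_iff by blast
  have "L2norm (\<lambda>x. y x t) \<le> max (L2norm u + 1) C" if t: "0 < t" "t \<le> T" for t
  proof (cases "t < d")
    case True
    then show ?thesis
      using L2norm_rev_triangle[OF y_L2[OF t(1)] u] d(2)[OF t(1) True] by linarith
  next
    case False
    then show ?thesis using C t by (force simp: le_max_iff_disj)
  qed
  then show thesis by (intro that[of "max (L2norm u + 1) C"]) (auto simp: le_max_iff_disj)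
qed

lemma f_diff_le: "\<bar>f a - f b\<bar> \<le> (\<bar>deriv f 0\<bar> + L * \<bar>a\<bar> + L * \<bar>b\<bar>) * \<bar>a - b\<bar>"
proof -
  have *: "\<bar>f b - f a\<bar> \<le> (\<bar>deriv f 0\<bar> + L * \<bar>a\<bar> + L * \<bar>b\<bar>) * \<bar>b - a\<bar>" if ab: "a < b" for a b
  proof -
    obtain z where z: "a < z" "z < b" "f b - f a = (b - a) * deriv f z"
      using MVT2[OF ab, of f "deriv f"] f_deriv by blast
    have "\<bar>deriv f z\<bar> \<le> \<bar>deriv f 0\<bar> + L * \<bar>z\<bar>" using fp_lip[of z 0] by auto
    also have "L * \<bar>z\<bar> \<le> L * (\<bar>a\<bar> + \<bar>b\<bar>)" using z L0 by (intro mult_left_mono) auto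
    finally have "\<bar>deriv f z\<bar> \<le> \<bar>deriv f 0\<bar> + L * \<bar>a\<bar> + L * \<bar>b\<bar>" by (simp add: distrib_left)
    then show ?thesis unfolding z(3) abs_mult mult.commute[of "\<bar>b - a\<bar>"] by (rule mult_right_mono) simp
  qed
  show ?thesis
    using *[of a b] *[of b a] by (cases a b rule: linorder_cases) (auto simp: abs_minus_commute algebra_simps)
qed

end

text \<open>By the linear growth of \<open>deriv f\<close> the difference of fluxes is pointwise a
  product of two L2 functions, hence in L1, and its cosine coefficients are bounded uniformly in
  \<open>k\<close> without being square summable. The factor \<open>om k\<close> and the summation
  over modes are left to the heat kernel.\<close>

lemma hs_diff_le:
  assumes "solution f r u1 y1 L" "solution f r u2 y2 L" and t: "0 < t"
    and B: "L2norm (\<lambda>x. y1 x t) \<le> B" "L2norm (\<lambda>x. y2 x t) \<le> B"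
  shows "\<bar>solution.hs f r y1 t k - solution.hs f r y2 t k\<bar> \<le> om k * ((L + 2 * (\<bar>deriv f 0\<bar> + 2 * L * B)) * L2norm (\<lambda>x. y1 x t - y2 x t))"
proof -
  interpret S1: solution f r u1 y1 L by fact
  interpret S2: solution f r u2 y2 L by fact
  note c = S1.slice[OF t] S2.slice[OF t]
  define n where "n = L2norm (\<lambda>x. y1 x t - y2 x t)"
  have n0: "0 \<le> n" by (simp add: n_def)
  have B0: "0 \<le> B" using B(1) L2norm_nonneg order_trans by blast
  have Lr: "(\<lambda>x. r (y1 x t)) \<in> L2" "(\<lambda>x. r (y2 x t)) \<in> L2" and Lf: "(\<lambda>x. f (y1 x t)) \<in> L2" "(\<lambda>x. f (y2 x t)) \<in> L2"
    using c by (auto intro: L2_continuous)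
  have "\<bar>L2inner (\<lambda>x. r (y1 x t) - r (y2 x t)) (es k)\<bar> \<le> L2norm (\<lambda>x. r (y1 x t) - r (y2 x t))"
    using cf_le[OF L2_diff[OF Lr], of k] by (simp add: cf_def)
  also have "\<dots> \<le> L * n"
    unfolding n_def using S1.L0 S1.r_lip by (intro L2norm_le_scaled L2_continuous continuous_intros c) auto
  finally have 1: "\<bar>L2inner (\<lambda>x. r (y1 x t)) (es k) - L2inner (\<lambda>x. r (y2 x t)) (es k)\<bar> \<le> L * n"
    by (simp add: L2inner_diff_left Lr)
  define \<phi> where "\<phi> x = \<bar>deriv f 0\<bar> + L * \<bar>y1 x t\<bar> + L * \<bar>y2 x t\<bar>" for x
  have \<phi>c: "continuous_on {0..1} \<phi>" unfolding \<phi>_def by (intro continuous_intros c)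
  have \<phi>n: "L2norm \<phi> \<le> \<bar>deriv f 0\<bar> + 2 * L * B"
  proof -
    have "L2norm \<phi> \<le> L2norm (\<lambda>x. \<bar>deriv f 0\<bar> + L * \<bar>y1 x t\<bar>) + L2norm (\<lambda>x. L * \<bar>y2 x t\<bar>)"
      unfolding \<phi>_def by (intro L2norm_triangle L2_continuous continuous_intros c)
    moreover have "L2norm (\<lambda>x. \<bar>deriv f 0\<bar> + L * \<bar>y1 x t\<bar>) \<le> \<bar>deriv f 0\<bar> + L * L2norm (\<lambda>x. y1 x t)"
      using S1.L0 by (intro L2norm_affine_le L2_continuous continuous_intros c) auto
    moreover have "L2norm (\<lambda>x. L * \<bar>y2 x t\<bar>) \<le> L * L2norm (\<lambda>x. y2 x t)"
      using S1.L0 by (intro L2norm_le_scaled L2_continuous continuous_intros c) (auto simp: abs_mult)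
    moreover have "L * L2norm (\<lambda>x. y1 x t) \<le> L * B" "L * L2norm (\<lambda>x. y2 x t) \<le> L * B"
      using B S1.L0 by (auto intro: mult_left_mono)
    ultimately show ?thesis by linarith
  qed
  have "\<bar>L2inner (\<lambda>x. f (y1 x t) - f (y2 x t)) (ec k)\<bar> \<le> L2inner (\<lambda>x. 2 * \<phi> x) (\<lambda>x. \<bar>y1 x t - y2 x t\<bar>)"
    unfolding L2inner_def
  proof (rule LINT_abs_le)
    show "set_integrable lborel {0..1} (\<lambda>x. (f (y1 x t) - f (y2 x t)) * ec k x)"
      "set_integrable lborel {0..1} (\<lambda>x. 2 * \<phi> x * \<bar>y1 x t - y2 x t\<bar>)"
      by (intro borel_integrable_atLeastAtMost' continuous_intros c \<phi>c)+
    fix x :: real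
    have "\<bar>f (y1 x t) - f (y2 x t)\<bar> * \<bar>ec k x\<bar> \<le> (\<phi> x * \<bar>y1 x t - y2 x t\<bar>) * 2"
      using S1.f_diff_le[of "y1 x t" "y2 x t"] ec_le[of k x] S1.L0 unfolding \<phi>_def by (intro mult_mono) auto
    then show "\<bar>(f (y1 x t) - f (y2 x t)) * ec k x\<bar> \<le> 2 * \<phi> x * \<bar>y1 x t - y2 x t\<bar>"
      by (simp add: abs_mult mult_ac)
  qed
  also have "\<dots> \<le> L2norm (\<lambda>x. 2 * \<phi> x) * L2norm (\<lambda>x. \<bar>y1 x t - y2 x t\<bar>)"
    using L2_Cauchy_Schwarz[of "\<lambda>x. 2 * \<phi> x" "\<lambda>x. \<bar>y1 x t - y2 x t\<bar>"] c \<phi>c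
    by (force intro: L2_continuous continuous_intros)
  also have "L2norm (\<lambda>x. \<bar>y1 x t - y2 x t\<bar>) = n" by (simp add: n_def L2norm_def L2inner_def)
  also have "L2norm (\<lambda>x. 2 * \<phi> x) = 2 * L2norm \<phi>" by (simp add: L2norm_scale)
  also have "2 * L2norm \<phi> * n \<le> 2 * (\<bar>deriv f 0\<bar> + 2 * L * B) * n"
    using \<phi>n n0 by (intro mult_right_mono mult_left_mono) auto
  finally have 2: "\<bar>L2inner (\<lambda>x. f (y1 x t)) (ec k) - L2inner (\<lambda>x. f (y2 x t)) (ec k)\<bar> \<le> 2 * (\<bar>deriv f 0\<bar> + 2 * L * B) * n"
    by (simp add: L2inner_diff_left Lf)
  have "\<bar>S1.hs t k - S2.hs t k\<bar> \<le> \<bar>L2inner (\<lambda>x. r (y1 x t)) (es k) - L2inner (\<lambda>x. r (y2 x t)) (es k)\<bar> +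
      om k * \<bar>L2inner (\<lambda>x. f (y1 x t)) (ec k) - L2inner (\<lambda>x. f (y2 x t)) (ec k)\<bar>"
  proof -
    have "S1.hs t k - S2.hs t k = (L2inner (\<lambda>x. r (y1 x t)) (es k) - L2inner (\<lambda>x. r (y2 x t)) (es k)) +
      om k * (L2inner (\<lambda>x. f (y1 x t)) (ec k) - L2inner (\<lambda>x. f (y2 x t)) (ec k))"
      unfolding S1.hs_def S2.hs_def by (simp add: algebra_simps)
    then show ?thesis using abs_triangle_ineq abs_mult[of "om k"] by (metis abs_of_pos om_pos(1))
  qed
  also have "\<dots> \<le> om k * (L * n) + om k * (2 * (\<bar>deriv f 0\<bar> + 2 * L * B) * n)"
  proof (rule add_mono)
    have "1 * (L * n) \<le> om k * (L * n)" using om_ge_1[of k] S1.L0 n0 by (intro mult_right_mono) auto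
    with 1 show "\<bar>L2inner (\<lambda>x. r (y1 x t)) (es k) - L2inner (\<lambda>x. r (y2 x t)) (es k)\<bar> \<le> om k * (L * n)" by linarith
    show "om k * \<bar>L2inner (\<lambda>x. f (y1 x t)) (ec k) - L2inner (\<lambda>x. f (y2 x t)) (ec k)\<bar> \<le> om k * (2 * (\<bar>deriv f 0\<bar> + 2 * L * B) * n)"
      by (rule mult_left_mono[OF 2]) simp
  qed
  also have "\<dots> = om k * ((L + 2 * (\<bar>deriv f 0\<bar> + 2 * L * B)) * n)" by (simp add: algebra_simps)
  finally show ?thesis unfolding n_def .
qed

text \<open>A singular Gronwall argument: with the weight \<open>exp (\<mu> t)\<close> the Duhamel term halves the
  distance of two solutions, so the distance is controlled by that of the initial data.\<close>

lemma solution_dependence: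
  assumes T: "0 < T" and B: "0 \<le> B" and L: "0 \<le> L"
  obtains C where "0 \<le> C" "\<And>u1 u2 y1 y2 t. solution f r u1 y1 L \<Longrightarrow> solution f r u2 y2 L \<Longrightarrow>
    (\<And>t. 0 < t \<Longrightarrow> t \<le> T \<Longrightarrow> L2norm (\<lambda>x. y1 x t) \<le> B) \<Longrightarrow> (\<And>t. 0 < t \<Longrightarrow> t \<le> T \<Longrightarrow> L2norm (\<lambda>x. y2 x t) \<le> B) \<Longrightarrow>
    0 < t \<Longrightarrow> t \<le> T \<Longrightarrow> L2norm (\<lambda>x. y1 x t - y2 x t) \<le> C * L2norm (\<lambda>x. u1 x - u2 x)"
proof -
  define Q where "Q = L + 2 * (\<bar>deriv f 0\<bar> + 2 * L * B)"
  have Q0: "0 \<le> Q" using L B by (simp add: Q_def)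
  \<comment> \<open>The weight is one power of frequency, so \<open>heat_sum\<close> needs an
    exponent above 3/4. With 7/8 there is room for the 1/32 spent on \<open>\<mu>\<close>: 7/8 +
    1/32 = 29/32, and 3/32 is the remaining power of time.\<close>
  obtain H where H: "0 < H" "\<And>\<tau> K. 0 < \<tau> \<Longrightarrow> (\<Sum>k<K. (om k powr 1 * exp (- (om k)\<^sup>2 * \<tau>))\<^sup>2) \<le> (H * \<tau> powr (- (7/8)))\<^sup>2"
    using heat_sum[of "7/8" 1] by auto
  define X where "X = H * Q * beta_int (29/32) 0 * T powr (3/32)"
  obtain \<mu> :: real where mu: "0 < \<mu>" "X * \<mu> powr (- (1/32)) \<le> 1/2"
    by (rule small_powr[of X "1/2"]) (use H Q0 in \<open>auto simp: X_def\<close>)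
  show thesis
  proof (rule that)
    show "0 \<le> 2 * exp (\<mu> * T)" by simp
    fix u1 u2 y1 y2 t1
    assume S1: "solution f r u1 y1 L" and S2: "solution f r u2 y2 L" and
      B1: "\<And>t. 0 < t \<Longrightarrow> t \<le> T \<Longrightarrow> L2norm (\<lambda>x. y1 x t) \<le> B" and B2: "\<And>t. 0 < t \<Longrightarrow> t \<le> T \<Longrightarrow> L2norm (\<lambda>x. y2 x t) \<le> B"
      and t1: "0 < t1" "t1 \<le> T"
    interpret S1: solution f r u1 y1 L by fact
    interpret S2: solution f r u2 y2 L by fact
    define n where "n t = L2norm (\<lambda>x. y1 x t - y2 x t)" for t
    define d where "d = L2norm (\<lambda>x. u1 x - u2 x)"
    define gh where "gh s k = S1.hs s k - S2.hs s k" for s k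
    have n_init: "(n \<longlongrightarrow> d) (at_right 0)"
    proof -
      have "\<forall>\<^sub>F t in at_right 0. norm (n t - d) \<le> L2norm (\<lambda>x. y1 x t - u1 x) + L2norm (\<lambda>x. y2 x t - u2 x)"
        using eventually_at_right_less[of 0]
      proof eventually_elim
        case (elim t)
        have "\<bar>n t - d\<bar> \<le> L2norm (\<lambda>x. (y1 x t - y2 x t) - (u1 x - u2 x))"
          unfolding n_def d_def using elim by (intro L2norm_rev_triangle L2_diff S1.y_L2 S2.y_L2 S1.u S2.u)
        also have "(\<lambda>x. (y1 x t - y2 x t) - (u1 x - u2 x)) = (\<lambda>x. (y1 x t - u1 x) - (y2 x t - u2 x))" by auto
        also have "L2norm \<dots> \<le> L2norm (\<lambda>x. y1 x t - u1 x) + L2norm (\<lambda>x. y2 x t - u2 x)"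
          using elim by (intro L2norm_diff_le L2_diff S1.y_L2 S2.y_L2 S1.u S2.u)
        finally show ?case by simp
      qed
      moreover have "((\<lambda>t. L2norm (\<lambda>x. y1 x t - u1 x) + L2norm (\<lambda>x. y2 x t - u2 x)) \<longlongrightarrow> 0) (at_right 0)"
        using tendsto_add[OF S1.initial S2.initial] by simp
      ultimately have "((\<lambda>t. n t - d) \<longlongrightarrow> 0) (at_right 0)" by (rule Lim_null_comparison)
      then show ?thesis by (rule LIM_zero_cancel)
    qed
    \<comment> \<open>A weighted bound \<open>W\<close> on the distance improves to
      \<open>d + W / 2\<close>; its fixed point is \<open>2 * d\<close>. Inside, the estimate is
      proved from a positive time \<open>s\<close>, and then \<open>s\<close> tends to zero.\<close>
    have step: "n t \<le> (d + W / 2) * exp (\<mu> * t)" if W: "0 \<le> W" "\<And>s. 0 < s \<Longrightarrow> s \<le> T \<Longrightarrow> n s \<le> W * exp (\<mu> * s)" and t: "0 < t" "t \<le> T" for W t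
    proof -
      define D where "D = H * (Q * W * exp (\<mu> * t) * \<mu> powr (- (1/32)))"
      have D0: "0 \<le> D" using H Q0 W by (simp add: D_def)
      have le: "n t \<le> n s + W / 2 * exp (\<mu> * t)" if s: "0 < s" "s < t" for s
      proof -
        have w: "(\<lambda>x. y1 x t - y2 x t) \<in> L2" "(\<lambda>x. y1 x s - y2 x s) \<in> L2"
          using s t by (auto intro!: L2_diff S1.y_L2 S2.y_L2)
        have hc: "continuous_on {s<..<t} (\<lambda>\<sigma>. gh \<sigma> k)" for k
          unfolding gh_def by (intro continuous_intros continuous_on_subset[OF S1.hs_cont] continuous_on_subset[OF S2.hs_cont]) (use s in auto)
        have i: "set_integrable lborel {s<..<t} (\<lambda>\<sigma>. exp (- (om k)\<^sup>2 * (t - \<sigma>)) * S1.hs \<sigma> k)"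
          "set_integrable lborel {s<..<t} (\<lambda>\<sigma>. exp (- (om k)\<^sup>2 * (t - \<sigma>)) * S2.hs \<sigma> k)" for k
          by (rule set_integrable_subset[of _ "{s..t}"], auto intro!: borel_integrable_atLeastAtMost' continuous_intros
              continuous_on_subset[OF S1.hs_cont] continuous_on_subset[OF S2.hs_cont] simp: s less_le_trans[OF s(1)])+
        have M: "(\<Sum>k<K. (LINT \<sigma>:{s<..<t}|lborel. exp (- (om k)\<^sup>2 * (t - \<sigma>)) * gh \<sigma> k)\<^sup>2) \<le> (D * beta_int (29/32) 0 * (t - s) powr (1 - 29/32 - 0))\<^sup>2" for K
        proof (rule Beta_Minkowski(2))
          show "continuous_on {s<..<t} (\<lambda>\<sigma>. exp (- (om k)\<^sup>2 * (t - \<sigma>)) * gh \<sigma> k)" for k by (intro continuous_intros hc)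
          fix \<sigma> K assume \<sigma>: "s < \<sigma>" "\<sigma> < t"
          have \<sigma>T: "0 < \<sigma>" "\<sigma> \<le> T" using \<sigma> s t by auto
          have ex: "exp (\<mu> * \<sigma>) \<le> exp (\<mu> * t) * (\<mu> powr (- (1/32)) * (t - \<sigma>) powr (- (1/32)))"
          proof -
            have "exp (- (\<mu> * (t - \<sigma>))) \<le> (1/32) powr (1/32) * (\<mu> * (t - \<sigma>)) powr (- (1/32))"
              using \<sigma> mu by (intro exp_le_powr) auto
            also have "\<dots> \<le> 1 * (\<mu> * (t - \<sigma>)) powr (- (1/32))" by (intro mult_right_mono powr_le1) auto
            also have "\<dots> = \<mu> powr (- (1/32)) * (t - \<sigma>) powr (- (1/32))" using \<sigma> mu by (simp add: powr_mult)
            finally have "exp (\<mu> * t) * exp (- (\<mu> * (t - \<sigma>))) \<le> exp (\<mu> * t) * (\<mu> powr (- (1/32)) * (t - \<sigma>) powr (- (1/32)))"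
              by (rule mult_left_mono) simp
            then show ?thesis by (simp add: right_diff_distrib flip: exp_add)
          qed
          have "(\<Sum>k<K. (exp (- (om k)\<^sup>2 * (t - \<sigma>)) * gh \<sigma> k)\<^sup>2) \<le> ((Q * n \<sigma>) * (H * (t - \<sigma>) powr (- (7/8))))\<^sup>2"
          proof (rule sum_le_scaled[OF _ H(2)])
            fix k
            have "\<bar>gh \<sigma> k\<bar> \<le> om k * (Q * n \<sigma>)"
              unfolding gh_def Q_def n_def by (rule hs_diff_le[OF S1 S2 \<sigma>T(1) B1[OF \<sigma>T] B2[OF \<sigma>T]])
            then have "exp (- (om k)\<^sup>2 * (t - \<sigma>)) * \<bar>gh \<sigma> k\<bar> \<le> exp (- (om k)\<^sup>2 * (t - \<sigma>)) * (om k * (Q * n \<sigma>))"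
              by (intro mult_left_mono) auto
            then show "\<bar>exp (- (om k)\<^sup>2 * (t - \<sigma>)) * gh \<sigma> k\<bar> \<le> (Q * n \<sigma>) * \<bar>om k powr 1 * exp (- (om k)\<^sup>2 * (t - \<sigma>))\<bar>"
              by (simp add: abs_mult mult_ac)
          qed (use \<sigma> Q0 in \<open>auto simp: n_def\<close>)
          also have "\<dots> \<le> (D * (t - \<sigma>) powr (- (29/32)) * (\<sigma> - s) powr (- 0))\<^sup>2"
          proof (rule power_mono)
            have "n \<sigma> \<le> W * (exp (\<mu> * t) * (\<mu> powr (- (1/32)) * (t - \<sigma>) powr (- (1/32))))"
              using W(2)[OF \<sigma>T] mult_left_mono[OF ex W(1)] by linarith
            then have "(Q * n \<sigma>) * (H * (t - \<sigma>) powr (- (7/8))) \<le> (Q * (W * (exp (\<mu> * t) * (\<mu> powr (- (1/32)) * (t - \<sigma>) powr (- (1/32)))))) * (H * (t - \<sigma>) powr (- (7/8)))"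
              using Q0 H by (intro mult_right_mono mult_left_mono) auto
            also have "\<dots> = D * ((t - \<sigma>) powr (- (1/32)) * (t - \<sigma>) powr (- (7/8)))" by (simp add: D_def mult_ac)
            also have "(t - \<sigma>) powr (- (1/32)) * (t - \<sigma>) powr (- (7/8)) = (t - \<sigma>) powr (- (29/32))" by (simp flip: powr_add)
            finally show "(Q * n \<sigma>) * (H * (t - \<sigma>) powr (- (7/8))) \<le> D * (t - \<sigma>) powr (- (29/32)) * (\<sigma> - s) powr (- 0)"
              using \<sigma> by simp
          qed (use Q0 H in \<open>auto simp: n_def\<close>)
          finally show "(\<Sum>k<K. (exp (- (om k)\<^sup>2 * (t - \<sigma>)) * gh \<sigma> k)\<^sup>2) \<le> (D * (t - \<sigma>) powr (- (29/32)) * (\<sigma> - s) powr (- 0))\<^sup>2" .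
        qed (use s D0 in auto)
        have De: "D * beta_int (29/32) 0 * (t - s) powr (1 - 29/32 - 0) \<le> W / 2 * exp (\<mu> * t)"
        proof -
          have "(t - s) powr (1 - 29/32 - 0) \<le> T powr (3/32)" using s t by (auto intro!: powr_mono2)
          then have "D * beta_int (29/32) 0 * (t - s) powr (1 - 29/32 - 0) \<le> D * beta_int (29/32) 0 * T powr (3/32)"
            using D0 by (intro mult_left_mono) auto
          also have "\<dots> = (X * \<mu> powr (- (1/32))) * (W * exp (\<mu> * t))" by (simp add: D_def X_def mult_ac)
          also have "\<dots> \<le> 1/2 * (W * exp (\<mu> * t))" using mu(2) W(1) by (intro mult_right_mono) auto
          finally show ?thesis by simp
        qed
        have "n t \<le> n s + D * beta_int (29/32) 0 * (t - s) powr (1 - 29/32 - 0)"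
          unfolding n_def[of t]
        proof (rule L2norm_le_if_cf_le[OF w(1)])
          fix K
          have "cf (\<lambda>x. y1 x t - y2 x t) k = exp (- (om k)\<^sup>2 * (t - s)) * cf (\<lambda>x. y1 x s - y2 x s) k +
              (LINT \<sigma>:{s<..<t}|lborel. exp (- (om k)\<^sup>2 * (t - \<sigma>)) * gh \<sigma> k)" for k
          proof -
            have "(LINT \<sigma>:{s<..<t}|lborel. exp (- (om k)\<^sup>2 * (t - \<sigma>)) * gh \<sigma> k) = duhamel S1.hs s t k - duhamel S2.hs s t k"
              using set_integral_diff(2)[OF i(1)[of k] i(2)[of k]] unfolding duhamel_def gh_def right_diff_distrib[of "exp _"] by simp
            moreover have "0 < t" using t by simp
            ultimately show ?thesis
              using S1.cfy_restart[OF s, of k] S2.cfy_restart[OF s, of k] s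
              by (simp add: cf_diff S1.y_L2 S2.y_L2 right_diff_distrib[of "exp _"])
          qed
          moreover have "(\<Sum>k<K. (exp (- (om k)\<^sup>2 * (t - s)) * cf (\<lambda>x. y1 x s - y2 x s) k)\<^sup>2) \<le> (1 * n s)\<^sup>2"
            unfolding n_def by (rule sum_le_scaled[OF _ Bessel[OF w(2)]]) (use s in \<open>auto simp: abs_mult intro!: mult_left_le_one_le\<close>)
          ultimately show "(\<Sum>k<K. (cf (\<lambda>x. y1 x t - y2 x t) k)\<^sup>2) \<le> (n s + D * beta_int (29/32) 0 * (t - s) powr (1 - 29/32 - 0))\<^sup>2"
            using M[of K] D0 by (simp only:) (intro L2_set_add_le; simp add: n_def)
        qed (use D0 in \<open>auto simp: n_def\<close>)
        with De show ?thesis by linarith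
      qed
      have "n t \<le> d + W / 2 * exp (\<mu> * t)"
      proof (rule tendsto_lowerbound)
        show "((\<lambda>s. n s + W / 2 * exp (\<mu> * t)) \<longlongrightarrow> d + W / 2 * exp (\<mu> * t)) (at_right 0)"
          by (intro tendsto_intros n_init)
        show "\<forall>\<^sub>F s in at_right 0. n t \<le> n s + W / 2 * exp (\<mu> * t)"
          by (rule eventually_at_rightI[of 0 t]) (use le t in auto)
      qed simp
      moreover have "d * 1 \<le> d * exp (\<mu> * t)" using mu t by (intro mult_left_mono) (auto simp: d_def)
      ultimately show ?thesis by (simp add: distrib_right)
    qed
    have d0: "0 \<le> d" by (simp add: d_def)
    \<comment> \<open>Iteration starts from the crude bound by \<open>2 * B\<close>, the only one
      available at first, and its share is halved at every step, so that only the multiple of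
      \<open>d\<close> survives.\<close>
    have iter: "n t \<le> (2 * d + 2 * B * (1/2)^j) * exp (\<mu> * t)" if "0 < t" "t \<le> T" for t j
      using that
    proof (induction j arbitrary: t)
      case 0
      have "n t \<le> L2norm (\<lambda>x. y1 x t) + L2norm (\<lambda>x. y2 x t)"
        unfolding n_def using 0 by (intro L2norm_diff_le S1.y_L2 S2.y_L2)
      also have "\<dots> \<le> (2 * d + 2 * B) * 1" using B1[OF 0] B2[OF 0] d0 by simp
      also have "\<dots> \<le> (2 * d + 2 * B) * exp (\<mu> * t)" using mu 0 d0 B by (intro mult_left_mono) auto
      finally show ?case by simp
    next
      case (Suc j)
      have "n t \<le> (d + (2 * d + 2 * B * (1/2)^j) / 2) * exp (\<mu> * t)"
        by (rule step) (use Suc d0 B in auto)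
      also have "\<dots> = (2 * d + 2 * B * (1/2)^Suc j) * exp (\<mu> * t)" by simp
      finally show ?case .
    qed
    have "(\<lambda>j. (2 * d + 2 * B * (1/2)^j) * exp (\<mu> * t1)) \<longlonglongrightarrow> (2 * d + 2 * B * 0) * exp (\<mu> * t1)"
      by (intro tendsto_intros LIMSEQ_realpow_zero) auto
    then have "n t1 \<le> (2 * d + 2 * B * 0) * exp (\<mu> * t1)"
      by (rule LIMSEQ_le_const) (use iter[OF t1] in auto)
    also have "\<dots> \<le> (2 * d) * exp (\<mu> * T)" using t1 mu d0 by (simp add: mult_left_mono)
    finally show "L2norm (\<lambda>x. y1 x t1 - y2 x t1) \<le> 2 * exp (\<mu> * T) * L2norm (\<lambda>x. u1 x - u2 x)"
      by (simp add: n_def d_def mult_ac)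
  qed
qed

text \<open>Equal data give seminorm zero at every positive time; continuity upgrades this to
  equality inside the interval, and the boundary conditions together with the extension by zero
  settle all remaining arguments.\<close>

lemma solution_unique:
  assumes S1: "solution f r u y1 L" and S2: "solution f r u y2 L"
  shows "y1 = y2"
proof (rule ext, rule ext)
  fix x t
  interpret S1: solution f r u y1 L by fact
  interpret S2: solution f r u y2 L by fact
  show "y1 x t = y2 x t"
  proof (cases "x \<in> {0..1} \<and> 0 < t")
    case False
    then show ?thesis using S1.sol S2.sol unfolding evolution_solution_def by (metis not_le)
  next
    case True
    then have t: "0 < t" and x: "x \<in> {0..1}" by auto
    obtain B1 where B1: "0 \<le> B1" "\<And>s. 0 < s \<Longrightarrow> s \<le> t \<Longrightarrow> L2norm (\<lambda>x. y1 x s) \<le> B1" by (rule S1.norm_bounded[OF t]) (rule that)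
    obtain B2 where B2: "0 \<le> B2" "\<And>s. 0 < s \<Longrightarrow> s \<le> t \<Longrightarrow> L2norm (\<lambda>x. y2 x s) \<le> B2" by (rule S2.norm_bounded[OF t]) (rule that)
    define B where "B = max B1 B2"
    have B: "0 \<le> B" "\<And>s. 0 < s \<Longrightarrow> s \<le> t \<Longrightarrow> L2norm (\<lambda>x. y1 x s) \<le> B" "\<And>s. 0 < s \<Longrightarrow> s \<le> t \<Longrightarrow> L2norm (\<lambda>x. y2 x s) \<le> B"
      using B1 B2 by (auto simp: B_def le_max_iff_disj)
    obtain C where C: "0 \<le> C" "\<And>u1 u2 y1 y2 s. solution f r u1 y1 L \<Longrightarrow> solution f r u2 y2 L \<Longrightarrow>
      (\<And>s. 0 < s \<Longrightarrow> s \<le> t \<Longrightarrow> L2norm (\<lambda>x. y1 x s) \<le> B) \<Longrightarrow> (\<And>s. 0 < s \<Longrightarrow> s \<le> t \<Longrightarrow> L2norm (\<lambda>x. y2 x s) \<le> B) \<Longrightarrow>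
      0 < s \<Longrightarrow> s \<le> t \<Longrightarrow> L2norm (\<lambda>x. y1 x s - y2 x s) \<le> C * L2norm (\<lambda>x. u1 x - u2 x)"
      by (rule solution_dependence[OF t B(1) S1.L0]) (rule that; blast)
    have "L2norm (\<lambda>x. y1 x t - y2 x t) \<le> C * L2norm (\<lambda>x. u x - u x)"
      by (rule C(2)[OF S1 S2 B(2,3) t order_refl])
    then have z: "L2norm (\<lambda>x. y1 x t - y2 x t) = 0" using L2norm_nonneg[of "\<lambda>x. y1 x t - y2 x t"] by simp
    have c: "continuous_on {0..1} (\<lambda>x. y1 x t - y2 x t)" by (intro continuous_intros S1.slice S2.slice t)
    have "cf (\<lambda>x. y1 x t - y2 x t) k = 0" for k using cf_le[OF L2_continuous[OF c], of k] z by simp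
    from continuous_cf_zero[OF c this] have "y1 x t - y2 x t = 0" if "x \<in> {0<..<1}" using that by blast
    moreover have "x = 0 \<or> x = 1 \<or> x \<in> {0<..<1}" using x by auto
    ultimately show ?thesis using S1.y_01[OF t] S2.y_01[OF t] by auto
  qed
qed

section \<open>The solution map\<close>

locale lipschitz_problem =
  fixes f r :: "real \<Rightarrow> real" and L :: real
  assumes L0: "0 \<le> L" and r_lip: "\<And>a b. \<bar>r a - r b\<bar> \<le> L * \<bar>a - b\<bar>" and fp_lip: "\<And>a b. \<bar>deriv f a - deriv f b\<bar> \<le> L * \<bar>a - b\<bar>"
    and f_deriv: "\<And>x. (f has_real_derivative deriv f x) (at x)"
begin

lemma solutionI: "evolution_solution f r u y \<Longrightarrow> u \<in> L2 \<Longrightarrow> solution f r u y L"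
  by unfold_locales (use L0 r_lip fp_lip f_deriv in auto)

lemma evolution_ex1:
  assumes "u \<in> L2" shows "\<exists>!y. evolution_solution f r u y"
proof -
  obtain y where "evolution_solution f r u y" by (rule evolution_exists[OF assms L0 r_lip fp_lip])
  then show ?thesis using solution_unique[OF solutionI solutionI] assms by (intro ex1I[of _ y]) auto
qed

lemma evolution_sol: "u \<in> L2 \<Longrightarrow> evolution_solution f r u (evolution_sol f r u)"
  unfolding evolution_sol_def by (rule theI'[OF evolution_ex1])

lemma evolution_sol_L2: "u \<in> L2 \<Longrightarrow> 0 < t \<Longrightarrow> (\<lambda>x. evolution_sol f r u x t) \<in> L2"
  by (rule solution.y_L2[OF solutionI[OF evolution_sol]])

lemma evolution_sol_bound:
  assumes u: "u \<in> L2" and t: "0 < t"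
  shows "(L2norm (\<lambda>x. evolution_sol f r u x t))\<^sup>2 \<le> exp ((1 + 2 * L) * t) * ((L2norm u)\<^sup>2 + \<bar>r 0\<bar>\<^sup>2 * t)"
proof -
  obtain y where y: "evolution_solution f r u y"
    and b: "\<And>t. 0 < t \<Longrightarrow> (L2norm (\<lambda>x. y x t))\<^sup>2 \<le> exp ((1 + 2 * L) * t) * ((L2norm u)\<^sup>2 + \<bar>r 0\<bar>\<^sup>2 * t)"
    by (rule evolution_exists[OF u L0 r_lip fp_lip]) (rule that)
  have "evolution_sol f r u = y" using evolution_ex1[OF u] evolution_sol[OF u] y by blast
  then show ?thesis using b[OF t] by simp
qed

text \<open>The constant of \<open>solution_dependence\<close> depends on a bound for both
  solutions. A convergent sequence of data is bounded, so the energy bound provides one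
  \<open>B\<close> for all of them.\<close>

lemma evolution_sol_continuous:
  assumes v: "\<And>n. v n \<in> L2" "w \<in> L2" "(\<lambda>n. L2norm (\<lambda>x. v n x - w x)) \<longlonglongrightarrow> 0" and T: "0 < T"
  shows "(\<lambda>n. L2norm (\<lambda>x. evolution_sol f r (v n) x T - evolution_sol f r w x T)) \<longlonglongrightarrow> 0"
proof -
  have "convergent (\<lambda>n. L2norm (v n))" using L2norm_tendsto[OF v] by (auto simp: convergent_def)
  then have "Bseq (\<lambda>n. L2norm (v n))" by (rule convergent_imp_Bseq)
  then obtain K where K: "0 < K" "\<And>n. norm (L2norm (v n)) \<le> K" by (auto simp: Bseq_def)
  define B where "B = sqrt (exp ((1 + 2 * L) * T) * ((max K (L2norm w))\<^sup>2 + \<bar>r 0\<bar>\<^sup>2 * T))"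
  have B0: "0 \<le> B" using T by (simp add: B_def)
  have Bb: "L2norm (\<lambda>x. evolution_sol f r u x t) \<le> B" if u: "u \<in> L2" "L2norm u \<le> max K (L2norm w)" and t: "0 < t" "t \<le> T" for u t
  proof -
    have "(L2norm (\<lambda>x. evolution_sol f r u x t))\<^sup>2 \<le> exp ((1 + 2 * L) * T) * ((max K (L2norm w))\<^sup>2 + \<bar>r 0\<bar>\<^sup>2 * T)"
      by (rule order_trans[OF evolution_sol_bound[OF u(1) t(1)]])
        (intro mult_mono add_mono power_mono mult_left_mono; use u t L0 T in \<open>auto intro: mult_left_mono\<close>)
    then have "sqrt ((L2norm (\<lambda>x. evolution_sol f r u x t))\<^sup>2) \<le> B" unfolding B_def by (rule real_sqrt_le_mono)
    then show ?thesis by simp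
  qed
  obtain C where C: "0 \<le> C" "\<And>u1 u2 y1 y2 t. solution f r u1 y1 L \<Longrightarrow> solution f r u2 y2 L \<Longrightarrow>
    (\<And>t. 0 < t \<Longrightarrow> t \<le> T \<Longrightarrow> L2norm (\<lambda>x. y1 x t) \<le> B) \<Longrightarrow> (\<And>t. 0 < t \<Longrightarrow> t \<le> T \<Longrightarrow> L2norm (\<lambda>x. y2 x t) \<le> B) \<Longrightarrow>
    0 < t \<Longrightarrow> t \<le> T \<Longrightarrow> L2norm (\<lambda>x. y1 x t - y2 x t) \<le> C * L2norm (\<lambda>x. u1 x - u2 x)"
    by (rule solution_dependence[OF T B0 L0]) (rule that; blast)
  show ?thesis
  proof (rule Lim_null_comparison)
    show "\<forall>\<^sub>F n in sequentially. norm (L2norm (\<lambda>x. evolution_sol f r (v n) x T - evolution_sol f r w x T)) \<le> C * L2norm (\<lambda>x. v n x - w x)"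
    proof (rule always_eventually, rule allI)
      fix n
      have "L2norm (\<lambda>x. evolution_sol f r (v n) x T - evolution_sol f r w x T) \<le> C * L2norm (\<lambda>x. v n x - w x)"
        by (rule C(2)[OF solutionI[OF evolution_sol] solutionI[OF evolution_sol]])
          (use v K(2)[of n] T in \<open>auto intro!: Bb simp: le_max_iff_disj\<close>)
      then show "norm (L2norm (\<lambda>x. evolution_sol f r (v n) x T - evolution_sol f r w x T)) \<le> C * L2norm (\<lambda>x. v n x - w x)" by simp
    qed
    show "(\<lambda>n. C * L2norm (\<lambda>x. v n x - w x)) \<longlonglongrightarrow> 0" using tendsto_mult_left[OF v(3), of C] by simp
  qed
qed

end

section \<open>Measurability and moments of the prior\<close>

lemma space_L2M [simp]: "space L2M = L2"
  unfolding L2M_def by (rule space_measure_of) blast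

lemma L2inner_measurable: "\<phi> \<in> L2 \<Longrightarrow> (\<lambda>u. L2inner u \<phi>) \<in> borel_measurable L2M"
proof (rule measurableI)
  fix A :: "real set" assume "\<phi> \<in> L2" "A \<in> sets borel"
  then have "{u \<in> L2. L2inner u \<phi> \<in> A} \<in> sets L2M"
    unfolding L2M_def by (subst sets_measure_of) (auto intro!: sigma_sets.Basic)
  then show "(\<lambda>u. L2inner u \<phi>) -` A \<inter> space L2M \<in> sets L2M"
    by (simp add: vimage_def Int_def conj_commute)
qed simp

lemma cf_measurable: "(\<lambda>u. cf u k) \<in> borel_measurable L2M"
  unfolding cf_def by (intro L2inner_measurable es_L2)

text \<open>The Fourier coefficients embed \<open>L2\<close> measurably into the Polish space of real sequences,
  on which a partial sum depends continuously.\<close>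

lemma L2_sequentially_continuous_measurable:
  fixes F :: "(real \<Rightarrow> real) \<Rightarrow> 'b::metric_space"
  assumes F: "\<And>v w. (\<And>n. v n \<in> L2) \<Longrightarrow> w \<in> L2 \<Longrightarrow> (\<lambda>n. L2norm (\<lambda>x. v n x - w x)) \<longlonglongrightarrow> 0 \<Longrightarrow>
    (\<lambda>n. F (v n)) \<longlonglongrightarrow> F w"
  shows "F \<in> borel_measurable L2M"
proof (rule borel_measurable_LIMSEQ_metric)
  fix n
  have "continuous_on UNIV (\<lambda>c. F (psum c n))"
    unfolding continuous_on_sequentially
  proof (intro allI ballI impI)
    fix c :: "nat \<Rightarrow> nat \<Rightarrow> real" and a
    assume "(\<forall>j. c j \<in> UNIV) \<and> c \<longlonglongrightarrow> a"
    then have c: "c \<longlonglongrightarrow> a" by simp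
    have ck: "(\<lambda>j. c j k) \<longlonglongrightarrow> a k" for k
      using continuous_on_tendsto_compose[OF continuous_on_product_coordinates[of k] c] by simp
    have "(\<lambda>j. sqrt (\<Sum>k<n. (c j k - a k)\<^sup>2)) \<longlonglongrightarrow> sqrt (\<Sum>k<n. (a k - a k)\<^sup>2)"
      by (intro tendsto_intros ck)
    moreover have "L2norm (\<lambda>x. psum (c j) n x - psum a n x) = sqrt (\<Sum>k<n. (c j k - a k)\<^sup>2)" for j
      unfolding psum_diff psum_norm[symmetric] by simp
    ultimately have "(\<lambda>j. L2norm (\<lambda>x. psum (c j) n x - psum a n x)) \<longlonglongrightarrow> 0" by simp
    then show "((\<lambda>c. F (psum c n)) \<circ> c) \<longlonglongrightarrow> F (psum a n)"
      unfolding o_def by (intro F) auto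
  qed
  then have 1: "(\<lambda>c. F (psum c n)) \<in> borel_measurable (Pi\<^sub>M UNIV (\<lambda>_::nat. borel::real measure))"
    by (subst measurable_cong_sets[OF sets_PiM_equal_borel refl]) (rule borel_measurable_continuous_onI)
  have 2: "(\<lambda>u k. cf u k) \<in> measurable L2M (Pi\<^sub>M UNIV (\<lambda>_::nat. borel::real measure))"
    by (rule measurable_PiM_single') (auto intro: cf_measurable)
  show "(\<lambda>u. F (psum (cf u) n)) \<in> borel_measurable L2M"
    using measurable_compose[OF 2 1] by simp
next
  fix u assume "u \<in> space L2M"
  then show "(\<lambda>n. F (psum (cf u) n)) \<longlonglongrightarrow> F u" by (intro F psum_cf_tendsto) auto
qed

lemma L2norm_measurable: "L2norm \<in> borel_measurable L2M"
proof (rule L2_sequentially_continuous_measurable)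
  fix v :: "nat \<Rightarrow> real \<Rightarrow> real" and w assume v: "\<And>n. v n \<in> L2" "w \<in> L2" "(\<lambda>n. L2norm (\<lambda>x. v n x - w x)) \<longlonglongrightarrow> 0"
  then show "(\<lambda>n. L2norm (v n)) \<longlonglongrightarrow> L2norm w" by (rule L2norm_tendsto)
qed

text \<open>Testing \<open>l\<close> on the partial sum of its own coefficients gives
  \<open>S \<le> C * sqrt S\<close>, hence square summability, and Riesz-Fischer supplies the
  vector. Agreement on all of \<open>L2\<close> follows by approximation with partial sums.\<close>

lemma Riesz_representation:
  assumes add: "\<And>\<phi> \<psi>. \<phi> \<in> L2 \<Longrightarrow> \<psi> \<in> L2 \<Longrightarrow> l (\<lambda>x. \<phi> x + \<psi> x) = l \<phi> + l \<psi>"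
    and scale: "\<And>\<phi> c. \<phi> \<in> L2 \<Longrightarrow> l (\<lambda>x. c * \<phi> x) = c * l \<phi>"
    and bound: "\<And>\<phi>. \<phi> \<in> L2 \<Longrightarrow> \<bar>l \<phi>\<bar> \<le> C * L2norm \<phi>"
  obtains v where "v \<in> L2" "\<And>\<phi>. \<phi> \<in> L2 \<Longrightarrow> L2inner v \<phi> = (l \<phi> :: real)"
proof -
  define a where "a k = l (es k)" for k
  have ps: "l (psum b K) = (\<Sum>k<K. b k * a k)" for b K
  proof (induction K)
    case 0
    then show ?case using scale[of "\<lambda>x. 0" 0] by (simp add: psum_def[abs_def])
  next
    case (Suc K)
    have "psum b (Suc K) = (\<lambda>x. psum b K x + b K * es K x)" by (simp add: psum_def fun_eq_iff)
    then show ?case using add[OF psum_L2 L2_scale[OF es_L2]] scale[OF es_L2] Suc by (simp add: a_def)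
  qed
  have "(\<Sum>k<K. (a k)\<^sup>2) \<le> C\<^sup>2" for K
  proof -
    define S where "S = (\<Sum>k<K. (a k)\<^sup>2)"
    have S: "0 \<le> S" by (simp add: S_def sum_nonneg)
    have "S \<le> C * sqrt S"
      using bound[of "psum a K"] psum_norm[of a K]
      by (simp add: ps S_def[symmetric] power2_eq_square[symmetric] real_sqrt_unique abs_le_iff)
    then have "S\<^sup>2 \<le> C\<^sup>2 * S"
      using power_mono[of S "C * sqrt S" 2] S by (simp add: power_mult_distrib)
    with S have "S \<le> C\<^sup>2" by (cases "S = 0") (auto simp: power2_eq_square)
    then show ?thesis by (simp add: S_def)
  qed
  then have "summable (\<lambda>k. (a k)\<^sup>2)" by (intro summableI_nonneg_bounded[of _ "C\<^sup>2"]) auto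
  from Riesz_Fischer[OF this] obtain v where v: "v \<in> L2" "\<And>k. cf v k = a k" by blast
  have "L2inner v \<phi> = l \<phi>" if \<phi>: "\<phi> \<in> L2" for \<phi>
  proof (rule LIMSEQ_unique)
    have n: "(\<lambda>K. D * L2norm (\<lambda>x. psum (cf \<phi>) K x - \<phi> x)) \<longlonglongrightarrow> 0" for D
      using tendsto_mult_left[OF psum_cf_tendsto[OF \<phi>], of D] by simp
    have "\<bar>l (psum (cf \<phi>) K) - l \<phi>\<bar> \<le> C * L2norm (\<lambda>x. psum (cf \<phi>) K x - \<phi> x)" for K
    proof -
      have "l (psum (cf \<phi>) K) = l (\<lambda>x. (psum (cf \<phi>) K x - \<phi> x) + \<phi> x)" by simp
      also have "\<dots> = l (\<lambda>x. psum (cf \<phi>) K x - \<phi> x) + l \<phi>" by (rule add) (use \<phi> in auto)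
      finally show ?thesis using bound[of "\<lambda>x. psum (cf \<phi>) K x - \<phi> x"] \<phi> by (simp add: L2_diff)
    qed
    then show "(\<lambda>K. l (psum (cf \<phi>) K)) \<longlonglongrightarrow> l \<phi>"
      by (intro LIM_zero_cancel[OF Lim_null_comparison[OF _ n[of C]]]) auto
    have "\<bar>L2inner (psum (cf \<phi>) K) v - L2inner v \<phi>\<bar> \<le> L2norm v * L2norm (\<lambda>x. psum (cf \<phi>) K x - \<phi> x)" for K
      using L2_Cauchy_Schwarz[of "\<lambda>x. psum (cf \<phi>) K x - \<phi> x" v] v(1) \<phi>
      by (simp add: L2_diff L2inner_diff_left L2inner_commute[of v] mult.commute)
    then have "(\<lambda>K. L2inner (psum (cf \<phi>) K) v) \<longlonglongrightarrow> L2inner v \<phi>"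
      by (intro LIM_zero_cancel[OF Lim_null_comparison[OF _ n[of "L2norm v"]]]) auto
    then show "(\<lambda>K. l (psum (cf \<phi>) K)) \<longlonglongrightarrow> L2inner v \<phi>"
      by (simp add: psum_inner[OF v(1)] v(2) ps)
  qed
  with v(1) that show thesis by blast
qed

text \<open>Green's function is diagonal in the sine basis. The integral is split at
  \<open>s = x\<close>, where the kernel changes its formula; on each piece an explicit
  antiderivative is available, and the cosine terms cancel.\<close>

lemma dirichlet_green_es:
  assumes x: "x \<in> {0..1}"
  shows "(LINT s:{0..1}|lborel. dirichlet_green x s * es k s) = es k x / (om k)\<^sup>2"
proof -
  let ?g = "\<lambda>s. dirichlet_green x s * es k s"
  have c: "continuous_on {0..1} ?g"
    unfolding dirichlet_green_def by (intro continuous_intros)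
  have "((\<lambda>s. (1 - x) * (s * es k s)) has_integral
      (1 - x) * (- x * ec k x / om k + es k x / (om k)\<^sup>2) - (1 - x) * (- 0 * ec k 0 / om k + es k 0 / (om k)\<^sup>2)) {0..x}"
    using x by (intro fundamental_theorem_of_calculus)
      (auto simp: has_real_derivative_iff_has_vector_derivative[symmetric] field_simps power2_eq_square
        intro!: derivative_eq_intros)
  then have 1: "(?g has_integral (1 - x) * (- x * ec k x / om k + es k x / (om k)\<^sup>2)) {0..x}"
    by (rule has_integral_eq_rhs[OF has_integral_eq, rotated]) (auto simp: dirichlet_green_def max_def min_def)
  have "((\<lambda>s. x * ((1 - s) * es k s)) has_integral
      x * (- (1 - 1) * ec k 1 / om k - es k 1 / (om k)\<^sup>2) - x * (- (1 - x) * ec k x / om k - es k x / (om k)\<^sup>2)) {x..1}"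
    using x by (intro fundamental_theorem_of_calculus)
      (auto simp: has_real_derivative_iff_has_vector_derivative[symmetric] field_simps power2_eq_square
        intro!: derivative_eq_intros)
  then have 2: "(?g has_integral - x * (- (1 - x) * ec k x / om k - es k x / (om k)\<^sup>2)) {x..1}"
    by (rule has_integral_eq_rhs[OF has_integral_eq, rotated]) (auto simp: dirichlet_green_def max_def min_def)
  have "integral {0..1} ?g = es k x / (om k)\<^sup>2"
    using has_integral_combine[OF _ _ 1 2] x by (intro integral_unique) (auto simp: algebra_simps diff_divide_distrib)
  then show ?thesis
    using set_borel_integral_eq_integral(2)[OF borel_integrable_atLeastAtMost'[OF c]] by simp
qed

lemma prior_variance: "L2inner (prior_cov \<sigma> (es k)) (es k) = (\<sigma> / om k)\<^sup>2"
proof -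
  have "L2inner (prior_cov \<sigma> (es k)) (es k) = L2inner (\<lambda>x. (\<sigma> / om k)\<^sup>2 * es k x) (es k)"
    by (intro L2inner_cong) (auto simp: prior_cov_def dirichlet_laplacian_inv_def dirichlet_green_es power_divide)
  then show ?thesis by (simp add: L2inner_scale_left es_orthonormal)
qed

text \<open>The prior is given by its one-dimensional marginals, so the squared norm is expanded by
  Parseval into squares of marginals along \<open>es k\<close>. Sum and integral are exchanged in
  \<open>ennreal\<close>, where integrability need not be known in advance; the squared means are
  summable because \<open>u0 \<in> L2\<close>.\<close>

lemma gaussian_square_integrable:
  assumes g: "gaussian_measure_L2 \<mu> u0 (prior_cov \<sigma>)" and \<sigma>: "0 < \<sigma>" and u0: "u0 \<in> L2"
  shows "integrable \<mu> (\<lambda>u. (L2norm u)\<^sup>2)"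
proof -
  interpret prob_space \<mu> using g by (simp add: gaussian_measure_L2_def)
  have s [measurable_cong]: "sets \<mu> = sets L2M" using g by (simp add: gaussian_measure_L2_def)
  have sp: "space \<mu> = L2" using sets_eq_imp_space_eq[OF s] by simp
  note cf_measurable [measurable] L2norm_measurable [measurable]
  have k: "integrable \<mu> (\<lambda>u. (cf u k)\<^sup>2)" "(\<integral>u. (cf u k)\<^sup>2 \<partial>\<mu>) = (cf u0 k)\<^sup>2 + (\<sigma> / om k)\<^sup>2" for k
  proof -
    have "L2norm (es k) = 1" by (simp add: L2norm_def es_orthonormal)
    moreover have "sqrt (L2inner (prior_cov \<sigma> (es k)) (es k)) = \<sigma> / om k"
      using \<sigma> by (simp add: prior_variance)
    ultimately have D: "distributed \<mu> lborel (\<lambda>u. cf u k) (normal_density (cf u0 k) (\<sigma> / om k))"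
      using g es_L2[of k] unfolding gaussian_measure_L2_def cf_def by (metis zero_neq_one)
    have p: "0 < \<sigma> / om k" using \<sigma> by simp
    have i1: "integrable \<mu> (\<lambda>u. cf u k)"
      using distributed_integrable[OF D, of "\<lambda>x. x"] integrable_normal_moment_nz_1[OF p] by simp
    have i2: "integrable \<mu> (\<lambda>u. (cf u k - cf u0 k)\<^sup>2)"
      using distributed_integrable[OF D, of "\<lambda>x. (x - cf u0 k)\<^sup>2"] integrable_normal_moment[OF p] by simp
    have "integrable \<mu> (\<lambda>u. (cf u k - cf u0 k)\<^sup>2 + 2 * cf u0 k * cf u k - (cf u0 k)\<^sup>2)"
      by (intro Bochner_Integration.integrable_add Bochner_Integration.integrable_diff i2 integrable_mult_right i1) auto
    then show i: "integrable \<mu> (\<lambda>u. (cf u k)\<^sup>2)" by (simp add: power2_diff)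
    have "variance (\<lambda>u. cf u k) = (\<integral>u. (cf u k)\<^sup>2 \<partial>\<mu>) - (cf u0 k)\<^sup>2"
      using variance_eq[OF i1 i] normal_distributed_expectation[OF p D] by simp
    then show "(\<integral>u. (cf u k)\<^sup>2 \<partial>\<mu>) = (cf u0 k)\<^sup>2 + (\<sigma> / om k)\<^sup>2"
      using normal_distributed_variance[OF p D] by simp
  qed
  have sm: "summable (\<lambda>k. (cf u0 k)\<^sup>2 + (\<sigma> / om k)\<^sup>2)"
  proof (intro summable_add cf_summable u0)
    have "summable (\<lambda>k. \<sigma>\<^sup>2 * om k powr (-2))" by (intro summable_mult summable_om_powr) simp
    then show "summable (\<lambda>k. (\<sigma> / om k)\<^sup>2)"
      by (simp add: powr_minus divide_inverse power_mult_distrib power_inverse)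
  qed
  have "(\<integral>\<^sup>+u. ennreal ((L2norm u)\<^sup>2) \<partial>\<mu>) = (\<integral>\<^sup>+u. (\<Sum>k. ennreal ((cf u k)\<^sup>2)) \<partial>\<mu>)"
    by (intro nn_integral_cong suminf_ennreal_eq[symmetric] Parseval) (auto simp: sp)
  also have "\<dots> = (\<Sum>k. \<integral>\<^sup>+u. ennreal ((cf u k)\<^sup>2) \<partial>\<mu>)" by (intro nn_integral_suminf) simp
  also have "\<dots> = (\<Sum>k. ennreal ((cf u0 k)\<^sup>2 + (\<sigma> / om k)\<^sup>2))"
    using k by (intro suminf_cong) (simp add: nn_integral_eq_integral)
  also have "\<dots> < \<infinity>" using sm by (subst suminf_ennreal2) auto
  finally show ?thesis by (intro integrableI_bounded) auto
qed

section \<open>Posterior measures and their moments\<close>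

lemma abs_integral_le:
  fixes f g :: "'a \<Rightarrow> real"
  assumes "integrable M f" "integrable M g" "\<And>x. x \<in> space M \<Longrightarrow> \<bar>f x\<bar> \<le> g x"
  shows "\<bar>\<integral>x. f x \<partial>M\<bar> \<le> (\<integral>x. g x \<partial>M)"
  using assms by (intro order_trans[OF integral_abs_bound] integral_mono integrable_abs)

locale square_integrable_measure = prob_space \<mu> for \<mu> :: "(real \<Rightarrow> real) measure" +
  assumes sets_eq [measurable_cong]: "sets \<mu> = sets L2M"
    and norm2_integrable: "integrable \<mu> (\<lambda>u. (L2norm u)\<^sup>2)"
begin

lemma space_eq [simp]: "space \<mu> = L2"
  using sets_eq_imp_space_eq[OF sets_eq] by simp

lemma inner_meas [measurable]: "\<phi> \<in> L2 \<Longrightarrow> (\<lambda>u. L2inner u \<phi>) \<in> borel_measurable \<mu>"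
  using L2inner_measurable by measurable

lemma norm_meas [measurable]: "L2norm \<in> borel_measurable \<mu>"
  using L2norm_measurable by measurable

text \<open>Uses \<open>L2norm u \<le> 1 + (L2norm u)\<^sup>2\<close>, so that the single weight
  \<open>1 + (L2norm u)\<^sup>2\<close> dominates first as well as second moments.\<close>

lemma inner_le: "u \<in> L2 \<Longrightarrow> \<phi> \<in> L2 \<Longrightarrow> \<bar>L2inner u \<phi>\<bar> \<le> (1 + (L2norm u)\<^sup>2) * L2norm \<phi>"
proof -
  assume u: "u \<in> L2" "\<phi> \<in> L2"
  have "0 \<le> (L2norm u - 1)\<^sup>2" by simp
  then have "L2norm u \<le> 1 + (L2norm u)\<^sup>2" by (simp add: power2_diff) (use L2norm_nonneg[of u] in linarith)
  then have "L2norm u * L2norm \<phi> \<le> (1 + (L2norm u)\<^sup>2) * L2norm \<phi>" by (intro mult_right_mono) auto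
  with L2_Cauchy_Schwarz[OF u] show ?thesis by linarith
qed

lemma inner_mult_le:
  assumes "u \<in> L2" "\<phi> \<in> L2" "\<psi> \<in> L2"
  shows "\<bar>L2inner u \<phi> * L2inner u \<psi>\<bar> \<le> (L2norm u)\<^sup>2 * (L2norm \<phi> * L2norm \<psi>)"
proof -
  have "\<bar>L2inner u \<phi>\<bar> * \<bar>L2inner u \<psi>\<bar> \<le> (L2norm u * L2norm \<phi>) * (L2norm u * L2norm \<psi>)"
    using assms by (intro mult_mono L2_Cauchy_Schwarz) auto
  then show ?thesis by (simp add: abs_mult power2_eq_square mult_ac)
qed

lemma inner_integrable: "\<phi> \<in> L2 \<Longrightarrow> integrable \<mu> (\<lambda>u. L2inner u \<phi>)"
  by (rule Bochner_Integration.integrable_bound[where f="\<lambda>u. (1 + (L2norm u)\<^sup>2) * L2norm \<phi>"])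
    (auto intro!: integrable_mult_left norm2_integrable AE_I2 inner_le)

lemma inner_mult_integrable:
  assumes "\<phi> \<in> L2" "\<psi> \<in> L2"
  shows "integrable \<mu> (\<lambda>u. L2inner u \<phi> * L2inner u \<psi>)"
proof (rule Bochner_Integration.integrable_bound)
  show "integrable \<mu> (\<lambda>u. (L2norm u)\<^sup>2 * (L2norm \<phi> * L2norm \<psi>))"
    by (intro integrable_mult_left norm2_integrable)
  show "AE u in \<mu>. norm (L2inner u \<phi> * L2inner u \<psi>) \<le> norm ((L2norm u)\<^sup>2 * (L2norm \<phi> * L2norm \<psi>))"
    unfolding real_norm_def using assms by (intro AE_I2 order_trans[OF inner_mult_le abs_ge_self]) auto
qed (use assms in measurable)

lemma mean_exists: "\<exists>m. is_mean_L2 \<mu> m"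
proof -
  let ?l = "\<lambda>\<phi>. \<integral>u. L2inner u \<phi> \<partial>\<mu>"
  obtain m where "m \<in> L2" "\<And>\<phi>. \<phi> \<in> L2 \<Longrightarrow> L2inner m \<phi> = ?l \<phi>"
  proof (rule Riesz_representation[of ?l "\<integral>u. 1 + (L2norm u)\<^sup>2 \<partial>\<mu>"])
    fix \<phi> \<psi> assume p: "\<phi> \<in> L2" "\<psi> \<in> L2"
    have "?l (\<lambda>x. \<phi> x + \<psi> x) = (\<integral>u. L2inner u \<phi> + L2inner u \<psi> \<partial>\<mu>)"
      using p by (intro Bochner_Integration.integral_cong) (auto simp: L2inner_add_right)
    then show "?l (\<lambda>x. \<phi> x + \<psi> x) = ?l \<phi> + ?l \<psi>" using p by (simp add: inner_integrable)
  next
    fix \<phi> assume p: "\<phi> \<in> L2"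
    have "\<bar>?l \<phi>\<bar> \<le> (\<integral>u. (1 + (L2norm u)\<^sup>2) * L2norm \<phi> \<partial>\<mu>)"
      using p by (intro abs_integral_le inner_integrable integrable_mult_left
        Bochner_Integration.integrable_add norm2_integrable inner_le) auto
    then show "\<bar>?l \<phi>\<bar> \<le> (\<integral>u. 1 + (L2norm u)\<^sup>2 \<partial>\<mu>) * L2norm \<phi>" by simp
  qed (auto simp: L2inner_scale_right)
  then show ?thesis using inner_integrable unfolding is_mean_L2_def by blast
qed

lemma
  assumes m: "is_mean_L2 \<mu> m" and p: "\<phi> \<in> L2" "\<psi> \<in> L2"
  shows centred_integrable: "integrable \<mu> (\<lambda>u. L2inner (\<lambda>x. u x - m x) \<phi> * L2inner (\<lambda>x. u x - m x) \<psi>)"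
    and centred_integral: "(\<integral>u. L2inner (\<lambda>x. u x - m x) \<phi> * L2inner (\<lambda>x. u x - m x) \<psi> \<partial>\<mu>) =
      (\<integral>u. L2inner u \<phi> * L2inner u \<psi> \<partial>\<mu>) - L2inner m \<phi> * L2inner m \<psi>"
proof -
  note m = m[unfolded is_mean_L2_def]
  let ?g = "\<lambda>u. L2inner u \<phi> * L2inner u \<psi> - L2inner u \<phi> * L2inner m \<psi> - L2inner u \<psi> * L2inner m \<phi> + L2inner m \<phi> * L2inner m \<psi>"
  have c: "L2inner (\<lambda>x. u x - m x) \<phi> * L2inner (\<lambda>x. u x - m x) \<psi> = ?g u" if "u \<in> L2" for u
    using that m p by (simp add: L2inner_diff_left algebra_simps)
  have i: "integrable \<mu> ?g"
    using p by (intro Bochner_Integration.integrable_add Bochner_Integration.integrable_diff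
      inner_mult_integrable integrable_mult_left inner_integrable) auto
  then show "integrable \<mu> (\<lambda>u. L2inner (\<lambda>x. u x - m x) \<phi> * L2inner (\<lambda>x. u x - m x) \<psi>)"
    by (subst Bochner_Integration.integrable_cong[OF refl c]) auto
  have "(\<integral>u. L2inner (\<lambda>x. u x - m x) \<phi> * L2inner (\<lambda>x. u x - m x) \<psi> \<partial>\<mu>) = (\<integral>u. ?g u \<partial>\<mu>)"
    by (intro Bochner_Integration.integral_cong c) auto
  also have "\<dots> = (\<integral>u. L2inner u \<phi> * L2inner u \<psi> \<partial>\<mu>) - L2inner m \<phi> * L2inner m \<psi>"
    using p m prob_space by (simp add: inner_mult_integrable inner_integrable mult.commute)
  finally show "(\<integral>u. L2inner (\<lambda>x. u x - m x) \<phi> * L2inner (\<lambda>x. u x - m x) \<psi> \<partial>\<mu>) =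
      (\<integral>u. L2inner u \<phi> * L2inner u \<psi> \<partial>\<mu>) - L2inner m \<phi> * L2inner m \<psi>" .
qed

text \<open>Riesz representation is applied to the uncentred second moments; the centring is then
  the rank-one correction \<open>L2inner m \<phi> * m\<close>.\<close>

lemma covariance_exists:
  assumes m: "is_mean_L2 \<mu> m"
  shows "\<exists>K. is_covariance_L2 \<mu> m K"
proof -
  have "\<exists>w\<in>L2. \<forall>\<psi>\<in>L2. L2inner w \<psi> = (\<integral>u. L2inner u \<phi> * L2inner u \<psi> \<partial>\<mu>) - L2inner m \<phi> * L2inner m \<psi>"
    if p: "\<phi> \<in> L2" for \<phi>
  proof -
    let ?l = "\<lambda>\<psi>. \<integral>u. L2inner u \<phi> * L2inner u \<psi> \<partial>\<mu>"
    obtain w where w: "w \<in> L2" "\<And>\<psi>. \<psi> \<in> L2 \<Longrightarrow> L2inner w \<psi> = ?l \<psi>"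
    proof (rule Riesz_representation[of ?l "(\<integral>u. (L2norm u)\<^sup>2 \<partial>\<mu>) * L2norm \<phi>"])
      fix \<psi> \<eta> assume q: "\<psi> \<in> L2" "\<eta> \<in> L2"
      have "?l (\<lambda>x. \<psi> x + \<eta> x) = (\<integral>u. L2inner u \<phi> * L2inner u \<psi> + L2inner u \<phi> * L2inner u \<eta> \<partial>\<mu>)"
        using q by (intro Bochner_Integration.integral_cong) (auto simp: L2inner_add_right distrib_left)
      then show "?l (\<lambda>x. \<psi> x + \<eta> x) = ?l \<psi> + ?l \<eta>" using p q by (simp add: inner_mult_integrable)
    next
      fix \<psi> assume q: "\<psi> \<in> L2"
      have "\<bar>?l \<psi>\<bar> \<le> (\<integral>u. (L2norm u)\<^sup>2 * (L2norm \<phi> * L2norm \<psi>) \<partial>\<mu>)"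
        using abs_integral_le[of \<mu> "\<lambda>u. L2inner u \<phi> * L2inner u \<psi>" "\<lambda>u. (L2norm u)\<^sup>2 * (L2norm \<phi> * L2norm \<psi>)"] p q
        by (auto intro: inner_mult_integrable norm2_integrable inner_mult_le simp del: abs_mult)
      then show "\<bar>?l \<psi>\<bar> \<le> (\<integral>u. (L2norm u)\<^sup>2 \<partial>\<mu>) * L2norm \<phi> * L2norm \<psi>" by (simp add: mult.assoc)
    qed (auto simp: L2inner_scale_right mult.left_commute)
    have "m \<in> L2" using m by (simp add: is_mean_L2_def)
    then show ?thesis
      using w by (intro bexI[of _ "\<lambda>x. w x - L2inner m \<phi> * m x"])
        (auto simp: L2inner_diff_left L2_scale L2inner_scale_left L2_diff)
  qed
  then obtain K where "\<forall>\<phi>\<in>L2. K \<phi> \<in> L2 \<and>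
      (\<forall>\<psi>\<in>L2. L2inner (K \<phi>) \<psi> = (\<integral>u. L2inner u \<phi> * L2inner u \<psi> \<partial>\<mu>) - L2inner m \<phi> * L2inner m \<psi>)"
    by metis
  then show ?thesis
    unfolding is_covariance_L2_def using centred_integrable[OF m] centred_integral[OF m]
    by (intro exI[of _ K]) simp
qed

section \<open>Normalised weights and their dependence on the potential\<close>

lemma weight_integrable:
  fixes w g :: "(real \<Rightarrow> real) \<Rightarrow> real"
  assumes "w \<in> borel_measurable \<mu>" "\<And>u. \<bar>w u\<bar> \<le> C" "integrable \<mu> g"
  shows "integrable \<mu> (\<lambda>u. w u * g u)"
proof (rule Bochner_Integration.integrable_bound[OF integrable_mult_right[of C, OF assms(3)]])
  have "\<bar>w u\<bar> * \<bar>g u\<bar> \<le> \<bar>C\<bar> * \<bar>g u\<bar>" for u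
    using assms(2)[of u] by (intro mult_right_mono) auto
  then show "AE u in \<mu>. norm (w u * g u) \<le> norm (C * g u)" by (simp add: abs_mult)
qed (use assms in auto)

definition weight :: "((real \<Rightarrow> real) \<Rightarrow> real) \<Rightarrow> (real \<Rightarrow> real) \<Rightarrow> real" where
  "weight P u = exp (- P u) / (\<integral>v. exp (- P v) \<partial>\<mu>)"

context
  fixes P :: "(real \<Rightarrow> real) \<Rightarrow> real"
  assumes P [measurable]: "P \<in> borel_measurable \<mu>" and P0: "\<And>u. 0 \<le> P u"
begin

lemma exp_integrable: "integrable \<mu> (\<lambda>u. exp (- P u))"
  using P0 by (intro integrable_const_bound[of _ 1]) auto

lemma evidence_pos: "0 < (\<integral>v. exp (- P v) \<partial>\<mu>)"
proof -
  have "(\<integral>v. exp (- P v) \<partial>\<mu>) \<noteq> 0"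
    using integral_nonneg_eq_0_iff_AE[OF exp_integrable] by (simp add: AE_False)
  moreover have "0 \<le> (\<integral>v. exp (- P v) \<partial>\<mu>)" by (rule Bochner_Integration.integral_nonneg) simp
  ultimately show ?thesis by linarith
qed

lemma weight_meas [measurable]: "weight P \<in> borel_measurable \<mu>"
  unfolding weight_def[abs_def] by measurable

lemma weight_nonneg: "0 \<le> weight P u"
  using evidence_pos by (simp add: weight_def)

lemma weight_le: "\<bar>weight P u\<bar> \<le> 1 / (\<integral>v. exp (- P v) \<partial>\<mu>)"
  using evidence_pos P0[of u] by (simp add: weight_def divide_right_mono)

lemma posterior_integral:
  assumes "g \<in> borel_measurable \<mu>"
  shows "(\<integral>u. g u \<partial>density \<mu> (weight P)) = (\<integral>u. weight P u * g u \<partial>\<mu>)"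
  using integral_density[of g \<mu> "weight P"] assms weight_nonneg by simp

lemma posterior: "square_integrable_measure (density \<mu> (weight P))"
proof -
  have "(\<integral>\<^sup>+u. ennreal (weight P u) \<partial>\<mu>) = ennreal (\<integral>u. weight P u \<partial>\<mu>)"
    by (intro nn_integral_eq_integral) (auto simp: weight_nonneg weight_def intro!: integrable_divide exp_integrable)
  also have "(\<integral>u. weight P u \<partial>\<mu>) = 1"
    using evidence_pos by (simp add: weight_def)
  finally have "prob_space (density \<mu> (weight P))"
    using sets.top[of \<mu>] by (intro prob_spaceI) (simp add: emeasure_density cong: nn_integral_cong_simp)
  moreover have "integrable (density \<mu> (weight P)) (\<lambda>u. (L2norm u)\<^sup>2)"
    using integrable_density[of "\<lambda>u. (L2norm u)\<^sup>2" \<mu> "weight P"] weight_nonneg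
      weight_integrable[OF weight_meas weight_le norm2_integrable] by simp
  ultimately show ?thesis
    by (simp add: square_integrable_measure_def square_integrable_measure_axioms_def sets_eq)
qed

end

text \<open>A weighted total variation distance of the two posteriors; it dominates the
  differences of means and covariances because both moments grow at most quadratically.\<close>

definition wdist :: "((real \<Rightarrow> real) \<Rightarrow> real) \<Rightarrow> ((real \<Rightarrow> real) \<Rightarrow> real) \<Rightarrow> real" where
  "wdist P Q = (\<integral>u. (1 + (L2norm u)\<^sup>2) * \<bar>weight P u - weight Q u\<bar> \<partial>\<mu>)"

text \<open>Two uses of dominated convergence: the normalising constants converge with dominating
  function 1, and then the weighted difference converges with a multiple of
  \<open>1 + (L2norm u)\<^sup>2\<close> as dominating function.\<close>

lemma wdist_tendsto:
  assumes P: "\<And>n. P n \<in> borel_measurable \<mu>" "\<And>n u. 0 \<le> P n u"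
    and Q: "Q \<in> borel_measurable \<mu>" "\<And>u. 0 \<le> Q u"
    and lim: "\<And>u. u \<in> L2 \<Longrightarrow> (\<lambda>n. P n u) \<longlonglongrightarrow> Q u"
  shows "(\<lambda>n. wdist (P n) Q) \<longlonglongrightarrow> 0"
proof -
  note [measurable] = P(1) Q(1)
  let ?Z = "\<lambda>P. \<integral>v. exp (- P v) \<partial>\<mu>"
  have Z: "(\<lambda>n. ?Z (P n)) \<longlonglongrightarrow> ?Z Q"
    by (rule integral_dominated_convergence[where w="\<lambda>_. 1"])
      (auto intro!: AE_I2 tendsto_intros lim simp: P(2))
  have Zp: "0 < ?Z Q" by (rule evidence_pos[OF Q])
  have "\<forall>\<^sub>F n in sequentially. ?Z Q / 2 < ?Z (P n)"
    using Zp by (intro order_tendstoD(1)[OF Z]) simp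
  then obtain n0 where n0: "\<And>n. n0 \<le> n \<Longrightarrow> ?Z Q / 2 < ?Z (P n)"
    unfolding eventually_sequentially by blast
  \<comment> \<open>From \<open>n0\<close> on, the normalising constants exceed half of their
    positive limit; hence \<open>C\<close> bounds all shifted weights and the limit weight, and
    twice \<open>C\<close> bounds their difference.\<close>
  define C where "C = 2 / ?Z Q"
  have Pb: "\<bar>weight (P (n + n0)) u\<bar> \<le> C" for n u
    using order_trans[OF weight_le[OF P, of "n + n0" u], of C] n0[of "n + n0"] Zp
    by (simp add: C_def frac_le field_simps)
  have Qb: "\<bar>weight Q u\<bar> \<le> C" for u
    using order_trans[OF weight_le[OF Q, of u], of C] Zp by (simp add: C_def divide_right_mono)
  have "(\<lambda>n. wdist (P (n + n0)) Q) \<longlonglongrightarrow> (\<integral>u. 0 \<partial>\<mu>)"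
    unfolding wdist_def
  proof (rule integral_dominated_convergence[where w="\<lambda>u. (1 + (L2norm u)\<^sup>2) * (2 * C)"])
    show "integrable \<mu> (\<lambda>u. (1 + (L2norm u)\<^sup>2) * (2 * C))"
      by (intro integrable_mult_left Bochner_Integration.integrable_add norm2_integrable) auto
    show "AE u in \<mu>. (\<lambda>n. (1 + (L2norm u)\<^sup>2) * \<bar>weight (P (n + n0)) u - weight Q u\<bar>) \<longlonglongrightarrow> 0"
    proof (rule AE_I2)
      fix u assume "u \<in> space \<mu>"
      then have "(\<lambda>n. weight (P n) u) \<longlonglongrightarrow> weight Q u"
        unfolding weight_def using Zp by (intro tendsto_intros lim Z) auto
      then have "(\<lambda>n. (1 + (L2norm u)\<^sup>2) * \<bar>weight (P (n + n0)) u - weight Q u\<bar>) \<longlonglongrightarrow>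
          (1 + (L2norm u)\<^sup>2) * \<bar>weight Q u - weight Q u\<bar>"
        by (intro tendsto_intros LIMSEQ_ignore_initial_segment)
      then show "(\<lambda>n. (1 + (L2norm u)\<^sup>2) * \<bar>weight (P (n + n0)) u - weight Q u\<bar>) \<longlonglongrightarrow> 0" by simp
    qed
    fix n
    have "\<bar>weight (P (n + n0)) u - weight Q u\<bar> \<le> 2 * C" for u
      using Pb[of n u] Qb[of u] by linarith
    then show "AE u in \<mu>. norm ((1 + (L2norm u)\<^sup>2) * \<bar>weight (P (n + n0)) u - weight Q u\<bar>) \<le> (1 + (L2norm u)\<^sup>2) * (2 * C)"
      by (intro AE_I2) (simp add: abs_mult mult_left_mono)
  qed (auto intro!: borel_measurable_times borel_measurable_add borel_measurable_abs borel_measurable_diff weight_meas P Q)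
  then show ?thesis by (simp add: LIMSEQ_offset)
qed

lemma
  assumes P: "P \<in> borel_measurable \<mu>" "\<And>u. 0 \<le> P u" and Q: "Q \<in> borel_measurable \<mu>" "\<And>u. 0 \<le> Q u"
  shows wdist_integral: "\<And>g c. g \<in> borel_measurable \<mu> \<Longrightarrow> 0 \<le> c \<Longrightarrow> (\<And>u. u \<in> L2 \<Longrightarrow> \<bar>g u\<bar> \<le> (1 + (L2norm u)\<^sup>2) * c) \<Longrightarrow>
      \<bar>(\<integral>u. g u \<partial>density \<mu> (weight P)) - (\<integral>u. g u \<partial>density \<mu> (weight Q))\<bar> \<le> wdist P Q * c"
    and wdist_nonneg: "0 \<le> wdist P Q"
proof -
  show "0 \<le> wdist P Q" unfolding wdist_def by (rule Bochner_Integration.integral_nonneg) simp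
  fix g :: "(real \<Rightarrow> real) \<Rightarrow> real" and c :: real
  assume g [measurable]: "g \<in> borel_measurable \<mu>" and c: "0 \<le> c" "\<And>u. u \<in> L2 \<Longrightarrow> \<bar>g u\<bar> \<le> (1 + (L2norm u)\<^sup>2) * c"
  have n: "integrable \<mu> (\<lambda>u. (1 + (L2norm u)\<^sup>2) * c)" by (intro integrable_mult_left Bochner_Integration.integrable_add norm2_integrable) auto
  have gi: "integrable \<mu> g" by (rule Bochner_Integration.integrable_bound[OF n]) (use c in \<open>auto intro!: AE_I2 simp: abs_mult\<close>)
  note gP = weight_integrable[OF weight_meas[OF P] weight_le[OF P]]
  note gQ = weight_integrable[OF weight_meas[OF Q] weight_le[OF Q]]
  have 1: "integrable \<mu> (\<lambda>u. 1 + (L2norm u)\<^sup>2)" using norm2_integrable by simp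
  have d: "integrable \<mu> (\<lambda>u. weight P u * (1 + (L2norm u)\<^sup>2) - weight Q u * (1 + (L2norm u)\<^sup>2))"
    by (intro Bochner_Integration.integrable_diff gP gQ 1)
  have "integrable \<mu> (\<lambda>u. \<bar>weight P u * (1 + (L2norm u)\<^sup>2) - weight Q u * (1 + (L2norm u)\<^sup>2)\<bar>)"
    using d by (rule integrable_abs)
  also have "(\<lambda>u. \<bar>weight P u * (1 + (L2norm u)\<^sup>2) - weight Q u * (1 + (L2norm u)\<^sup>2)\<bar>) =
      (\<lambda>u. (1 + (L2norm u)\<^sup>2) * \<bar>weight P u - weight Q u\<bar>)"
    by (simp add: left_diff_distrib[symmetric] abs_mult mult.commute fun_eq_iff del: abs_mult_pos)
  finally have D: "integrable \<mu> (\<lambda>u. (1 + (L2norm u)\<^sup>2) * \<bar>weight P u - weight Q u\<bar>)" .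
  have "(\<integral>u. g u \<partial>density \<mu> (weight P)) - (\<integral>u. g u \<partial>density \<mu> (weight Q)) =
      (\<integral>u. weight P u * g u - weight Q u * g u \<partial>\<mu>)"
    by (simp add: posterior_integral[OF P g] posterior_integral[OF Q g] gP[OF gi] gQ[OF gi])
  also have "\<bar>\<dots>\<bar> \<le> (\<integral>u. ((1 + (L2norm u)\<^sup>2) * \<bar>weight P u - weight Q u\<bar>) * c \<partial>\<mu>)"
  proof (rule abs_integral_le)
    fix u assume "u \<in> space \<mu>"
    then have "\<bar>weight P u - weight Q u\<bar> * \<bar>g u\<bar> \<le> \<bar>weight P u - weight Q u\<bar> * ((1 + (L2norm u)\<^sup>2) * c)"
      using c by (intro mult_left_mono) auto
    then show "\<bar>weight P u * g u - weight Q u * g u\<bar> \<le> ((1 + (L2norm u)\<^sup>2) * \<bar>weight P u - weight Q u\<bar>) * c"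
      unfolding left_diff_distrib[symmetric] abs_mult by (simp only: mult_ac)
  qed (use gP[OF gi] gQ[OF gi] D in auto)
  finally show "\<bar>(\<integral>u. g u \<partial>density \<mu> (weight P)) - (\<integral>u. g u \<partial>density \<mu> (weight Q))\<bar> \<le> wdist P Q * c"
    by (simp add: wdist_def)
qed

text \<open>Both bounds come from testing with the difference itself. In the covariance bound the 1
  stems from the uncentred second moments, and \<open>wdist P Q + 2 * L2norm m'\<close> from
  splitting the product of means, where \<open>L2norm m\<close> is replaced by
  \<open>wdist P Q + L2norm m'\<close>.\<close>

lemma
  assumes P: "P \<in> borel_measurable \<mu>" "\<And>u. 0 \<le> P u" and Q: "Q \<in> borel_measurable \<mu>" "\<And>u. 0 \<le> Q u"
    and m: "is_mean_L2 (density \<mu> (weight P)) m" and m': "is_mean_L2 (density \<mu> (weight Q)) m'"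
  shows mean_diff_le: "L2norm (\<lambda>x. m x - m' x) \<le> wdist P Q"
    and covariance_diff_le: "is_covariance_L2 (density \<mu> (weight P)) m K \<Longrightarrow>
      is_covariance_L2 (density \<mu> (weight Q)) m' K' \<Longrightarrow> \<phi> \<in> L2 \<Longrightarrow>
      L2norm (\<lambda>x. K \<phi> x - K' \<phi> x) \<le> wdist P Q * (1 + wdist P Q + 2 * L2norm m') * L2norm \<phi>"
proof -
  interpret MP: square_integrable_measure "density \<mu> (weight P)" by (rule posterior[OF P])
  interpret MQ: square_integrable_measure "density \<mu> (weight Q)" by (rule posterior[OF Q])
  let ?D = "wdist P Q"
  have D0: "0 \<le> ?D" by (rule wdist_nonneg[OF P Q])
  have mL: "m \<in> L2" "m' \<in> L2" using m m' by (auto simp: is_mean_L2_def)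
  \<comment> \<open>The squared norm is bounded by \<open>c\<close> times the norm; one factor is
    cancelled, the null case being separate.\<close>
  have from_inner: "L2norm w \<le> c" if "w \<in> L2" "\<bar>L2inner w w\<bar> \<le> c * L2norm w" "0 \<le> c" for w c
    using that mult_right_le_imp_le[of "L2norm w" "L2norm w" c] L2norm_nonneg[of w]
    by (cases "L2norm w = 0") (auto simp: L2norm_power2[symmetric] power2_eq_square)
  have mp: "\<bar>L2inner m \<phi> - L2inner m' \<phi>\<bar> \<le> ?D * L2norm \<phi>" if "\<phi> \<in> L2" for \<phi>
    using wdist_integral[OF P Q, of "\<lambda>u. L2inner u \<phi>" "L2norm \<phi>"] that m m' inner_le
    by (auto simp: is_mean_L2_def)
  show md: "L2norm (\<lambda>x. m x - m' x) \<le> ?D"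
    using mp[of "\<lambda>x. m x - m' x"] mL D0 by (intro from_inner) (auto simp: L2inner_diff_left L2_diff)
  assume K: "is_covariance_L2 (density \<mu> (weight P)) m K" and K': "is_covariance_L2 (density \<mu> (weight Q)) m' K'"
    and p: "\<phi> \<in> L2"
  have KL: "K \<phi> \<in> L2" "K' \<phi> \<in> L2" using K K' p by (auto simp: is_covariance_L2_def)
  define \<psi> where "\<psi> = (\<lambda>x. K \<phi> x - K' \<phi> x)"
  have q: "\<psi> \<in> L2" unfolding \<psi>_def using KL by auto
  have 1: "\<bar>(\<integral>u. L2inner u \<phi> * L2inner u \<psi> \<partial>density \<mu> (weight P)) - (\<integral>u. L2inner u \<phi> * L2inner u \<psi> \<partial>density \<mu> (weight Q))\<bar>
      \<le> ?D * (L2norm \<phi> * L2norm \<psi>)"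
  proof (rule wdist_integral[OF P Q])
    fix u :: "real \<Rightarrow> real" assume "u \<in> L2"
    from inner_mult_le[OF this p q] show "\<bar>L2inner u \<phi> * L2inner u \<psi>\<bar> \<le> (1 + (L2norm u)\<^sup>2) * (L2norm \<phi> * L2norm \<psi>)"
      by (simp add: distrib_right add.commute[of "L2norm \<phi> * L2norm \<psi>"] add_increasing2)
  qed (use p q in auto)
  have mm: "L2norm m \<le> ?D + L2norm m'" using L2norm_rev_triangle[OF mL] md by linarith
  have "\<bar>L2inner m \<phi> * L2inner m \<psi> - L2inner m' \<phi> * L2inner m' \<psi>\<bar> =
      \<bar>(L2inner m \<phi> - L2inner m' \<phi>) * L2inner m \<psi> + L2inner m' \<phi> * (L2inner m \<psi> - L2inner m' \<psi>)\<bar>"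
    by (simp add: algebra_simps)
  also have "\<dots> \<le> \<bar>L2inner m \<phi> - L2inner m' \<phi>\<bar> * \<bar>L2inner m \<psi>\<bar> + \<bar>L2inner m' \<phi>\<bar> * \<bar>L2inner m \<psi> - L2inner m' \<psi>\<bar>"
    by (rule order_trans[OF abs_triangle_ineq]) (simp add: abs_mult)
  also have "\<dots> \<le> (?D * L2norm \<phi>) * ((?D + L2norm m') * L2norm \<psi>) + (L2norm m' * L2norm \<phi>) * (?D * L2norm \<psi>)"
    using order_trans[OF L2_Cauchy_Schwarz[OF mL(1) q] mult_right_mono[OF mm]] D0
    by (intro add_mono mult_mono mp p q L2_Cauchy_Schwarz mL) auto
  finally have 2: "\<bar>L2inner m \<phi> * L2inner m \<psi> - L2inner m' \<phi> * L2inner m' \<psi>\<bar> \<le> \<dots>" .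
  have "L2inner \<psi> \<psi> = L2inner (K \<phi>) \<psi> - L2inner (K' \<phi>) \<psi>"
    using KL q by (subst \<psi>_def) (simp add: L2inner_diff_left)
  also have "\<dots> = ((\<integral>u. L2inner u \<phi> * L2inner u \<psi> \<partial>density \<mu> (weight P)) - L2inner m \<phi> * L2inner m \<psi>) -
      ((\<integral>u. L2inner u \<phi> * L2inner u \<psi> \<partial>density \<mu> (weight Q)) - L2inner m' \<phi> * L2inner m' \<psi>)"
    using K K' p q MP.centred_integral[OF m p q] MQ.centred_integral[OF m' p q] unfolding is_covariance_L2_def by simp
  finally have "\<bar>L2inner \<psi> \<psi>\<bar> \<le> ?D * (L2norm \<phi> * L2norm \<psi>) +
      ((?D * L2norm \<phi>) * ((?D + L2norm m') * L2norm \<psi>) + (L2norm m' * L2norm \<phi>) * (?D * L2norm \<psi>))"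
    using 1 2 by linarith
  also have "\<dots> = (?D * (1 + ?D + 2 * L2norm m') * L2norm \<phi>) * L2norm \<psi>" by (simp add: algebra_simps)
  finally show "L2norm (\<lambda>x. K \<phi> x - K' \<phi> x) \<le> ?D * (1 + ?D + 2 * L2norm m') * L2norm \<phi>"
    using q D0 unfolding \<psi>_def[symmetric] by (intro from_inner) auto
qed

end

section \<open>The misfit functional\<close>

lemma bounded_linear_L2_tendsto:
  assumes H: "bounded_linear_L2 H" and v: "\<And>n. v n \<in> L2" "w \<in> L2"
    and lim: "(\<lambda>n. L2norm (\<lambda>x. v n x - w x)) \<longlonglongrightarrow> 0"
  shows "(\<lambda>n. H (v n)) \<longlonglongrightarrow> H w"
proof -
  obtain K where K: "\<forall>u\<in>L2. norm (H u) \<le> K * L2norm u"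
    using H by (auto simp: bounded_linear_L2_def)
  have "H (v n) - H w = H (\<lambda>x. v n x - w x)" for n
  proof -
    have "\<forall>u\<in>L2. \<forall>v\<in>L2. H (\<lambda>x. u x + v x) = H u + H v"
      using H by (simp add: bounded_linear_L2_def)
    from this[THEN bspec, OF L2_diff[OF v(1)[of n] v(2)], THEN bspec, OF v(2)]
    show ?thesis by simp
  qed
  then have "\<forall>n. norm (H (v n) - H w) \<le> K * L2norm (\<lambda>x. v n x - w x)"
    using K L2_diff[OF v] by simp
  moreover have "(\<lambda>n. K * L2norm (\<lambda>x. v n x - w x)) \<longlonglongrightarrow> 0"
    using tendsto_mult_left[OF lim, of K] by simp
  ultimately show ?thesis
    by (rule LIM_zero_cancel[OF Lim_null_comparison[OF always_eventually]])
qed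

lemma misfit_nonneg: "0 \<le> misfit f r H R N t z u"
  by (simp add: misfit_def sum_nonneg)

text \<open>State and data vary together, so one statement serves two purposes: constant data give
  continuity in \<open>u\<close> and thereby measurability, a constant state gives continuity in the
  data.\<close>

lemma misfit_tendsto:
  assumes "\<And>i. i < N \<Longrightarrow> (\<lambda>n. H (\<lambda>x. evolution_sol f r (v n) x (t i))) \<longlonglongrightarrow> H (\<lambda>x. evolution_sol f r w x (t i))"
    and "\<And>i. i < N \<Longrightarrow> (\<lambda>n. zs n i) \<longlonglongrightarrow> z i"
  shows "(\<lambda>n. misfit f r H R N t (zs n) (v n)) \<longlonglongrightarrow> misfit f r H R N t z w"
  unfolding misfit_def
  by (intro tendsto_sum tendsto_power tendsto_norm bounded_linear.tendsto[OF matrix_vector_mul_bounded_linear]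
    tendsto_diff assms) simp_all

lemma (in lipschitz_problem) misfit_measurable:
  assumes H: "bounded_linear_L2 H" and t: "\<forall>i<N. 0 < t i"
  shows "misfit f r H R N t z \<in> borel_measurable L2M"
proof (rule L2_sequentially_continuous_measurable)
  fix v :: "nat \<Rightarrow> real \<Rightarrow> real" and w
  assume v: "\<And>n. v n \<in> L2" "w \<in> L2" "(\<lambda>n. L2norm (\<lambda>x. v n x - w x)) \<longlonglongrightarrow> 0"
  show "(\<lambda>n. misfit f r H R N t z (v n)) \<longlonglongrightarrow> misfit f r H R N t z w"
  proof (rule misfit_tendsto[where zs="\<lambda>_. z"])
    fix i assume "i < N"
    with t have ti: "0 < t i" by simp
    show "(\<lambda>n. H (\<lambda>x. evolution_sol f r (v n) x (t i))) \<longlonglongrightarrow> H (\<lambda>x. evolution_sol f r w x (t i))"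
      by (rule bounded_linear_L2_tendsto[OF H evolution_sol_L2[OF v(1) ti] evolution_sol_L2[OF v(2) ti]
            evolution_sol_continuous[OF v ti]])
  qed (rule tendsto_const)
qed

theorem theorem1:
  fixes f r :: "real \<Rightarrow> real"
    and \<mu>0 :: "(real \<Rightarrow> real) measure"
    and u0 :: "real \<Rightarrow> real"
    and \<sigma> :: real
    and H :: "(real \<Rightarrow> real) \<Rightarrow> real^'q"
    and R :: "real^'q^'q"
    and N :: nat
    and t :: "nat \<Rightarrow> real"
  assumes f_C2: "C2_fun f" and r_C2: "C2_fun r"
    and r_neg: "(\<integral>\<^sup>+ y. indicator {..0} y * ennreal (1 / (\<bar>r y\<bar> + 1)) \<partial>lborel) = \<infinity>"
    and r_pos: "(\<integral>\<^sup>+ y. indicator {0..} y * ennreal (1 / (\<bar>r y\<bar> + 1)) \<partial>lborel) = \<infinity>"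
    and r_lip: "\<exists>L. \<forall>a b. \<bar>r a - r b\<bar> \<le> L * \<bar>a - b\<bar>"
    and f'_lip: "\<exists>L. \<forall>a b. \<bar>deriv f a - deriv f b\<bar> \<le> L * \<bar>a - b\<bar>"
    and \<sigma>_pos: "\<sigma> > 0"
    and u0_V: "u0 \<in> H10"
    and prior: "gaussian_measure_L2 \<mu>0 u0 (prior_cov \<sigma>)"
    and H_bl: "bounded_linear_L2 H"
    and R_spd: "sym_pos_def R"
    and t_pos: "\<forall>i<N. 0 < t i"
    and t_incr: "\<forall>i j. i < j \<and> j < N \<longrightarrow> t i < t j"
  shows "(\<forall>u \<in> L2. \<exists>!y. evolution_solution f r u y) \<and>
    (\<exists>\<mu>z :: (nat \<Rightarrow> real^'q) \<Rightarrow> (real \<Rightarrow> real) measure.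
      (\<forall>z. misfit f r H R N t z \<in> borel_measurable L2M \<and>
           prob_space (\<mu>z z) \<and> absolutely_continuous \<mu>0 (\<mu>z z) \<and>
           (\<exists>c>0. \<mu>z z = density \<mu>0 (\<lambda>u. ennreal (c * exp (- misfit f r H R N t z u))))) \<and>
      (\<exists>m K. (\<forall>z. is_mean_L2 (\<mu>z z) (m z) \<and> is_covariance_L2 (\<mu>z z) (m z) (K z)) \<and>
        (\<forall>z. \<forall>\<epsilon>>0. \<exists>\<delta>>0. \<forall>z'. (\<forall>i<N. norm (z' i - z i) < \<delta>) \<longrightarrow>
            L2norm (\<lambda>x. m z' x - m z x) < \<epsilon> \<and>
            (\<forall>\<phi> \<in> L2. L2norm (\<lambda>x. K z' \<phi> x - K z \<phi> x) \<le> \<epsilon> * L2norm \<phi>))))"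
proof -
  obtain L1 where L1: "\<And>a b. \<bar>r a - r b\<bar> \<le> L1 * \<bar>a - b\<bar>" using r_lip by blast
  obtain Lf where Lf: "\<And>a b. \<bar>deriv f a - deriv f b\<bar> \<le> Lf * \<bar>a - b\<bar>" using f'_lip by blast
  \<comment> \<open>The given constants carry no sign information; the sum of absolute values is
    nonnegative and serves both functions.\<close>
  interpret lipschitz_problem f r "\<bar>L1\<bar> + \<bar>Lf\<bar>"
  proof
    show "0 \<le> \<bar>L1\<bar> + \<bar>Lf\<bar>" by simp
    show "\<bar>r a - r b\<bar> \<le> (\<bar>L1\<bar> + \<bar>Lf\<bar>) * \<bar>a - b\<bar>" for a b
      by (rule order_trans[OF L1 mult_right_mono]) auto
    show "\<bar>deriv f a - deriv f b\<bar> \<le> (\<bar>L1\<bar> + \<bar>Lf\<bar>) * \<bar>a - b\<bar>" for a b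
      by (rule order_trans[OF Lf mult_right_mono]) auto
    show "(f has_real_derivative deriv f x) (at x)" for x
      using f_C2 DERIV_imp_deriv unfolding C2_fun_def by metis
  qed
  let ?P = "misfit f r H R N t"
  note Pm = misfit_measurable[OF H_bl t_pos]
  interpret square_integrable_measure \<mu>0
  proof -
    have "integrable \<mu>0 (\<lambda>u. (L2norm u)\<^sup>2)"
      using u0_V by (intro gaussian_square_integrable[OF prior \<sigma>_pos]) (simp add: H10_def)
    then show "square_integrable_measure \<mu>0"
      using prior by (simp add: gaussian_measure_L2_def square_integrable_measure_def square_integrable_measure_axioms_def)
  qed
  have P: "?P z \<in> borel_measurable \<mu>0" "\<And>u. 0 \<le> ?P z u" for z
    using Pm[where z=z] by (auto simp: misfit_nonneg cong: measurable_cong_sets[OF sets_eq refl])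
  define \<mu>z where "\<mu>z z = density \<mu>0 (weight (?P z))" for z
  have M: "square_integrable_measure (\<mu>z z)" for z
    unfolding \<mu>z_def by (rule posterior[OF P])
  have "\<exists>c>0. \<mu>z z = density \<mu>0 (\<lambda>u. ennreal (c * exp (- ?P z u)))" for z
    using evidence_pos[OF P]
    by (intro exI[of _ "1 / (\<integral>v. exp (- ?P z v) \<partial>\<mu>0)"]) (simp add: \<mu>z_def weight_def[abs_def])
  moreover have "absolutely_continuous \<mu>0 (\<mu>z z)" for z
    unfolding \<mu>z_def using weight_meas[OF P] by (intro absolutely_continuousI_density) auto
  ultimately have \<mu>z: "?P z \<in> borel_measurable L2M \<and> prob_space (\<mu>z z) \<and> absolutely_continuous \<mu>0 (\<mu>z z) \<and>
      (\<exists>c>0. \<mu>z z = density \<mu>0 (\<lambda>u. ennreal (c * exp (- ?P z u))))" for z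
    using Pm[where z=z] M[of z] by (simp add: square_integrable_measure_def)
  obtain m where m: "\<And>z. is_mean_L2 (\<mu>z z) (m z)"
    using square_integrable_measure.mean_exists[OF M] by metis
  obtain K where K: "\<And>z. is_covariance_L2 (\<mu>z z) (m z) (K z)"
    using square_integrable_measure.covariance_exists[OF M m] by metis
  \<comment> \<open>Dominated convergence is sequential, so continuity in the data is proved by
    contradiction along data within \<open>1 / Suc n\<close> of \<open>z\<close>. Only the entries
    below \<open>N\<close> are compared, as only these enter the misfit.\<close>
  have close: "\<exists>\<delta>>0. \<forall>z'. (\<forall>i<N. norm (z' i - z i) < \<delta>) \<longrightarrow> wdist (?P z') (?P z) < \<eta>" if \<eta>: "0 < \<eta>" for z \<eta>
  proof (rule ccontr)
    assume "\<not> ?thesis"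
    then have "\<exists>z'. (\<forall>i<N. norm (z' i - z i) < 1 / real (Suc n)) \<and> \<eta> \<le> wdist (?P z') (?P z)" for n
      by (metis not_less of_nat_0_less_iff zero_less_Suc zero_less_divide_1_iff)
    then obtain zs where zs: "\<And>n i. i < N \<Longrightarrow> norm (zs n i - z i) < 1 / real (Suc n)"
        and far: "\<And>n. \<eta> \<le> wdist (?P (zs n)) (?P z)"
      by metis
    have "(\<lambda>n. zs n i) \<longlonglongrightarrow> z i" if i: "i < N" for i
    proof -
      have "\<forall>n. norm (zs n i - z i) \<le> 1 / real (Suc n)" using zs[OF i] less_imp_le by blast
      from Lim_null_comparison[OF always_eventually[OF this] LIMSEQ_Suc[OF lim_1_over_n]]
      show ?thesis by (rule LIM_zero_cancel)
    qed
    then have "(\<lambda>n. wdist (?P (zs n)) (?P z)) \<longlonglongrightarrow> 0"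
      by (intro wdist_tendsto P misfit_tendsto tendsto_const) auto
    then have "\<eta> \<le> 0" by (rule LIMSEQ_le_const) (use far in auto)
    with \<eta> show False by simp
  qed
  have cont: "\<exists>\<delta>>0. \<forall>z'. (\<forall>i<N. norm (z' i - z i) < \<delta>) \<longrightarrow>
      L2norm (\<lambda>x. m z' x - m z x) < \<epsilon> \<and> (\<forall>\<phi> \<in> L2. L2norm (\<lambda>x. K z' \<phi> x - K z \<phi> x) \<le> \<epsilon> * L2norm \<phi>)"
    if \<epsilon>: "0 < \<epsilon>" for z \<epsilon>
  proof -
    \<comment> \<open>Once the distance is below 1, the factor
      \<open>1 + wdist + 2 * L2norm (m z)\<close> from the covariance bound is at most
      \<open>A\<close>; since \<open>A\<close> is at least 1, the same choice of \<delta> also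
      handles the means.\<close>
    define A where "A = 2 + 2 * L2norm (m z)"
    have A: "2 \<le> A" by (simp add: A_def)
    obtain \<delta> where \<delta>: "0 < \<delta>" "\<And>z'. (\<forall>i<N. norm (z' i - z i) < \<delta>) \<Longrightarrow> wdist (?P z') (?P z) < min 1 (\<epsilon> / A)"
      using close[of "min 1 (\<epsilon> / A)" z] \<epsilon> A by auto
    have "L2norm (\<lambda>x. m z' x - m z x) < \<epsilon> \<and> (\<forall>\<phi> \<in> L2. L2norm (\<lambda>x. K z' \<phi> x - K z \<phi> x) \<le> \<epsilon> * L2norm \<phi>)"
      if "\<forall>i<N. norm (z' i - z i) < \<delta>" for z'
    proof -
      let ?D = "wdist (?P z') (?P z)"
      have D: "?D < 1" "?D < \<epsilon> / A" "0 \<le> ?D" using \<delta>(2)[OF that] wdist_nonneg[OF P P] by auto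
      have DA: "?D * A < \<epsilon>" using D A by (simp add: field_simps)
      have "?D * 1 \<le> ?D * A" using D A by (intro mult_left_mono) auto
      moreover have "L2norm (\<lambda>x. m z' x - m z x) \<le> ?D"
        using mean_diff_le[OF P P] m unfolding \<mu>z_def by blast
      moreover have "L2norm (\<lambda>x. K z' \<phi> x - K z \<phi> x) \<le> \<epsilon> * L2norm \<phi>" if \<phi>: "\<phi> \<in> L2" for \<phi>
      proof -
        have "L2norm (\<lambda>x. K z' \<phi> x - K z \<phi> x) \<le> ?D * (1 + ?D + 2 * L2norm (m z)) * L2norm \<phi>"
          using covariance_diff_le[OF P P _ _ _ _ \<phi>] m K unfolding \<mu>z_def by blast
        also have "\<dots> \<le> (?D * A) * L2norm \<phi>"
          using D by (intro mult_right_mono mult_left_mono) (auto simp: A_def)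
        also have "\<dots> \<le> \<epsilon> * L2norm \<phi>" using DA by (intro mult_right_mono) auto
        finally show ?thesis .
      qed
      ultimately show ?thesis using DA by auto
    qed
    with \<delta>(1) show ?thesis by blast
  qed
  have "\<forall>z. is_mean_L2 (\<mu>z z) (m z) \<and> is_covariance_L2 (\<mu>z z) (m z) (K z)" using m K by blast
  moreover have "\<forall>z. \<forall>\<epsilon>>0. \<exists>\<delta>>0. \<forall>z'. (\<forall>i<N. norm (z' i - z i) < \<delta>) \<longrightarrow>
      L2norm (\<lambda>x. m z' x - m z x) < \<epsilon> \<and> (\<forall>\<phi> \<in> L2. L2norm (\<lambda>x. K z' \<phi> x - K z \<phi> x) \<le> \<epsilon> * L2norm \<phi>)"
    by (intro allI impI cont)
  ultimately have mK: "\<exists>m K. (\<forall>z. is_mean_L2 (\<mu>z z) (m z) \<and> is_covariance_L2 (\<mu>z z) (m z) (K z)) \<and>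
      (\<forall>z. \<forall>\<epsilon>>0. \<exists>\<delta>>0. \<forall>z'. (\<forall>i<N. norm (z' i - z i) < \<delta>) \<longrightarrow>
        L2norm (\<lambda>x. m z' x - m z x) < \<epsilon> \<and> (\<forall>\<phi> \<in> L2. L2norm (\<lambda>x. K z' \<phi> x - K z \<phi> x) \<le> \<epsilon> * L2norm \<phi>))"
    by (intro exI[of _ m] exI[of _ K] conjI)
  show ?thesis
  proof (rule conjI)
    show "\<forall>u \<in> L2. \<exists>!y. evolution_solution f r u y" by (rule ballI) (rule evolution_ex1)
    show "\<exists>\<mu>z :: (nat \<Rightarrow> real^'q) \<Rightarrow> (real \<Rightarrow> real) measure.
      (\<forall>z. ?P z \<in> borel_measurable L2M \<and> prob_space (\<mu>z z) \<and> absolutely_continuous \<mu>0 (\<mu>z z) \<and>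
           (\<exists>c>0. \<mu>z z = density \<mu>0 (\<lambda>u. ennreal (c * exp (- ?P z u))))) \<and>
      (\<exists>m K. (\<forall>z. is_mean_L2 (\<mu>z z) (m z) \<and> is_covariance_L2 (\<mu>z z) (m z) (K z)) \<and>
        (\<forall>z. \<forall>\<epsilon>>0. \<exists>\<delta>>0. \<forall>z'. (\<forall>i<N. norm (z' i - z i) < \<delta>) \<longrightarrow>
            L2norm (\<lambda>x. m z' x - m z x) < \<epsilon> \<and>
            (\<forall>\<phi> \<in> L2. L2norm (\<lambda>x. K z' \<phi> x - K z \<phi> x) \<le> \<epsilon> * L2norm \<phi>)))"
      by (rule exI[of _ \<mu>z], rule conjI, rule allI, rule \<mu>z, rule mK)
  qed
qed

end
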